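(* Assume that $g$ is locally semiconcave, i.e., for every $r>0$ there exists $C(r)$ such that $g(z+z_0,w+w_0)+g(z-z_0,w-w_0)-2g(z,w)\le C(r)\|w_0\|_{H^1}^2$ for all $(z,w),(z_0,w_0)\in\mathcal X$ with $w,w_0\in W(r)$. Let $r>0$. Then there exists $C(r)>0$ such that, for every $h>0$, $$\rho(t+h,w+w_0)+\rho(t-h,w-w_0)-2\rho(t,w)\le C(r)\bigl(h^2+\|w_0\|_{H^1}^2\bigr)$$ whenever $$t_0\le t-h<t+h\le T,\qquad w,w_0\in W'(r),\qquad w-w_0\in X_{t,\alpha(t)},$$ where $\alpha$ is an optimal control for $(t,w)$.
   Context: Setting. Let $t_0<T$, $I=[t_0,T]$, $n,m\ge 1$; $A\subset\mathbb R^m$ is nonempty, convex and compact. $\|\cdot\|$ is the Euclidean norm on $\mathbb R^n$; $\|\cdot\|_m$ that on $\mathbb R^m$; $\|\cdot\|_1,\|\cdot\|_2,\|\cdot\|_\infty,\|\cdot\|_{H^1}$ are the usual $L^1,L^2,L^\infty,H^1$ norms for functions on $[-\bar\tau,0]$ (with $\bar\tau$ introduced in (7) below). $\operatorname{Lip}(v)$ is the Lipschitz constant of $v$. $\mathbb G:=I\times\operatorname{Lip}([-\bar\tau,0];\mathbb R^n)$. For $t_0\le t<s\le T$, $\mathcal A_{t,s}$ is the set of measurable functions $\alpha:(t,s)\to A$. For $R>0$: $P(R)=\{w\in\operatorname{Lip}([-\bar\tau,0];\mathbb R^n):\|w\|_\infty\le R\}$, $V(R)=\{w\in P(R):\|\dot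 w\|_\infty\le R\}$, $B_R=\{x\in\mathbb R^n:\|x\|\le R\}$. $\mathcal X=\{(z,w):w\in\operatorname{Lip}([-\bar\tau,0];\mathbb R^n),\ z=w(0)\}$ with norm $\|(z,w)\|_{\mathcal X}=\|z\|+\|w\|_1$. Standing assumptions. (1) $f:I\times\mathbb R^n\times\mathbb R^n\times A\to\mathbb R^n$ and $L:I\times\mathbb R^n\times\mathbb R^n\times A\to\mathbb R$ are continuous. (2) There is $\lambda_f>0$ with $\|f(t,z,y,a)-f(t,z',y',a)\|\le\lambda_f(\|z-z'\|+\|y-y'\|)$ for all arguments, and hence $\|f(t,z,y,a)\|\le C_f(1+\|z\|+\|y\|)$ for some $C_f>0$. (3) For every $(t,z,y)$ the set $\{(f(t,z,y,a),\ell)\in\mathbb R^n\times\mathbb R:a\in A,\ \ell\ge L(t,z,y,a)\}$ is convex. (4) For every $R>0$ there is $\lambda_L(R)>0$ with $|L(t,z,y,a)-L(t,z',y',a)|\le\lambda_L(R)(\|z-z'\|+\|y-y'\|)$ for $t\in I$, $a\in A$, $z,y,z',y'\in B_R$. (5) There is $C_L>0$ with $|L(t,z,y,a)|\le C_L(1+\|z\|+\|y\|)$ for all arguments. (6) $g:\mathcal X\to\mathbb R$ and for every $R>0$ there is $\lambda_g(R)>0$ with $|g(z_1,w_1)-g(z_2,w_2)|\le\lambda_g(R)\|(z_1,w_1)-(z_2,w_2)\|_{\mathcal X}$ for all $(z_i,w_i)\in\mathcal X$ with $w_i\in P(R)$. (7) $\tau:I\times\mathbb R^n\to[0,\infty)$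 is $C^1$ with supremum $\bar\tau<\infty$, and there is $\lambda_\tau>0$ with $|\tau(t,z)-\tau(t,y)|\le\lambda_\tau\|z-y\|$ for all $t\in I$, $z,y\in\mathbb R^n$. State equation. For $(t,w)\in\mathbb G$ and $\alpha\in\mathcal A_{t,T}$, $x(\cdot\,|\,t,w,\alpha)$ denotes the unique Lipschitz $x:[t-\bar\tau,T]\to\mathbb R^n$ with $\dot x(s)=f(s,x(s),x(s-\tau(s,x(s))),\alpha(s))$ for a.e. $s\in(t,T)$ and $x(t+\theta)=w(\theta)$ for $\theta\in[-\bar\tau,0]$ (it exists and is unique under (1)-(7)). Write $x_s(\theta)=x(s+\theta)$, $\theta\in[-\bar\tau,0]$. (8) (Monotone delay) For every $r>0$ there is $d(r)>0$ such that for every such solution with $t\in I$, $w\in P(r)$, $\alpha\in\mathcal A_{t,T}$: $1-\tau_t(s,x(s))-\tau_z(s,x(s))\cdot\dot x(s)\ge d(r)$ for a.e. $s\in[t,T]$. Cost and value. $J(t,w,\alpha)=\int_t^TL(s,x(s),x(s-\tau(s,x(s))),\alpha(s))\,ds+g(x(T),x_T)$ with $x=x(\cdot\,|\,t,w,\alpha)$, and $\rho(t,w)=\inf_{\alpha\in\mathcal A_{t,T}}J(t,w,\alpha)$ (for $t=T$: $\rho(T,w)=g(w(0),w)$). $\alpha\in\mathcal A_{t,T}$ is an optimal control for $(t,w)$ if $J(t,w,\alpha)=\rho(t,w)$. Under the assumptions of this statement optimal controls have Lipschitz representatives; $\alpha$ is identified with its Lipschitz representative on $[t,T]$, and $\alpha(t)$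 is its value at $t$. Additional assumptions. With $\mathcal H(t,z,y,p,a)=f(t,z,y,a)\cdot p+L(t,z,y,a)$: (S1) $f,L\in C^1(I\times\mathbb R^n\times\mathbb R^n\times A)$. (S2) There are $\mu,\lambda_{\mathcal H}>0$ with $(\mathcal H_a(t,z,y,p,a_1)-\mathcal H_a(t,z,y,p,a_2))\cdot(a_1-a_2)\ge\mu\|a_1-a_2\|_m^2$ and $\|\mathcal H_a(t_1,z_1,y_1,p_1,a)-\mathcal H_a(t_2,z_2,y_2,p_2,a)\|\le\lambda_{\mathcal H}(|t_1-t_2|+\|z_1-z_2\|+\|y_1-y_2\|+\|p_1-p_2\|)$ for all $(t,z,y,p),(t_i,z_i,y_i,p_i)\in I\times(\mathbb R^n)^3$, $a,a_1,a_2\in A$. (S3) For every $r>0$ there are $\gamma_f(r),\gamma_L(r)>0$ with $\|f(t,z_1,y_1,a)+f(t,z_2,y_2,a)-2f(t,\frac{z_1+z_2}2,\frac{y_1+y_2}2,a)\|\le\gamma_f(r)(\|z_1-z_2\|^2+\|y_1-y_2\|^2)$ and $|L(t,z_1,y_1,a)+L(t,z_2,y_2,a)-2L(t,\frac{z_1+z_2}2,\frac{y_1+y_2}2,a)|\le\gamma_L(r)(\|z_1-z_2\|^2+\|y_1-y_2\|^2)$ for $t\in I$, $a\in A$, $z_i,y_i\in B_r$. (S4) For every $r>0$ there is $\gamma_\tau(r)>0$ with $|\tau(t,z_1)+\tau(t,z_2)-2\tau(t,\frac{z_1+z_2}2)|\le\gamma_\tau(r)\|z_1-z_2\|^2$ for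 $t\in I$, $z_1,z_2\in B_r$. (S5) For any $(t,w)\in\mathbb G$, $\alpha\in\mathcal A_{t,T}$ and $x=x(\cdot\,|\,t,w,\alpha)$, $g$ is Fr\'echet differentiable at $(x(T),x_T)$; and for every $r>0$ there is $\gamma_g(r)>0$ with $\|g_w(x(T),x_T)\|_\infty\le\gamma_g(r)$ for all $t\in I$, $w\in V(r)$, $\alpha\in\mathcal A_{t,T}$. Here $g$ is Fr\'echet differentiable at $(z,w)\in\mathcal X$ if there are $g_z(z,w)\in\mathbb R^n$, $g_w(z,w)\in L^\infty([-\bar\tau,0];\mathbb R^n)$ with $g(z+\delta z,w+\delta w)-g(z,w)=g_z(z,w)\cdot\delta z+\int_{-\bar\tau}^0g_w(z,w)(\theta)\cdot\delta w(\theta)\,d\theta+o(\|(\delta z,\delta w)\|_{\mathcal X})$ for $(\delta z,\delta w)\in\mathcal X$. Classes of histories. $W(r)$ is the set of all piecewise $C^{1,1}$ functions $w\in V(r)$ (finitely many breakpoints) such that $\operatorname{Lip}(\dot w|_{(\theta_{j-1},\theta_j)})\le r$ on every subinterval $(\theta_{j-1},\theta_j)$ on which $w$ is $C^{1,1}$. $W'(r)=W(r)\cap C^{1,1}([-\bar\tau,0];\mathbb R^n)$. For $t\in I$, $a\in A$, the $C^{1,1}$ solution manifold is $X_{t,a}=\{w\in C^{1,1}([-\bar\tau,0];\mathbb R^n):\dot w(0)=f(t,w(0),w(-\tau(t,w(0))),a)\}$. *)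

theory Defs
  imports "HOL-Analysis.Analysis" "HOL-Probability.Essential_Supremum"
begin

section \<open>Function spaces of histories\<close>

text \<open>
  Throughout, \<open>b\<close> is the maximal delay. A history on \<open>[-b, 0]\<close> is a total function on the reals of
  which only the values on \<open>{-b..0}\<close> matter.
\<close>

definition hist_deriv :: "real \<Rightarrow> (real \<Rightarrow> 'a::real_normed_vector) \<Rightarrow> real \<Rightarrow> 'a" where
  "hist_deriv b w \<theta> = vector_derivative w (at \<theta> within {-b..0})"

definition norm_L1 :: "real \<Rightarrow> (real \<Rightarrow> 'a::real_normed_vector) \<Rightarrow> real" where
  "norm_L1 b u = (LINT \<theta>:{-b..0}|lebesgue. norm (u \<theta>))"

definition norm_Linf :: "real \<Rightarrow> (real \<Rightarrow> 'a::real_normed_vector) \<Rightarrow> ereal" where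
  "norm_Linf b u = esssup (lebesgue_on {-b..0}) (\<lambda>\<theta>. ereal (norm (u \<theta>)))"

definition norm_H1 :: "real \<Rightarrow> (real \<Rightarrow> 'a::real_normed_vector) \<Rightarrow> real" where
  "norm_H1 b w =
     sqrt ((LINT \<theta>:{-b..0}|lebesgue. (norm (w \<theta>))\<^sup>2) +
           (LINT \<theta>:{-b..0}|lebesgue. (norm (hist_deriv b w \<theta>))\<^sup>2))"

definition Lip_hist :: "real \<Rightarrow> (real \<Rightarrow> 'a::real_normed_vector) set" where
  "Lip_hist b = {w. \<exists>K. K-lipschitz_on {-b..0} w}"

definition P_hist :: "real \<Rightarrow> real \<Rightarrow> (real \<Rightarrow> 'a::real_normed_vector) set" where
  "P_hist b R = {w \<in> Lip_hist b. norm_Linf b w \<le> ereal R}"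

definition V_hist :: "real \<Rightarrow> real \<Rightarrow> (real \<Rightarrow> 'a::real_normed_vector) set" where
  "V_hist b R = {w \<in> P_hist b R. norm_Linf b (hist_deriv b w) \<le> ereal R}"

definition C11_hist :: "real \<Rightarrow> (real \<Rightarrow> 'a::real_normed_vector) set" where
  "C11_hist b = {w. (\<forall>\<theta>\<in>{-b..0}. w differentiable (at \<theta> within {-b..0})) \<and>
                    (\<exists>K. K-lipschitz_on {-b..0} (hist_deriv b w))}"

text \<open>
  \<open>\<theta> 0 < \<dots> < \<theta> N\<close> is a partition of \<open>[-b, 0]\<close>. Continuity across the breakpoints is part of
  \<open>w \<in> V_hist b r\<close>.
\<close>

definition W_hist :: "real \<Rightarrow> real \<Rightarrow> (real \<Rightarrow> 'a::real_normed_vector) set" where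
  "W_hist b r = {w \<in> V_hist b r.
     \<exists>(N::nat) \<theta>. \<theta> 0 = -b \<and> \<theta> N = 0 \<and> (\<forall>j<N. \<theta> j < \<theta> (Suc j)) \<and>
       (\<forall>j<N. (\<forall>\<xi>\<in>{\<theta> j<..<\<theta> (Suc j)}. w differentiable (at \<xi> within {-b..0})) \<and>
              r-lipschitz_on {\<theta> j<..<\<theta> (Suc j)} (hist_deriv b w))}"

definition W'_hist :: "real \<Rightarrow> real \<Rightarrow> (real \<Rightarrow> 'a::real_normed_vector) set" where
  "W'_hist b r = W_hist b r \<inter> C11_hist b"

definition X_space :: "real \<Rightarrow> ('a::real_normed_vector \<times> (real \<Rightarrow> 'a)) set" where
  "X_space b = {(z, w). w \<in> Lip_hist b \<and> z = w 0}"

definition norm_X :: "real \<Rightarrow> 'a::real_normed_vector \<times> (real \<Rightarrow> 'a) \<Rightarrow> real" where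
  "norm_X b = (\<lambda>(z, w). norm z + norm_L1 b w)"

section \<open>Differentiability\<close>

text \<open>
  The sets on which this is used are convex but need not be open. If \<open>S\<close> has empty interior
  the derivative is not unique, and any continuous choice is admitted.
\<close>

definition C1_on :: "('a::real_normed_vector \<Rightarrow> 'b::real_normed_vector) \<Rightarrow> 'a set \<Rightarrow> bool" where
  "C1_on F S \<longleftrightarrow>
     (\<exists>F' :: 'a \<Rightarrow> 'a \<Rightarrow>\<^sub>L 'b.
        (\<forall>p\<in>S. (F has_derivative blinfun_apply (F' p)) (at p within S)) \<and> continuous_on S F')"

definition X_frechet_deriv ::
  "real \<Rightarrow> ('a::euclidean_space \<times> (real \<Rightarrow> 'a) \<Rightarrow> real) \<Rightarrow> 'a \<times> (real \<Rightarrow> 'a) \<Rightarrow> 'a \<Rightarrow> (real \<Rightarrow> 'a) \<Rightarrow> bool"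
where
  "X_frechet_deriv b g = (\<lambda>(z, w) gz gw.
     gw \<in> borel_measurable (lebesgue_on {-b..0}) \<and> norm_Linf b gw < \<infinity> \<and>
     (\<forall>\<epsilon>>0. \<exists>\<delta>>0. \<forall>(dz, dw)\<in>X_space b. norm_X b (dz, dw) < \<delta> \<longrightarrow>
        \<bar>g (z + dz, \<lambda>\<theta>. w \<theta> + dw \<theta>) - g (z, w)
           - (gz \<bullet> dz + (LINT \<theta>:{-b..0}|lebesgue. gw \<theta> \<bullet> dw \<theta>))\<bar> \<le> \<epsilon> * norm_X b (dz, dw)))"

definition locally_semiconcave ::
  "real \<Rightarrow> ('a::real_normed_vector \<times> (real \<Rightarrow> 'a) \<Rightarrow> real) \<Rightarrow> bool" where
  "locally_semiconcave b g \<longleftrightarrow>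
     (\<forall>r>0. \<exists>C. \<forall>(z, w)\<in>X_space b. \<forall>(z0, w0)\<in>X_space b. w \<in> W_hist b r \<longrightarrow> w0 \<in> W_hist b r \<longrightarrow>
        g (z + z0, \<lambda>\<theta>. w \<theta> + w0 \<theta>) + g (z - z0, \<lambda>\<theta>. w \<theta> - w0 \<theta>) - 2 * g (z, w)
          \<le> C * (norm_H1 b w0)\<^sup>2)"

section \<open>State equation, cost and value function\<close>

definition controls :: "'c::real_normed_vector set \<Rightarrow> real \<Rightarrow> real \<Rightarrow> (real \<Rightarrow> 'c) set" where
  "controls A t s = {\<alpha>. \<alpha> \<in> borel_measurable (lebesgue_on {t<..<s}) \<and> \<alpha> ` {t<..<s} \<subseteq> A}"

definition is_trajectory ::
  "(real \<Rightarrow> 'a::real_normed_vector \<Rightarrow> 'a \<Rightarrow> 'c \<Rightarrow> 'a) \<Rightarrow> (real \<Rightarrow> 'a \<Rightarrow> real) \<Rightarrow> real \<Rightarrow> real \<Rightarrow>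
   real \<Rightarrow> (real \<Rightarrow> 'a) \<Rightarrow> (real \<Rightarrow> 'c) \<Rightarrow> (real \<Rightarrow> 'a) \<Rightarrow> bool" where
  "is_trajectory f \<tau> b T t w \<alpha> x \<longleftrightarrow>
     (\<exists>K. K-lipschitz_on {t - b..T} x) \<and>
     (AE s\<in>{t<..<T} in lebesgue.
        (x has_vector_derivative f s (x s) (x (s - \<tau> s (x s))) (\<alpha> s)) (at s)) \<and>
     (\<forall>\<theta>\<in>{-b..0}. x (t + \<theta>) = w \<theta>)"

text \<open>The solution is unique on \<open>[t - b, T]\<close> only, hence the restriction to extensional functions.\<close>

definition trajectory ::
  "(real \<Rightarrow> 'a::real_normed_vector \<Rightarrow> 'a \<Rightarrow> 'c \<Rightarrow> 'a) \<Rightarrow> (real \<Rightarrow> 'a \<Rightarrow> real) \<Rightarrow> real \<Rightarrow> real \<Rightarrow>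
   real \<Rightarrow> (real \<Rightarrow> 'a) \<Rightarrow> (real \<Rightarrow> 'c) \<Rightarrow> real \<Rightarrow> 'a" where
  "trajectory f \<tau> b T t w \<alpha> =
     (THE x. x \<in> extensional {t - b..T} \<and> is_trajectory f \<tau> b T t w \<alpha> x)"

definition segment_at :: "(real \<Rightarrow> 'a) \<Rightarrow> real \<Rightarrow> real \<Rightarrow> 'a" where
  "segment_at x s = (\<lambda>\<theta>. x (s + \<theta>))"

definition cost ::
  "(real \<Rightarrow> 'a::real_normed_vector \<Rightarrow> 'a \<Rightarrow> 'c \<Rightarrow> 'a) \<Rightarrow> (real \<Rightarrow> 'a \<Rightarrow> 'a \<Rightarrow> 'c \<Rightarrow> real) \<Rightarrow>
   ('a \<times> (real \<Rightarrow> 'a) \<Rightarrow> real) \<Rightarrow> (real \<Rightarrow> 'a \<Rightarrow> real) \<Rightarrow> real \<Rightarrow> real \<Rightarrow>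
   real \<Rightarrow> (real \<Rightarrow> 'a) \<Rightarrow> (real \<Rightarrow> 'c) \<Rightarrow> real" where
  "cost f L g \<tau> b T t w \<alpha> =
     (let x = trajectory f \<tau> b T t w \<alpha> in
       (LINT s:{t..T}|lebesgue. L s (x s) (x (s - \<tau> s (x s))) (\<alpha> s)) + g (x T, segment_at x T))"

definition value_fn ::
  "'c::real_normed_vector set \<Rightarrow>
   (real \<Rightarrow> 'a::real_normed_vector \<Rightarrow> 'a \<Rightarrow> 'c \<Rightarrow> 'a) \<Rightarrow> (real \<Rightarrow> 'a \<Rightarrow> 'a \<Rightarrow> 'c \<Rightarrow> real) \<Rightarrow>
   ('a \<times> (real \<Rightarrow> 'a) \<Rightarrow> real) \<Rightarrow> (real \<Rightarrow> 'a \<Rightarrow> real) \<Rightarrow> real \<Rightarrow> real \<Rightarrow>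
   real \<Rightarrow> (real \<Rightarrow> 'a) \<Rightarrow> real" where
  "value_fn A f L g \<tau> b T t w =
     (if t = T then g (w 0, w) else (INF \<alpha>\<in>controls A t T. cost f L g \<tau> b T t w \<alpha>))"

definition optimal_control ::
  "'c::real_normed_vector set \<Rightarrow>
   (real \<Rightarrow> 'a::real_normed_vector \<Rightarrow> 'a \<Rightarrow> 'c \<Rightarrow> 'a) \<Rightarrow> (real \<Rightarrow> 'a \<Rightarrow> 'a \<Rightarrow> 'c \<Rightarrow> real) \<Rightarrow>
   ('a \<times> (real \<Rightarrow> 'a) \<Rightarrow> real) \<Rightarrow> (real \<Rightarrow> 'a \<Rightarrow> real) \<Rightarrow> real \<Rightarrow> real \<Rightarrow>
   real \<Rightarrow> (real \<Rightarrow> 'a) \<Rightarrow> (real \<Rightarrow> 'c) \<Rightarrow> bool" where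
  "optimal_control A f L g \<tau> b T t w \<alpha> \<longleftrightarrow>
     \<alpha> \<in> controls A t T \<and> cost f L g \<tau> b T t w \<alpha> = value_fn A f L g \<tau> b T t w"

definition lipschitz_representative ::
  "real \<Rightarrow> real \<Rightarrow> (real \<Rightarrow> 'c::metric_space) \<Rightarrow> (real \<Rightarrow> 'c) \<Rightarrow> bool" where
  "lipschitz_representative t T \<alpha> \<beta> \<longleftrightarrow>
     (\<exists>K. K-lipschitz_on {t..T} \<beta>) \<and> (AE s\<in>{t<..<T} in lebesgue. \<beta> s = \<alpha> s)"

definition C11_solution_manifold ::
  "(real \<Rightarrow> 'a::real_normed_vector \<Rightarrow> 'a \<Rightarrow> 'c \<Rightarrow> 'a) \<Rightarrow> (real \<Rightarrow> 'a \<Rightarrow> real) \<Rightarrow> real \<Rightarrow>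
   real \<Rightarrow> 'c \<Rightarrow> (real \<Rightarrow> 'a) set" where
  "C11_solution_manifold f \<tau> b t a =
     {w \<in> C11_hist b. hist_deriv b w 0 = f t (w 0) (w (- \<tau> t (w 0))) a}"

definition hamiltonian ::
  "(real \<Rightarrow> 'a::real_inner \<Rightarrow> 'a \<Rightarrow> 'c \<Rightarrow> 'a) \<Rightarrow> (real \<Rightarrow> 'a \<Rightarrow> 'a \<Rightarrow> 'c \<Rightarrow> real) \<Rightarrow>
   real \<Rightarrow> 'a \<Rightarrow> 'a \<Rightarrow> 'a \<Rightarrow> 'c \<Rightarrow> real" where
  "hamiltonian f L t z y p a = f t z y a \<bullet> p + L t z y a"

section \<open>Assumptions\<close>

text \<open>
  \<open>max_delay_pos\<close> excludes only the degenerate case of an identically vanishing delay, in which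
  the history interval is a single point and \<open>L\<^sup>1\<close>, \<open>H\<^sup>1\<close> and derivatives of histories are meaningless.
  The linear growth of \<open>f\<close> follows from \<open>f_cont\<close>, \<open>f_lipschitz\<close> and compactness of \<open>A\<close>.
  By \<open>g_lipschitz\<close>, the value \<open>g (z, w)\<close> depends only on \<open>z\<close> and \<open>w\<close> on \<open>{-b..0}\<close>.
\<close>

locale delay_control_problem =
  fixes t0 T :: real
    and A :: "(real ^ 'm) set"
    and f :: "real \<Rightarrow> real ^ 'n \<Rightarrow> real ^ 'n \<Rightarrow> real ^ 'm \<Rightarrow> real ^ 'n"
    and L :: "real \<Rightarrow> real ^ 'n \<Rightarrow> real ^ 'n \<Rightarrow> real ^ 'm \<Rightarrow> real"
    and g :: "(real ^ 'n) \<times> (real \<Rightarrow> real ^ 'n) \<Rightarrow> real"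
    and \<tau> :: "real \<Rightarrow> real ^ 'n \<Rightarrow> real"
    and b :: real
  assumes time_interval: "t0 < T"
    and A_nonempty: "A \<noteq> {}"
    and A_convex: "convex A"
    and A_compact: "compact A"
    and f_cont: "continuous_on ({t0..T} \<times> UNIV \<times> UNIV \<times> A) (\<lambda>(t, z, y, a). f t z y a)"
    and L_cont: "continuous_on ({t0..T} \<times> UNIV \<times> UNIV \<times> A) (\<lambda>(t, z, y, a). L t z y a)"
    and f_lipschitz: "\<exists>lf>0. \<forall>t\<in>{t0..T}. \<forall>a\<in>A. \<forall>z y z' y'.
          norm (f t z y a - f t z' y' a) \<le> lf * (norm (z - z') + norm (y - y'))"
    and epigraph_convex: "\<forall>t\<in>{t0..T}. \<forall>z y. convex {(f t z y a, l) | a l. a \<in> A \<and> L t z y a \<le> l}"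
    and L_lipschitz: "\<forall>R>0. \<exists>lL>0. \<forall>t\<in>{t0..T}. \<forall>a\<in>A.
          \<forall>z\<in>cball 0 R. \<forall>y\<in>cball 0 R. \<forall>z'\<in>cball 0 R. \<forall>y'\<in>cball 0 R.
          \<bar>L t z y a - L t z' y' a\<bar> \<le> lL * (norm (z - z') + norm (y - y'))"
    and L_growth: "\<exists>CL>0. \<forall>t\<in>{t0..T}. \<forall>a\<in>A. \<forall>z y. \<bar>L t z y a\<bar> \<le> CL * (1 + norm z + norm y)"
    and g_lipschitz: "\<forall>R>0. \<exists>lg>0. \<forall>(z1, w1)\<in>X_space b. \<forall>(z2, w2)\<in>X_space b.
          w1 \<in> P_hist b R \<longrightarrow> w2 \<in> P_hist b R \<longrightarrow>
          \<bar>g (z1, w1) - g (z2, w2)\<bar> \<le> lg * norm_X b (z1 - z2, \<lambda>\<theta>. w1 \<theta> - w2 \<theta>)"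
    and delay_nonneg: "\<forall>t\<in>{t0..T}. \<forall>z. 0 \<le> \<tau> t z"
    and delay_C1: "C1_on (\<lambda>(t, z). \<tau> t z) ({t0..T} \<times> UNIV)"
    and delay_bdd: "bdd_above ((\<lambda>(t, z). \<tau> t z) ` ({t0..T} \<times> UNIV))"
    and max_delay: "b = (SUP (t, z)\<in>{t0..T} \<times> UNIV. \<tau> t z)"
    and max_delay_pos: "0 < b"
    and delay_lipschitz: "\<exists>lt>0. \<forall>t\<in>{t0..T}. \<forall>z y. \<bar>\<tau> t z - \<tau> t y\<bar> \<le> lt * norm (z - y)"
    and delay_monotone: "\<forall>r>0. \<exists>d>0. \<forall>t\<in>{t0..T}. \<forall>w\<in>P_hist b r. \<forall>\<alpha>\<in>controls A t T.
          let x = trajectory f \<tau> b T t w \<alpha> in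
          AE s\<in>{t..T} in lebesgue.
            d \<le> 1 - vector_derivative (\<lambda>u. \<tau> u (x s)) (at s within {t0..T})
                  - frechet_derivative (\<lambda>z. \<tau> s z) (at (x s)) (vector_derivative x (at s))"

text \<open>
  In \<open>hamiltonian_gradient\<close>, \<open>Ha\<close> is the gradient with respect to the control, taken relative
  to \<open>A\<close>. It is unique if \<open>A\<close> has nonempty interior; otherwise any choice is admitted.
\<close>

locale smooth_delay_control_problem = delay_control_problem t0 T A f L g \<tau> b
  for t0 T :: real
    and A :: "(real ^ 'm) set"
    and f :: "real \<Rightarrow> real ^ 'n \<Rightarrow> real ^ 'n \<Rightarrow> real ^ 'm \<Rightarrow> real ^ 'n"
    and L :: "real \<Rightarrow> real ^ 'n \<Rightarrow> real ^ 'n \<Rightarrow> real ^ 'm \<Rightarrow> real"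
    and g :: "(real ^ 'n) \<times> (real \<Rightarrow> real ^ 'n) \<Rightarrow> real"
    and \<tau> :: "real \<Rightarrow> real ^ 'n \<Rightarrow> real"
    and b :: real +
  assumes f_C1: "C1_on (\<lambda>(t, z, y, a). f t z y a) ({t0..T} \<times> UNIV \<times> UNIV \<times> A)"
    and L_C1: "C1_on (\<lambda>(t, z, y, a). L t z y a) ({t0..T} \<times> UNIV \<times> UNIV \<times> A)"
    and hamiltonian_gradient: "\<exists>Ha :: real \<Rightarrow> real ^ 'n \<Rightarrow> real ^ 'n \<Rightarrow> real ^ 'n \<Rightarrow> real ^ 'm \<Rightarrow> real ^ 'm.
          (\<forall>t\<in>{t0..T}. \<forall>z y p. \<forall>a\<in>A.
             (hamiltonian f L t z y p has_derivative (\<lambda>v. Ha t z y p a \<bullet> v)) (at a within A)) \<and>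
          (\<exists>\<mu>>0. \<forall>t\<in>{t0..T}. \<forall>z y p. \<forall>a1\<in>A. \<forall>a2\<in>A.
             \<mu> * (norm (a1 - a2))\<^sup>2 \<le> (Ha t z y p a1 - Ha t z y p a2) \<bullet> (a1 - a2)) \<and>
          (\<exists>lH>0. \<forall>t1\<in>{t0..T}. \<forall>t2\<in>{t0..T}. \<forall>z1 y1 p1 z2 y2 p2. \<forall>a\<in>A.
             norm (Ha t1 z1 y1 p1 a - Ha t2 z2 y2 p2 a)
               \<le> lH * (\<bar>t1 - t2\<bar> + norm (z1 - z2) + norm (y1 - y2) + norm (p1 - p2)))"
    and f_second_difference: "\<forall>r>0. \<exists>\<gamma>>0. \<forall>t\<in>{t0..T}. \<forall>a\<in>A.
          \<forall>z1\<in>cball 0 r. \<forall>z2\<in>cball 0 r. \<forall>y1\<in>cball 0 r. \<forall>y2\<in>cball 0 r.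
          norm (f t z1 y1 a + f t z2 y2 a - 2 *\<^sub>R f t ((1/2) *\<^sub>R (z1 + z2)) ((1/2) *\<^sub>R (y1 + y2)) a)
            \<le> \<gamma> * ((norm (z1 - z2))\<^sup>2 + (norm (y1 - y2))\<^sup>2)"
    and L_second_difference: "\<forall>r>0. \<exists>\<gamma>>0. \<forall>t\<in>{t0..T}. \<forall>a\<in>A.
          \<forall>z1\<in>cball 0 r. \<forall>z2\<in>cball 0 r. \<forall>y1\<in>cball 0 r. \<forall>y2\<in>cball 0 r.
          \<bar>L t z1 y1 a + L t z2 y2 a - 2 * L t ((1/2) *\<^sub>R (z1 + z2)) ((1/2) *\<^sub>R (y1 + y2)) a\<bar>
            \<le> \<gamma> * ((norm (z1 - z2))\<^sup>2 + (norm (y1 - y2))\<^sup>2)"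
    and delay_second_difference: "\<forall>r>0. \<exists>\<gamma>>0. \<forall>t\<in>{t0..T}. \<forall>z1\<in>cball 0 r. \<forall>z2\<in>cball 0 r.
          \<bar>\<tau> t z1 + \<tau> t z2 - 2 * \<tau> t ((1/2) *\<^sub>R (z1 + z2))\<bar> \<le> \<gamma> * (norm (z1 - z2))\<^sup>2"
    and g_frechet: "\<forall>t\<in>{t0..T}. \<forall>w\<in>Lip_hist b. \<forall>\<alpha>\<in>controls A t T.
          let x = trajectory f \<tau> b T t w \<alpha> in
          \<exists>gz gw. X_frechet_deriv b g (x T, segment_at x T) gz gw"
    and g_frechet_bound: "\<forall>r>0. \<exists>\<gamma>>0. \<forall>t\<in>{t0..T}. \<forall>w\<in>V_hist b r. \<forall>\<alpha>\<in>controls A t T.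
          let x = trajectory f \<tau> b T t w \<alpha> in
          \<forall>gz gw. X_frechet_deriv b g (x T, segment_at x T) gz gw \<longrightarrow> norm_Linf b gw \<le> ereal \<gamma>"

end

theory Submission
  imports Defs
begin

text \<open>
  Both bounds on the gradient of the Hamiltonian hold uniformly in the unbounded variable \<open>p\<close>. Hence \<open>f\<close> is affine in
  the control with a constant linear part and \<open>L\<close> is strongly convex in it, so averaging an optimal control with its own
  shift lowers the running cost by a quadratic amount; comparison with this competitor bounds the Lipschitz constant of
  optimal controls in terms of \<open>r\<close> alone.

  Let \<open>\<alpha>\<close> be optimal for \<open>(t, w)\<close>, extended to times before \<open>t\<close> by its value at \<open>t\<close>, and let \<open>xp\<close>, \<open>xm\<close> and \<open>x\<close> be the
  trajectories of this one control from \<open>(t + h, w + w0)\<close>, \<open>(t - h, w - w0)\<close> and \<open>(t, w)\<close>. By the compatibility condition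
  \<open>xm\<close> has a kink of size only \<open>O(h)\<close> at \<open>t - h\<close>, so with \<open>eps = h + norm_H1 b w0\<close> the second difference
  \<open>S = xp + xm - 2 x\<close> is \<open>O(eps\<^sup>2)\<close> at \<open>t + h\<close>. Delayed states at the three different delayed times have a second
  difference which is \<open>O(eps\<^sup>2)\<close> up to \<open>S\<close> itself and an error of integral \<open>O(eps\<^sup>2)\<close>. As the delayed time is expanding,
  Gronwall's inequality gives \<open>S = O(eps\<^sup>2)\<close> on \<open>{t + h..T}\<close>. Inserting the same control in all three costs, the running
  costs are compared by the second order conditions on \<open>L\<close>, and the terminal costs by the semiconcavity of \<open>g\<close> applied
  to half the sum and half the difference of the final segments of \<open>xp\<close> and \<open>xm\<close>.
\<close>

section \<open>Differentiation of indefinite integrals\<close>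

text \<open>The obstacle is that \<open>norm_H1 b w0\<close> controls the derivative
  \<open>v0\<close> of \<open>w0\<close> only in the mean. The trajectory \<open>x\<close> has a
  kink of size about \<open>norm (v0 0)\<close> at \<open>t\<close>, and in the history of
  \<open>xp\<close> the second difference \<open>S\<close> is of size
  \<open>h * norm (v0 \<theta>)\<close>. Neither leads to a pointwise second order bound; integrals
  over time do better, since \<open>v0\<close> is of order \<open>eps\<close> in L1 and the delayed
  times straddle \<open>t\<close> only during a time of order \<open>eps\<close>. Hence delayed
  terms are estimated after integration, and the monotone delay serves there: a delayed time that
  expands by a factor at least \<open>DD\<close> turns the integral of a function of the delayed
  time into at most \<open>1 / DD\<close> times the integral of that function. The terminal cost
  fits in because \<open>g\<close> is Lipschitz in the L1 norm of the history. The same estimate in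
  L1 drives the bound on optimal controls: averaging on two short intervals at distance
  \<open>\<delta>\<close> perturbs the state substantially only for a time of order
  \<open>\<delta>\<close>, a gain invisible to supremum norms. Constants are fixed before
  \<open>t\<close>, \<open>h\<close>, \<open>w\<close> and \<open>w0\<close>.\<close>

lemma one_sided_bad_set_negligible:
  fixes g :: "real \<Rightarrow> 'a::euclidean_space"
  assumes int: "g integrable_on {a..c}" and k: "0 < k" and \<sigma>: "\<sigma> = 0 \<or> \<sigma> = -1"
  defines "E \<equiv> {x. \<forall>\<delta>>0. \<exists>d. 0 < d \<and> d < \<delta> \<and> a \<le> x - d \<and> x + d \<le> c \<and>
      k * d < norm (d *\<^sub>R g x - integral {x + \<sigma> * d..x + \<sigma> * d + d} g)}"
  shows "negligible E"
  unfolding negligible_outer_le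
proof (intro allI impI)
  fix e :: real assume "e > 0"
  \<comment> \<open>The ball around a tag has length \<open>2 * d\<close> while Henstock's lemma
    controls the sum of \<open>k * d\<close>; this choice turns a Henstock sum below
    \<open>e'\<close> into covered length below \<open>e\<close>.\<close>
  define e' where "e' = e * k / 2"
  have "e' > 0" using \<open>e > 0\<close> k by (simp add: e'_def)
  obtain \<gamma> where \<gamma>: "gauge \<gamma>" and hen: "\<And>p. \<lbrakk>p tagged_partial_division_of (cbox a c); \<gamma> fine p\<rbrakk> \<Longrightarrow>
             (\<Sum>(x,k)\<in>p. norm (measure lborel k *\<^sub>R g x - integral k g)) < e'"
    using Henstock_lemma[of g a c e'] int \<open>e' > 0\<close> by (auto simp: cbox_interval)
  \<comment> \<open>Vitali's theorem covers by balls, Henstock's lemma needs tagged intervals: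
    \<open>J\<close> is the half of the ball to the right or left of its centre, according to
    \<open>\<sigma>\<close>, and contains the tag. Disjoint balls thus give a tagged partial
    division.\<close>
  define J where "J = (\<lambda>(x::real, d::real). {x + \<sigma> * d..x + \<sigma> * d + d})"
  define K where "K = {(x, d). x \<in> E \<and> 0 < d \<and> a \<le> x - d \<and> x + d \<le> c \<and> J (x, d) \<subseteq> \<gamma> x \<and>
      k * d < norm (d *\<^sub>R g x - integral (J (x, d)) g)}"
  have Jsub: "J (x, d) \<subseteq> cball x d" and xJ: "x \<in> J (x, d)" if "0 < d" for x d
    using \<sigma> that by (auto simp: J_def dist_real_def)
  have cover: "\<exists>i. i \<in> K \<and> x \<in> cball (fst i) (snd i) \<and> snd i < \<delta>" if "x \<in> E" "0 < \<delta>" for x \<delta>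
  proof -
    obtain \<eta> where \<eta>: "\<eta> > 0" "ball x \<eta> \<subseteq> \<gamma> x"
      using gaugeD[OF \<gamma>, of x] open_contains_ball by blast
    obtain d where d: "0 < d" "d < min \<delta> \<eta>" "a \<le> x - d" "x + d \<le> c"
      "k * d < norm (d *\<^sub>R g x - integral {x + \<sigma> * d..x + \<sigma> * d + d} g)"
      using \<open>x \<in> E\<close>[unfolded E_def mem_Collect_eq, rule_format, of "min \<delta> \<eta>"] \<open>0 < \<delta>\<close> \<eta>(1) by auto
    have "J (x, d) \<subseteq> \<gamma> x" using Jsub[OF d(1), of x] \<eta>(2) d(2)
      by (auto simp: subset_iff dist_real_def)
    then have "(x, d) \<in> K" using d that by (auto simp: K_def J_def)
    then show ?thesis using d by (intro exI[of _ "(x, d)"]) auto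
  qed
  have Kpos: "0 < snd i" if "i \<in> K" for i using that by (auto simp: K_def)
  obtain C where C: "countable C" "C \<subseteq> K"
     "pairwise (\<lambda>i j. disjnt (cball (fst i) (snd i)) (cball (fst j) (snd j))) C"
     "negligible (E - (\<Union>i\<in>C. cball (fst i) (snd i)))"
    by (rule Vitali_covering_theorem_cballs[of K snd E fst, OF Kpos cover])
  have bound: "measure lebesgue (\<Union>i\<in>D. cball (fst i) (snd i)) \<le> e" if D: "D \<subseteq> C" "finite D" for D
  proof -
    define p where "p = (\<lambda>i. (fst i, J i)) ` D"
    have DK: "i \<in> K" if "i \<in> D" for i using that D C by auto
    have pos: "0 < snd i" if "i \<in> D" for i using DK[OF that] by (auto simp: K_def)
    have Ji: "J i \<subseteq> cball (fst i) (snd i)" "fst i \<in> J i" if "i \<in> D" for i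
      using Jsub[of "snd i" "fst i"] xJ[of "snd i" "fst i"] pos[OF that] by auto
    have disj: "J i \<inter> J j = {}" if "i \<in> D" "j \<in> D" "i \<noteq> j" for i j
    proof -
      have "disjnt (cball (fst i) (snd i)) (cball (fst j) (snd j))"
        using C(3) D(1) that by (auto simp: pairwise_def)
      then show ?thesis using Ji(1)[OF that(1)] Ji(1)[OF that(2)] by (auto simp: disjnt_def)
    qed
    have inj: "inj_on (\<lambda>i. (fst i, J i)) D"
    proof (rule inj_onI, rule ccontr)
      fix i j assume "i \<in> D" "j \<in> D" "(fst i, J i) = (fst j, J j)" "i \<noteq> j"
      then show False using disj[of i j] Ji(2)[of i] by auto
    qed
    have "p tagged_partial_division_of (cbox a c)"
      unfolding tagged_partial_division_of_def
    proof (intro conjI allI impI)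
      show "finite p" using D by (simp add: p_def)
    next
      fix x L assume "(x, L) \<in> p"
      then obtain i where i: "i \<in> D" "x = fst i" "L = J i" by (auto simp: p_def)
      show "x \<in> L" using Ji i by auto
      show "L \<subseteq> cbox a c" using Ji(1)[OF i(1)] DK[OF i(1)] i
        by (auto simp: K_def subset_iff dist_real_def cball_eq_atLeastAtMost)
      show "\<exists>a b. L = cbox a b" by (auto simp: i J_def split: prod.splits)
    next
      fix x1 L1 x2 L2 assume "(x1, L1) \<in> p \<and> (x2, L2) \<in> p \<and> (x1, L1) \<noteq> (x2, L2)"
      then obtain i j where "i \<in> D" "j \<in> D" "i \<noteq> j" "L1 = J i" "L2 = J j" by (auto simp: p_def)
      then show "interior L1 \<inter> interior L2 = {}"
        using disj[of i j] interior_subset by blast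
    qed
    moreover have "\<gamma> fine p"
      unfolding fine_def
    proof (intro ballI, clarify)
      fix x L y assume "(x, L) \<in> p" "y \<in> L"
      then obtain i where i: "i \<in> D" "x = fst i" "L = J i" by (auto simp: p_def)
      have "J (fst i, snd i) \<subseteq> \<gamma> (fst i)"
        using DK[OF i(1)] unfolding K_def by (simp only: mem_Collect_eq case_prod_beta)
      then show "y \<in> \<gamma> x" using i \<open>y \<in> L\<close> by auto
    qed
    ultimately have "(\<Sum>(x,k)\<in>p. norm (measure lborel k *\<^sub>R g x - integral k g)) < e'" by (rule hen)
    also have "(\<Sum>(x,k)\<in>p. norm (measure lborel k *\<^sub>R g x - integral k g)) =
        (\<Sum>i\<in>D. norm (measure lborel (J i) *\<^sub>R g (fst i) - integral (J i) g))"
      unfolding p_def by (subst sum.reindex[OF inj]) auto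
    finally have 1: "(\<Sum>i\<in>D. norm (measure lborel (J i) *\<^sub>R g (fst i) - integral (J i) g)) < e'" .
    have 2: "k * snd i \<le> norm (measure lborel (J i) *\<^sub>R g (fst i) - integral (J i) g)" if "i \<in> D" for i
      using DK[OF that] pos[OF that] by (auto simp: K_def J_def)
    have "(\<Sum>i\<in>D. k * snd i) < e'"
      using sum_mono[of D "\<lambda>i. k * snd i", OF 2] 1 by linarith
    then have "k * sum snd D < k * (e / 2)"
      by (simp add: sum_distrib_left e'_def algebra_simps)
    then have "sum snd D < e / 2" using mult_less_cancel_left_pos[OF k] by blast
    moreover have "(\<Sum>i\<in>D. 2 * snd i) = 2 * sum snd D" by (rule sum_distrib_left[symmetric])
    ultimately have 3: "(\<Sum>i\<in>D. 2 * snd i) < e" by linarith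
    have "measure lebesgue (\<Union>i\<in>D. cball (fst i) (snd i)) \<le> (\<Sum>i\<in>D. measure lebesgue (cball (fst i) (snd i)))"
      by (rule measure_UNION_le[OF D(2)]) (auto simp: )
    also have "\<dots> = (\<Sum>i\<in>D. 2 * snd i)"
      by (rule sum.cong) (use pos in \<open>auto simp: cball_eq_atLeastAtMost less_imp_le\<close>)
    finally show ?thesis using 3 by linarith
  qed
  have U: "(\<Union>i\<in>C. cball (fst i) (snd i)) \<in> lmeasurable"
     "measure lebesgue (\<Union>i\<in>C. cball (fst i) (snd i)) \<le> e"
    using fmeasurable_UN_bound[OF C(1) _ bound] measure_UN_bound[OF C(1) _ bound] by auto
  define N where "N = E - (\<Union>i\<in>C. cball (fst i) (snd i))"
  have N: "N \<in> lmeasurable" "measure lebesgue N = 0"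
    using C(4) negligible_imp_measurable negligible_imp_measure0 by (auto simp: N_def)
  show "\<exists>T. E \<subseteq> T \<and> T \<in> lmeasurable \<and> measure lebesgue T \<le> e"
  proof (intro exI conjI)
    show "E \<subseteq> (\<Union>i\<in>C. cball (fst i) (snd i)) \<union> N" by (auto simp: N_def)
    show "(\<Union>i\<in>C. cball (fst i) (snd i)) \<union> N \<in> lmeasurable" using U N by blast
    show "measure lebesgue ((\<Union>i\<in>C. cball (fst i) (snd i)) \<union> N) \<le> e"
      using measure_Un_le[of "\<Union>i\<in>C. cball (fst i) (snd i)" lebesgue N] U N by (auto simp: fmeasurableD)
  qed
qed

text \<open>Lebesgue's differentiation theorem for a Henstock-Kurzweil integrable function. The bad
  set is a countable union over the thresholds \<open>inverse (real (Suc n))\<close> and the two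
  sides. It turns a solution of the integral equation into a solution of the differential equation
  almost everywhere.\<close>

lemma indefinite_integral_ae_differentiable:
  fixes g :: "real \<Rightarrow> 'a::euclidean_space"
  assumes int: "g integrable_on {a..c}"
  obtains N where "negligible N"
    "\<And>s. s \<in> {a<..<c} - N \<Longrightarrow> ((\<lambda>u. integral {a..u} g) has_vector_derivative g s) (at s)"
proof -
  define B where "B = (\<lambda>n \<sigma>. {x. \<forall>\<delta>>0. \<exists>d. 0 < d \<and> d < \<delta> \<and> a \<le> x - d \<and> x + d \<le> c \<and>
      inverse (real (Suc n)) * d < norm (d *\<^sub>R g x - integral {x + \<sigma> * d..x + \<sigma> * d + d} g)})"
  define N where "N = (\<Union>n. B n 0 \<union> B n (-1))"
  have "negligible (B n \<sigma>)" if "\<sigma> = 0 \<or> \<sigma> = -1" for n \<sigma>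
    unfolding B_def by (rule one_sided_bad_set_negligible[OF int _ that]) simp
  then have "negligible N"
    unfolding N_def by (intro negligible_countable_Union) auto
  moreover have "((\<lambda>u. integral {a..u} g) has_vector_derivative g s) (at s)" if s: "s \<in> {a<..<c} - N" for s
    unfolding has_vector_derivative_def has_derivative_at_alt
  proof (intro conjI allI impI)
    show "bounded_linear (\<lambda>x. x *\<^sub>R g s)" by (rule bounded_linear_scaleR_left)
    fix e :: real assume "0 < e"
    then obtain n where n: "inverse (real (Suc n)) < e" using reals_Archimedean by blast
    have "s \<notin> B n 0" "s \<notin> B n (-1)" using s by (auto simp: N_def)
    obtain \<delta>1 where \<delta>1: "0 < \<delta>1"
      "\<And>d. \<lbrakk>0 < d; d < \<delta>1; a \<le> s - d; s + d \<le> c\<rbrakk> \<Longrightarrow> norm (d *\<^sub>R g s - integral {s..s + d} g) \<le> inverse (real (Suc n)) * d"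
      using \<open>s \<notin> B n 0\<close> unfolding B_def mem_Collect_eq not_all not_imp not_ex not_le[symmetric] by auto
    obtain \<delta>2 where \<delta>2: "0 < \<delta>2"
      "\<And>d. \<lbrakk>0 < d; d < \<delta>2; a \<le> s - d; s + d \<le> c\<rbrakk> \<Longrightarrow> norm (d *\<^sub>R g s - integral {s - d..s} g) \<le> inverse (real (Suc n)) * d"
      using \<open>s \<notin> B n (-1)\<close> unfolding B_def mem_Collect_eq not_all not_imp not_ex not_le[symmetric] by auto
    note \<delta> = \<delta>1(1) \<delta>2(1) \<delta>1(2) \<delta>2(2)
    define \<delta> where "\<delta> = min (min \<delta>1 \<delta>2) (min (s - a) (c - s))"
    have "\<delta> > 0" using s \<delta> by (auto simp: \<delta>_def)
    moreover have "norm (integral {a..y} g - integral {a..s} g - (y - s) *\<^sub>R g s) \<le> e * norm (y - s)"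
      if y: "norm (y - s) < \<delta>" for y
    proof (cases "s \<le> y")
      case True
      have yc: "y < c" using y by (auto simp: \<delta>_def)
      have "integral {a..y} g = integral {a..s} g + integral {s..y} g"
        by (rule Henstock_Kurzweil_Integration.integral_combine[symmetric])
           (use True yc s in \<open>auto intro: integrable_subinterval_real[OF int]\<close>)
      then have "norm (integral {a..y} g - integral {a..s} g - (y - s) *\<^sub>R g s) = norm ((y - s) *\<^sub>R g s - integral {s..y} g)"
        by (simp add: norm_minus_commute)
      also have "\<dots> \<le> inverse (real (Suc n)) * (y - s)"
        using \<delta>(3)[of "y - s"] y True by (cases "s = y") (auto simp: \<delta>_def)
      also have "\<dots> \<le> e * (y - s)" using n True by (intro mult_right_mono) auto
      finally show ?thesis using True by simp
    next
      case False
      have ya: "y > a" using y by (auto simp: \<delta>_def)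
      have "integral {a..s} g = integral {a..y} g + integral {y..s} g"
        by (rule Henstock_Kurzweil_Integration.integral_combine[symmetric])
           (use False ya s in \<open>auto intro: integrable_subinterval_real[OF int]\<close>)
      then have "norm (integral {a..y} g - integral {a..s} g - (y - s) *\<^sub>R g s) = norm ((s - y) *\<^sub>R g s - integral {y..s} g)"
        by (simp add: algebra_simps)
      also have "\<dots> \<le> inverse (real (Suc n)) * (s - y)"
        using \<delta>(4)[of "s - y"] y False by (auto simp: \<delta>_def)
      also have "\<dots> \<le> e * (s - y)" using n False by (intro mult_right_mono) auto
      finally show ?thesis using False by simp
    qed
    ultimately show "\<exists>d>0. \<forall>y. norm (y - s) < d \<longrightarrow>
        norm (integral {a..y} g - integral {a..s} g - (y - s) *\<^sub>R g s) \<le> e * norm (y - s)"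
      by blast
  qed
  ultimately show ?thesis using that by blast
qed

section \<open>Lipschitz functions and almost everywhere derivatives\<close>

lemma continuous_on_Icc_bounded:
  fixes \<phi> :: "real \<Rightarrow> 'a::real_normed_vector"
  assumes "continuous_on {a..c} \<phi>"
  obtains B where "\<And>s. s \<in> {a..c} \<Longrightarrow> norm (\<phi> s) \<le> B" "0 \<le> B"
proof -
  obtain B where "\<forall>s\<in>{a..c}. norm (\<phi> s) \<le> B"
    using compact_imp_bounded[OF compact_continuous_image[OF assms compact_Icc]] by (auto simp: bounded_iff)
  then show ?thesis using that[of "max 0 B"] by fastforce
qed

text \<open>A Lipschitz map sends the exceptional null set to a null set. If \<open>x\<close>
  dropped, some level in between would be attained only at points with positive derivative; just
  after the last such point the function exceeds the level and would have to return to it.\<close>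

lemma lipschitz_ae_increasing:
  fixes x :: "real \<Rightarrow> real"
  assumes lip: "K-lipschitz_on {a..c} x" and "a \<le> c" and N: "negligible N"
    and der: "\<And>s. s \<in> {a<..<c} - N \<Longrightarrow> \<exists>D>0. (x has_real_derivative D) (at s)"
  shows "x a \<le> x c"
proof (rule ccontr)
  assume "\<not> x a \<le> x c"
  then have less: "x c < x a" by simp
  have cont: "continuous_on {a..c} x" using lip by (rule lipschitz_on_continuous_on)
  have "negligible (x ` (N \<inter> {a..c}))"
  proof (rule negligible_locally_Lipschitz_image)
    show "negligible (N \<inter> {a..c})" using N negligible_subset by blast
    fix s assume "s \<in> N \<inter> {a..c}"
    then show "\<exists>T B. open T \<and> s \<in> T \<and> (\<forall>y\<in>N \<inter> {a..c} \<inter> T. norm (x y - x s) \<le> B * norm (y - s))"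
      using lipschitz_onD[OF lip] by (intro exI[of _ UNIV] exI[of _ K]) (auto simp: dist_norm)
  qed simp
  moreover have "\<not> negligible {x c<..<x a}" using less open_not_negligible[of "{x c<..<x a}"] by auto
  ultimately obtain y where y: "x c < y" "y < x a" "y \<notin> x ` (N \<inter> {a..c})"
    using negligible_subset by (metis greaterThanLessThan_iff subsetI)
  define Z where "Z = {s \<in> {a..c}. x s = y}"
  have "compact Z"
  proof -
    have "Z = {a..c} \<inter> x -` {y}" by (auto simp: Z_def)
    then show ?thesis
      by (metis cont compact_Icc closed_singleton compact_Int_closed compact_imp_closed
          continuous_closed_preimage inf.idem inf.left_idem compact_eq_bounded_closed bounded_Int)
  qed
  moreover have "Z \<noteq> {}"
    using IVT2'[of x c y a] y cont \<open>a \<le> c\<close> by (auto simp: Z_def)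
  ultimately obtain s where s: "s \<in> Z" "\<And>v. v \<in> Z \<Longrightarrow> v \<le> s" by (meson compact_attains_sup)
  have "s \<noteq> a" "s \<noteq> c" using s(1) y by (auto simp: Z_def)
  then have "s \<in> {a<..<c} - N" using s(1) y(3) by (auto simp: Z_def)
  then obtain D where D: "D > 0" "(x has_real_derivative D) (at s)" using der by blast
  obtain d where d: "d > 0" "\<And>h. \<lbrakk>0 < h; h < d\<rbrakk> \<Longrightarrow> x s < x (s + h)"
    using has_real_derivative_pos_inc_right[OF D(2,1)] by (auto)
  define h where "h = min (d / 2) ((c - s) / 2)"
  have sc: "s < c" "a < s" using \<open>s \<in> {a<..<c} - N\<close> by auto
  have h: "0 < h" "h < d" "s + h < c" using d(1) sc by (auto simp: h_def min_def field_simps)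
  have "y < x (s + h)" using d(2)[OF h(1,2)] s(1) by (simp add: Z_def)
  then obtain v where "s + h \<le> v" "v \<le> c" "x v = y"
    using IVT2'[of x c y "s + h"] y h sc continuous_on_subset[OF cont, of "{s + h..c}"] by auto
  then have "v \<in> Z" using sc h by (auto simp: Z_def)
  then show False using s(2)[of v] \<open>s + h \<le> v\<close> h by linarith
qed

lemma lipschitz_ae_nondecreasing:
  fixes x :: "real \<Rightarrow> real"
  assumes lip: "K-lipschitz_on {a..c} x" and "a \<le> c" and N: "negligible N"
    and der: "\<And>s. s \<in> {a<..<c} - N \<Longrightarrow> \<exists>D\<ge>0. (x has_real_derivative D) (at s)"
  shows "x a \<le> x c"
proof (rule field_le_epsilon)
  fix e :: real assume "e > 0"
  define \<epsilon> where "\<epsilon> = e / (c - a + 1)"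
  have "\<epsilon> > 0" using \<open>e > 0\<close> \<open>a \<le> c\<close> by (simp add: \<epsilon>_def)
  have "x a + \<epsilon> * a \<le> x c + \<epsilon> * c"
  proof (rule lipschitz_ae_increasing[where x = "\<lambda>s. x s + \<epsilon> * s", OF _ \<open>a \<le> c\<close> N])
    show "(K + \<bar>\<epsilon>\<bar> * 1)-lipschitz_on {a..c} (\<lambda>s. x s + \<epsilon> * s)"
      by (intro lipschitz_on_add lip lipschitz_on_cmult_real lipschitz_on_id)
    fix s assume "s \<in> {a<..<c} - N"
    then obtain D where "D \<ge> 0" "(x has_real_derivative D) (at s)" using der by blast
    then show "\<exists>D>0. ((\<lambda>s. x s + \<epsilon> * s) has_real_derivative D) (at s)"
      using \<open>\<epsilon> > 0\<close> by (intro exI[of _ "D + \<epsilon>"]) (auto intro!: derivative_eq_intros)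
  qed
  moreover have "\<epsilon> * (c - a) \<le> e"
    using \<open>e > 0\<close> \<open>a \<le> c\<close> by (simp add: \<epsilon>_def field_simps)
  ultimately show "x a \<le> x c + e" by (simp add: algebra_simps)
qed

lemma lipschitz_on_inner_left:
  fixes x :: "real \<Rightarrow> 'a::real_inner"
  assumes "K-lipschitz_on S x" shows "(norm v * K)-lipschitz_on S (\<lambda>s. v \<bullet> x s)"
proof (rule lipschitz_onI)
  show "0 \<le> norm v * K" using lipschitz_on_nonneg[OF assms] by simp
  fix s u assume su: "s \<in> S" "u \<in> S"
  have "\<bar>v \<bullet> (x s - x u)\<bar> \<le> norm v * norm (x s - x u)" by (rule Cauchy_Schwarz_ineq2)
  also have "\<dots> \<le> norm v * (K * dist s u)"
    using lipschitz_onD[OF assms su] by (intro mult_left_mono) (auto simp: dist_norm)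
  finally show "dist (v \<bullet> x s) (v \<bullet> x u) \<le> norm v * K * dist s u"
    by (simp add: dist_real_def inner_diff_right mult.assoc)
qed

text \<open>Projecting on the direction \<open>v\<close> of the increment reduces to real functions:
  \<open>\<Phi> s - v \<bullet> x s\<close> is nondecreasing by Cauchy-Schwarz. This mean value
  inequality takes the place of the fundamental theorem of calculus for Lipschitz functions.\<close>

lemma lipschitz_ae_diff_bound:
  fixes x :: "real \<Rightarrow> 'a::real_inner"
  assumes lip: "K-lipschitz_on {a..c} x" and "a \<le> c" and N: "negligible N"
    and lip2: "K'-lipschitz_on {a..c} \<Phi>"
    and der: "\<And>s. s \<in> {a<..<c} - N \<Longrightarrow> \<exists>D p. (x has_vector_derivative D) (at s) \<and>
       (\<Phi> has_real_derivative p) (at s) \<and> norm D \<le> p"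
  shows "norm (x c - x a) \<le> \<Phi> c - \<Phi> a"
proof -
  define v where "v = sgn (x c - x a)"
  have nv: "norm v \<le> 1" by (simp add: v_def norm_sgn)
  have "\<Phi> a - v \<bullet> x a \<le> \<Phi> c - v \<bullet> x c"
  proof (rule lipschitz_ae_nondecreasing[where x = "\<lambda>s. \<Phi> s - v \<bullet> x s", OF _ \<open>a \<le> c\<close> N])
    show "(K' + norm v * K)-lipschitz_on {a..c} (\<lambda>s. \<Phi> s - v \<bullet> x s)"
      by (intro lipschitz_on_diff lip2 lipschitz_on_inner_left lip)
    fix s assume "s \<in> {a<..<c} - N"
    then obtain D p where D: "(x has_vector_derivative D) (at s)" "(\<Phi> has_real_derivative p) (at s)" "norm D \<le> p"
      using der by blast
    have "((\<lambda>s. v \<bullet> x s) has_real_derivative (v \<bullet> D)) (at s)"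
      using bounded_linear.has_vector_derivative[OF bounded_linear_inner_right D(1)]
      by (simp add: has_real_derivative_iff_has_vector_derivative)
    then have "((\<lambda>s. \<Phi> s - v \<bullet> x s) has_real_derivative (p - v \<bullet> D)) (at s)"
      using D(2) by (rule DERIV_diff[rotated])
    moreover have "v \<bullet> D \<le> p"
      using norm_cauchy_schwarz[of v D] mult_right_mono[OF nv norm_ge_zero[of D]] D(3) by simp
    ultimately show "\<exists>D\<ge>0. ((\<lambda>s. \<Phi> s - v \<bullet> x s) has_real_derivative D) (at s)"
      by (intro exI[of _ "p - v \<bullet> D"]) auto
  qed
  moreover have "v \<bullet> (x c - x a) = norm (x c - x a)"
    by (cases "x c = x a") (simp_all add: v_def sgn_div_norm power2_norm_eq_inner[symmetric] power2_eq_square)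
  ultimately show ?thesis by (simp add: inner_diff_right)
qed

lemma continuous_indefinite_integral_lipschitz:
  fixes \<phi> :: "real \<Rightarrow> 'a::banach"
  assumes cont: "continuous_on {a..c} \<phi>" and B: "\<And>s. s \<in> {a..c} \<Longrightarrow> norm (\<phi> s) \<le> B" and "0 \<le> B"
  shows "B-lipschitz_on {a..c} (\<lambda>s. integral {a..s} \<phi>)"
proof (rule bounded_derivative_imp_lipschitz[where f' = "\<lambda>s h. h *\<^sub>R \<phi> s"])
  show "((\<lambda>s. integral {a..s} \<phi>) has_derivative (\<lambda>h. h *\<^sub>R \<phi> s)) (at s within {a..c})" if "s \<in> {a..c}" for s
    using integral_has_vector_derivative[OF cont that] by (simp add: has_vector_derivative_def)
  show "onorm (\<lambda>h. h *\<^sub>R \<phi> s) \<le> B" if "s \<in> {a..c}" for s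
    using B[OF that] \<open>0 \<le> B\<close> by (intro onorm_bound) (auto simp: mult.commute[of B] intro: mult_left_mono)
qed (use \<open>0 \<le> B\<close> in auto)

lemma integral_has_vector_derivative_interior:
  fixes \<phi> :: "real \<Rightarrow> 'a::banach"
  assumes cont: "continuous_on {a..c} \<phi>" and s: "s \<in> {a<..<c}"
  shows "((\<lambda>s. integral {a..s} \<phi>) has_vector_derivative \<phi> s) (at s)"
  using integral_has_vector_derivative[OF cont, of s] s
  by (auto simp: at_within_Icc_at)

lemma lipschitz_ae_integral_bound:
  fixes x :: "real \<Rightarrow> 'a::real_inner"
  assumes lip: "K-lipschitz_on {a..c} x" and "a \<le> c" and N: "negligible N"
    and cont: "continuous_on {a..c} \<phi>"
    and der: "\<And>s. s \<in> {a<..<c} - N \<Longrightarrow> \<exists>D. (x has_vector_derivative D) (at s) \<and> norm D \<le> \<phi> s"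
  shows "norm (x c - x a) \<le> integral {a..c} \<phi>"
proof -
  obtain B where B: "\<And>s. s \<in> {a..c} \<Longrightarrow> norm (\<phi> s) \<le> B" "0 \<le> B"
    using continuous_on_Icc_bounded[OF cont] by blast
  have "norm (x c - x a) \<le> integral {a..c} \<phi> - integral {a..a} \<phi>"
  proof (rule lipschitz_ae_diff_bound[OF lip \<open>a \<le> c\<close> N continuous_indefinite_integral_lipschitz[OF cont B]])
    fix s assume s: "s \<in> {a<..<c} - N"
    show "\<exists>D p. (x has_vector_derivative D) (at s) \<and>
             ((\<lambda>s. integral {a..s} \<phi>) has_real_derivative p) (at s) \<and> norm D \<le> p"
      using der[OF s] integral_has_vector_derivative_interior[OF cont, of s] s
      by (auto simp: has_real_derivative_iff_has_vector_derivative)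
  qed
  then show ?thesis by simp
qed

lemma lipschitz_ae_linear_bound:
  fixes x :: "real \<Rightarrow> 'a::real_inner"
  assumes lip: "K-lipschitz_on {a..c} x" and "a \<le> c" and N: "negligible N"
    and der: "\<And>s. s \<in> {a<..<c} - N \<Longrightarrow> \<exists>D. (x has_vector_derivative D) (at s) \<and> norm (D - V) \<le> B"
  shows "norm (x c - x a - (c - a) *\<^sub>R V) \<le> B * (c - a)"
proof -
  have "norm ((x c - c *\<^sub>R V) - (x a - a *\<^sub>R V)) \<le> integral {a..c} (\<lambda>_. B)"
  proof (rule lipschitz_ae_integral_bound[OF _ \<open>a \<le> c\<close> N])
    show "(K + norm V)-lipschitz_on {a..c} (\<lambda>s. x s - s *\<^sub>R V)"
      by (intro lipschitz_on_diff lip)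
         (auto intro!: lipschitz_onI simp: dist_norm scaleR_left_diff_distrib[symmetric])
    fix s assume "s \<in> {a<..<c} - N"
    then obtain D where "(x has_vector_derivative D) (at s)" "norm (D - V) \<le> B" using der by blast
    then show "\<exists>D. ((\<lambda>s. x s - s *\<^sub>R V) has_vector_derivative D) (at s) \<and> norm D \<le> B"
      by (intro exI[of _ "D - V"]) (auto intro!: derivative_eq_intros)
  qed auto
  then show ?thesis using \<open>a \<le> c\<close> by (simp add: algebra_simps)
qed

text \<open>A one-sided change of variables: the primitive of \<open>\<phi>\<close> composed with
  \<open>\<sigma>\<close>, minus \<open>d\<close> times the integral of the composition, has
  nonnegative derivative almost everywhere.\<close>

lemma integral_comp_expanding_le:
  fixes \<phi> \<sigma> :: "real \<Rightarrow> real"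
  assumes lip: "K-lipschitz_on {a..c} \<sigma>" and "a \<le> c" and N: "negligible N"
    and der: "\<And>s. s \<in> {a<..<c} - N \<Longrightarrow> \<exists>D\<ge>d. (\<sigma> has_real_derivative D) (at s)"
    and range: "\<sigma> ` {a..c} \<subseteq> {p..q}" and cont: "continuous_on {p..q} \<phi>"
    and nonneg: "\<And>s. s \<in> {p..q} \<Longrightarrow> 0 \<le> \<phi> s" and "0 < d"
  shows "d * integral {a..c} (\<lambda>u. \<phi> (\<sigma> u)) \<le> integral {p..q} \<phi>"
proof -
  obtain B where B: "\<And>s. s \<in> {p..q} \<Longrightarrow> norm (\<phi> s) \<le> B" "0 \<le> B"
    using continuous_on_Icc_bounded[OF cont] by blast
  define \<Phi> where "\<Phi> = (\<lambda>s. integral {p..s} \<phi>)"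
  \<comment> \<open>Strict expansion keeps \<open>\<sigma> s\<close> in the interior of
    \<open>{p..q}\<close>, where the primitive of \<open>\<phi>\<close> has a two-sided
    derivative.\<close>
  have mono: "d * (v - u) \<le> \<sigma> v - \<sigma> u" if "u \<in> {a..c}" "v \<in> {a..c}" "u \<le> v" for u v
  proof -
    have "\<sigma> u - d * u \<le> \<sigma> v - d * v"
    proof (rule lipschitz_ae_nondecreasing[where x = "\<lambda>s. \<sigma> s - d * s", OF _ \<open>u \<le> v\<close> N])
      show "(K + \<bar>d\<bar> * 1)-lipschitz_on {u..v} (\<lambda>s. \<sigma> s - d * s)"
        using that by (intro lipschitz_on_diff lipschitz_on_subset[OF lip] lipschitz_on_cmult_real lipschitz_on_id) auto
      fix s assume "s \<in> {u<..<v} - N"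
      then have "s \<in> {a<..<c} - N" using that by auto
      from der[OF this] obtain D where "D \<ge> d" "(\<sigma> has_real_derivative D) (at s)" by blast
      then show "\<exists>D\<ge>0. ((\<lambda>s. \<sigma> s - d * s) has_real_derivative D) (at s)"
        by (intro exI[of _ "D - d"]) (auto intro!: derivative_eq_intros)
    qed
    then show ?thesis by (simp add: algebra_simps)
  qed
  have con\<sigma>: "continuous_on {a..c} \<sigma>" using lip by (rule lipschitz_on_continuous_on)
  have con: "continuous_on {a..c} (\<lambda>u. \<phi> (\<sigma> u))"
    by (rule continuous_on_compose2[OF cont con\<sigma> range])
  define H where "H = (\<lambda>u. \<Phi> (\<sigma> u) - d * integral {a..u} (\<lambda>u. \<phi> (\<sigma> u)))"
  have lipI: "B-lipschitz_on {a..c} (\<lambda>s. integral {a..s} (\<lambda>u. \<phi> (\<sigma> u)))"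
    by (rule continuous_indefinite_integral_lipschitz[OF con _ B(2)]) (use range B(1) in \<open>auto simp: image_subset_iff\<close>)
  have lip\<Phi>: "B-lipschitz_on {p..q} \<Phi>" unfolding \<Phi>_def
    by (rule continuous_indefinite_integral_lipschitz[OF cont B])
  have "H a \<le> H c"
  proof (rule lipschitz_ae_nondecreasing[OF _ \<open>a \<le> c\<close> N])
    show "(B * K + \<bar>d\<bar> * B)-lipschitz_on {a..c} H"
      unfolding H_def
      by (intro lipschitz_on_diff lipschitz_on_cmult_real lipI lipschitz_on_compose2[OF lip]
            lipschitz_on_subset[OF lip\<Phi> range])
    fix s assume s: "s \<in> {a<..<c} - N"
    from der[OF s] obtain D where D: "D \<ge> d" "(\<sigma> has_real_derivative D) (at s)" by blast
    have "\<sigma> a < \<sigma> s" "\<sigma> s < \<sigma> c"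
    proof -
      have "0 < d * (s - a)" "0 < d * (c - s)" using s \<open>0 < d\<close> by simp_all
      then show "\<sigma> a < \<sigma> s" "\<sigma> s < \<sigma> c" using mono[of a s] mono[of s c] s by auto
    qed
    moreover have "\<sigma> a \<in> {p..q}" "\<sigma> c \<in> {p..q}" using range \<open>a \<le> c\<close> by (auto simp: image_subset_iff)
    ultimately have "\<sigma> s \<in> {p<..<q}" by auto
    then have "(\<Phi> has_real_derivative \<phi> (\<sigma> s)) (at (\<sigma> s))"
      using integral_has_vector_derivative_interior[OF cont]
      by (simp add: \<Phi>_def has_real_derivative_iff_has_vector_derivative)
    from DERIV_chain2[OF this D(2)]
    have "(H has_real_derivative \<phi> (\<sigma> s) * D - d * \<phi> (\<sigma> s)) (at s)"
      unfolding H_def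
      by (intro DERIV_diff DERIV_cmult)
         (use integral_has_vector_derivative_interior[OF con, of s] s in
           \<open>auto simp: has_real_derivative_iff_has_vector_derivative\<close>)
    moreover have "d * \<phi> (\<sigma> s) \<le> \<phi> (\<sigma> s) * D"
      using D(1) nonneg[of "\<sigma> s"] \<open>\<sigma> s \<in> {p<..<q}\<close> by (subst mult.commute) (auto intro: mult_left_mono)
    ultimately show "\<exists>D\<ge>0. (H has_real_derivative D) (at s)" by (meson diff_ge_0_iff_ge)
  qed
  then have *: "d * integral {a..c} (\<lambda>u. \<phi> (\<sigma> u)) \<le> \<Phi> (\<sigma> c) - \<Phi> (\<sigma> a)" by (simp add: H_def)
  have "\<phi> integrable_on {p..q}" using cont by (rule integrable_continuous_real)
  then have int: "\<phi> integrable_on {u..v}" if "p \<le> u" "v \<le> q" for u v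
    using integrable_subinterval_real that by fastforce
  have "\<sigma> a \<in> {p..q}" "\<sigma> c \<in> {p..q}" using range \<open>a \<le> c\<close> by (auto simp: image_subset_iff)
  then have "0 \<le> \<Phi> (\<sigma> a)" "\<Phi> (\<sigma> c) \<le> integral {p..q} \<phi>"
    unfolding \<Phi>_def using nonneg
    by (auto intro!: integral_nonneg integral_subset_le int)
  with * show ?thesis by linarith
qed

text \<open>With \<open>M\<close> the maximum of \<open>norm (e s) * exp (- k * (s - a))\<close>,
  the derivative bound returns at most half of \<open>M\<close> at the maximiser, and the remaining
  terms bound \<open>M\<close>. The derivative bound is asked for every \<open>M\<close> because
  with delays the derivative depends on the whole past of \<open>e\<close>. The function
  \<open>E\<close> is a perturbation that is small itself, while its derivative may be
  large.\<close>

lemma exponential_gronwall: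
  fixes e E :: "real \<Rightarrow> 'a::real_inner"
  assumes "a \<le> c" and k: "0 < k" and \<beta>: "0 \<le> \<beta>"
    and cont: "continuous_on {a..c} e"
    and lip: "K-lipschitz_on {a..c} (\<lambda>s. e s - E s)" and N: "negligible N"
    and E: "\<And>s. s \<in> {a..c} \<Longrightarrow> norm (E s) \<le> \<eta>" and init: "norm (e a - E a) \<le> \<eta>'"
    and der: "\<And>u. u \<in> {a<..<c} - N \<Longrightarrow> \<exists>D. ((\<lambda>s. e s - E s) has_vector_derivative D) (at u) \<and>
       (\<forall>M\<ge>0. (\<forall>v\<in>{a..u}. norm (e v) \<le> M * exp (k * (v - a))) \<longrightarrow>
          norm D \<le> k / 2 * M * exp (k * (u - a)) + \<beta>)"
    and s: "s \<in> {a..c}"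
  shows "norm (e s) \<le> 2 * (\<eta> + \<eta>' + \<beta> * (c - a)) * exp (k * (s - a))"
proof -
  have "continuous_on {a..c} (\<lambda>s. norm (e s) * exp (- k * (s - a)))"
    by (intro continuous_intros cont)
  then obtain z where z: "z \<in> {a..c}"
    "\<And>s. s \<in> {a..c} \<Longrightarrow> norm (e s) * exp (- k * (s - a)) \<le> norm (e z) * exp (- k * (z - a))"
    using continuous_attains_sup[of "{a..c}" "\<lambda>s. norm (e s) * exp (- k * (s - a))"] \<open>a \<le> c\<close> by auto
  define M where "M = norm (e z) * exp (- k * (z - a))"
  have "M \<ge> 0" by (simp add: M_def)
  have M: "norm (e s) \<le> M * exp (k * (s - a))" if "s \<in> {a..c}" for s
  proof -
    have "norm (e s) * exp (- k * (s - a)) * exp (k * (s - a)) \<le> M * exp (k * (s - a))"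
      using z(2)[OF that] by (intro mult_right_mono) (auto simp: M_def)
    then show ?thesis by (simp add: mult.assoc exp_add[symmetric])
  qed
  obtain B where B: "B-lipschitz_on {a..z} (\<lambda>s. M / 2 * exp (k * (s - a)) + \<beta> * s)"
  proof -
    have "continuous_on {a..z} (\<lambda>x. k * (M / 2 * exp (k * (x - a))) + \<beta>)" by (intro continuous_intros)
    then obtain B where B: "\<And>x. x \<in> {a..z} \<Longrightarrow> norm (k * (M / 2 * exp (k * (x - a))) + \<beta>) \<le> B" "0 \<le> B"
      using continuous_on_Icc_bounded by blast
    have "B-lipschitz_on {a..z} (\<lambda>s. M / 2 * exp (k * (s - a)) + \<beta> * s)"
    proof (rule bounded_derivative_imp_lipschitz[where f' = "\<lambda>s h. (k * (M / 2 * exp (k * (s - a))) + \<beta>) * h"])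
      fix x assume x: "x \<in> {a..z}"
      show "((\<lambda>s. M / 2 * exp (k * (s - a)) + \<beta> * s) has_derivative
         (\<lambda>h. (k * (M / 2 * exp (k * (x - a))) + \<beta>) * h)) (at x within {a..z})"
        by (auto intro!: derivative_eq_intros simp: algebra_simps)
      show "onorm (\<lambda>h. (k * (M / 2 * exp (k * (x - a))) + \<beta>) * h) \<le> B"
        using B(1)[OF x] B(2) by (intro onorm_bound) (auto simp: abs_mult intro: mult_right_mono)
    qed (use B in auto)
    then show ?thesis using that by blast
  qed
  have "norm ((e z - E z) - (e a - E a)) \<le> (M / 2 * exp (k * (z - a)) + \<beta> * z) - (M / 2 * exp (k * (a - a)) + \<beta> * a)"
  proof (rule lipschitz_ae_diff_bound[OF lipschitz_on_subset[OF lip] _ N B])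
    fix s assume s: "s \<in> {a<..<z} - N"
    then have "s \<in> {a<..<c} - N" using z by auto
    from der[OF this] obtain D where D: "((\<lambda>s. e s - E s) has_vector_derivative D) (at s)"
       "\<forall>M\<ge>0. (\<forall>v\<in>{a..s}. norm (e v) \<le> M * exp (k * (v - a))) \<longrightarrow> norm D \<le> k / 2 * M * exp (k * (s - a)) + \<beta>"
      by blast
    have "norm D \<le> k / 2 * M * exp (k * (s - a)) + \<beta>"
      using D(2) \<open>M \<ge> 0\<close> M s z by auto
    then show "\<exists>D p. ((\<lambda>s. e s - E s) has_vector_derivative D) (at s) \<and>
             ((\<lambda>s. M / 2 * exp (k * (s - a)) + \<beta> * s) has_real_derivative p) (at s) \<and> norm D \<le> p"
      using D(1) by (intro exI[of _ D] exI[of _ "k / 2 * M * exp (k * (s - a)) + \<beta>"])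
        (auto intro!: derivative_eq_intros)
  qed (use z in auto)
  then have "norm ((e z - E z) - (e a - E a)) \<le> M / 2 * exp (k * (z - a)) + \<beta> * (z - a)"
    using \<open>M \<ge> 0\<close> by (simp add: algebra_simps)
  also have "\<dots> \<le> M / 2 * exp (k * (z - a)) + \<beta> * (c - a)" using z \<beta> by (intro add_left_mono mult_left_mono) auto
  finally have 1: "norm ((e z - E z) - (e a - E a)) \<le> M / 2 * exp (k * (z - a)) + \<beta> * (c - a)" .
  have "norm (e z) = norm (((e z - E z) - (e a - E a)) + (e a - E a) + E z)" by simp
  also have "\<dots> \<le> norm ((e z - E z) - (e a - E a)) + norm (e a - E a) + norm (E z)"
    by (intro order_trans[OF norm_triangle_ineq] add_right_mono norm_triangle_ineq)
  finally have 2: "norm (e z) \<le> M / 2 * exp (k * (z - a)) + (\<eta> + \<eta>' + \<beta> * (c - a))"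
    using 1 init E[OF z(1)] by linarith
  have ge1: "1 \<le> exp (k * (z - a))" using z k by auto
  have nn: "0 \<le> \<eta> + \<eta>' + \<beta> * (c - a)"
    using order_trans[OF norm_ge_zero E[OF z(1)]] order_trans[OF norm_ge_zero init] \<beta> \<open>a \<le> c\<close> by simp
  have "norm (e z) = M * exp (k * (z - a))" by (simp add: M_def mult.assoc exp_add[symmetric])
  then have "M / 2 * exp (k * (z - a)) \<le> (\<eta> + \<eta>' + \<beta> * (c - a)) * exp (k * (z - a))"
  proof -
    have "M * exp (k * (z - a)) / 2 \<le> \<eta> + \<eta>' + \<beta> * (c - a)"
      using 2 \<open>norm (e z) = M * exp (k * (z - a))\<close> by (simp only: times_divide_eq_left)
    moreover have "\<eta> + \<eta>' + \<beta> * (c - a) \<le> (\<eta> + \<eta>' + \<beta> * (c - a)) * exp (k * (z - a))"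
      using mult_left_mono[OF ge1 nn] by (simp only: mult_1_right)
    ultimately show ?thesis unfolding times_divide_eq_left by (rule order_trans)
  qed
  then have "M / 2 \<le> \<eta> + \<eta>' + \<beta> * (c - a)" by (rule mult_right_le_imp_le) simp
  then have "2 * (M / 2) \<le> 2 * (\<eta> + \<eta>' + \<beta> * (c - a))" by (intro mult_left_mono) auto
  then have "M \<le> 2 * (\<eta> + \<eta>' + \<beta> * (c - a))" by (metis field_sum_of_halves mult_2)
  then have "M * exp (k * (s - a)) \<le> 2 * (\<eta> + \<eta>' + \<beta> * (c - a)) * exp (k * (s - a))"
    by (intro mult_right_mono) auto
  then show ?thesis using M[OF s] by linarith
qed

lemma C1_on_imp_lipschitz:
  fixes F :: "'a::real_normed_vector \<Rightarrow> 'b::real_normed_vector"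
  assumes "C1_on F S" and "compact K" "convex K" "K \<subseteq> S"
  shows "\<exists>C>0. \<forall>p\<in>K. \<forall>q\<in>K. norm (F p - F q) \<le> C * norm (p - q)"
proof -
  obtain F' :: "'a \<Rightarrow> 'a \<Rightarrow>\<^sub>L 'b" where F': "\<forall>p\<in>S. (F has_derivative blinfun_apply (F' p)) (at p within S)"
    "continuous_on S F'"
    using assms(1) by (auto simp: C1_on_def)
  obtain B where B: "\<And>p. p \<in> K \<Longrightarrow> norm (F' p) \<le> B"
    using compact_imp_bounded[OF compact_continuous_image[OF continuous_on_subset[OF F'(2) \<open>K \<subseteq> S\<close>] \<open>compact K\<close>]]
    by (auto simp: bounded_iff)
  have "norm (F p - F q) \<le> max B 1 * norm (p - q)" if "p \<in> K" "q \<in> K" for p q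
  proof (rule differentiable_bound[OF \<open>convex K\<close> _ _ that(1,2)])
    fix x assume "x \<in> K"
    show "(F has_derivative blinfun_apply (F' x)) (at x within K)"
      using F'(1) \<open>x \<in> K\<close> \<open>K \<subseteq> S\<close> has_derivative_subset by blast
    show "onorm (blinfun_apply (F' x)) \<le> max B 1"
      using B[OF \<open>x \<in> K\<close>] by (simp add: norm_blinfun.rep_eq)
  qed
  then show ?thesis by (intro exI[of _ "max B 1"]) auto
qed

section \<open>Delayed states and stability\<close>

lemma norm_Pair_le2: "norm (x, y) \<le> norm x + norm y"
  using norm_Pair_le by blast

context delay_control_problem
begin

lemma lipschitz_f:
  "\<exists>l\<ge>1. \<forall>t\<in>{t0..T}. \<forall>a\<in>A. \<forall>z y z' y'. norm (f t z y a - f t z' y' a) \<le> l * (norm (z - z') + norm (y - y'))"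
proof -
  obtain l where l: "l > 0" "\<And>t a z y z' y'. t \<in> {t0..T} \<Longrightarrow> a \<in> A \<Longrightarrow>
          norm (f t z y a - f t z' y' a) \<le> l * (norm (z - z') + norm (y - y'))"
    using f_lipschitz by blast
  have "l * (norm (z - z') + norm (y - y')) \<le> max 1 l * (norm (z - z') + norm (y - y'))" for z z' y y' :: "real ^ 'n"
    by (intro mult_right_mono) auto
  then show ?thesis using l(2) by (intro exI[of _ "max 1 l"]) (meson max.cobounded1 order_trans)
qed

text \<open>Selected by choice from the data of the locale alone, so that constants built from it
  visibly do not depend on times, histories or controls. The same holds, with a radius as parameter
  where needed, for the other constants introduced by \<open>SOME\<close>.\<close>

definition "fL = (SOME l. l \<ge> 1 \<and> (\<forall>t\<in>{t0..T}. \<forall>a\<in>A. \<forall>z y z' y'.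
   norm (f t z y a - f t z' y' a) \<le> l * (norm (z - z') + norm (y - y'))))"

lemma fL: "1 \<le> fL"
  "t \<in> {t0..T} \<Longrightarrow> a \<in> A \<Longrightarrow> norm (f t z y a - f t z' y' a) \<le> fL * (norm (z - z') + norm (y - y'))"
  using someI_ex[OF lipschitz_f] unfolding fL_def[symmetric] by blast+

lemma lipschitz_delay: "\<exists>l\<ge>1. \<forall>t\<in>{t0..T}. \<forall>z y. \<bar>\<tau> t z - \<tau> t y\<bar> \<le> l * norm (z - y)"
proof -
  obtain l where l: "l > 0" "\<And>t z y. t \<in> {t0..T} \<Longrightarrow> \<bar>\<tau> t z - \<tau> t y\<bar> \<le> l * norm (z - y)"
    using delay_lipschitz by blast
  have "l * norm (z - y) \<le> max 1 l * norm (z - y)" for z y :: "real ^ 'n"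
    by (intro mult_right_mono) auto
  then show ?thesis using l(2) by (intro exI[of _ "max 1 l"]) (meson max.cobounded1 order_trans)
qed

definition "tL = (SOME l. l \<ge> 1 \<and> (\<forall>t\<in>{t0..T}. \<forall>z y. \<bar>\<tau> t z - \<tau> t y\<bar> \<le> l * norm (z - y)))"

lemma tL: "1 \<le> tL" "t \<in> {t0..T} \<Longrightarrow> \<bar>\<tau> t z - \<tau> t y\<bar> \<le> tL * norm (z - y)"
  using someI_ex[OF lipschitz_delay] unfolding tL_def[symmetric] by blast+

lemma growth_f:
  obtains Cf where "1 \<le> Cf" "\<And>t a z y. t \<in> {t0..T} \<Longrightarrow> a \<in> A \<Longrightarrow> norm (f t z y a) \<le> Cf * (1 + norm z + norm y)"
proof -
  have "continuous_on ({t0..T} \<times> A) (\<lambda>(t, a). f t 0 0 a)"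
  proof -
    have "continuous_on ({t0..T} \<times> A) (\<lambda>p. (fst p, 0::real ^ 'n, 0::real ^ 'n, snd p))"
      by (intro continuous_intros)
    moreover have "(\<lambda>p. (fst p, 0::real ^ 'n, 0::real ^ 'n, snd p)) ` ({t0..T} \<times> A) \<subseteq> {t0..T} \<times> UNIV \<times> UNIV \<times> A"
      by auto
    ultimately show ?thesis using continuous_on_compose2[OF f_cont] by (fastforce simp: case_prod_unfold)
  qed
  then have "compact ((\<lambda>(t, a). f t 0 0 a) ` ({t0..T} \<times> A))"
    by (intro compact_continuous_image compact_Times A_compact compact_Icc)
  from compact_imp_bounded[OF this]
  obtain B where "\<forall>x\<in>(\<lambda>(t, a). f t 0 0 a) ` ({t0..T} \<times> A). norm x \<le> B" unfolding bounded_iff by blast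
  then have B: "\<And>t a. t \<in> {t0..T} \<Longrightarrow> a \<in> A \<Longrightarrow> norm (f t 0 0 a) \<le> B" by auto
  show thesis
  proof (rule that[of "max B fL"])
    fix t a z y assume "t \<in> {t0..T}" "a \<in> A"
    then have "norm (f t z y a) \<le> B + fL * (norm z + norm y)"
      using norm_triangle_sub[of "f t z y a" "f t 0 0 a"] B fL(2)[of t a z y 0 0] by fastforce
    also have "\<dots> \<le> max B fL * 1 + max B fL * (norm z + norm y)"
      by (intro add_mono mult_right_mono) auto
    finally show "norm (f t z y a) \<le> max B fL * (1 + norm z + norm y)" by (simp add: algebra_simps)
  qed (use fL in auto)
qed

lemma delay_le: "t \<in> {t0..T} \<Longrightarrow> \<tau> t z \<le> b"
  using cSUP_upper[OF _ delay_bdd, of "(t, z)"] by (auto simp: max_delay)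

lemma delay_ge: "t \<in> {t0..T} \<Longrightarrow> 0 \<le> \<tau> t z"
  using delay_nonneg by blast

lemma delay_cont: "continuous_on ({t0..T} \<times> UNIV) (\<lambda>(t, z). \<tau> t z)"
  using delay_C1 unfolding C1_on_def
  by (meson continuous_on_eq_continuous_within has_derivative_continuous)

text \<open>Lipschitz continuity of the delay is assumed globally in the state; in time it comes
  from continuous differentiability on compact sets, hence the radius \<open>R\<close>.\<close>

lemma delay_lipschitz_local:
  assumes "0 \<le> R"
  obtains lt where "1 \<le> lt" "\<And>t t' z z'. \<lbrakk>t \<in> {t0..T}; t' \<in> {t0..T}; norm z \<le> R; norm z' \<le> R\<rbrakk> \<Longrightarrow>
      \<bar>\<tau> t z - \<tau> t' z'\<bar> \<le> lt * (\<bar>t - t'\<bar> + norm (z - z'))"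
proof -
  obtain C where C: "C > 0" "\<forall>p\<in>{t0..T} \<times> cball 0 R. \<forall>q\<in>{t0..T} \<times> cball 0 R.
      norm ((\<lambda>(t, z). \<tau> t z) p - (\<lambda>(t, z). \<tau> t z) q) \<le> C * norm (p - q)"
  proof -
    have "compact ({t0..T} \<times> cball (0::real ^ 'n) R)" "convex ({t0..T} \<times> cball (0::real ^ 'n) R)"
      by (auto intro: compact_Times convex_Times)
    moreover have "{t0..T} \<times> cball (0::real ^ 'n) R \<subseteq> {t0..T} \<times> UNIV" by auto
    ultimately show ?thesis using C1_on_imp_lipschitz[OF delay_C1] that by blast
  qed
  show thesis
  proof (rule that[of "max 1 C"])
    fix t t' and z z' :: "real ^ 'n" assume a: "t \<in> {t0..T}" "t' \<in> {t0..T}" "norm z \<le> R" "norm z' \<le> R"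
    then have "norm (\<tau> t z - \<tau> t' z') \<le> C * norm ((t, z) - (t', z'))"
      using C(2)[rule_format, of "(t, z)" "(t', z')"] by auto
    also have "\<dots> \<le> max 1 C * (\<bar>t - t'\<bar> + norm (z - z'))"
      using norm_Pair_le2[of "t - t'" "z - z'"] C(1) by (intro mult_mono) auto
    finally show "\<bar>\<tau> t z - \<tau> t' z'\<bar> \<le> max 1 C * (\<bar>t - t'\<bar> + norm (z - z'))" by simp
  qed simp
qed

definition delayed :: "(real \<Rightarrow> real ^ 'n) \<Rightarrow> real \<Rightarrow> real ^ 'n" where
  "delayed x s = x (s - \<tau> s (x s))"

definition dtime :: "(real \<Rightarrow> real ^ 'n) \<Rightarrow> real \<Rightarrow> real" where
  "dtime x s = s - \<tau> s (x s)"

lemma delayed_eq: "delayed x s = x (dtime x s)"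
  by (simp add: delayed_def dtime_def)

lemma dtime_bounds: "s \<in> {t0..T} \<Longrightarrow> dtime x s \<in> {s - b..s}"
  using delay_le[of s "x s"] delay_ge[of s "x s"] by (auto simp: dtime_def)

abbreviation solves :: "real \<Rightarrow> (real \<Rightarrow> real ^ 'n) \<Rightarrow> (real \<Rightarrow> real ^ 'm) \<Rightarrow> (real \<Rightarrow> real ^ 'n) \<Rightarrow> bool" where
  "solves t w \<alpha> x \<equiv> is_trajectory f \<tau> b T t w \<alpha> x"

lemma continuous_on_dtime:
  assumes "t0 \<le> t" and "continuous_on {t..T} x"
  shows "continuous_on {t..T} (dtime x)"
  unfolding dtime_def[abs_def]
  using assms by (intro continuous_intros continuous_on_compose2[OF delay_cont, of "{t..T}" "\<lambda>s. (s, x s)", simplified]) auto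

lemma continuous_on_delayed:
  assumes "t0 \<le> t" and "continuous_on {t - b..T} x"
  shows "continuous_on {t..T} (delayed x)"
  unfolding delayed_eq[abs_def]
proof (rule continuous_on_compose2[OF assms(2)])
  show "continuous_on {t..T} (dtime x)"
    using assms max_delay_pos by (intro continuous_on_dtime continuous_on_subset[OF assms(2)]) auto
  show "dtime x ` {t..T} \<subseteq> {t - b..T}"
  proof (rule image_subsetI)
    fix s assume "s \<in> {t..T}"
    then show "dtime x s \<in> {t - b..T}" using dtime_bounds[of s x] assms(1) by auto
  qed
qed

lemma integrable_along:
  fixes F :: "real \<Rightarrow> real ^ 'n \<Rightarrow> real ^ 'n \<Rightarrow> real ^ 'm \<Rightarrow> 'e::euclidean_space"
  assumes cont: "continuous_on ({t0..T} \<times> UNIV \<times> UNIV \<times> A) (\<lambda>(t, z, y, a). F t z y a)"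
    and t: "t0 \<le> t" and x: "continuous_on {t..T} x" and y: "continuous_on {t..T} y"
    and \<alpha>: "\<alpha> \<in> controls A t T"
  shows "(\<lambda>s. F s (x s) (y s) (\<alpha> s)) absolutely_integrable_on {t..T}"
    and "\<exists>B. \<forall>s\<in>{t<..<T}. norm (F s (x s) (y s) (\<alpha> s)) \<le> B"
proof -
  let ?S = "{t0..T} \<times> UNIV \<times> UNIV \<times> A"
  have "closed ?S" by (intro closed_Times closed_UNIV compact_imp_closed[OF A_compact]) auto
  \<comment> \<open>Extension by zero off the closed domain gives a Borel function on the whole
    space, which may be composed with a Lebesgue measurable control.\<close>
  then have F: "(\<lambda>p. if p \<in> ?S then (\<lambda>(t, z, y, a). F t z y a) p else 0) \<in> borel_measurable borel"
    using cont borel_closed[OF \<open>closed ?S\<close>] by (intro borel_measurable_continuous_on_if) auto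
  have \<alpha>m: "\<alpha> \<in> borel_measurable (lebesgue_on {t<..<T})" and \<alpha>A: "\<And>s. s \<in> {t<..<T} \<Longrightarrow> \<alpha> s \<in> A"
    using \<alpha> by (auto simp: controls_def)
  have meas: "u \<in> borel_measurable (lebesgue_on {t<..<T})" if "continuous_on {t..T} u" for u :: "real \<Rightarrow> real ^ 'n"
    using that by (intro continuous_imp_measurable_on_sets_lebesgue continuous_on_subset[OF that]) auto
  have "(\<lambda>s. (s, x s, y s, \<alpha> s)) \<in> borel_measurable (lebesgue_on {t<..<T})"
    by (intro borel_measurable_Pair \<alpha>m meas x y continuous_imp_measurable_on_sets_lebesgue) auto
  from measurable_compose[OF this F]
  have "(\<lambda>s. F s (x s) (y s) (\<alpha> s)) \<in> borel_measurable (lebesgue_on {t<..<T})"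
    by (rule measurable_cong[THEN iffD1, rotated]) (use t \<alpha>A in \<open>auto simp: space_restrict_space\<close>)
  then have meas: "(\<lambda>s. F s (x s) (y s) (\<alpha> s)) \<in> borel_measurable (lebesgue_on {t<..<T})" .
  have "compact ({t..T} \<times> x ` {t..T} \<times> y ` {t..T} \<times> A)"
    by (intro compact_Times compact_continuous_image x y A_compact compact_Icc)
  then have "compact ((\<lambda>(t, z, y, a). F t z y a) ` ({t..T} \<times> x ` {t..T} \<times> y ` {t..T} \<times> A))"
    using t by (intro compact_continuous_image continuous_on_subset[OF cont]) auto
  from compact_imp_bounded[OF this] obtain B where
    B': "\<forall>v\<in>(\<lambda>(t, z, y, a). F t z y a) ` ({t..T} \<times> x ` {t..T} \<times> y ` {t..T} \<times> A). norm v \<le> B"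
    unfolding bounded_iff by blast
  have B: "norm (F s (x s) (y s) (\<alpha> s)) \<le> B" if "s \<in> {t<..<T}" for s
  proof -
    have "(s, x s, y s, \<alpha> s) \<in> {t..T} \<times> x ` {t..T} \<times> y ` {t..T} \<times> A" using \<alpha>A[OF that] that by auto
    from bspec[OF B' imageI[OF this]] show ?thesis by simp
  qed
  then show "\<exists>B. \<forall>s\<in>{t<..<T}. norm (F s (x s) (y s) (\<alpha> s)) \<le> B" by blast
  have "(\<lambda>_. B) integrable_on {t<..<T}"
    by (metis integrable_on_open_interval_real integrable_const_ivl)
  then have "(\<lambda>s. F s (x s) (y s) (\<alpha> s)) absolutely_integrable_on {t<..<T}"
    by (intro measurable_bounded_by_integrable_imp_absolutely_integrable[OF meas _ _ B]) simp_all
  then show "(\<lambda>s. F s (x s) (y s) (\<alpha> s)) absolutely_integrable_on {t..T}"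
  proof (rule absolutely_integrable_spike_set)
    have "negligible {t, T}" by simp
    then show "negligible {u \<in> {t<..<T} - {t..T}. F u (x u) (y u) (\<alpha> u) \<noteq> 0}"
      "negligible {u \<in> {t..T} - {t<..<T}. F u (x u) (y u) (\<alpha> u) \<noteq> 0}"
      by (rule negligible_subset; force)+
  qed
qed

text \<open>The comparison is split at the delayed time of \<open>x2\<close>: there the two
  functions are compared at one common time, and only the Lipschitz constant of \<open>x1\<close>
  pays for the difference of the delayed times.\<close>

lemma delayed_diff:
  assumes x1: "K-lipschitz_on {a - b..T} x1" and u: "u \<in> {a..T}" and a: "t0 \<le> a"
  shows "norm (delayed x2 u - delayed x1 u) \<le>
    norm (x2 (dtime x2 u) - x1 (dtime x2 u)) + K * tL * norm (x2 u - x1 u)"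
proof -
  have u': "u \<in> {t0..T}" using u a by auto
  have "dtime x2 u \<in> {a - b..T}" "dtime x1 u \<in> {a - b..T}"
    using dtime_bounds[OF u', of x1] dtime_bounds[OF u', of x2] u by auto
  then have "norm (x1 (dtime x2 u) - x1 (dtime x1 u)) \<le> K * \<bar>dtime x2 u - dtime x1 u\<bar>"
    using lipschitz_onD[OF x1] by (auto simp: dist_norm)
  also have "\<bar>dtime x2 u - dtime x1 u\<bar> \<le> tL * norm (x2 u - x1 u)"
    using tL(2)[OF u', of "x2 u" "x1 u"] by (simp add: dtime_def)
  finally have "norm (x1 (dtime x2 u) - x1 (dtime x1 u)) \<le> K * tL * norm (x2 u - x1 u)"
    using lipschitz_on_nonneg[OF x1] by (simp add: mult.assoc mult_left_mono)
  moreover have "norm (delayed x2 u - delayed x1 u) \<le>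
     norm (x2 (dtime x2 u) - x1 (dtime x2 u)) + norm (x1 (dtime x2 u) - x1 (dtime x1 u))"
    using norm_triangle_ineq[of "x2 (dtime x2 u) - x1 (dtime x2 u)" "x1 (dtime x2 u) - x1 (dtime x1 u)"]
    by (simp add: delayed_eq)
  ultimately show ?thesis by linarith
qed

text \<open>The bound of \<open>exponential_gronwall\<close> as used in \<open>stability\<close>:
  \<open>3\<close> collects \<open>\<eta>\<close> for \<open>E\<close> and \<open>2 * \<eta>\<close>
  for the initial error, \<open>fL * (T - t0)\<close> the error at delayed times that fall into the
  history. Half the rate, \<open>fL * (2 + K * tL)\<close>, is the Lipschitz rate of state and
  delayed state together.\<close>

definition "sC K = 2 * (3 + fL * (T - t0)) * exp (2 * (fL * (2 + K * tL)) * (T - t0))"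

lemma sC_ge1:
  assumes "0 \<le> K" shows "1 \<le> sC K"
proof -
  have "0 \<le> 2 * (fL * (2 + K * tL)) * (T - t0)" using fL(1) tL(1) assms time_interval by auto
  moreover have "0 \<le> fL * (T - t0)" using fL(1) time_interval by auto
  ultimately have "1 * 1 \<le> (2 * (3 + fL * (T - t0))) * exp (2 * (fL * (2 + K * tL)) * (T - t0))"
    by (intro mult_mono) auto
  then show ?thesis by (simp add: sC_def)
qed

text \<open>Delayed times before \<open>a\<close> contribute the history error
  \<open>\<eta>\<close>; later ones are bounded by the weighted supremum of the error up to the
  current time, as \<open>exponential_gronwall\<close> requires. \<open>E\<close> stands for the
  time integral of a perturbation of the right-hand side.\<close>

lemma stability:
  assumes a: "a \<in> {t0..T}" and x1: "K-lipschitz_on {a - b..T} x1" and x2: "K-lipschitz_on {a - b..T} x2"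
      and hist: "\<And>s. s \<in> {a - b..a} \<Longrightarrow> norm (x2 s - x1 s) \<le> \<eta>"
      and E: "\<And>s. s \<in> {a..T} \<Longrightarrow> norm (E s) \<le> \<eta>" "KE-lipschitz_on {a..T} E"
      and N: "negligible N" and \<alpha>: "\<And>u. u \<in> {a<..<T} - N \<Longrightarrow> \<alpha> u \<in> A"
      and d1: "\<And>u. u \<in> {a<..<T} - N \<Longrightarrow> (x1 has_vector_derivative f u (x1 u) (delayed x1 u) (\<alpha> u)) (at u)"
      and d2: "\<And>u. u \<in> {a<..<T} - N \<Longrightarrow> ((\<lambda>s. x2 s - E s) has_vector_derivative f u (x2 u) (delayed x2 u) (\<alpha> u)) (at u)"
      and s: "s \<in> {a - b..T}"
  shows "norm (x2 s - x1 s) \<le> sC K * \<eta>"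
proof -
  have K0: "0 \<le> K" using x1 by (rule lipschitz_on_nonneg)
  define k where "k = 2 * (fL * (2 + K * tL))"
  have k: "k > 0" using fL(1) tL(1) K0 by (auto simp: k_def intro!: mult_pos_pos add_pos_nonneg)
  define C where "C = sC K"
  have C1: "1 \<le> C" by (simp add: C_def sC_ge1[OF K0])
    have \<eta>0: "0 \<le> \<eta>" using order_trans[OF norm_ge_zero E(1)[of a]] a by auto
    have b: "0 < b" by (rule max_delay_pos)
    have l12: "(K + K)-lipschitz_on {a..T} (\<lambda>s. x2 s - x1 s)"
      using b by (intro lipschitz_on_diff lipschitz_on_subset[OF x1] lipschitz_on_subset[OF x2]) auto
    show "norm (x2 s - x1 s) \<le> sC K * \<eta>"
    proof (cases "s \<le> a")
      case True
      then have "norm (x2 s - x1 s) \<le> 1 * \<eta>" using hist s by simp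
      then show ?thesis using C1 \<eta>0 unfolding C_def by (meson mult_right_mono order_trans)
    next
      case False
      have "norm (x2 s - x1 s) \<le> 2 * (\<eta> + 2 * \<eta> + fL * \<eta> * (T - a)) * exp (k * (s - a))"
      proof (rule exponential_gronwall[where e = "\<lambda>s. x2 s - x1 s" and E = E, OF _ k _ _ _ N E(1)])
        show "((K + K) + KE)-lipschitz_on {a..T} (\<lambda>s. x2 s - x1 s - E s)"
          by (intro lipschitz_on_diff l12 E(2))
        show "norm (x2 a - x1 a - E a) \<le> 2 * \<eta>"
          using norm_triangle_ineq4[of "x2 a - x1 a" "E a"] hist[of a] E(1)[of a] a b by auto
        fix u assume u: "u \<in> {a<..<T} - N"
        then have u': "u \<in> {a..T}" "u \<in> {t0..T}" using a by auto
        have "((\<lambda>s. (x2 s - E s) - x1 s) has_vector_derivative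
            (f u (x2 u) (delayed x2 u) (\<alpha> u) - f u (x1 u) (delayed x1 u) (\<alpha> u))) (at u)"
          by (intro has_vector_derivative_diff d1 d2 u)
        moreover have "norm (f u (x2 u) (delayed x2 u) (\<alpha> u) - f u (x1 u) (delayed x1 u) (\<alpha> u))
            \<le> k / 2 * M * exp (k * (u - a)) + fL * \<eta>"
          if "M \<ge> 0" and M: "\<forall>v\<in>{a..u}. norm (x2 v - x1 v) \<le> M * exp (k * (v - a))" for M
        proof -
          have e: "norm (x2 u - x1 u) \<le> M * exp (k * (u - a))" using M u by auto
          have "norm (x2 (dtime x2 u) - x1 (dtime x2 u)) \<le> M * exp (k * (u - a)) + \<eta>"
          proof (cases "dtime x2 u \<le> a")
            case True
            then have "norm (x2 (dtime x2 u) - x1 (dtime x2 u)) \<le> \<eta>"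
              using hist dtime_bounds[OF u'(2), of x2] u' by auto
            then show ?thesis using \<open>M \<ge> 0\<close> by (simp add: add_increasing)
          next
            case False
            then have "norm (x2 (dtime x2 u) - x1 (dtime x2 u)) \<le> M * exp (k * (dtime x2 u - a))"
              using M dtime_bounds[OF u'(2), of x2] by auto
            also have "\<dots> \<le> M * exp (k * (u - a))"
              using \<open>M \<ge> 0\<close> k dtime_bounds[OF u'(2), of x2] by (intro mult_left_mono) auto
            finally show ?thesis using \<eta>0 by linarith
          qed
          with delayed_diff[OF x1 u'(1), of x2] a
          have y: "norm (delayed x2 u - delayed x1 u) \<le> M * exp (k * (u - a)) + \<eta> + K * tL * (M * exp (k * (u - a)))"
            using mult_left_mono[OF e, of "K * tL"] K0 tL(1) by fastforce
          have "norm (f u (x2 u) (delayed x2 u) (\<alpha> u) - f u (x1 u) (delayed x1 u) (\<alpha> u))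
             \<le> fL * (norm (x2 u - x1 u) + norm (delayed x2 u - delayed x1 u))"
            by (rule fL(2)[OF u'(2) \<alpha>[OF u]])
          also have "\<dots> \<le> fL * (M * exp (k * (u - a)) + (M * exp (k * (u - a)) + \<eta> + K * tL * (M * exp (k * (u - a)))))"
            using e y fL(1) by (intro mult_left_mono add_mono) auto
          also have "\<dots> = k / 2 * M * exp (k * (u - a)) + fL * \<eta>"
            by (simp add: k_def algebra_simps)
          finally show ?thesis .
        qed
        ultimately show "\<exists>D. ((\<lambda>s. x2 s - x1 s - E s) has_vector_derivative D) (at u) \<and>
           (\<forall>M\<ge>0. (\<forall>v\<in>{a..u}. norm (x2 v - x1 v) \<le> M * exp (k * (v - a))) \<longrightarrow>
               norm D \<le> k / 2 * M * exp (k * (u - a)) + fL * \<eta>)"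
          by (intro exI[of _ "f u (x2 u) (delayed x2 u) (\<alpha> u) - f u (x1 u) (delayed x1 u) (\<alpha> u)"])
             (auto simp: algebra_simps)
      qed (use a \<eta>0 fL(1) s False lipschitz_on_continuous_on[OF l12] in auto)
      also have "\<dots> \<le> 2 * (\<eta> + 2 * \<eta> + fL * \<eta> * (T - t0)) * exp (k * (T - t0))"
        using a s k \<eta>0 fL(1) by (intro mult_mono mult_left_mono add_mono) auto
      also have "\<dots> = sC K * \<eta>" by (simp add: sC_def k_def algebra_simps)
      finally show ?thesis .
    qed
qed

end

section \<open>Existence and uniqueness of trajectories\<close>

context delay_control_problem
begin

lemma trajectory_derivative_ae:
  assumes "solves t w \<alpha> x"
  obtains N where "negligible N"
    "\<And>s. s \<in> {t<..<T} - N \<Longrightarrow> (x has_vector_derivative f s (x s) (delayed x s) (\<alpha> s)) (at s)"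
proof -
  have "AE s in lebesgue. s \<in> {t<..<T} \<longrightarrow> (x has_vector_derivative f s (x s) (delayed x s) (\<alpha> s)) (at s)"
    using assms by (simp add: is_trajectory_def delayed_def)
  then obtain N where "N \<in> null_sets lebesgue"
    "{s \<in> space lebesgue. \<not> (s \<in> {t<..<T} \<longrightarrow> (x has_vector_derivative f s (x s) (delayed x s) (\<alpha> s)) (at s))} \<subseteq> N"
    unfolding eventually_ae_filter by blast
  then show ?thesis using that[of N] by (auto simp: negligible_iff_null_sets)
qed

lemma trajectoryI:
  assumes "K-lipschitz_on {t - b..T} x" and "negligible N"
    "\<And>s. s \<in> {t<..<T} - N \<Longrightarrow> (x has_vector_derivative f s (x s) (delayed x s) (\<alpha> s)) (at s)"
    "\<And>\<theta>. \<theta> \<in> {-b..0} \<Longrightarrow> x (t + \<theta>) = w \<theta>"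
  shows "solves t w \<alpha> x"
  unfolding is_trajectory_def
proof (intro conjI ballI)
  have "AE s in lebesgue. s \<notin> N" using assms(2) by (intro AE_not_in) (simp add: negligible_iff_null_sets)
  then show "AE s\<in>{t<..<T} in lebesgue. (x has_vector_derivative f s (x s) (x (s - \<tau> s (x s))) (\<alpha> s)) (at s)"
    by eventually_elim (use assms(3) in \<open>auto simp: delayed_def\<close>)
qed (use assms in auto)

lemma trajectory_history:
  assumes "solves t w \<alpha> x" and "s \<in> {t - b..t}" shows "x s = w (s - t)"
proof -
  have "s - t \<in> {-b..0}" using assms(2) by auto
  then have "x (t + (s - t)) = w (s - t)" using assms(1) unfolding is_trajectory_def by blast
  then show ?thesis by simp
qed

lemma trajectory_unique:
  assumes t: "t \<in> {t0..T}" and \<alpha>: "\<And>s. s \<in> {t<..<T} \<Longrightarrow> \<alpha> s \<in> A"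
    and x: "solves t w \<alpha> x" and y: "solves t w \<alpha> y" and s: "s \<in> {t - b..T}"
  shows "x s = y s"
proof -
  obtain Kx Ky where "Kx-lipschitz_on {t - b..T} x" "Ky-lipschitz_on {t - b..T} y"
    using x y by (auto simp: is_trajectory_def)
  then have K: "(max Kx Ky)-lipschitz_on {t - b..T} x" "(max Kx Ky)-lipschitz_on {t - b..T} y"
    by (auto intro: lipschitz_on_le)
  obtain N1 where N1: "negligible N1"
    "\<And>s. s \<in> {t<..<T} - N1 \<Longrightarrow> (x has_vector_derivative f s (x s) (delayed x s) (\<alpha> s)) (at s)"
    using trajectory_derivative_ae[OF x] by blast
  obtain N2 where N2: "negligible N2"
    "\<And>s. s \<in> {t<..<T} - N2 \<Longrightarrow> (y has_vector_derivative f s (y s) (delayed y s) (\<alpha> s)) (at s)"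
    using trajectory_derivative_ae[OF y] by blast
  have "norm (y s - x s) \<le> sC (max Kx Ky) * 0"
  proof (rule stability[OF t K, where E = "\<lambda>_. 0" and KE = 0 and N = "N1 \<union> N2" and \<alpha> = \<alpha>])
    fix s assume "s \<in> {t - b..t}"
    then show "norm (y s - x s) \<le> 0" using trajectory_history[OF x] trajectory_history[OF y] by simp
  qed (use N1 N2 \<alpha> s in \<open>auto simp: lipschitz_on_def\<close>)
  then show ?thesis by simp
qed

lemma exp_integral_bound:
  fixes \<phi> :: "real \<Rightarrow> 'e::euclidean_space"
  assumes "a \<le> s" and k: "0 < k" and int: "\<phi> integrable_on {a..s}"
    and bound: "\<And>u. u \<in> {a..s} \<Longrightarrow> norm (\<phi> u) \<le> k * M * exp (k * (u - a))"
  shows "norm (integral {a..s} \<phi>) \<le> M * (exp (k * (s - a)) - 1)"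
proof -
  have "((\<lambda>u. k * M * exp (k * (u - a))) has_integral M * exp (k * (s - a)) - M * exp (k * (a - a))) {a..s}"
    by (rule fundamental_theorem_of_calculus[OF \<open>a \<le> s\<close>])
       (auto intro!: derivative_eq_intros simp: has_real_derivative_iff_has_vector_derivative[symmetric])
  moreover have "M * exp (k * (s - a)) - M * exp (k * (a - a)) = M * (exp (k * (s - a)) - 1)"
    by (simp add: algebra_simps)
  ultimately have i: "(\<lambda>u. k * M * exp (k * (u - a))) integrable_on {a..s}"
    "integral {a..s} (\<lambda>u. k * M * exp (k * (u - a))) = M * (exp (k * (s - a)) - 1)"
    by (metis has_integral_integrable, metis integral_unique)
  show ?thesis using integral_norm_bound_integral[OF int i(1) bound] unfolding i(2) by simp
qed

text \<open>Picard iteration in a supremum norm with weight \<open>exp (- c * (s - t))\<close>. The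
  map from \<open>x\<close> to its delayed state is Lipschitz only among functions with a common
  Lipschitz constant, so the iterates are kept in the invariant class \<open>I\<close>, whose bounds
  pass to the limit. The rate \<open>k\<close> depends on neither history nor control, which makes
  the resulting bounds uniform.\<close>

lemma trajectory_exists:
  obtains k where "0 < k"
    "\<And>t w \<alpha> B Kw. \<lbrakk>t \<in> {t0..T}; \<alpha> \<in> controls A t T; Kw-lipschitz_on {-b..0} w;
        \<And>\<theta>. \<theta> \<in> {-b..0} \<Longrightarrow> norm (w \<theta>) \<le> B; 1 \<le> B\<rbrakk> \<Longrightarrow>
      \<exists>x. solves t w \<alpha> x \<and> (\<forall>s\<in>{t - b..T}. norm (x s) \<le> B * exp (k * (T - t0))) \<and>
        (max Kw (k * (B * exp (k * (T - t0)))))-lipschitz_on {t - b..T} x"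
proof -
  obtain Cf where Cf: "1 \<le> Cf"
    "\<And>t a z y. t \<in> {t0..T} \<Longrightarrow> a \<in> A \<Longrightarrow> norm (f t z y a) \<le> Cf * (1 + norm z + norm y)"
    using growth_f by blast
  \<comment> \<open>As \<open>1 \<le> B\<close>, each of the three terms of the growth bound
    \<open>1 + norm z + norm y\<close> will be at most \<open>B * exp (k * (s - t))\<close>.\<close>
  define k where "k = 3 * Cf"
  have k: "0 < k" using Cf by (simp add: k_def)
  show thesis
  proof (rule that[OF k])
    fix t and w :: "real \<Rightarrow> real ^ 'n" and \<alpha> B Kw
    assume t: "t \<in> {t0..T}" and \<alpha>: "\<alpha> \<in> controls A t T" and w: "Kw-lipschitz_on {-b..0} w"
      and wB: "\<And>\<theta>. \<theta> \<in> {-b..0} \<Longrightarrow> norm (w \<theta>) \<le> B" and B: "1 \<le> B"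
    define R where "R = B * exp (k * (T - t0))"
    define M where "M = max Kw (k * R)"
    have b: "0 < b" by (rule max_delay_pos)
    have \<alpha>A: "\<And>s. s \<in> {t<..<T} \<Longrightarrow> \<alpha> s \<in> A" using \<alpha> by (auto simp: controls_def)
    have R: "B * exp (k * (s - t)) \<le> R" if "s \<in> {t..T}" for s
      using that t B k unfolding R_def by (intro mult_left_mono) auto
    have R0: "0 \<le> R" using B by (simp add: R_def)
    have M0: "0 \<le> M" using R0 k by (simp add: M_def le_max_iff_disj)
    define rhs where "rhs = (\<lambda>x u. if u \<in> {t<..<T} then f u (x u) (delayed x u) (\<alpha> u) else 0)"
    define \<Phi> where "\<Phi> = (\<lambda>x s. if s \<le> t then w (s - t) else w 0 + integral {t..s} (rhs x))"
    define I where "I = (\<lambda>x. M-lipschitz_on {t - b..T} x \<and> (\<forall>s\<in>{t - b..t}. x s = w (s - t)) \<and>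
        (\<forall>s\<in>{t..T}. norm (x s) \<le> B * exp (k * (s - t))))"
    have I_cont: "continuous_on {t - b..T} x" if "I x" for x
      using that lipschitz_on_continuous_on unfolding I_def by blast
    have rhs_int: "rhs x integrable_on {t..T}" if "I x" for x
    proof -
      have c: "continuous_on {t..T} x" "continuous_on {t..T} (delayed x)"
        using continuous_on_subset[OF I_cont[OF that]] continuous_on_delayed[OF _ I_cont[OF that]] t b by auto
      have "(\<lambda>u. f u (x u) (delayed x u) (\<alpha> u)) integrable_on {t..T}"
        using integrable_along(1)[OF f_cont _ c \<alpha>] t set_lebesgue_integral_eq_integral(1) by auto
      then show ?thesis
        by (rule integrable_spike_finite[of "{t, T}", rotated 2]) (auto simp: rhs_def)
    qed
    have rhs_int': "rhs x integrable_on {u..v}" if "I x" "t \<le> u" "v \<le> T" for x u v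
      by (rule integrable_subinterval_real[OF rhs_int[OF that(1)]]) (use that in auto)
    have delayed_bound: "norm (delayed x u) \<le> B * exp (k * (u - t))" if "I x" "u \<in> {t..T}" for x u
    proof -
      have d: "dtime x u \<in> {u - b..u}" using dtime_bounds that t by auto
      show ?thesis
      proof (cases "dtime x u \<le> t")
        case True
        then have "delayed x u = w (dtime x u - t)" using that d unfolding I_def delayed_eq by auto
        then have "norm (delayed x u) \<le> B" using wB True d that(2) by auto
        also have "B \<le> B * exp (k * (u - t))" using B k that by auto
        finally show ?thesis .
      next
        case False
        then have "norm (delayed x u) \<le> B * exp (k * (dtime x u - t))"
          using that d unfolding I_def delayed_eq by auto
        also have "\<dots> \<le> B * exp (k * (u - t))" using B k d by (intro mult_left_mono) auto
        finally show ?thesis .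
      qed
    qed
    have rhs_bound: "norm (rhs x u) \<le> k * B * exp (k * (u - t))" if "I x" "u \<in> {t..T}" for x u
    proof (cases "u \<in> {t<..<T}")
      case True
      have "norm (rhs x u) \<le> Cf * (1 + norm (x u) + norm (delayed x u))"
        using True Cf(2)[of u "\<alpha> u"] \<alpha>A[OF True] t by (auto simp: rhs_def)
      also have "\<dots> \<le> Cf * (B * exp (k * (u - t)) + B * exp (k * (u - t)) + B * exp (k * (u - t)))"
      proof (intro mult_left_mono add_mono)
        have "1 * 1 \<le> B * exp (k * (u - t))" using B k that by (intro mult_mono) auto
        then show "1 \<le> B * exp (k * (u - t))" by simp
      qed (use Cf delayed_bound[OF that] that in \<open>auto simp: I_def\<close>)
      finally show ?thesis by (simp add: k_def)
    next
      case False
      then show ?thesis using k B by (auto simp: rhs_def)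
    qed
    have \<Phi>_eq: "\<Phi> x s = w 0 + integral {t..s} (rhs x)" if "s \<in> {t..T}" for x s
      using that by (cases "s = t") (auto simp: \<Phi>_def)
    have I_\<Phi>: "I (\<Phi> x)" if x: "I x" for x
      unfolding I_def
    proof (intro conjI ballI)
      have "M-lipschitz_on {t - b..T} (\<lambda>s. if s \<le> t then w (s - t) else w 0 + integral {t..s} (rhs x))"
      proof (rule lipschitz_on_concat)
        show "M-lipschitz_on {t - b..t} (\<lambda>s. w (s - t))"
        proof (rule lipschitz_onI[OF _ M0])
          fix s u assume "s \<in> {t - b..t}" "u \<in> {t - b..t}"
          then have "dist (w (s - t)) (w (u - t)) \<le> Kw * dist (s - t) (u - t)"
            by (intro lipschitz_onD[OF w]) auto
          also have "\<dots> \<le> M * dist (s - t) (u - t)" by (intro mult_right_mono) (auto simp: M_def)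
          finally show "dist (w (s - t)) (w (u - t)) \<le> M * dist s u" by (simp add: dist_real_def)
        qed
        show "M-lipschitz_on {t..T} (\<lambda>s. w 0 + integral {t..s} (rhs x))"
        proof (rule lipschitz_on_leI[OF _ M0])
          fix s u assume su: "s \<in> {t..T}" "u \<in> {t..T}" "s \<le> u"
          have "integral {t..u} (rhs x) = integral {t..s} (rhs x) + integral {s..u} (rhs x)"
            using su by (intro Henstock_Kurzweil_Integration.integral_combine[symmetric] rhs_int'[OF x]) auto
          then have "dist (w 0 + integral {t..s} (rhs x)) (w 0 + integral {t..u} (rhs x)) = norm (integral {s..u} (rhs x))"
            by (simp add: dist_norm)
          also have "\<dots> \<le> integral {s..u} (\<lambda>_. k * R)"
          proof (rule integral_norm_bound_integral[OF rhs_int'[OF x]])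
            fix v assume "v \<in> {s..u}"
            then have v: "v \<in> {t..T}" using su by auto
            have "norm (rhs x v) \<le> k * (B * exp (k * (v - t)))" using rhs_bound[OF x v] by (simp add: mult.assoc)
            also have "\<dots> \<le> k * R" using R[OF v] k by (intro mult_left_mono) auto
            finally show "norm (rhs x v) \<le> k * R" .
          qed (use su in auto)
          also have "\<dots> \<le> M * dist s u"
            using su mult_right_mono[of "k * R" M "u - s"] by (simp add: M_def dist_real_def mult.commute mult.left_commute)
          finally show "dist (w 0 + integral {t..s} (rhs x)) (w 0 + integral {t..u} (rhs x)) \<le> M * dist s u" .
        qed
      qed simp
      then show "M-lipschitz_on {t - b..T} (\<Phi> x)" by (simp add: \<Phi>_def)
      fix s assume s: "s \<in> {t..T}"
      have "norm (integral {t..s} (rhs x)) \<le> B * (exp (k * (s - t)) - 1)"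
        using s by (intro exp_integral_bound k rhs_int'[OF x] rhs_bound[OF x]) auto
      then have "norm (w 0 + integral {t..s} (rhs x)) \<le> B + B * (exp (k * (s - t)) - 1)"
        using wB[of 0] b by (intro order_trans[OF norm_triangle_ineq] add_mono) auto
      then show "norm (\<Phi> x s) \<le> B * exp (k * (s - t))"
        unfolding \<Phi>_eq[OF s] by (simp add: algebra_simps)
    qed (simp add: \<Phi>_def)
    \<comment> \<open>The rate is twice the Lipschitz rate of the right-hand side, so that one
      iteration halves the weighted distance.\<close>
    define c where "c = 2 * (fL * (2 + M * tL))"
    have c: "0 < c" using fL(1) tL(1) M0 by (auto simp: c_def intro!: mult_pos_pos add_pos_nonneg)
    have contract: "norm (\<Phi> y s - \<Phi> x s) \<le> D / 2 * exp (c * (s - t))"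
      if x: "I x" and y: "I y" and D: "0 \<le> D" "\<And>s. s \<in> {t..T} \<Longrightarrow> norm (y s - x s) \<le> D * exp (c * (s - t))"
        and s: "s \<in> {t..T}" for x y D s
    proof -
      have "norm (integral {t..s} (\<lambda>u. rhs y u - rhs x u)) \<le> D / 2 * (exp (c * (s - t)) - 1)"
      proof (rule exp_integral_bound[OF _ c])
        show "(\<lambda>u. rhs y u - rhs x u) integrable_on {t..s}"
          using s by (intro integrable_diff rhs_int' x y) auto
        fix u assume u: "u \<in> {t..s}"
        then have u': "u \<in> {t..T}" "u \<in> {t0..T}" using s t by auto
        show "norm (rhs y u - rhs x u) \<le> c * (D / 2) * exp (c * (u - t))"
        proof (cases "u \<in> {t<..<T}")
          case True
          have d: "dtime y u \<in> {u - b..u}" by (rule dtime_bounds[OF u'(2)])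
          have "norm (y (dtime y u) - x (dtime y u)) \<le> D * exp (c * (u - t))"
          proof (cases "dtime y u \<le> t")
            case True
            then show ?thesis using x y d u D(1) unfolding I_def by auto
          next
            case False
            then have "norm (y (dtime y u) - x (dtime y u)) \<le> D * exp (c * (dtime y u - t))"
              using D(2) d u' by auto
            also have "\<dots> \<le> D * exp (c * (u - t))" using c D(1) d by (intro mult_left_mono) auto
            finally show ?thesis .
          qed
          moreover have "norm (delayed y u - delayed x u) \<le>
              norm (y (dtime y u) - x (dtime y u)) + M * tL * norm (y u - x u)"
            using x u' t by (intro delayed_diff) (auto simp: I_def)
          moreover have "M * tL * norm (y u - x u) \<le> M * tL * (D * exp (c * (u - t)))"
            using D(2)[OF u'(1)] M0 tL(1) by (intro mult_left_mono) auto
          ultimately have 1: "norm (delayed y u - delayed x u) \<le> D * exp (c * (u - t)) + M * tL * (D * exp (c * (u - t)))"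
            by linarith
          have "norm (rhs y u - rhs x u) \<le> fL * (norm (y u - x u) + norm (delayed y u - delayed x u))"
            using True fL(2)[OF u'(2) \<alpha>A[OF True]] by (auto simp: rhs_def)
          also have "\<dots> \<le> fL * (D * exp (c * (u - t)) + (D * exp (c * (u - t)) + M * tL * (D * exp (c * (u - t)))))"
            using 1 D(2)[OF u'(1)] fL(1) by (intro mult_left_mono add_mono) auto
          also have "\<dots> = c * (D / 2) * exp (c * (u - t))" by (simp add: c_def algebra_simps)
          finally show ?thesis .
        qed (use c D(1) in \<open>auto simp: rhs_def\<close>)
      qed (use s in auto)
      also have "\<dots> \<le> D / 2 * exp (c * (s - t))" using D(1) by (simp add: algebra_simps)
      finally have "norm (integral {t..s} (\<lambda>u. rhs y u - rhs x u)) \<le> D / 2 * exp (c * (s - t))" .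
      moreover have "\<Phi> y s - \<Phi> x s = integral {t..s} (\<lambda>u. rhs y u - rhs x u)"
        unfolding \<Phi>_eq[OF s] using s
        by (subst Henstock_Kurzweil_Integration.integral_diff) (auto intro: rhs_int' x y)
      ultimately show ?thesis by simp
    qed
    \<comment> \<open>The iteration starts from the history continued by its final value.\<close>
    define X where "X = (\<lambda>n. (\<Phi> ^^ n) (\<lambda>s. w (min (s - t) 0)))"
    have X_Suc: "X (Suc n) = \<Phi> (X n)" for n by (simp add: X_def)
    have I0: "I (X 0)"
      unfolding I_def
    proof (intro conjI ballI)
      show "M-lipschitz_on {t - b..T} (X 0)"
      proof (rule lipschitz_onI[OF _ M0])
        fix s u assume "s \<in> {t - b..T}" "u \<in> {t - b..T}"
        then have "dist (w (min (s - t) 0)) (w (min (u - t) 0)) \<le> Kw * dist (min (s - t) 0) (min (u - t) 0)"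
          using b by (intro lipschitz_onD[OF w]) auto
        also have "\<dots> \<le> M * dist s u"
          using M0 by (intro mult_mono) (auto simp: M_def dist_real_def)
        finally show "dist (X 0 s) (X 0 u) \<le> M * dist s u" by (simp add: X_def)
      qed
      fix s assume s: "s \<in> {t..T}"
      have "norm (X 0 s) \<le> B" using s wB[of 0] b by (simp add: X_def)
      also have "B \<le> B * exp (k * (s - t))" using B k s by auto
      finally show "norm (X 0 s) \<le> B * exp (k * (s - t))" .
    qed (auto simp: X_def)
    have IX: "I (X n)" for n
    proof (induction n)
      case (Suc n) then show ?case unfolding X_Suc by (rule I_\<Phi>)
    qed (rule I0)
    have geo: "norm (X (n + m) s - X n s) \<le> 2 * R / 2 ^ n * exp (c * (s - t))" if "s \<in> {t..T}" for n m s
      using that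
    proof (induction n arbitrary: s)
      case 0
      have "norm (X m s - X 0 s) \<le> R + R"
      proof (intro order_trans[OF norm_triangle_ineq4] add_mono)
        have "norm (X j s) \<le> B * exp (k * (s - t))" for j using IX[of j] 0 unfolding I_def by blast
        then show "norm (X m s) \<le> R" "norm (X 0 s) \<le> R" using R[OF 0] order_trans by blast+
      qed
      also have "\<dots> = 2 * R * 1" by simp
      also have "\<dots> \<le> 2 * R * exp (c * (s - t))" using R0 c 0 by (intro mult_left_mono) auto
      finally show ?case by simp
    next
      case (Suc n)
      then have "norm (\<Phi> (X (n + m)) s - \<Phi> (X n) s) \<le> 2 * R / 2 ^ n / 2 * exp (c * (s - t))"
        using R0 by (intro contract IX) auto
      then show ?case by (simp add: X_Suc)
    qed
    define G where "G = 2 * R * exp (c * (T - t))"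
    have geo': "norm (X (n + m) s - X n s) \<le> G / 2 ^ n" if "s \<in> {t - b..T}" for n m s
    proof (cases "s \<le> t")
      case True
      then have "X (n + m) s = X n s" using IX[of n] IX[of "n + m"] that unfolding I_def by auto
      then show ?thesis using R0 by (simp add: G_def)
    next
      case False
      then have "norm (X (n + m) s - X n s) \<le> 2 * R / 2 ^ n * exp (c * (s - t))" using geo that by auto
      also have "\<dots> \<le> 2 * R / 2 ^ n * exp (c * (T - t))" using that c R0 by (intro mult_left_mono) auto
      finally show ?thesis by (simp add: G_def)
    qed
    have Glim: "(\<lambda>n. G / 2 ^ n) \<longlonglongrightarrow> 0" by (rule LIMSEQ_divide_realpow_zero) simp
    have "Cauchy (\<lambda>n. X n s)" if "s \<in> {t - b..T}" for s
    proof (rule metric_CauchyI)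
      fix e :: real assume "e > 0"
      then obtain n0 where n0: "\<And>n. n \<ge> n0 \<Longrightarrow> norm (G / 2 ^ n) < e / 2"
        using LIMSEQ_D[OF Glim, of "e / 2"] by auto
      have "dist (X m s) (X n0 s) < e / 2" if "m \<ge> n0" for m
      proof -
        have "norm (X (n0 + (m - n0)) s - X n0 s) \<le> G / 2 ^ n0" by (rule geo'[OF \<open>s \<in> {t - b..T}\<close>])
        also have "\<dots> \<le> norm (G / 2 ^ n0)" unfolding real_norm_def by (rule abs_ge_self)
        also have "\<dots> < e / 2" by (rule n0) simp
        finally show ?thesis using that by (simp add: dist_norm)
      qed
      then show "\<exists>M. \<forall>m\<ge>M. \<forall>n\<ge>M. dist (X m s) (X n s) < e"
        by (meson dist_triangle_half_l dist_commute)
    qed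
    then have "\<exists>l. (\<lambda>n. X n s) \<longlonglongrightarrow> l" if "s \<in> {t - b..T}" for s
      using that Cauchy_convergent_iff convergent_def by blast
    then obtain x where x: "\<And>s. s \<in> {t - b..T} \<Longrightarrow> (\<lambda>n. X n s) \<longlonglongrightarrow> x s" by metis
    have Ix: "I x"
      unfolding I_def
    proof (intro conjI ballI)
      show "M-lipschitz_on {t - b..T} x"
      proof (rule lipschitz_onI[OF _ M0])
        fix s u assume "s \<in> {t - b..T}" "u \<in> {t - b..T}"
        then show "dist (x s) (x u) \<le> M * dist s u"
          using IX by (intro LIMSEQ_le_const2[OF tendsto_dist[OF x x]]) (auto simp: I_def lipschitz_on_def)
      qed
      show "x s = w (s - t)" if "s \<in> {t - b..t}" for s
      proof -
        have "X n s = w (s - t)" for n using IX[of n] that unfolding I_def by blast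
        moreover have "(\<lambda>n. X n s) \<longlonglongrightarrow> x s" using x that t by auto
        ultimately have "(\<lambda>n::nat. w (s - t)) \<longlonglongrightarrow> x s" by simp
        then show ?thesis using LIMSEQ_unique[OF _ tendsto_const] by blast
      qed
      show "norm (x s) \<le> B * exp (k * (s - t))" if "s \<in> {t..T}" for s
        using IX that b by (intro LIMSEQ_le_const2[OF tendsto_norm[OF x]]) (auto simp: I_def)
    qed
    have near: "norm (x s - X n s) \<le> 2 * R / 2 ^ n * exp (c * (s - t))" if "s \<in> {t..T}" for n s
    proof (rule LIMSEQ_le_const2)
      show "(\<lambda>m. norm (X (n + m) s - X n s)) \<longlonglongrightarrow> norm (x s - X n s)"
        using x[of s] that b by (intro tendsto_intros LIMSEQ_ignore_initial_segment[of "\<lambda>n. X n s" _ n, unfolded add.commute[of _ n]]) auto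
    qed (use geo[OF that] in auto)
    have fix_x: "\<Phi> x s = x s" if s: "s \<in> {t..T}" for s
    proof -
      have "norm (\<Phi> x s - x s) \<le> 2 * (2 * R * exp (c * (s - t))) / 2 ^ n" for n
      proof -
        have "norm (\<Phi> x s - \<Phi> (X n) s) \<le> 2 * R / 2 ^ n / 2 * exp (c * (s - t))"
          using R0 near by (intro contract IX Ix s) auto
        moreover have "norm (x s - X (Suc n) s) \<le> 2 * R / 2 ^ Suc n * exp (c * (s - t))" by (rule near[OF s])
        moreover have "norm (\<Phi> x s - x s) \<le> norm (\<Phi> x s - \<Phi> (X n) s) + norm (x s - X (Suc n) s)"
          unfolding X_Suc using norm_triangle_ineq4[of "\<Phi> x s - \<Phi> (X n) s" "x s - \<Phi> (X n) s"] by simp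
        moreover have "2 * R / 2 ^ n / 2 * exp (c * (s - t)) = R * exp (c * (s - t)) / 2 ^ n"
          "2 * R / 2 ^ Suc n * exp (c * (s - t)) = R * exp (c * (s - t)) / 2 ^ n"
          "(2 * R * exp (c * (s - t))) / 2 ^ n = R * exp (c * (s - t)) / 2 ^ n + R * exp (c * (s - t)) / 2 ^ n"
          by simp_all
        ultimately have "norm (\<Phi> x s - x s) \<le> (2 * R * exp (c * (s - t))) / 2 ^ n" by linarith
        also have "\<dots> \<le> 2 * (2 * R * exp (c * (s - t))) / 2 ^ n" using R0 by (intro divide_right_mono) auto
        finally show ?thesis .
      qed
      moreover have "(\<lambda>n. 2 * (2 * R * exp (c * (s - t))) / 2 ^ n) \<longlonglongrightarrow> 0" by (rule LIMSEQ_divide_realpow_zero) simp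
      ultimately have "norm (\<Phi> x s - x s) \<le> 0" by (intro LIMSEQ_le_const) auto
      then show ?thesis by simp
    qed
    obtain N where N: "negligible N"
      "\<And>s. s \<in> {t<..<T} - N \<Longrightarrow> ((\<lambda>u. integral {t..u} (rhs x)) has_vector_derivative rhs x s) (at s)"
      using indefinite_integral_ae_differentiable[OF rhs_int[OF Ix]] by blast
    have "solves t w \<alpha> x"
    proof (rule trajectoryI[OF _ N(1)])
      show "M-lipschitz_on {t - b..T} x" using Ix by (simp add: I_def)
      fix s assume s: "s \<in> {t<..<T} - N"
      have "((\<lambda>u. w 0 + integral {t..u} (rhs x)) has_vector_derivative 0 + rhs x s) (at s)"
        by (intro has_vector_derivative_add has_vector_derivative_const N(2) s)
      then have "(x has_vector_derivative 0 + rhs x s) (at s)"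
        by (rule has_vector_derivative_transform_within_open[of _ _ _ "{t<..<T}"])
           (use s fix_x \<Phi>_eq in auto)
      then show "(x has_vector_derivative f s (x s) (delayed x s) (\<alpha> s)) (at s)" using s by (auto simp: rhs_def)
    next
      fix \<theta> assume "\<theta> \<in> {-b..0}"
      then have "t + \<theta> \<in> {t - b..t}" by auto
      then have "x (t + \<theta>) = w ((t + \<theta>) - t)" using Ix unfolding I_def by blast
      then show "x (t + \<theta>) = w \<theta>" by simp
    qed
    moreover have "norm (x s) \<le> R" if "s \<in> {t - b..T}" for s
    proof (cases "s \<le> t")
      case True
      then have "norm (x s) \<le> B" using Ix wB that unfolding I_def by auto
      also have "B \<le> R" using R[of t] t by simp
      finally show ?thesis .
    next
      case False
      then have s: "s \<in> {t..T}" using that by auto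
      then have "norm (x s) \<le> B * exp (k * (s - t))" using Ix unfolding I_def by blast
      then show ?thesis using R[OF s] by linarith
    qed
    moreover have "M-lipschitz_on {t - b..T} x" using Ix by (simp add: I_def)
    ultimately show "\<exists>x. solves t w \<alpha> x \<and> (\<forall>s\<in>{t - b..T}. norm (x s) \<le> B * exp (k * (T - t0))) \<and>
        (max Kw (k * (B * exp (k * (T - t0)))))-lipschitz_on {t - b..T} x"
      unfolding R_def M_def by blast
  qed
qed

end

section \<open>Cost and value function\<close>

lemma AE_imp_negligible:
  assumes "AE s in lebesgue. P s"
  obtains N where "negligible N" "\<And>s. s \<notin> N \<Longrightarrow> P s"
proof -
  obtain N where "N \<in> null_sets lebesgue" "{s \<in> space lebesgue. \<not> P s} \<subseteq> N"
    using assms unfolding eventually_ae_filter by blast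
  then show ?thesis using that[of N] by (auto simp: negligible_iff_null_sets)
qed

lemma negligible_imp_AE:
  assumes "negligible N" "\<And>s. s \<notin> N \<Longrightarrow> P s"
  shows "AE s in lebesgue. P s"
proof -
  have "AE s in lebesgue. s \<notin> N" using assms(1) by (intro AE_not_in) (simp add: negligible_iff_null_sets)
  then show ?thesis by eventually_elim (rule assms(2))
qed

text \<open>The complement of \<open>C\<close> pulls back to an open set inside a null set, hence to
  the empty set; the end points follow by closure.\<close>

lemma ae_in_closed_imp_all:
  fixes u :: "real \<Rightarrow> 'a::topological_space"
  assumes cont: "continuous_on {a..c} u" and "closed C" and N: "negligible N" and "a < c"
    and ae: "\<And>s. s \<in> {a<..<c} - N \<Longrightarrow> u s \<in> C"
    and s: "s \<in> {a..c}"
  shows "u s \<in> C"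
proof -
  have "open ({a<..<c} \<inter> u -` (- C))"
    using \<open>closed C\<close> by (intro continuous_open_preimage continuous_on_subset[OF cont]) auto
  moreover have "{a<..<c} \<inter> u -` (- C) \<subseteq> N" using ae by blast
  ultimately have "{a<..<c} \<inter> u -` (- C) = {}"
    using open_not_negligible N negligible_subset by blast
  then have *: "u ` {a<..<c} \<subseteq> C" by auto
  have cl: "closure {a<..<c} = {a..c}" using \<open>a < c\<close> by (rule closure_greaterThanLessThan)
  have "u ` closure {a<..<c} \<subseteq> C"
    by (rule image_closure_subset[OF _ \<open>closed C\<close> *]) (use cont cl in simp)
  then show ?thesis using s cl by blast
qed

lemma norm_Linf_le_imp_AE:
  assumes "norm_Linf b u \<le> ereal r"
  obtains N where "negligible N" "\<And>\<theta>. \<theta> \<in> {-b..0} - N \<Longrightarrow> norm (u \<theta>) \<le> r"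
proof -
  have "AE \<theta> in lebesgue_on {-b..0}. ereal (norm (u \<theta>)) \<le> norm_Linf b u"
    unfolding norm_Linf_def by (rule esssup_AE)
  then have "AE \<theta> in lebesgue. \<theta> \<in> {-b..0} \<longrightarrow> ereal (norm (u \<theta>)) \<le> norm_Linf b u"
    by (subst (asm) AE_restrict_space_iff) auto
  then obtain N where N: "negligible N" "\<And>s. s \<notin> N \<Longrightarrow> s \<in> {-b..0} \<longrightarrow> ereal (norm (u s)) \<le> norm_Linf b u"
    by (rule AE_imp_negligible) auto
  show ?thesis
  proof (rule that[OF N(1)])
    fix \<theta> assume "\<theta> \<in> {-b..0} - N"
    then have "ereal (norm (u \<theta>)) \<le> ereal r" using N(2)[of \<theta>] assms order_trans by blast
    then show "norm (u \<theta>) \<le> r" by simp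
  qed
qed

lemma norm_Linf_le_imp_all:
  assumes "norm_Linf b u \<le> ereal r" and "0 < b" and cont: "continuous_on {-b..0} u" and "\<theta> \<in> {-b..0}"
  shows "norm (u \<theta>) \<le> r"
proof -
  obtain N where N: "negligible N" "\<And>\<theta>. \<theta> \<in> {-b..0} - N \<Longrightarrow> norm (u \<theta>) \<le> r"
    using norm_Linf_le_imp_AE[OF assms(1)] by blast
  have "u \<theta> \<in> cball 0 r"
    by (rule ae_in_closed_imp_all[OF cont _ N(1)]) (use N(2) assms in auto)
  then show ?thesis by simp
qed

lemma norm_Linf_leI:
  assumes "u \<in> borel_measurable (lebesgue_on {-b..0})" and "negligible N"
    and "\<And>\<theta>. \<theta> \<in> {-b..0} - N \<Longrightarrow> norm (u \<theta>) \<le> r"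
  shows "norm_Linf b u \<le> ereal r"
  unfolding norm_Linf_def
proof (rule esssup_I)
  show "(\<lambda>\<theta>. ereal (norm (u \<theta>))) \<in> borel_measurable (lebesgue_on {-b..0})"
    using assms(1) by measurable
  have "AE \<theta> in lebesgue. \<theta> \<in> {-b..0} \<longrightarrow> ereal (norm (u \<theta>)) \<le> ereal r"
    by (rule negligible_imp_AE[OF assms(2)]) (use assms(3) in auto)
  then show "AE \<theta> in lebesgue_on {-b..0}. ereal (norm (u \<theta>)) \<le> ereal r"
    by (subst AE_restrict_space_iff) auto
qed

lemma P_histI:
  fixes w :: "real \<Rightarrow> 'a::euclidean_space"
  assumes "K-lipschitz_on {-b..0} w" "\<And>\<theta>. \<theta> \<in> {-b..0} \<Longrightarrow> norm (w \<theta>) \<le> R"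
  shows "w \<in> P_hist b R"
  unfolding P_hist_def Lip_hist_def
  using assms lipschitz_on_continuous_on[OF assms(1)]
  by (auto intro!: norm_Linf_leI[of _ _ "{}"] continuous_imp_measurable_on_sets_lebesgue)

lemma norm_L1_eq:
  fixes u :: "real \<Rightarrow> 'a::euclidean_space"
  assumes "continuous_on {-b..0} u"
  shows "norm_L1 b u = integral {-b..0} (\<lambda>\<theta>. norm (u \<theta>))"
  unfolding norm_L1_def
  by (intro set_lebesgue_integral_eq_integral(2) absolutely_integrable_continuous_real continuous_intros assms)

text \<open>\<open>C11_hist\<close> gives some Lipschitz constant of the derivative,
  \<open>W_hist\<close> gives \<open>r\<close> on each piece. Continuity of the derivative across
  the breakpoints lets the pieces be concatenated, so \<open>r\<close> itself serves on the whole
  interval; the uniformity of all later constants rests on this.\<close>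

lemma W'_hist_regular:
  fixes w :: "real \<Rightarrow> 'a::euclidean_space"
  assumes w: "w \<in> W'_hist b r" and b: "0 < b" and r: "0 < r"
  shows "\<And>\<theta>. \<theta> \<in> {-b..0} \<Longrightarrow> (w has_vector_derivative hist_deriv b w \<theta>) (at \<theta> within {-b..0})"
    and "\<And>\<theta>. \<theta> \<in> {-b..0} \<Longrightarrow> norm (w \<theta>) \<le> r"
    and "\<And>\<theta>. \<theta> \<in> {-b..0} \<Longrightarrow> norm (hist_deriv b w \<theta>) \<le> r"
    and "r-lipschitz_on {-b..0} (hist_deriv b w)"
    and "r-lipschitz_on {-b..0} w"
proof -
  have V: "w \<in> V_hist b r" and C: "w \<in> C11_hist b" and W: "w \<in> W_hist b r"
    using w by (auto simp: W'_hist_def W_hist_def)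
  obtain K0 where K0: "K0-lipschitz_on {-b..0} w" using V by (auto simp: V_hist_def P_hist_def Lip_hist_def)
  obtain K where K: "K-lipschitz_on {-b..0} (hist_deriv b w)" using C by (auto simp: C11_hist_def)
  show d: "(w has_vector_derivative hist_deriv b w \<theta>) (at \<theta> within {-b..0})" if "\<theta> \<in> {-b..0}" for \<theta>
    using C that unfolding C11_hist_def hist_deriv_def by (auto simp: vector_derivative_works)
  show "norm (w \<theta>) \<le> r" if "\<theta> \<in> {-b..0}" for \<theta>
    using V that by (intro norm_Linf_le_imp_all[OF _ b lipschitz_on_continuous_on[OF K0]]) (auto simp: V_hist_def P_hist_def)
  show bd: "norm (hist_deriv b w \<theta>) \<le> r" if "\<theta> \<in> {-b..0}" for \<theta>
    using V that by (intro norm_Linf_le_imp_all[OF _ b lipschitz_on_continuous_on[OF K]]) (auto simp: V_hist_def)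
  show "r-lipschitz_on {-b..0} w"
  proof (rule bounded_derivative_imp_lipschitz[where f' = "\<lambda>\<theta> h. h *\<^sub>R hist_deriv b w \<theta>"])
    show "(w has_derivative (\<lambda>h. h *\<^sub>R hist_deriv b w \<theta>)) (at \<theta> within {-b..0})" if "\<theta> \<in> {-b..0}" for \<theta>
      using d[OF that] by (simp add: has_vector_derivative_def)
    show "onorm (\<lambda>h. h *\<^sub>R hist_deriv b w \<theta>) \<le> r" if "\<theta> \<in> {-b..0}" for \<theta>
      using bd[OF that] r by (intro onorm_bound) (auto simp: mult.commute[of r] intro: mult_left_mono)
  qed (use r in auto)
  obtain n \<theta> where \<theta>: "\<theta> 0 = -b" "\<theta> n = 0" "\<And>j. j < n \<Longrightarrow> \<theta> j < \<theta> (Suc j)"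
     "\<And>j. j < n \<Longrightarrow> r-lipschitz_on {\<theta> j<..<\<theta> (Suc j)} (hist_deriv b w)"
    using W unfolding W_hist_def by blast
  have mono: "\<theta> i \<le> \<theta> j" if "i \<le> j" "j \<le> n" for i j
    using that
  proof (induction j)
    case (Suc j)
    then show ?case using \<theta>(3)[of j] by (cases "i = Suc j") auto
  qed simp
  have "r-lipschitz_on {-b..\<theta> j} (hist_deriv b w)" if "j \<le> n" for j
    using that
  proof (induction j)
    case 0
    then show ?case using \<theta>(1) r by (auto simp: lipschitz_on_def)
  next
    case (Suc j)
    have sub: "{\<theta> j..\<theta> (Suc j)} \<subseteq> {-b..0}"
      using mono[of 0 j] mono[of "Suc j" n] \<theta>(1,2) Suc.prems by auto
    have cl: "closure {\<theta> j<..<\<theta> (Suc j)} = {\<theta> j..\<theta> (Suc j)}"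
      using \<theta>(3)[of j] Suc.prems by (intro closure_greaterThanLessThan) auto
    have "r-lipschitz_on (closure {\<theta> j<..<\<theta> (Suc j)}) (hist_deriv b w)"
      using \<theta>(4)[of j] Suc.prems cl continuous_on_subset[OF lipschitz_on_continuous_on[OF K] sub]
      by (intro lipschitz_on_closure) auto
    then have "r-lipschitz_on {\<theta> j..\<theta> (Suc j)} (hist_deriv b w)" by (simp add: cl)
    from lipschitz_on_concat[OF Suc.IH this] Suc.prems show ?case by (simp add: if_distrib)
  qed
  from this[of n] show "r-lipschitz_on {-b..0} (hist_deriv b w)" using \<theta>(2) by simp
qed

section \<open>Cost along a solution\<close>

context delay_control_problem
begin

lemma trajectory_restrict_cong:
  assumes x: "solves t w \<alpha> x" and t: "t \<in> {t0..T}"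
    and eq: "\<And>s. s \<in> {t - b..T} \<Longrightarrow> y s = x s"
    and N: "negligible N" and \<beta>: "\<And>s. s \<in> {t<..<T} - N \<Longrightarrow> \<beta> s = \<alpha> s"
  shows "solves t w \<beta> y"
proof -
  obtain K where K: "K-lipschitz_on {t - b..T} x" using x by (auto simp: is_trajectory_def)
  obtain N' where N': "negligible N'"
    "\<And>s. s \<in> {t<..<T} - N' \<Longrightarrow> (x has_vector_derivative f s (x s) (delayed x s) (\<alpha> s)) (at s)"
    using trajectory_derivative_ae[OF x] by blast
  have b: "0 < b" by (rule max_delay_pos)
  show ?thesis
  proof (rule trajectoryI)
    show "K-lipschitz_on {t - b..T} y" using K eq by (rule lipschitz_on_transform)
    show "negligible (N \<union> N')" using N N'(1) by (rule negligible_Un)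
    fix s assume s: "s \<in> {t<..<T} - (N \<union> N')"
    then have s': "s \<in> {t0..T}" "s \<in> {t<..<T}" using t by auto
    have "(y has_vector_derivative f s (x s) (delayed x s) (\<alpha> s)) (at s)"
      by (rule has_vector_derivative_transform_within_open[of x _ _ "{t<..<T}"])
         (use s N'(2) eq b in auto)
    moreover have "y s = x s" using s b by (intro eq) auto
    moreover have "delayed y s = delayed x s"
      using dtime_bounds[OF s'(1), of x] s' eq[of "dtime x s"] \<open>y s = x s\<close> by (auto simp: delayed_def dtime_def)
    ultimately show "(y has_vector_derivative f s (y s) (delayed y s) (\<beta> s)) (at s)" using s \<beta> by simp
  next
    fix \<theta> assume \<theta>: "\<theta> \<in> {-b..0}"
    then have "y (t + \<theta>) = x (t + \<theta>)" using t by (intro eq) auto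
    then show "y (t + \<theta>) = w \<theta>" using trajectory_history[OF x, of "t + \<theta>"] \<theta> by auto
  qed
qed

lemma controls_in_A: "\<alpha> \<in> controls A t T \<Longrightarrow> s \<in> {t<..<T} \<Longrightarrow> \<alpha> s \<in> A"
  by (auto simp: controls_def)

lemma trajectory_eq_restrict:
  assumes x: "solves t w \<alpha> x" and t: "t \<in> {t0..T}" and \<alpha>: "\<alpha> \<in> controls A t T"
  shows "trajectory f \<tau> b T t w \<alpha> = restrict x {t - b..T}"
  unfolding trajectory_def
proof (rule the_equality)
  show "restrict x {t - b..T} \<in> extensional {t - b..T} \<and> solves t w \<alpha> (restrict x {t - b..T})"
    by (intro conjI restrict_extensional trajectory_restrict_cong[OF x t _ negligible_empty]) auto
  fix y assume y: "y \<in> extensional {t - b..T} \<and> solves t w \<alpha> y"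
  show "y = restrict x {t - b..T}"
  proof (rule extensionalityI[of _ "{t - b..T}"])
    fix s assume "s \<in> {t - b..T}"
    then show "y s = restrict x {t - b..T} s"
      using trajectory_unique[OF t controls_in_A[OF \<alpha>] conjunct2[OF y] x] by auto
  qed (use y in auto)
qed

lemma segment_lipschitz:
  assumes "K-lipschitz_on {t - b..T} x" "t \<le> T"
  shows "K-lipschitz_on {-b..0} (segment_at x T)"
proof (rule lipschitz_onI)
  fix u v assume "u \<in> {-b..0}" "v \<in> {-b..0}"
  then show "dist (segment_at x T u) (segment_at x T v) \<le> K * dist u v"
    using lipschitz_onD[OF assms(1), of "T + u" "T + v"] assms(2) by (auto simp: segment_at_def)
qed (rule lipschitz_on_nonneg[OF assms(1)])

lemma g_lipschitz_pairs:
  assumes "0 < R"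
  shows "\<exists>l. 0 < l \<and> (\<forall>z1 w1 z2 w2. (z1, w1) \<in> X_space b \<longrightarrow> (z2, w2) \<in> X_space b \<longrightarrow> w1 \<in> P_hist b R \<longrightarrow> w2 \<in> P_hist b R \<longrightarrow>
          \<bar>g (z1, w1) - g (z2, w2)\<bar> \<le> l * norm_X b (z1 - z2, \<lambda>\<theta>. w1 \<theta> - w2 \<theta>))"
proof -
  obtain l where l: "0 < l" "\<forall>(z1, w1)\<in>X_space b. \<forall>(z2, w2)\<in>X_space b. w1 \<in> P_hist b R \<longrightarrow> w2 \<in> P_hist b R \<longrightarrow>
          \<bar>g (z1, w1) - g (z2, w2)\<bar> \<le> l * norm_X b (z1 - z2, \<lambda>\<theta>. w1 \<theta> - w2 \<theta>)"
    using g_lipschitz[THEN spec, THEN mp, OF assms] by (elim exE conjE)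
  show ?thesis
  proof (intro exI conjI allI impI)
    fix z1 z2 :: "real ^ 'n" and w1 w2 :: "real \<Rightarrow> real ^ 'n"
    assume a: "(z1, w1) \<in> X_space b" "(z2, w2) \<in> X_space b" "w1 \<in> P_hist b R" "w2 \<in> P_hist b R"
    from bspec[OF bspec[OF l(2) a(1), unfolded prod.case] a(2), unfolded prod.case] a(3,4)
    show "\<bar>g (z1, w1) - g (z2, w2)\<bar> \<le> l * norm_X b (z1 - z2, \<lambda>\<theta>. w1 \<theta> - w2 \<theta>)" by blast
  qed (rule l(1))
qed

lemma g_cong:
  assumes w: "K-lipschitz_on {-b..0} w" and eq: "\<And>\<theta>. \<theta> \<in> {-b..0} \<Longrightarrow> v \<theta> = w \<theta>"
  shows "g (v 0, v) = g (w 0, w)"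
proof -
  have v: "K-lipschitz_on {-b..0} v" using w eq by (rule lipschitz_on_transform)
  obtain R where R: "\<And>\<theta>. \<theta> \<in> {-b..0} \<Longrightarrow> norm (w \<theta>) \<le> R"
    using continuous_on_Icc_bounded[OF lipschitz_on_continuous_on[OF w]] by blast
  then have R': "\<And>\<theta>. \<theta> \<in> {-b..0} \<Longrightarrow> norm (w \<theta>) \<le> max R 1" by fastforce
  have P: "w \<in> P_hist b (max R 1)" "v \<in> P_hist b (max R 1)"
    using R' eq by (auto intro!: P_histI[OF w] P_histI[OF v])
  have X: "(w 0, w) \<in> X_space b" "(v 0, v) \<in> X_space b"
    using w v by (auto simp: X_space_def Lip_hist_def)
  have "0 < max R 1" by simp
  from g_lipschitz_pairs[OF this] obtain l where l: "0 < l \<and> (\<forall>z1 w1 z2 w2. (z1, w1) \<in> X_space b \<longrightarrow> (z2, w2) \<in> X_space b \<longrightarrow> w1 \<in> P_hist b (max R 1) \<longrightarrow> w2 \<in> P_hist b (max R 1) \<longrightarrow>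
          \<bar>g (z1, w1) - g (z2, w2)\<bar> \<le> l * norm_X b (z1 - z2, \<lambda>\<theta>. w1 \<theta> - w2 \<theta>))" ..
  have lg: "\<bar>g (v 0, v) - g (w 0, w)\<bar> \<le> l * norm_X b (v 0 - w 0, \<lambda>\<theta>. v \<theta> - w \<theta>)"
    by (rule l[THEN conjunct2, rule_format, OF X(2,1) P(2,1)])
  have "norm_L1 b (\<lambda>\<theta>. v \<theta> - w \<theta>) = 0"
  proof -
    have "continuous_on {-b..0} (\<lambda>\<theta>. v \<theta> - w \<theta>)"
      using v w lipschitz_on_continuous_on by (intro continuous_intros) blast+
    then have "norm_L1 b (\<lambda>\<theta>. v \<theta> - w \<theta>) = integral {-b..0} (\<lambda>\<theta>. norm (v \<theta> - w \<theta>))" by (rule norm_L1_eq)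
    also have "\<dots> = integral {-b..0} (\<lambda>\<theta>. 0)" by (rule integral_cong) (simp add: eq)
    finally show ?thesis by simp
  qed
  then show ?thesis using lg eq[of 0] max_delay_pos by (auto simp: norm_X_def)
qed

text \<open>The cost along a given solution, free of the definite description in
  \<open>trajectory\<close>; the connection with \<open>cost\<close> is
  \<open>cost_eq\<close>.\<close>

definition J :: "real \<Rightarrow> (real \<Rightarrow> real ^ 'n) \<Rightarrow> (real \<Rightarrow> real ^ 'm) \<Rightarrow> real" where
  "J t x \<alpha> = integral {t..T} (\<lambda>s. L s (x s) (delayed x s) (\<alpha> s)) + g (x T, segment_at x T)"

lemma cost_eq:
  assumes x: "solves t w \<alpha> x" and t: "t \<in> {t0..T}" and \<alpha>: "\<alpha> \<in> controls A t T"
  shows "cost f L g \<tau> b T t w \<alpha> = J t x \<alpha>"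
proof -
  let ?y = "restrict x {t - b..T}"
  have b: "0 < b" by (rule max_delay_pos)
  obtain K where K: "K-lipschitz_on {t - b..T} x" using x by (auto simp: is_trajectory_def)
  have c: "continuous_on {t..T} x" "continuous_on {t..T} (delayed x)"
    using continuous_on_subset[OF lipschitz_on_continuous_on[OF K]] t b
      continuous_on_delayed[OF _ lipschitz_on_continuous_on[OF K]] by auto
  have int: "(\<lambda>s. L s (x s) (delayed x s) (\<alpha> s)) absolutely_integrable_on {t..T}"
    using integrable_along(1)[OF L_cont _ c \<alpha>] t by auto
  have "(LINT s:{t..T}|lebesgue. L s (?y s) (?y (s - \<tau> s (?y s))) (\<alpha> s)) = (LINT s:{t..T}|lebesgue. L s (x s) (delayed x s) (\<alpha> s))"
  proof (rule set_lebesgue_integral_cong, simp, intro allI impI)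
    fix s assume s: "s \<in> {t..T}"
    then have "?y s = x s" "?y (dtime x s) = x (dtime x s)"
      using dtime_bounds[of s x] t b by auto
    then show "L s (?y s) (?y (s - \<tau> s (?y s))) (\<alpha> s) = L s (x s) (delayed x s) (\<alpha> s)"
      by (simp only: delayed_eq dtime_def)
  qed
  also have "\<dots> = integral {t..T} (\<lambda>s. L s (x s) (delayed x s) (\<alpha> s))"
    by (rule set_lebesgue_integral_eq_integral(2)[OF int])
  finally have 1: "(LINT s:{t..T}|lebesgue. L s (?y s) (?y (s - \<tau> s (?y s))) (\<alpha> s))
      = integral {t..T} (\<lambda>s. L s (x s) (delayed x s) (\<alpha> s))" .
  have "g (segment_at ?y T 0, segment_at ?y T) = g (segment_at x T 0, segment_at x T)"
    using t by (intro g_cong[OF segment_lipschitz[OF K]]) (auto simp: segment_at_def)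
  moreover have "segment_at ?y T 0 = ?y T" "segment_at x T 0 = x T" by (simp_all only: segment_at_def add_0_right)
  ultimately have "g (?y T, segment_at ?y T) = g (x T, segment_at x T)" by (simp only:)
  with 1 show ?thesis unfolding cost_def J_def trajectory_eq_restrict[OF x t \<alpha>] Let_def by simp
qed

section \<open>A priori bounds uniform in the control, and finiteness of the value function\<close>

lemma growth_rate_exists:
  "\<exists>k. 0 < k \<and> (\<forall>t w \<alpha> B Kw. t \<in> {t0..T} \<longrightarrow> \<alpha> \<in> controls A t T \<longrightarrow> Kw-lipschitz_on {-b..0} w \<longrightarrow>
     (\<forall>\<theta>\<in>{-b..0}. norm (w \<theta>) \<le> B) \<longrightarrow> 1 \<le> B \<longrightarrow>
     (\<exists>x. solves t w \<alpha> x \<and> (\<forall>s\<in>{t - b..T}. norm (x s) \<le> B * exp (k * (T - t0))) \<and>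
        (max Kw (k * (B * exp (k * (T - t0)))))-lipschitz_on {t - b..T} x))"
proof (rule trajectory_exists)
  fix k :: real
  assume k: "0 < k" and ex: "\<And>t w \<alpha> B Kw. \<lbrakk>t \<in> {t0..T}; \<alpha> \<in> controls A t T; Kw-lipschitz_on {-b..0} w;
        \<And>\<theta>. \<theta> \<in> {-b..0} \<Longrightarrow> norm (w \<theta>) \<le> B; 1 \<le> B\<rbrakk> \<Longrightarrow>
      \<exists>x. solves t w \<alpha> x \<and> (\<forall>s\<in>{t - b..T}. norm (x s) \<le> B * exp (k * (T - t0))) \<and>
        (max Kw (k * (B * exp (k * (T - t0)))))-lipschitz_on {t - b..T} x"
  show ?thesis
    by (intro exI[of _ k] conjI allI impI ex k) (assumption | erule bspec)+
qed

definition "kT = (SOME k. 0 < k \<and> (\<forall>t w \<alpha> B Kw. t \<in> {t0..T} \<longrightarrow> \<alpha> \<in> controls A t T \<longrightarrow> Kw-lipschitz_on {-b..0} w \<longrightarrow>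
     (\<forall>\<theta>\<in>{-b..0}. norm (w \<theta>) \<le> B) \<longrightarrow> 1 \<le> B \<longrightarrow>
     (\<exists>x. solves t w \<alpha> x \<and> (\<forall>s\<in>{t - b..T}. norm (x s) \<le> B * exp (k * (T - t0))) \<and>
        (max Kw (k * (B * exp (k * (T - t0)))))-lipschitz_on {t - b..T} x)))"

lemma kT_pos: "0 < kT"
  and trajectory_with_bounds: "\<lbrakk>t \<in> {t0..T}; \<alpha> \<in> controls A t T; Kw-lipschitz_on {-b..0} w;
     \<forall>\<theta>\<in>{-b..0}. norm (w \<theta>) \<le> B; 1 \<le> B\<rbrakk> \<Longrightarrow>
     \<exists>x. solves t w \<alpha> x \<and> (\<forall>s\<in>{t - b..T}. norm (x s) \<le> B * exp (kT * (T - t0))) \<and>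
        (max Kw (kT * (B * exp (kT * (T - t0)))))-lipschitz_on {t - b..T} x"
  using someI_ex[OF growth_rate_exists] unfolding kT_def[symmetric] by blast+

lemma trajectory_obtain:
  assumes "t \<in> {t0..T}" "\<alpha> \<in> controls A t T" "w \<in> Lip_hist b"
  obtains x where "solves t w \<alpha> x"
proof -
  obtain Kw where Kw: "Kw-lipschitz_on {-b..0} w" using assms by (auto simp: Lip_hist_def)
  obtain r0 where r0: "\<And>\<theta>. \<theta> \<in> {-b..0} \<Longrightarrow> norm (w \<theta>) \<le> r0" "0 \<le> r0"
    using continuous_on_Icc_bounded[OF lipschitz_on_continuous_on[OF Kw]] by blast
  have "norm (w \<theta>) \<le> max 1 r0" if "\<theta> \<in> {-b..0}" for \<theta> using r0(1)[OF that] by simp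
  then show ?thesis using trajectory_with_bounds[OF assms(1,2) Kw, of "max 1 r0"] that by auto
qed

text \<open>\<open>RB r\<close> and \<open>MB r\<close> bound the size and the Lipschitz constant of
  every trajectory whose history has size and Lipschitz constant at most \<open>r\<close>, for all
  controls and initial times. The maximum with \<open>1\<close> in \<open>RB\<close> meets the
  requirement \<open>1 \<le> B\<close> of the existence result.\<close>

definition "RB r = max 1 r * exp (kT * (T - t0))"
definition "MB r = max 1 (max r (kT * RB r))"

lemma RB_ge: "1 \<le> RB r" "r \<le> RB r"
proof -
  have "max 1 r * 1 \<le> RB r" unfolding RB_def using kT_pos time_interval by (intro mult_left_mono) auto
  then show "1 \<le> RB r" "r \<le> RB r" by auto
qed

lemma MB_ge: "1 \<le> MB r" by (simp add: MB_def)

lemma trajectory_bounds: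
  assumes t: "t \<in> {t0..T}" and \<alpha>: "\<alpha> \<in> controls A t T" and w: "Kw-lipschitz_on {-b..0} w"
    and wr: "\<And>\<theta>. \<theta> \<in> {-b..0} \<Longrightarrow> norm (w \<theta>) \<le> r" and x: "solves t w \<alpha> x"
  shows "s \<in> {t - b..T} \<Longrightarrow> norm (x s) \<le> RB r"
    and "Kw \<le> r \<Longrightarrow> (MB r)-lipschitz_on {t - b..T} x"
proof -
  have "\<forall>\<theta>\<in>{-b..0}. norm (w \<theta>) \<le> max 1 r" using wr by force
  then obtain y where y: "solves t w \<alpha> y" "\<forall>s\<in>{t - b..T}. norm (y s) \<le> RB r" "(max Kw (kT * RB r))-lipschitz_on {t - b..T} y"
    using trajectory_with_bounds[OF t \<alpha> w, of "max 1 r"] unfolding RB_def by auto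
  have eq: "x s = y s" if "s \<in> {t - b..T}" for s
    by (rule trajectory_unique[OF t controls_in_A[OF \<alpha>] x y(1) that])
  show "norm (x s) \<le> RB r" if "s \<in> {t - b..T}" using eq[OF that] y(2) that by simp
  show "(MB r)-lipschitz_on {t - b..T} x" if "Kw \<le> r"
    using lipschitz_on_transform[OF y(3) eq] by (rule lipschitz_on_le) (use that in \<open>auto simp: MB_def\<close>)
qed

definition "gL R = (SOME l. 0 < l \<and> (\<forall>z1 w1 z2 w2. (z1, w1) \<in> X_space b \<longrightarrow> (z2, w2) \<in> X_space b \<longrightarrow> w1 \<in> P_hist b R \<longrightarrow> w2 \<in> P_hist b R \<longrightarrow>
          \<bar>g (z1, w1) - g (z2, w2)\<bar> \<le> l * norm_X b (z1 - z2, \<lambda>\<theta>. w1 \<theta> - w2 \<theta>)))"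

lemma gL_pos: "0 < R \<Longrightarrow> 0 < gL R"
  unfolding gL_def using someI_ex[OF g_lipschitz_pairs[of R]] by (rule conjunct1)

lemma g_lipschitz_L1:
  fixes v w :: "real \<Rightarrow> real ^ 'n"
  assumes R: "0 < R" and v: "Kv-lipschitz_on {-b..0} v" and w: "Kw-lipschitz_on {-b..0} w"
    and vR: "\<And>\<theta>. \<theta> \<in> {-b..0} \<Longrightarrow> norm (v \<theta>) \<le> R" and wR: "\<And>\<theta>. \<theta> \<in> {-b..0} \<Longrightarrow> norm (w \<theta>) \<le> R"
  shows "\<bar>g (v 0, v) - g (w 0, w)\<bar> \<le> gL R * (norm (v 0 - w 0) + integral {-b..0} (\<lambda>\<theta>. norm (v \<theta> - w \<theta>)))"
proof -
  have c: "continuous_on {-b..0} (\<lambda>\<theta>. v \<theta> - w \<theta>)"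
    by (intro continuous_intros lipschitz_on_continuous_on[OF v] lipschitz_on_continuous_on[OF w])
  have X: "(v 0, v) \<in> X_space b" "(w 0, w) \<in> X_space b" using v w by (auto simp: X_space_def Lip_hist_def)
  have "\<bar>g (v 0, v) - g (w 0, w)\<bar> \<le> gL R * norm_X b (v 0 - w 0, \<lambda>\<theta>. v \<theta> - w \<theta>)"
    unfolding gL_def
    by (rule someI_ex[OF g_lipschitz_pairs[OF R], THEN conjunct2, rule_format, OF X P_histI[OF v vR] P_histI[OF w wR]])
  also have "\<dots> = gL R * (norm (v 0 - w 0) + integral {-b..0} (\<lambda>\<theta>. norm (v \<theta> - w \<theta>)))"
    by (simp add: norm_X_def norm_L1_eq[OF c])
  finally show ?thesis .
qed

text \<open>Without a lower bound the infimum of reals defining the value function would carry no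
  information. Uniform trajectory bounds and the growth of \<open>L\<close> control the integral;
  \<open>g\<close> is compared with its value at the zero history.\<close>

lemma cost_bounded_below:
  assumes t: "t \<in> {t0..T}" and w: "w \<in> Lip_hist b"
  shows "bdd_below (cost f L g \<tau> b T t w ` controls A t T)"
proof -
  obtain Kw where Kw: "Kw-lipschitz_on {-b..0} w" using w by (auto simp: Lip_hist_def)
  obtain r0 where r0: "\<And>\<theta>. \<theta> \<in> {-b..0} \<Longrightarrow> norm (w \<theta>) \<le> r0" "0 \<le> r0"
    using continuous_on_Icc_bounded[OF lipschitz_on_continuous_on[OF Kw]] by blast
  define r where "r = r0 + 1"
  have r: "0 < r" "\<And>\<theta>. \<theta> \<in> {-b..0} \<Longrightarrow> norm (w \<theta>) \<le> r" using r0 by (auto simp: r_def add_increasing2)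
  define R where "R = RB r"
  have R: "1 \<le> R" "r \<le> R" by (simp_all add: R_def RB_ge)
  obtain CL where CL: "0 < CL" "\<And>t a z y. t \<in> {t0..T} \<Longrightarrow> a \<in> A \<Longrightarrow> \<bar>L t z y a\<bar> \<le> CL * (1 + norm z + norm y)"
    using L_growth by blast
  have b: "0 < b" by (rule max_delay_pos)
  define m where "m = CL * (1 + R + R) * (T - t) + (\<bar>g (0, \<lambda>_. 0)\<bar> + gL R * (R + R * b))"
  have "- m \<le> cost f L g \<tau> b T t w \<alpha>" if \<alpha>: "\<alpha> \<in> controls A t T" for \<alpha>
  proof -
    obtain x where x: "solves t w \<alpha> x" using trajectory_obtain[OF t \<alpha> w] by blast
    obtain K where K: "K-lipschitz_on {t - b..T} x" using x by (auto simp: is_trajectory_def)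
    have xb: "norm (x s) \<le> R" if "s \<in> {t - b..T}" for s 
      unfolding R_def by (rule trajectory_bounds(1)[OF t \<alpha> Kw r(2) x that])
    have c: "continuous_on {t..T} x" "continuous_on {t..T} (delayed x)"
      using continuous_on_subset[OF lipschitz_on_continuous_on[OF K]] t b
        continuous_on_delayed[OF _ lipschitz_on_continuous_on[OF K]] by auto
    have int: "(\<lambda>s. L s (x s) (delayed x s) (\<alpha> s)) integrable_on {t..T}"
      using integrable_along(1)[OF L_cont _ c \<alpha>] t set_lebesgue_integral_eq_integral(1) by auto
    have "norm (integral {t..T} (\<lambda>s. if s \<in> {t<..<T} then L s (x s) (delayed x s) (\<alpha> s) else 0)) \<le> CL * (1 + R + R) * (T - t)"
    proof -
      have "norm (integral {t..T} (\<lambda>s. if s \<in> {t<..<T} then L s (x s) (delayed x s) (\<alpha> s) else 0)) \<le> integral {t..T} (\<lambda>_. CL * (1 + R + R))"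
      proof (rule integral_norm_bound_integral)
        show "(\<lambda>s. if s \<in> {t<..<T} then L s (x s) (delayed x s) (\<alpha> s) else 0) integrable_on {t..T}"
          by (rule integrable_spike_finite[of "{t, T}", OF _ _ int]) auto
        fix s assume s: "s \<in> {t..T}"
        show "norm (if s \<in> {t<..<T} then L s (x s) (delayed x s) (\<alpha> s) else 0) \<le> CL * (1 + R + R)"
        proof (cases "s \<in> {t<..<T}")
          case True
          have "norm (x s) \<le> R" "norm (delayed x s) \<le> R"
            using s b t dtime_bounds[of s x] by (auto intro!: xb simp: delayed_eq)
          then have "CL * (1 + norm (x s) + norm (delayed x s)) \<le> CL * (1 + R + R)"
            using CL(1) by (intro mult_left_mono) auto
          moreover have "\<bar>L s (x s) (delayed x s) (\<alpha> s)\<bar> \<le> CL * (1 + norm (x s) + norm (delayed x s))"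
            using s t by (intro CL(2) controls_in_A[OF \<alpha> True]) auto
          ultimately show ?thesis using True by simp
        next
          case False
          show ?thesis unfolding if_not_P[OF False] using CL(1) R by simp
        qed
      qed (rule integrable_const_ivl)
      then show ?thesis using t by (simp add: mult_ac)
    qed
    moreover have "integral {t..T} (\<lambda>s. if s \<in> {t<..<T} then L s (x s) (delayed x s) (\<alpha> s) else 0)
        = integral {t..T} (\<lambda>s. L s (x s) (delayed x s) (\<alpha> s))"
      by (rule integral_spike[of "{t, T}"]) auto
    ultimately have 1: "\<bar>integral {t..T} (\<lambda>s. L s (x s) (delayed x s) (\<alpha> s))\<bar> \<le> CL * (1 + R + R) * (T - t)" by simp
    have sl: "K-lipschitz_on {-b..0} (segment_at x T)" using t by (intro segment_lipschitz[OF K]) auto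
    have sR: "norm (segment_at x T \<theta>) \<le> R" if "\<theta> \<in> {-b..0}" for \<theta>
      using that t by (auto simp: segment_at_def intro!: xb)
    have "\<bar>g (segment_at x T 0, segment_at x T) - g ((\<lambda>_::real. 0) 0, (\<lambda>_. 0))\<bar> \<le>
       gL R * (norm (segment_at x T 0 - 0) + integral {-b..0} (\<lambda>\<theta>. norm (segment_at x T \<theta> - 0)))"
      using R by (intro g_lipschitz_L1[OF _ sl, of R 0] sR) (auto simp: lipschitz_on_def)
    also have "\<dots> \<le> gL R * (R + integral {-b..0} (\<lambda>\<theta>. R))"
      using gL_pos[of R] R sR b by (intro mult_left_mono add_mono integral_le integrable_continuous_real continuous_intros
          lipschitz_on_continuous_on[OF sl]) auto
    also have "\<dots> = gL R * (R + R * b)" using b by simp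
    finally have "\<bar>g (x T, segment_at x T) - g (0, (\<lambda>_. 0))\<bar> \<le> gL R * (R + R * b)" by (simp add: segment_at_def)
    then show ?thesis using 1 unfolding cost_eq[OF x t \<alpha>] J_def m_def by linarith
  qed
  then show ?thesis by (intro bdd_belowI2) auto
qed

text \<open>The case \<open>t = T\<close> matters, since the later initial time \<open>t + h\<close>
  may equal \<open>T\<close>.\<close>

lemma value_le_J:
  assumes t: "t \<in> {t0..T}" and w: "w \<in> Lip_hist b" and \<alpha>: "\<alpha> \<in> controls A t T" and x: "solves t w \<alpha> x"
  shows "value_fn A f L g \<tau> b T t w \<le> J t x \<alpha>"
proof (cases "t = T")
  case True
  obtain Kw where Kw: "Kw-lipschitz_on {-b..0} w" using w by (auto simp: Lip_hist_def)
  have "g (segment_at x T 0, segment_at x T) = g (w 0, w)"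
    using trajectory_history[OF x] True by (intro g_cong[OF Kw]) (auto simp: segment_at_def)
  then show ?thesis by (simp add: value_fn_def J_def True segment_at_def)
next
  case False
  have "(INF \<alpha>\<in>controls A t T. cost f L g \<tau> b T t w \<alpha>) \<le> cost f L g \<tau> b T t w \<alpha>"
    by (rule cINF_lower[OF cost_bounded_below[OF t w] \<alpha>])
  then show ?thesis using False by (simp add: value_fn_def cost_eq[OF x t \<alpha>])
qed

text \<open>The Lipschitz representative differs from the optimal control on a null set, so
  trajectory and cost agree; its values lie in \<open>A\<close> everywhere because \<open>A\<close>
  is closed. In particular the value at the initial time, which occurs in the compatibility
  condition, is admissible.\<close>

lemma optimal_control_J:
  assumes t: "t \<in> {t0..<T}" and w: "w \<in> Lip_hist b"
    and opt: "optimal_control A f L g \<tau> b T t w \<alpha>" and rep: "lipschitz_representative t T \<alpha> \<alpha>'"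
  obtains x where "solves t w \<alpha>' x" "value_fn A f L g \<tau> b T t w = J t x \<alpha>'" "\<alpha>' \<in> controls A t T"
    "\<And>s. s \<in> {t..T} \<Longrightarrow> \<alpha>' s \<in> A"
proof -
  have t': "t \<in> {t0..T}" "t < T" using t by auto
  have \<alpha>: "\<alpha> \<in> controls A t T" using opt by (simp add: optimal_control_def)
  obtain x where x: "solves t w \<alpha> x" using trajectory_obtain[OF t'(1) \<alpha> w] by blast
  obtain K where K: "K-lipschitz_on {t..T} \<alpha>'" and ae: "AE s\<in>{t<..<T} in lebesgue. \<alpha>' s = \<alpha> s"
    using rep by (auto simp: lipschitz_representative_def)
  obtain N where N: "negligible N" "\<And>s. s \<notin> N \<Longrightarrow> s \<in> {t<..<T} \<longrightarrow> \<alpha>' s = \<alpha> s"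
    using AE_imp_negligible[OF ae] by blast
  have inA: "\<alpha>' s \<in> A" if "s \<in> {t..T}" for s
    by (rule ae_in_closed_imp_all[OF lipschitz_on_continuous_on[OF K] compact_imp_closed[OF A_compact] N(1) t'(2) _ that])
       (use N(2) controls_in_A[OF \<alpha>] in force)
  have \<alpha>': "\<alpha>' \<in> controls A t T"
    unfolding controls_def using inA
    by (auto intro!: continuous_imp_measurable_on_sets_lebesgue continuous_on_subset[OF lipschitz_on_continuous_on[OF K]])
  have x': "solves t w \<alpha>' x" by (rule trajectory_restrict_cong[OF x t'(1) _ N(1)]) (use N(2) in auto)
  have "value_fn A f L g \<tau> b T t w = J t x \<alpha>"
    using opt cost_eq[OF x t'(1) \<alpha>] by (simp add: optimal_control_def)
  also have "\<dots> = J t x \<alpha>'"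
  proof -
    have "negligible (N \<union> {t, T})" using N(1) by simp
    then have "integral {t..T} (\<lambda>s. L s (x s) (delayed x s) (\<alpha> s)) = integral {t..T} (\<lambda>s. L s (x s) (delayed x s) (\<alpha>' s))"
      by (rule integral_spike) (use N(2) in auto)
    then show ?thesis by (simp add: J_def)
  qed
  finally show ?thesis using that x' \<alpha>' inA by blast
qed

section \<open>Expansion of the delayed time\<close>

definition "dd r = (SOME d. 0 < d \<and> (\<forall>t\<in>{t0..T}. \<forall>w\<in>P_hist b r. \<forall>\<alpha>\<in>controls A t T.
          let x = trajectory f \<tau> b T t w \<alpha> in
          AE s\<in>{t..T} in lebesgue.
            d \<le> 1 - vector_derivative (\<lambda>u. \<tau> u (x s)) (at s within {t0..T})
                  - frechet_derivative (\<lambda>z. \<tau> s z) (at (x s)) (vector_derivative x (at s))))"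

lemma dd:
  assumes "0 < r"
  shows "0 < dd r"
    and "\<lbrakk>t \<in> {t0..T}; w \<in> P_hist b r; \<alpha> \<in> controls A t T\<rbrakk> \<Longrightarrow>
      (let x = trajectory f \<tau> b T t w \<alpha> in
          AE s\<in>{t..T} in lebesgue.
            dd r \<le> 1 - vector_derivative (\<lambda>u. \<tau> u (x s)) (at s within {t0..T})
                  - frechet_derivative (\<lambda>z. \<tau> s z) (at (x s)) (vector_derivative x (at s)))"
proof -
  have "\<exists>d. 0 < d \<and> (\<forall>t\<in>{t0..T}. \<forall>w\<in>P_hist b r. \<forall>\<alpha>\<in>controls A t T.
          let x = trajectory f \<tau> b T t w \<alpha> in
          AE s\<in>{t..T} in lebesgue.
            d \<le> 1 - vector_derivative (\<lambda>u. \<tau> u (x s)) (at s within {t0..T})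
                  - frechet_derivative (\<lambda>z. \<tau> s z) (at (x s)) (vector_derivative x (at s)))"
    by (rule delay_monotone[rule_format, OF assms])
  note D = someI_ex[OF this, folded dd_def]
  show "0 < dd r" by (rule D[THEN conjunct1])
  assume a: "t \<in> {t0..T}" "w \<in> P_hist b r" "\<alpha> \<in> controls A t T"
  show "let x = trajectory f \<tau> b T t w \<alpha> in
          AE s\<in>{t..T} in lebesgue.
            dd r \<le> 1 - vector_derivative (\<lambda>u. \<tau> u (x s)) (at s within {t0..T})
                  - frechet_derivative (\<lambda>z. \<tau> s z) (at (x s)) (vector_derivative x (at s))"
    by (rule bspec[OF bspec[OF bspec[OF D[THEN conjunct2] a(1)] a(2)] a(3)])
qed

text \<open>The quantity bounded below by the monotone delay assumption is the derivative of the
  delayed time: the total derivative of \<open>\<tau>\<close> along the trajectory splits by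
  linearity into its time part and its state part.\<close>

lemma dtime_expanding:
  assumes r: "0 < r" and t: "t \<in> {t0..T}" and w: "w \<in> P_hist b r" and \<alpha>: "\<alpha> \<in> controls A t T"
    and x0: "solves t w \<alpha> x0"
  obtains N where "negligible N" "\<And>s. s \<in> {t<..<T} - N \<Longrightarrow> \<exists>D\<ge>dd r. (dtime x0 has_real_derivative D) (at s)"
proof -
  obtain \<tau>' :: "real \<times> (real ^ 'n) \<Rightarrow> (real \<times> (real ^ 'n)) \<Rightarrow>\<^sub>L real" where
    \<tau>': "\<forall>p\<in>{t0..T} \<times> UNIV. ((\<lambda>(t, z). \<tau> t z) has_derivative blinfun_apply (\<tau>' p)) (at p within {t0..T} \<times> UNIV)"
    using delay_C1 by (auto simp: C1_on_def)
    \<comment> \<open>The assumption speaks of the solution selected by \<open>trajectory\<close>,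
      which is this restriction of \<open>x0\<close>; the two agree near every interior
      time.\<close>
    define x where "x = restrict x0 {t - b..T}"
    have b: "0 < b" by (rule max_delay_pos)
    have x: "solves t w \<alpha> x"
      unfolding x_def by (rule trajectory_restrict_cong[OF x0 t _ negligible_empty]) auto
    have "AE s\<in>{t..T} in lebesgue. dd r \<le> 1 - vector_derivative (\<lambda>u. \<tau> u (x s)) (at s within {t0..T})
                  - frechet_derivative (\<lambda>z. \<tau> s z) (at (x s)) (vector_derivative x (at s))"
      using dd(2)[OF r t w \<alpha>] unfolding trajectory_eq_restrict[OF x0 t \<alpha>] x_def Let_def .
    then obtain N1 where N1: "negligible N1" "\<And>s. s \<notin> N1 \<Longrightarrow> s \<in> {t..T} \<longrightarrow> dd r \<le> 1 - vector_derivative (\<lambda>u. \<tau> u (x s)) (at s within {t0..T})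
                  - frechet_derivative (\<lambda>z. \<tau> s z) (at (x s)) (vector_derivative x (at s))"
      by (rule AE_imp_negligible) blast
    obtain N2 where N2: "negligible N2"
      "\<And>s. s \<in> {t<..<T} - N2 \<Longrightarrow> (x has_vector_derivative f s (x s) (delayed x s) (\<alpha> s)) (at s)"
      using trajectory_derivative_ae[OF x] by blast
    have "\<exists>D\<ge>dd r. (dtime x0 has_real_derivative D) (at s)" if s: "s \<in> {t<..<T} - (N1 \<union> N2)" for s
    proof -
      let ?v = "f s (x s) (delayed x s) (\<alpha> s)" and ?p = "(s, x s)"
      have xd: "(x has_vector_derivative ?v) (at s)" using N2(2) s by auto
      have "?p \<in> interior ({t0..T} \<times> UNIV)" using s t by (auto simp: interior_Times)
      then have at: "at ?p within {t0..T} \<times> UNIV = at ?p" by (rule at_within_interior)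
      have D: "((\<lambda>(t, z). \<tau> t z) has_derivative blinfun_apply (\<tau>' ?p)) (at ?p)"
        using bspec[OF \<tau>', of ?p] s t at by auto
      have lin: "blinfun_apply (\<tau>' ?p) (h, k) = h * blinfun_apply (\<tau>' ?p) (1, 0) + blinfun_apply (\<tau>' ?p) (0, k)" for h k
      proof -
        have "(h, k) = h *\<^sub>R (1, 0) + (0, k)" by simp
        then show ?thesis by (metis blinfun.add_right blinfun.scaleR_right real_scaleR_def)
      qed
      have lin0: "blinfun_apply (\<tau>' ?p) (h, 0) = h * blinfun_apply (\<tau>' ?p) (1, 0)" for h
        using blinfun.scaleR_right[of "\<tau>' ?p" h "(1, 0)"] by simp
      have "((\<lambda>u. (u, x s)) has_derivative (\<lambda>h. (h, 0))) (at s)"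
        by (auto intro!: derivative_eq_intros)
      from has_derivative_compose[OF this D]
      have "((\<lambda>u. \<tau> u (x s)) has_derivative (\<lambda>h. blinfun_apply (\<tau>' ?p) (h, 0))) (at s)" by (simp only: prod.case)
      then have "((\<lambda>u. \<tau> u (x s)) has_vector_derivative blinfun_apply (\<tau>' ?p) (1, 0)) (at s)"
        unfolding has_vector_derivative_def real_scaleR_def by (rule subst[where P = "\<lambda>F. (_ has_derivative F) _", OF ext, rotated]) (rule lin0)
      then have v1: "vector_derivative (\<lambda>u. \<tau> u (x s)) (at s within {t0..T}) = blinfun_apply (\<tau>' ?p) (1, 0)"
        using s t by (subst at_within_Icc_at) (auto intro: vector_derivative_at)
      have "((\<lambda>z. (s, z)) has_derivative (\<lambda>k. (0, k))) (at (x s))"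
        by (auto intro!: derivative_eq_intros)
      from has_derivative_compose[OF this D]
      have "((\<lambda>z. \<tau> s z) has_derivative (\<lambda>k. blinfun_apply (\<tau>' ?p) (0, k))) (at (x s))" by (simp only: prod.case)
      then have v2: "frechet_derivative (\<lambda>z. \<tau> s z) (at (x s)) = (\<lambda>k. blinfun_apply (\<tau>' ?p) (0, k))"
        by (rule frechet_derivative_at[symmetric])
      have "((\<lambda>u. (u, x u)) has_derivative (\<lambda>h. (h, h *\<^sub>R ?v))) (at s)"
        using xd unfolding has_vector_derivative_def by (intro has_derivative_Pair has_derivative_ident)
      from has_derivative_compose[OF this D]
      have "((\<lambda>u. \<tau> u (x u)) has_derivative (\<lambda>h. blinfun_apply (\<tau>' ?p) (h, h *\<^sub>R ?v))) (at s)" by (simp only: prod.case)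
      moreover have "blinfun_apply (\<tau>' ?p) (h, h *\<^sub>R ?v) = h * blinfun_apply (\<tau>' ?p) (1, ?v)" for h
        using blinfun.scaleR_right[of "\<tau>' ?p" h "(1, ?v)"] by simp
      ultimately have "((\<lambda>u. \<tau> u (x u)) has_real_derivative blinfun_apply (\<tau>' ?p) (1, ?v)) (at s)"
        by (simp add: has_field_derivative_def mult_commute_abs)
      then have "((\<lambda>u. u - \<tau> u (x u)) has_real_derivative 1 - blinfun_apply (\<tau>' ?p) (1, ?v)) (at s)"
        by (intro DERIV_diff DERIV_ident)
      then have "(dtime x0 has_real_derivative 1 - blinfun_apply (\<tau>' ?p) (1, ?v)) (at s)"
        by (rule has_field_derivative_transform_within_open[of _ _ _ "{t<..<T}"])
           (use s b in \<open>auto simp: dtime_def x_def\<close>)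
      moreover have "dd r \<le> 1 - blinfun_apply (\<tau>' ?p) (1, ?v)"
        using N1(2)[of s] s v1 v2 vector_derivative_at[OF xd] lin[of 1 ?v] by auto
      ultimately show ?thesis by blast
    qed
    moreover have "negligible (N1 \<union> N2)" using N1(1) N2(1) by (rule negligible_Un)
    ultimately show ?thesis using that by blast
qed

end

section \<open>Structure of the Hamiltonian\<close>

lemma unbounded_affine_imp_nonpos:
  fixes q l B :: real
  assumes "\<And>c. c * q + l \<le> B" shows "q \<le> 0"
proof (rule ccontr)
  assume "\<not> q \<le> 0"
  then have "(B - l + 1) / q * q = B - l + 1" by simp
  then show False using assms[of "(B - l + 1) / q"] by linarith
qed

lemma integral_shift_Icc:
  fixes h :: "real \<Rightarrow> 'a::euclidean_space"
  shows "integral {a..c} (\<lambda>u. h (u + d)) = integral {a + d..c + d} h"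
  using integral_shift_Icc_real[of a c h d] by (simp add: o_def add.commute)

context smooth_delay_control_problem
begin

text \<open>The mean value inequality on the convex set \<open>A\<close> for the difference of two
  Hamiltonians. Control increments of the Hamiltonian, unlike its gradient relative to
  \<open>A\<close>, are determined even when \<open>A\<close> has empty interior.\<close>

lemma hamiltonian_mixed_difference:
  "\<exists>lH>0. \<forall>t1\<in>{t0..T}. \<forall>t2\<in>{t0..T}. \<forall>z1 y1 p1 z2 y2 p2. \<forall>a\<in>A. \<forall>a'\<in>A.
     \<bar>(hamiltonian f L t1 z1 y1 p1 a - hamiltonian f L t1 z1 y1 p1 a') -
      (hamiltonian f L t2 z2 y2 p2 a - hamiltonian f L t2 z2 y2 p2 a')\<bar>
     \<le> lH * (\<bar>t1 - t2\<bar> + norm (z1 - z2) + norm (y1 - y2) + norm (p1 - p2)) * norm (a - a')"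
proof -
  obtain Ha :: "real \<Rightarrow> real ^ 'n \<Rightarrow> real ^ 'n \<Rightarrow> real ^ 'n \<Rightarrow> real ^ 'm \<Rightarrow> real ^ 'm" and lH where
    Ha: "\<forall>t\<in>{t0..T}. \<forall>z y p. \<forall>a\<in>A. (hamiltonian f L t z y p has_derivative (\<lambda>v. Ha t z y p a \<bullet> v)) (at a within A)"
    and lH: "lH > 0" "\<forall>t1\<in>{t0..T}. \<forall>t2\<in>{t0..T}. \<forall>z1 y1 p1 z2 y2 p2. \<forall>a\<in>A.
             norm (Ha t1 z1 y1 p1 a - Ha t2 z2 y2 p2 a)
               \<le> lH * (\<bar>t1 - t2\<bar> + norm (z1 - z2) + norm (y1 - y2) + norm (p1 - p2))"
    using hamiltonian_gradient by (elim exE conjE)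
  show ?thesis
  proof (intro exI[of _ lH] conjI ballI allI lH(1))
    fix t1 t2 z1 y1 p1 z2 y2 p2 a a'
    assume t: "t1 \<in> {t0..T}" "t2 \<in> {t0..T}" and a: "a \<in> A" "a' \<in> A"
    let ?H = "\<lambda>a. hamiltonian f L t1 z1 y1 p1 a - hamiltonian f L t2 z2 y2 p2 a"
    have "norm (?H a - ?H a') \<le> lH * (\<bar>t1 - t2\<bar> + norm (z1 - z2) + norm (y1 - y2) + norm (p1 - p2)) * norm (a - a')"
    proof (rule differentiable_bound[OF A_convex _ _ a])
      fix x assume x: "x \<in> A"
      show "(?H has_derivative (\<lambda>v. Ha t1 z1 y1 p1 x \<bullet> v - Ha t2 z2 y2 p2 x \<bullet> v)) (at x within A)"
        by (intro has_derivative_diff Ha[rule_format] t x)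
      show "onorm (\<lambda>v. Ha t1 z1 y1 p1 x \<bullet> v - Ha t2 z2 y2 p2 x \<bullet> v)
          \<le> lH * (\<bar>t1 - t2\<bar> + norm (z1 - z2) + norm (y1 - y2) + norm (p1 - p2))"
      proof (rule onorm_bound)
        show "0 \<le> lH * (\<bar>t1 - t2\<bar> + norm (z1 - z2) + norm (y1 - y2) + norm (p1 - p2))" using lH(1) by simp
        fix v
        have "norm (Ha t1 z1 y1 p1 x \<bullet> v - Ha t2 z2 y2 p2 x \<bullet> v) \<le> norm (Ha t1 z1 y1 p1 x - Ha t2 z2 y2 p2 x) * norm v"
          by (simp add: inner_diff_left[symmetric] Cauchy_Schwarz_ineq2)
        also have "\<dots> \<le> lH * (\<bar>t1 - t2\<bar> + norm (z1 - z2) + norm (y1 - y2) + norm (p1 - p2)) * norm v"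
          by (intro mult_right_mono lH(2)[rule_format] t x) simp
        finally show "norm (Ha t1 z1 y1 p1 x \<bullet> v - Ha t2 z2 y2 p2 x \<bullet> v)
          \<le> lH * (\<bar>t1 - t2\<bar> + norm (z1 - z2) + norm (y1 - y2) + norm (p1 - p2)) * norm v" .
      qed
    qed
    then show "\<bar>(hamiltonian f L t1 z1 y1 p1 a - hamiltonian f L t1 z1 y1 p1 a') -
      (hamiltonian f L t2 z2 y2 p2 a - hamiltonian f L t2 z2 y2 p2 a')\<bar>
     \<le> lH * (\<bar>t1 - t2\<bar> + norm (z1 - z2) + norm (y1 - y2) + norm (p1 - p2)) * norm (a - a')"
      by (simp add: algebra_simps)
  qed
qed

lemma mid_in_A: "a1 \<in> A \<Longrightarrow> a2 \<in> A \<Longrightarrow> (1/2) *\<^sub>R (a1 + a2) \<in> A"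
  using convexD[OF A_convex, of a1 a2 "1/2" "1/2"] by (simp add: scaleR_add_right)

text \<open>The increment of the Hamiltonian over half of the segment from \<open>a1\<close> to
  \<open>a2\<close> is followed along the segment. By the mean value theorem its change is a
  gradient difference tested with half of \<open>d\<close>; the square of that half explains the
  quotient \<open>\<mu> / 4\<close>.\<close>

lemma hamiltonian_midpoint_convex:
  "\<exists>\<mu>>0. \<forall>t\<in>{t0..T}. \<forall>z y p. \<forall>a1\<in>A. \<forall>a2\<in>A.
     \<mu> * (norm (a1 - a2))\<^sup>2 \<le> hamiltonian f L t z y p a1 + hamiltonian f L t z y p a2
        - 2 * hamiltonian f L t z y p ((1/2) *\<^sub>R (a1 + a2))"
proof -
  obtain Ha :: "real \<Rightarrow> real ^ 'n \<Rightarrow> real ^ 'n \<Rightarrow> real ^ 'n \<Rightarrow> real ^ 'm \<Rightarrow> real ^ 'm" and \<mu> where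
    Ha: "\<forall>t\<in>{t0..T}. \<forall>z y p. \<forall>a\<in>A. (hamiltonian f L t z y p has_derivative (\<lambda>v. Ha t z y p a \<bullet> v)) (at a within A)"
    and \<mu>: "\<mu> > 0" "\<forall>t\<in>{t0..T}. \<forall>z y p. \<forall>a1\<in>A. \<forall>a2\<in>A.
             \<mu> * (norm (a1 - a2))\<^sup>2 \<le> (Ha t z y p a1 - Ha t z y p a2) \<bullet> (a1 - a2)"
    using hamiltonian_gradient by (elim exE conjE)
  show ?thesis
  proof (intro exI[of _ "\<mu> / 4"] conjI ballI allI)
    fix t z y p a1 a2
    assume t: "t \<in> {t0..T}" and a: "a1 \<in> A" "a2 \<in> A"
    let ?H = "hamiltonian f L t z y p"
    define d where "d = a2 - a1"
    define c where "c = (\<lambda>s::real. a1 + s *\<^sub>R d)"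
    have cA: "c s \<in> A" if "0 \<le> s" "s \<le> 1" for s
      using convexD[OF A_convex a, of "1 - s" s] that by (simp add: c_def d_def algebra_simps)
    have der: "((\<lambda>s. ?H (c (s + e))) has_derivative (\<lambda>h. Ha t z y p (c (s + e)) \<bullet> (h *\<^sub>R d))) (at s within {0..1/2})"
      if "0 \<le> s" "s \<le> 1/2" "e = 0 \<or> e = 1/2" for s e :: real
    proof -
      have 1: "((\<lambda>s. c (s + e)) has_derivative (\<lambda>h. h *\<^sub>R d)) (at s within {0..1/2})"
        unfolding c_def by (auto intro!: derivative_eq_intros)
      have "(\<lambda>s. c (s + e)) ` {0..1/2} \<subseteq> A" using that(3) cA by auto
      then have "(?H has_derivative (\<lambda>v. Ha t z y p (c (s + e)) \<bullet> v)) (at (c (s + e)) within (\<lambda>s. c (s + e)) ` {0..1/2})"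
        using that by (intro has_derivative_subset[OF Ha[rule_format, OF t cA]]) auto
      from diff_chain_within[OF 1 this] show ?thesis by (simp add: o_def)
    qed
    have "\<exists>s\<in>{0<..<1/2::real}. (?H (c (1/2 + 1/2)) - ?H (c (1/2 + 0))) - (?H (c (0 + 1/2)) - ?H (c (0 + 0)))
       = Ha t z y p (c (s + 1/2)) \<bullet> ((1/2 - 0) *\<^sub>R d) - Ha t z y p (c (s + 0)) \<bullet> ((1/2 - 0) *\<^sub>R d)"
      by (rule mvt_simple[where f = "\<lambda>s. ?H (c (s + 1/2)) - ?H (c (s + 0))" and
              f' = "\<lambda>s h. Ha t z y p (c (s + 1/2)) \<bullet> (h *\<^sub>R d) - Ha t z y p (c (s + 0)) \<bullet> (h *\<^sub>R d)"])
         (simp, intro has_derivative_diff der, simp_all)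
    then obtain s where s: "s \<in> {0<..<1/2::real}" and eq: "(?H (c (1/2 + 1/2)) - ?H (c (1/2 + 0))) - (?H (c (0 + 1/2)) - ?H (c (0 + 0)))
       = Ha t z y p (c (s + 1/2)) \<bullet> ((1/2 - 0) *\<^sub>R d) - Ha t z y p (c (s + 0)) \<bullet> ((1/2 - 0) *\<^sub>R d)" ..
    have "c (s + 1/2) - c (s + 0) = (1/2) *\<^sub>R d" by (simp add: c_def algebra_simps)
    moreover have "c (s + 1/2) \<in> A" "c (s + 0) \<in> A" using s by (auto intro!: cA)
    ultimately have "\<mu> * (norm ((1/2) *\<^sub>R d))\<^sup>2 \<le> (Ha t z y p (c (s + 1/2)) - Ha t z y p (c (s + 0))) \<bullet> ((1/2) *\<^sub>R d)"
      using \<mu>(2)[rule_format, OF t, of "c (s + 1/2)" "c (s + 0)" z y p] by simp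
    also have "\<dots> = (?H (c (1/2 + 1/2)) - ?H (c (1/2 + 0))) - (?H (c (0 + 1/2)) - ?H (c (0 + 0)))"
      unfolding eq by (simp add: inner_diff_left)
    also have "\<dots> = ?H a1 + ?H a2 - 2 * ?H ((1/2) *\<^sub>R (a1 + a2))"
    proof -
      have "c (1/2 + 1/2) = a2" "c (1/2 + 0) = (1/2) *\<^sub>R (a1 + a2)" "c (0 + 1/2) = (1/2) *\<^sub>R (a1 + a2)" "c (0 + 0) = a1"
        by (simp_all add: c_def d_def vec_eq_iff field_simps)
      then show ?thesis by simp
    qed
    finally show "\<mu> / 4 * (norm (a1 - a2))\<^sup>2 \<le> ?H a1 + ?H a2 - 2 * ?H ((1/2) *\<^sub>R (a1 + a2))"
      by (simp add: d_def power_divide norm_minus_commute)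
  qed (use \<mu>(1) in simp)
qed

lemma L_mixed_difference:
  "\<exists>lH>0. \<forall>t1\<in>{t0..T}. \<forall>t2\<in>{t0..T}. \<forall>z1 y1 z2 y2. \<forall>a\<in>A. \<forall>a'\<in>A.
     \<bar>(L t1 z1 y1 a - L t1 z1 y1 a') - (L t2 z2 y2 a - L t2 z2 y2 a')\<bar>
     \<le> lH * (\<bar>t1 - t2\<bar> + norm (z1 - z2) + norm (y1 - y2)) * norm (a - a')"
proof -
  obtain lH where lH: "lH > 0" "\<forall>t1\<in>{t0..T}. \<forall>t2\<in>{t0..T}. \<forall>z1 y1 p1 z2 y2 p2. \<forall>a\<in>A. \<forall>a'\<in>A.
     \<bar>(hamiltonian f L t1 z1 y1 p1 a - hamiltonian f L t1 z1 y1 p1 a') -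
      (hamiltonian f L t2 z2 y2 p2 a - hamiltonian f L t2 z2 y2 p2 a')\<bar>
     \<le> lH * (\<bar>t1 - t2\<bar> + norm (z1 - z2) + norm (y1 - y2) + norm (p1 - p2)) * norm (a - a')"
    using hamiltonian_mixed_difference by (elim exE conjE)
  show ?thesis
  proof (intro exI[of _ lH] conjI ballI allI lH(1))
    fix t1 t2 z1 y1 z2 y2 a a'
    assume t: "t1 \<in> {t0..T}" "t2 \<in> {t0..T}" and a: "a \<in> A" "a' \<in> A"
    from lH(2)[rule_format, OF t a, of z1 y1 0 z2 y2 0]
    show "\<bar>(L t1 z1 y1 a - L t1 z1 y1 a') - (L t2 z2 y2 a - L t2 z2 y2 a')\<bar>
     \<le> lH * (\<bar>t1 - t2\<bar> + norm (z1 - z2) + norm (y1 - y2)) * norm (a - a')"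
      by (simp add: hamiltonian_def)
  qed
qed

lemma L_midpoint_convex:
  "\<exists>\<mu>>0. \<forall>t\<in>{t0..T}. \<forall>z y. \<forall>a1\<in>A. \<forall>a2\<in>A.
     \<mu> * (norm (a1 - a2))\<^sup>2 \<le> L t z y a1 + L t z y a2 - 2 * L t z y ((1/2) *\<^sub>R (a1 + a2))"
proof -
  obtain \<mu> where \<mu>: "\<mu> > 0" "\<forall>t\<in>{t0..T}. \<forall>z y p. \<forall>a1\<in>A. \<forall>a2\<in>A.
     \<mu> * (norm (a1 - a2))\<^sup>2 \<le> hamiltonian f L t z y p a1 + hamiltonian f L t z y p a2
        - 2 * hamiltonian f L t z y p ((1/2) *\<^sub>R (a1 + a2))"
    using hamiltonian_midpoint_convex by (elim exE conjE)
  show ?thesis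
  proof (intro exI[of _ \<mu>] conjI ballI allI \<mu>(1))
    fix t z y a1 a2 assume t: "t \<in> {t0..T}" and a: "a1 \<in> A" "a2 \<in> A"
    from \<mu>(2)[rule_format, OF t a, of z y 0]
    show "\<mu> * (norm (a1 - a2))\<^sup>2 \<le> L t z y a1 + L t z y a2 - 2 * L t z y ((1/2) *\<^sub>R (a1 + a2))"
      by (simp add: hamiltonian_def)
  qed
qed

text \<open>Both bounds on the Hamiltonian are uniform in the unbounded variable p, in which it is affine;
  letting p tend to infinity shows that f is affine in the control with a constant linear part.\<close>

lemma f_control_part:
  assumes t: "t1 \<in> {t0..T}" "t2 \<in> {t0..T}" and a: "a \<in> A" "a' \<in> A"
  shows "f t1 z1 y1 a - f t1 z1 y1 a' = f t2 z2 y2 a - f t2 z2 y2 a'"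
proof -
  obtain lH where lH: "lH > 0" "\<forall>t1\<in>{t0..T}. \<forall>t2\<in>{t0..T}. \<forall>z1 y1 p1 z2 y2 p2. \<forall>a\<in>A. \<forall>a'\<in>A.
     \<bar>(hamiltonian f L t1 z1 y1 p1 a - hamiltonian f L t1 z1 y1 p1 a') -
      (hamiltonian f L t2 z2 y2 p2 a - hamiltonian f L t2 z2 y2 p2 a')\<bar>
     \<le> lH * (\<bar>t1 - t2\<bar> + norm (z1 - z2) + norm (y1 - y2) + norm (p1 - p2)) * norm (a - a')"
    using hamiltonian_mixed_difference by (elim exE conjE)
  define v where "v = (f t1 z1 y1 a - f t1 z1 y1 a') - (f t2 z2 y2 a - f t2 z2 y2 a')"
  define l where "l = (L t1 z1 y1 a - L t1 z1 y1 a') - (L t2 z2 y2 a - L t2 z2 y2 a')"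
  define B where "B = lH * (\<bar>t1 - t2\<bar> + norm (z1 - z2) + norm (y1 - y2)) * norm (a - a')"
  \<comment> \<open>The test direction \<open>p = c *\<^sub>R v\<close> is the same at both points,
    so the bound \<open>B\<close> does not see it, while the left side is linear in
    \<open>c\<close>.\<close>
  have "c * (v \<bullet> v) + l \<le> B" for c
  proof -
    have "(hamiltonian f L t1 z1 y1 p a - hamiltonian f L t1 z1 y1 p a') -
      (hamiltonian f L t2 z2 y2 p a - hamiltonian f L t2 z2 y2 p a') = v \<bullet> p + l" for p
      unfolding hamiltonian_def v_def l_def by (simp add: inner_diff_left)
    from this[of "c *\<^sub>R v"]
    have "(hamiltonian f L t1 z1 y1 (c *\<^sub>R v) a - hamiltonian f L t1 z1 y1 (c *\<^sub>R v) a') -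
      (hamiltonian f L t2 z2 y2 (c *\<^sub>R v) a - hamiltonian f L t2 z2 y2 (c *\<^sub>R v) a') = c * (v \<bullet> v) + l" by simp
    moreover have "(hamiltonian f L t1 z1 y1 (c *\<^sub>R v) a - hamiltonian f L t1 z1 y1 (c *\<^sub>R v) a') -
      (hamiltonian f L t2 z2 y2 (c *\<^sub>R v) a - hamiltonian f L t2 z2 y2 (c *\<^sub>R v) a') \<le> B"
      using lH(2)[rule_format, OF t a, of z1 y1 "c *\<^sub>R v" z2 y2 "c *\<^sub>R v"] unfolding B_def by simp
    ultimately show ?thesis by simp
  qed
  then have "v \<bullet> v \<le> 0" by (rule unbounded_affine_imp_nonpos)
  then have "v = 0" by (metis inner_eq_zero_iff inner_ge_zero order_antisym)
  then show ?thesis by (simp add: v_def)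
qed

lemma f_midpoint:
  assumes t: "t \<in> {t0..T}" and a: "a1 \<in> A" "a2 \<in> A"
  shows "2 *\<^sub>R f t z y ((1/2) *\<^sub>R (a1 + a2)) = f t z y a1 + f t z y a2"
proof -
  obtain \<mu> where \<mu>: "\<mu> > 0" "\<forall>t\<in>{t0..T}. \<forall>z y p. \<forall>a1\<in>A. \<forall>a2\<in>A.
     \<mu> * (norm (a1 - a2))\<^sup>2 \<le> hamiltonian f L t z y p a1 + hamiltonian f L t z y p a2
        - 2 * hamiltonian f L t z y p ((1/2) *\<^sub>R (a1 + a2))"
    using hamiltonian_midpoint_convex by (elim exE conjE)
  define v where "v = 2 *\<^sub>R f t z y ((1/2) *\<^sub>R (a1 + a2)) - f t z y a1 - f t z y a2"
  define l where "l = L t z y a1 + L t z y a2 - 2 * L t z y ((1/2) *\<^sub>R (a1 + a2))"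
  \<comment> \<open>Midpoint convexity bounds \<open>v \<bullet> p\<close> above by \<open>l\<close>
    for every \<open>p\<close>; along \<open>p = c *\<^sub>R v\<close> this forces
    \<open>v = 0\<close>.\<close>
  have "c * (v \<bullet> v) + 0 \<le> l" for c
  proof -
    have "0 \<le> \<mu> * (norm (a1 - a2))\<^sup>2" using \<mu>(1) by simp
    also have "\<dots> \<le> hamiltonian f L t z y (c *\<^sub>R v) a1 + hamiltonian f L t z y (c *\<^sub>R v) a2
        - 2 * hamiltonian f L t z y (c *\<^sub>R v) ((1/2) *\<^sub>R (a1 + a2))"
      by (rule \<mu>(2)[rule_format, OF t a])
    also have "\<dots> = l - v \<bullet> (c *\<^sub>R v)"
    proof -
      have "hamiltonian f L t z y p a1 + hamiltonian f L t z y p a2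
        - 2 * hamiltonian f L t z y p ((1/2) *\<^sub>R (a1 + a2)) = l - v \<bullet> p" for p
        unfolding hamiltonian_def l_def v_def by (simp add: inner_diff_left)
      then show ?thesis .
    qed
    finally show ?thesis by simp
  qed
  then have "v \<bullet> v \<le> 0" by (rule unbounded_affine_imp_nonpos)
  then have "v = 0" by (metis inner_eq_zero_iff inner_ge_zero order_antisym)
  then show ?thesis by (simp add: v_def algebra_simps)
qed

lemma C1_lipschitz_on_ball:
  fixes F :: "real \<Rightarrow> real ^ 'n \<Rightarrow> real ^ 'n \<Rightarrow> real ^ 'm \<Rightarrow> 'e::euclidean_space"
  assumes "C1_on (\<lambda>(t, z, y, a). F t z y a) ({t0..T} \<times> UNIV \<times> UNIV \<times> A)"
  shows "\<exists>C\<ge>1. \<forall>t\<in>{t0..T}. \<forall>t'\<in>{t0..T}. \<forall>a\<in>A. \<forall>a'\<in>A. \<forall>z\<in>cball 0 R. \<forall>z'\<in>cball 0 R. \<forall>y\<in>cball 0 R. \<forall>y'\<in>cball 0 R.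
     norm (F t z y a - F t' z' y' a') \<le> C * (\<bar>t - t'\<bar> + norm (z - z') + norm (y - y') + norm (a - a'))"
proof -
  let ?K = "{t0..T} \<times> cball (0::real ^ 'n) R \<times> cball (0::real ^ 'n) R \<times> A"
  have "compact ?K" "convex ?K" "?K \<subseteq> {t0..T} \<times> UNIV \<times> UNIV \<times> A"
    by (auto intro!: compact_Times convex_Times A_compact A_convex)
  from C1_on_imp_lipschitz[OF assms this] obtain C where C: "C > 0"
    "\<forall>p\<in>?K. \<forall>q\<in>?K. norm ((\<lambda>(t, z, y, a). F t z y a) p - (\<lambda>(t, z, y, a). F t z y a) q) \<le> C * norm (p - q)"
    by blast
  show ?thesis
  proof (intro exI[of _ "max 1 C"] conjI ballI)
    fix t t' a a' and z z' y y' :: "real ^ 'n"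
    assume a: "t \<in> {t0..T}" "t' \<in> {t0..T}" "a \<in> A" "a' \<in> A" "z \<in> cball 0 R" "z' \<in> cball 0 R" "y \<in> cball 0 R" "y' \<in> cball 0 R"
    have "norm (F t z y a - F t' z' y' a') \<le> C * norm ((t, z, y, a) - (t', z', y', a'))"
      using bspec[OF bspec[OF C(2), of "(t, z, y, a)"], of "(t', z', y', a')"] a by simp
    also have "norm ((t, z, y, a) - (t', z', y', a')) = norm (t - t', z - z', y - y', a - a')" by simp
    also have "\<dots> \<le> norm (t - t') + (norm (z - z') + (norm (y - y') + norm (a - a')))"
      by (intro order_trans[OF norm_Pair_le] add_left_mono order.refl)
    finally have "norm (F t z y a - F t' z' y' a') \<le> C * (norm (t - t') + (norm (z - z') + (norm (y - y') + norm (a - a'))))"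
      using C(1) by simp
    also have "\<dots> \<le> max 1 C * (\<bar>t - t'\<bar> + norm (z - z') + norm (y - y') + norm (a - a'))"
      by (simp add: add.assoc) (intro mult_right_mono, auto)
    finally show "norm (F t z y a - F t' z' y' a') \<le> max 1 C * (\<bar>t - t'\<bar> + norm (z - z') + norm (y - y') + norm (a - a'))" .
  qed simp
qed

end

section \<open>Stability of trajectories in the L1 norm\<close>

context delay_control_problem
begin

lemma dtime_in_range: "u \<in> {a..T} \<Longrightarrow> t0 \<le> a \<Longrightarrow> dtime x u \<in> {a - b..T}"
  using dtime_bounds[of u x] by auto

definition "tR R = (SOME l. 1 \<le> l \<and> (\<forall>t\<in>{t0..T}. \<forall>t'\<in>{t0..T}. \<forall>z\<in>cball 0 R. \<forall>z'\<in>cball 0 R.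
      \<bar>\<tau> t z - \<tau> t' z'\<bar> \<le> l * (\<bar>t - t'\<bar> + norm (z - z'))))"

lemma tR:
  assumes "0 \<le> R"
  shows "1 \<le> tR R"
    and "\<lbrakk>t \<in> {t0..T}; t' \<in> {t0..T}; norm z \<le> R; norm z' \<le> R\<rbrakk> \<Longrightarrow>
      \<bar>\<tau> t z - \<tau> t' z'\<bar> \<le> tR R * (\<bar>t - t'\<bar> + norm (z - z'))"
proof -
  have "\<exists>l. 1 \<le> l \<and> (\<forall>t\<in>{t0..T}. \<forall>t'\<in>{t0..T}. \<forall>z\<in>cball 0 R. \<forall>z'\<in>cball 0 R.
      \<bar>\<tau> t z - \<tau> t' z'\<bar> \<le> l * (\<bar>t - t'\<bar> + norm (z - z')))"
    by (rule delay_lipschitz_local[OF assms]) (intro exI conjI ballI; simp)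
  note D = someI_ex[OF this, folded tR_def]
  show "1 \<le> tR R" by (rule D[THEN conjunct1])
  show "\<bar>\<tau> t z - \<tau> t' z'\<bar> \<le> tR R * (\<bar>t - t'\<bar> + norm (z - z'))"
    if "t \<in> {t0..T}" "t' \<in> {t0..T}" "norm z \<le> R" "norm z' \<le> R"
    using D[THEN conjunct2, rule_format, OF that(1,2)] that(3,4) by simp
qed

definition "dL R M = 1 + tR R * (1 + M)"

lemma dtime_lipschitz:
  assumes a: "t0 \<le> a" and x: "M-lipschitz_on {a..T} x" and R: "\<And>s. s \<in> {a..T} \<Longrightarrow> norm (x s) \<le> R" and "0 \<le> R"
  shows "(dL R M)-lipschitz_on {a..T} (dtime x)"
proof (rule lipschitz_onI)
  have M: "0 \<le> M" using x by (rule lipschitz_on_nonneg)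
  then show "0 \<le> dL R M" using tR(1)[OF \<open>0 \<le> R\<close>] by (simp add: dL_def)
  fix s u assume s: "s \<in> {a..T}" "u \<in> {a..T}"
  have "\<bar>\<tau> s (x s) - \<tau> u (x u)\<bar> \<le> tR R * (\<bar>s - u\<bar> + norm (x s - x u))"
    using s a by (intro tR(2)[OF \<open>0 \<le> R\<close>] R) auto
  also have "\<dots> \<le> tR R * (\<bar>s - u\<bar> + M * \<bar>s - u\<bar>)"
    using lipschitz_onD[OF x s] tR(1)[OF \<open>0 \<le> R\<close>] by (intro mult_left_mono add_left_mono) (auto simp: dist_norm)
  finally have "\<bar>\<tau> s (x s) - \<tau> u (x u)\<bar> \<le> tR R * (1 + M) * \<bar>s - u\<bar>" by (simp add: algebra_simps)
  then show "dist (dtime x s) (dtime x u) \<le> dL R M * dist s u"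
    unfolding dtime_def dist_real_def dL_def by (simp add: algebra_simps)
qed

lemma delayed_lipschitz:
  assumes a: "t0 \<le> a" and x: "M-lipschitz_on {a - b..T} x" and R: "\<And>s. s \<in> {a..T} \<Longrightarrow> norm (x s) \<le> R" and "0 \<le> R"
  shows "(M * dL R M)-lipschitz_on {a..T} (delayed x)"
  unfolding delayed_eq[abs_def]
proof (rule lipschitz_on_compose2[where f = "dtime x" and g = x])
  have "M-lipschitz_on {a..T} x" using max_delay_pos by (intro lipschitz_on_subset[OF x]) auto
  then show "(dL R M)-lipschitz_on {a..T} (dtime x)" by (intro dtime_lipschitz a R \<open>0 \<le> R\<close>)
  show "M-lipschitz_on (dtime x ` {a..T}) x"
    by (rule lipschitz_on_subset[OF x]) (use dtime_in_range[OF _ a] in blast)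
qed

text \<open>In the rate of the L1 estimate, \<open>1 + K * tL\<close> stems from the state, directly
  and through the shift of the delayed time, and \<open>1 / d\<close> from the delayed states
  compared at equal times. The exponent of \<open>lC\<close> doubles the rate, as
  \<open>exponential_gronwall\<close> asks.\<close>

definition "c1 K d = fL * (1 + K * tL + 1 / d)"
definition "lC K d = 2 * exp (2 * c1 K d * (T - t0))"

text \<open>Integrated delayed errors become integrated errors, at the price \<open>1 / d\<close>,
  because the delayed time of \<open>x2\<close> expands. Gronwall is therefore applied to the
  primitive \<open>Y\<close> of \<open>norm (e u)\<close>, with the primitive of
  \<open>norm (E u)\<close> as perturbation. The gain over \<open>stability\<close> is that only the
  integral of \<open>norm (E u)\<close> enters, which is much smaller than its supremum when
  \<open>E\<close> has short support.\<close>

lemma stability_L1: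
  assumes a: "a \<in> {t0..T}" and x1: "K-lipschitz_on {a - b..T} x1" and x2: "K-lipschitz_on {a - b..T} x2"
      and hist: "\<And>s. s \<in> {a - b..a} \<Longrightarrow> x2 s = x1 s"
      and E: "E a = 0" "KE-lipschitz_on {a..T} E"
      and N: "negligible N" and \<alpha>: "\<And>u. u \<in> {a<..<T} - N \<Longrightarrow> \<alpha> u \<in> A"
      and d1: "\<And>u. u \<in> {a<..<T} - N \<Longrightarrow> (x1 has_vector_derivative f u (x1 u) (delayed x1 u) (\<alpha> u)) (at u)"
      and d2: "\<And>u. u \<in> {a<..<T} - N \<Longrightarrow> ((\<lambda>s. x2 s - E s) has_vector_derivative f u (x2 u) (delayed x2 u) (\<alpha> u)) (at u)"
      and \<sigma>: "Ks-lipschitz_on {a..T} (dtime x2)" "0 < d"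
      and expd: "\<And>u. u \<in> {a<..<T} - N \<Longrightarrow> \<exists>D\<ge>d. (dtime x2 has_real_derivative D) (at u)"
  shows "integral {a - b..T} (\<lambda>u. norm (x2 u - x1 u)) \<le> lC K d * integral {a..T} (\<lambda>u. norm (E u))"
    and "norm (x2 T - x1 T) \<le> norm (E T) + c1 K d * lC K d * integral {a..T} (\<lambda>u. norm (E u))"
    and "integral {a..T} (\<lambda>u. norm (x2 (dtime x2 u) - x1 (dtime x2 u))) \<le> (1 / d) * (lC K d * integral {a..T} (\<lambda>u. norm (E u)))"
proof -
  have b: "0 < b" by (rule max_delay_pos)
  have K0: "0 \<le> K" using x1 by (rule lipschitz_on_nonneg)
  have aT: "a \<le> T" "t0 \<le> a" using a by auto
  define e where "e = (\<lambda>s. x2 s - x1 s)"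
  define Y where "Y = (\<lambda>s. integral {a..s} (\<lambda>u. norm (e u)))"
  define EE where "EE = (\<lambda>s. integral {a..s} (\<lambda>u. norm (E u)))"
  define C where "C = c1 K d"
  have C: "0 < C" using fL(1) tL(1) K0 \<open>0 < d\<close> unfolding C_def c1_def
    by (intro mult_pos_pos add_pos_pos add_pos_nonneg) auto
  have le: "(K + K)-lipschitz_on {a - b..T} e"
    unfolding e_def by (intro lipschitz_on_diff x2 x1)
  have ce: "continuous_on {a - b..T} e" using le by (rule lipschitz_on_continuous_on)
  have ce': "continuous_on {a..T} e" using b by (intro continuous_on_subset[OF ce]) auto
  have cE: "continuous_on {a..T} E" using E(2) by (rule lipschitz_on_continuous_on)
  have c\<sigma>: "continuous_on {a..T} (dtime x2)" using \<sigma>(1) by (rule lipschitz_on_continuous_on)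
  have range: "dtime x2 ` {a..T} \<subseteq> {a - b..T}" using dtime_in_range[OF _ aT(2)] by blast
  have ce\<sigma>: "continuous_on {a..T} (\<lambda>u. e (dtime x2 u))" by (rule continuous_on_compose2[OF ce c\<sigma> range])
  have e0: "e s = 0" if "s \<in> {a - b..a}" for s using hist[OF that] by (simp add: e_def)
  have int_hist: "integral {a - b..s} (\<lambda>u. norm (e u)) = Y s" if s: "s \<in> {a..T}" for s
  proof -
    have "integral {a - b..a} (\<lambda>u. norm (e u)) + integral {a..s} (\<lambda>u. norm (e u)) = integral {a - b..s} (\<lambda>u. norm (e u))"
      using s b by (intro Henstock_Kurzweil_Integration.integral_combine integrable_continuous_real continuous_intros continuous_on_subset[OF ce]) auto
    moreover have "integral {a - b..a} (\<lambda>u. norm (e u)) = integral {a - b..a} (\<lambda>u. 0)"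
      by (rule integral_cong) (use e0 in simp)
    ultimately show ?thesis by (simp add: Y_def)
  qed
  have delay_int: "integral {a..s} (\<lambda>u. norm (e (dtime x2 u))) \<le> (1 / d) * Y s" if s: "s \<in> {a..T}" for s
  proof -
    have "d * integral {a..s} (\<lambda>u. norm (e (dtime x2 u))) \<le> integral {a - b..s} (\<lambda>u. norm (e u))"
    proof (rule integral_comp_expanding_le[where N = N])
      show "Ks-lipschitz_on {a..s} (dtime x2)" using s by (intro lipschitz_on_subset[OF \<sigma>(1)]) auto
      show "\<exists>D\<ge>d. (dtime x2 has_real_derivative D) (at u)" if "u \<in> {a<..<s} - N" for u
        using expd[of u] that s by auto
      show "dtime x2 ` {a..s} \<subseteq> {a - b..s}"
      proof (rule image_subsetI)
        fix u assume "u \<in> {a..s}"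
        then show "dtime x2 u \<in> {a - b..s}" using dtime_bounds[of u x2] s aT by auto
      qed
      show "continuous_on {a - b..s} (\<lambda>u. norm (e u))"
        using s by (intro continuous_intros continuous_on_subset[OF ce]) auto
    qed (use s N \<open>0 < d\<close> in auto)
    then show ?thesis using int_hist[OF s] \<open>0 < d\<close> by (simp add: field_simps)
  qed
  have eE: "norm (e s - E s) \<le> C * Y s" if s: "s \<in> {a..T}" for s
  proof -
    define \<phi> where "\<phi> = (\<lambda>u. fL * (norm (e u) + (norm (e (dtime x2 u)) + K * tL * norm (e u))))"
    have "norm ((e s - E s) - (e a - E a)) \<le> integral {a..s} \<phi>"
    proof (rule lipschitz_ae_integral_bound[OF _ _ N])
      show "((K + K) + KE)-lipschitz_on {a..s} (\<lambda>s. e s - E s)"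
        using s b by (intro lipschitz_on_diff lipschitz_on_subset[OF le] lipschitz_on_subset[OF E(2)]) auto
      show "continuous_on {a..s} \<phi>" unfolding \<phi>_def
        using s by (intro continuous_intros continuous_on_subset[OF ce'] continuous_on_subset[OF ce\<sigma>]) auto
      fix u assume u: "u \<in> {a<..<s} - N"
      then have u': "u \<in> {a<..<T} - N" "u \<in> {a..T}" "u \<in> {t0..T}" using s aT by auto
      have "((\<lambda>s. (x2 s - E s) - x1 s) has_vector_derivative
            (f u (x2 u) (delayed x2 u) (\<alpha> u) - f u (x1 u) (delayed x1 u) (\<alpha> u))) (at u)"
        by (intro has_vector_derivative_diff d1 d2 u')
      moreover have "(\<lambda>s. (x2 s - E s) - x1 s) = (\<lambda>s. e s - E s)" by (simp add: e_def fun_eq_iff)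
      moreover have "norm (f u (x2 u) (delayed x2 u) (\<alpha> u) - f u (x1 u) (delayed x1 u) (\<alpha> u)) \<le> \<phi> u"
      proof -
        have "norm (delayed x2 u - delayed x1 u) \<le> norm (e (dtime x2 u)) + K * tL * norm (e u)"
          using delayed_diff[OF x1 u'(2) aT(2), of x2] by (simp add: e_def)
        then have "fL * (norm (x2 u - x1 u) + norm (delayed x2 u - delayed x1 u)) \<le> \<phi> u"
          unfolding \<phi>_def using fL(1) by (intro mult_left_mono add_mono) (auto simp: e_def)
        then show ?thesis using fL(2)[OF u'(3) \<alpha>[OF u'(1)], of "x2 u" "delayed x2 u" "x1 u" "delayed x1 u"] by linarith
      qed
      ultimately show "\<exists>D. ((\<lambda>s. e s - E s) has_vector_derivative D) (at u) \<and> norm D \<le> \<phi> u" by auto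
    qed (use s in auto)
    also have "integral {a..s} \<phi> = fL * ((1 + K * tL) * Y s + integral {a..s} (\<lambda>u. norm (e (dtime x2 u))))"
    proof -
      have i: "(\<lambda>u. norm (e u)) integrable_on {a..s}" "(\<lambda>u. norm (e (dtime x2 u))) integrable_on {a..s}"
        using s by (auto intro!: integrable_continuous_real continuous_intros continuous_on_subset[OF ce'] continuous_on_subset[OF ce\<sigma>])
      have "\<phi> = (\<lambda>u. fL * ((1 + K * tL) * norm (e u) + norm (e (dtime x2 u))))" by (simp add: \<phi>_def fun_eq_iff algebra_simps)
      then have "integral {a..s} \<phi> = fL * integral {a..s} (\<lambda>u. (1 + K * tL) * norm (e u) + norm (e (dtime x2 u)))"
        by (simp only: integral_mult_right)
      also have "integral {a..s} (\<lambda>u. (1 + K * tL) * norm (e u) + norm (e (dtime x2 u))) =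
          integral {a..s} (\<lambda>u. (1 + K * tL) * norm (e u)) + integral {a..s} (\<lambda>u. norm (e (dtime x2 u)))"
        by (intro Henstock_Kurzweil_Integration.integral_add i integrable_on_mult_right)
      finally show ?thesis by (simp only: integral_mult_right Y_def)
    qed
    also have "\<dots> \<le> fL * ((1 + K * tL) * Y s + (1 / d) * Y s)"
      using delay_int[OF s] fL(1) by (intro mult_left_mono add_left_mono) auto
    also have "\<dots> = C * Y s" by (simp only: C_def c1_def) (simp add: algebra_simps)
    finally show ?thesis using e0[of a] E(1) b by simp
  qed
  obtain Be where Be: "\<And>s. s \<in> {a..T} \<Longrightarrow> norm (norm (e s)) \<le> Be" "0 \<le> Be"
    using continuous_on_Icc_bounded[OF continuous_on_norm[OF ce']] by blast
  obtain BE where BE: "\<And>s. s \<in> {a..T} \<Longrightarrow> norm (norm (E s)) \<le> BE" "0 \<le> BE"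
    using continuous_on_Icc_bounded[OF continuous_on_norm[OF cE]] by blast
  have lY: "Be-lipschitz_on {a..T} Y" unfolding Y_def
    by (rule continuous_indefinite_integral_lipschitz[OF continuous_on_norm[OF ce'] Be])
  have lEE: "BE-lipschitz_on {a..T} EE" unfolding EE_def
    by (rule continuous_indefinite_integral_lipschitz[OF continuous_on_norm[OF cE] BE])
  have EE_le: "norm (EE s) \<le> EE T" if "s \<in> {a..T}" for s
  proof -
    have "EE s \<le> EE T" unfolding EE_def
      using that by (intro integral_subset_le integrable_continuous_real continuous_on_norm continuous_on_subset[OF cE]) auto
    moreover have "0 \<le> EE s" unfolding EE_def
      using that by (intro integral_nonneg integrable_continuous_real continuous_on_norm continuous_on_subset[OF cE]) auto
    ultimately show ?thesis by simp
  qed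
  have EET: "0 \<le> EE T" using EE_le[of T] aT by (auto intro: order_trans[OF norm_ge_zero])
  have "norm (Y T) \<le> 2 * (EE T + 0 + 0 * (T - a)) * exp (2 * C * (T - a))"
  proof (rule exponential_gronwall[where e = Y and E = EE, OF aT(1) _ _ _ _ negligible_empty])
    show "(Be + BE)-lipschitz_on {a..T} (\<lambda>s. Y s - EE s)" by (intro lipschitz_on_diff lY lEE)
    fix u assume "u \<in> {a<..<T} - {}"
    then have u: "u \<in> {a<..<T}" "u \<in> {a..T}" by auto
    have "((\<lambda>s. Y s - EE s) has_vector_derivative norm (e u) - norm (E u)) (at u)"
      unfolding Y_def EE_def
      by (intro has_vector_derivative_diff integral_has_vector_derivative_interior[OF continuous_on_norm[OF ce'] u(1)]
            integral_has_vector_derivative_interior[OF continuous_on_norm[OF cE] u(1)])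
    moreover have "norm (norm (e u) - norm (E u)) \<le> 2 * C / 2 * M * exp (2 * C * (u - a)) + 0"
      if M: "0 \<le> M" "\<forall>v\<in>{a..u}. norm (Y v) \<le> M * exp (2 * C * (v - a))" for M
    proof -
      have "norm (norm (e u) - norm (E u)) \<le> norm (e u - E u)" using norm_triangle_ineq3 by simp
      also have "\<dots> \<le> C * Y u" by (rule eE[OF u(2)])
      also have "\<dots> \<le> C * (M * exp (2 * C * (u - a)))"
        using bspec[OF M(2), of u] u C by (intro mult_left_mono) auto
      finally show ?thesis by (simp add: mult.assoc)
    qed
    ultimately show "\<exists>D. ((\<lambda>s. Y s - EE s) has_vector_derivative D) (at u) \<and>
         (\<forall>M\<ge>0. (\<forall>v\<in>{a..u}. norm (Y v) \<le> M * exp (2 * C * (v - a))) \<longrightarrow>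
            norm D \<le> 2 * C / 2 * M * exp (2 * C * (u - a)) + 0)"
      by (intro exI[of _ "norm (e u) - norm (E u)"]) auto
  qed (use C EE_le aT lipschitz_on_continuous_on[OF lY] in \<open>auto simp: Y_def EE_def\<close>)
  also have "\<dots> \<le> 2 * EE T * exp (2 * C * (T - t0))"
  proof -
    have "exp (2 * C * (T - a)) \<le> exp (2 * C * (T - t0))" using C aT by simp
    then show ?thesis using mult_left_mono[of _ _ "2 * EE T"] EET by simp
  qed
  finally have YT: "Y T \<le> lC K d * EE T" by (simp add: lC_def C_def mult_ac)
  show "integral {a - b..T} (\<lambda>u. norm (x2 u - x1 u)) \<le> lC K d * integral {a..T} (\<lambda>u. norm (E u))"
    using int_hist[of T] aT YT by (simp add: e_def EE_def)
  have "norm (e T) \<le> norm (E T) + C * Y T" using eE[of T] aT norm_triangle_ineq2[of "e T" "E T"] by simp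
  also have "\<dots> \<le> norm (E T) + C * (lC K d * EE T)" using YT C by simp
  finally show "norm (x2 T - x1 T) \<le> norm (E T) + c1 K d * lC K d * integral {a..T} (\<lambda>u. norm (E u))"
    by (simp add: e_def EE_def C_def mult_ac)
  have "integral {a..T} (\<lambda>u. norm (e (dtime x2 u))) \<le> (1 / d) * Y T" using delay_int[of T] aT by simp
  also have "\<dots> \<le> (1 / d) * (lC K d * EE T)" using YT \<open>0 < d\<close> by (intro mult_left_mono) auto
  finally show "integral {a..T} (\<lambda>u. norm (x2 (dtime x2 u) - x1 (dtime x2 u))) \<le> (1 / d) * (lC K d * integral {a..T} (\<lambda>u. norm (E u)))"
    by (simp add: e_def EE_def)
qed

end

section \<open>Lipschitz continuity of optimal controls\<close>

text \<open>The primitive of \<open>\<gamma>\<close> cut off to \<open>{p..q}\<close>, constant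
  outside; clamping the upper limit makes it Lipschitz on the whole line for continuous
  \<open>\<gamma>\<close>.\<close>

definition clip_integral :: "real \<Rightarrow> real \<Rightarrow> (real \<Rightarrow> 'a::euclidean_space) \<Rightarrow> real \<Rightarrow> 'a" where
  "clip_integral p q \<gamma> s = integral {p..max p (min q s)} \<gamma>"

lemma clip_integral:
  fixes \<gamma> :: "real \<Rightarrow> 'a::euclidean_space"
  assumes cont: "continuous_on {p..q} \<gamma>" and "p < q"
  shows "\<exists>B. B-lipschitz_on UNIV (clip_integral p q \<gamma>)"
    and "s \<notin> {p, q} \<Longrightarrow> (clip_integral p q \<gamma> has_vector_derivative (if s \<in> {p<..<q} then \<gamma> s else 0)) (at s)"
    and "norm (clip_integral p q \<gamma> s) \<le> integral {p..q} (\<lambda>u. norm (\<gamma> u))"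
    and "s \<le> p \<Longrightarrow> clip_integral p q \<gamma> s = 0"
    and "q \<le> s \<Longrightarrow> clip_integral p q \<gamma> s = integral {p..q} \<gamma>"
proof -
  obtain B where B: "\<And>s. s \<in> {p..q} \<Longrightarrow> norm (\<gamma> s) \<le> B" "0 \<le> B"
    using continuous_on_Icc_bounded[OF cont] by blast
  have lip: "B-lipschitz_on {p..q} (\<lambda>s. integral {p..s} \<gamma>)"
    by (rule continuous_indefinite_integral_lipschitz[OF cont B])
  have "B-lipschitz_on UNIV (clip_integral p q \<gamma>)"
  proof (rule lipschitz_onI[OF _ B(2)])
    fix s u :: real
    have "dist (clip_integral p q \<gamma> s) (clip_integral p q \<gamma> u) \<le> B * dist (max p (min q s)) (max p (min q u))"
      unfolding clip_integral_def using \<open>p < q\<close> by (intro lipschitz_onD[OF lip]) auto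
    also have "\<dots> \<le> B * dist s u"
      using B(2) by (intro mult_left_mono) (auto simp: dist_real_def)
    finally show "dist (clip_integral p q \<gamma> s) (clip_integral p q \<gamma> u) \<le> B * dist s u" .
  qed
  then show "\<exists>B. B-lipschitz_on UNIV (clip_integral p q \<gamma>)" by blast
  show left: "clip_integral p q \<gamma> s = 0" if "s \<le> p" for s
    using that \<open>p < q\<close> by (simp add: clip_integral_def)
  show right: "clip_integral p q \<gamma> s = integral {p..q} \<gamma>" if "q \<le> s" for s
    using that \<open>p < q\<close> by (simp add: clip_integral_def)
  show "norm (clip_integral p q \<gamma> s) \<le> integral {p..q} (\<lambda>u. norm (\<gamma> u))"
  proof -
    let ?m = "max p (min q s)"
    have m: "p \<le> ?m" "?m \<le> q" using \<open>p < q\<close> by auto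
    have "norm (integral {p..?m} \<gamma>) \<le> integral {p..?m} (\<lambda>u. norm (\<gamma> u))"
      using m by (intro integral_norm_bound_integral integrable_continuous_real continuous_on_norm continuous_on_subset[OF cont]) auto
    also have "\<dots> \<le> integral {p..q} (\<lambda>u. norm (\<gamma> u))"
      using m by (intro integral_subset_le integrable_continuous_real continuous_on_norm continuous_on_subset[OF cont]) auto
    finally show ?thesis by (simp add: clip_integral_def)
  qed
  assume s: "s \<notin> {p, q}"
  consider "s < p" | "s \<in> {p<..<q}" | "q < s" using s by fastforce
  then show "(clip_integral p q \<gamma> has_vector_derivative (if s \<in> {p<..<q} then \<gamma> s else 0)) (at s)"
  proof cases
    case 1
    have "((\<lambda>_. 0) has_vector_derivative 0) (at s)" by simp
    then have "(clip_integral p q \<gamma> has_vector_derivative 0) (at s)"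
      by (rule has_vector_derivative_transform_within_open[of _ _ _ "{..<p}"]) (use 1 left in auto)
    then show ?thesis using 1 by simp
  next
    case 2
    have "(clip_integral p q \<gamma> has_vector_derivative \<gamma> s) (at s)"
      by (rule has_vector_derivative_transform_within_open[OF integral_has_vector_derivative_interior[OF cont 2], of "{p<..<q}"])
         (use 2 in \<open>auto simp: clip_integral_def\<close>)
    then show ?thesis using 2 by simp
  next
    case 3
    have "((\<lambda>_. integral {p..q} \<gamma>) has_vector_derivative 0) (at s)" by simp
    then have "(clip_integral p q \<gamma> has_vector_derivative 0) (at s)"
      by (rule has_vector_derivative_transform_within_open[of _ _ _ "{q<..}"]) (use 3 right in auto)
    then show ?thesis using 3 by simp
  qed
qed

lemma integral_if_in:
  fixes h :: "real \<Rightarrow> 'a::euclidean_space"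
  assumes "S \<subseteq> T"
  shows "integral T (\<lambda>u. if u \<in> S then h u else 0) = integral S h"
    and "h integrable_on S \<Longrightarrow> (\<lambda>u. if u \<in> S then h u else 0) integrable_on T"
  using assms by (simp_all only: Henstock_Kurzweil_Integration.integral_restrict_Int
      Henstock_Kurzweil_Integration.integrable_restrict_Int inf_absorb1)

lemma has_vector_derivative_shift:
  assumes "(h has_vector_derivative D) (at (u - d))"
  shows "((\<lambda>s. h (s - d)) has_vector_derivative D) (at (u::real))"
proof -
  have "((\<lambda>s. s - d) has_vector_derivative 1) (at u)" by (auto intro!: derivative_eq_intros)
  from vector_diff_chain_at[OF this] assms show ?thesis by (simp add: o_def)
qed

context smooth_delay_control_problem
begin

lemma continuous_on_along:
  fixes F :: "real \<Rightarrow> real ^ 'n \<Rightarrow> real ^ 'n \<Rightarrow> real ^ 'm \<Rightarrow> 'e::topological_space"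
  assumes cont: "continuous_on ({t0..T} \<times> UNIV \<times> UNIV \<times> A) (\<lambda>(t, z, y, a). F t z y a)"
    and "S \<subseteq> {t0..T}" "continuous_on S x" "continuous_on S y" "continuous_on S a" "\<And>s. s \<in> S \<Longrightarrow> a s \<in> A"
  shows "continuous_on S (\<lambda>s. F s (x s) (y s) (a s))"
proof -
  have "continuous_on S (\<lambda>s. (s, x s, y s, a s))" using assms by (intro continuous_intros)
  moreover have "(\<lambda>s. (s, x s, y s, a s)) ` S \<subseteq> {t0..T} \<times> UNIV \<times> UNIV \<times> A" using assms by auto
  ultimately show ?thesis using continuous_on_compose2[OF cont] by fastforce
qed

text \<open>The control part of \<open>f\<close> is the same at all times and states, so it may be
  evaluated at \<open>t0\<close> and zero states: averaging two controls changes the velocity by a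
  vector that does not involve the state.\<close>

lemma f_mid_eq:
  assumes "t \<in> {t0..T}" "a1 \<in> A" "a2 \<in> A"
  shows "f t z y ((1/2) *\<^sub>R (a1 + a2)) = f t z y a1 + (1/2) *\<^sub>R (f t0 0 0 a2 - f t0 0 0 a1)"
proof -
  have "f t z y a2 - f t z y a1 = f t0 0 0 a2 - f t0 0 0 a1"
    using assms time_interval by (intro f_control_part) auto
  moreover have "f t z y ((1/2) *\<^sub>R (a1 + a2)) = (1/2) *\<^sub>R (f t z y a1 + f t z y a2)"
    using arg_cong[OF f_midpoint[OF assms, of z y], of "\<lambda>v. (1/2) *\<^sub>R v"] by simp
  moreover have "(1/2) *\<^sub>R (u + v) = u + (1/2) *\<^sub>R (v - u)" for u v :: "real ^ 'n"
    by (simp add: vec_eq_iff field_simps)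
  ultimately show ?thesis by metis
qed

text \<open>The replacement at the second point is transferred to the first, where strong convexity
  yields the gain. The transfer costs \<open>lH\<close> times the distance of the two points times
  \<open>norm (a2 - a1) / 2\<close>, the distance of \<open>a2\<close> from the midpoint.\<close>

lemma exchange_cost_decrease:
  assumes lH: "0 \<le> lH" "\<forall>t1\<in>{t0..T}. \<forall>t2\<in>{t0..T}. \<forall>z1 y1 z2 y2. \<forall>a\<in>A. \<forall>a'\<in>A.
     \<bar>(L t1 z1 y1 a - L t1 z1 y1 a') - (L t2 z2 y2 a - L t2 z2 y2 a')\<bar>
     \<le> lH * (\<bar>t1 - t2\<bar> + norm (z1 - z2) + norm (y1 - y2)) * norm (a - a')"
    and \<mu>: "\<forall>t\<in>{t0..T}. \<forall>z y. \<forall>a1\<in>A. \<forall>a2\<in>A.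
     \<mu> * (norm (a1 - a2))\<^sup>2 \<le> L t z y a1 + L t z y a2 - 2 * L t z y ((1/2) *\<^sub>R (a1 + a2))"
    and t: "t1 \<in> {t0..T}" "t2 \<in> {t0..T}" and a: "a1 \<in> A" "a2 \<in> A"
    and q: "\<bar>t1 - t2\<bar> + norm (z1 - z2) + norm (y1 - y2) \<le> B"
  shows "(L t1 z1 y1 ((1/2) *\<^sub>R (a1 + a2)) - L t1 z1 y1 a1) + (L t2 z2 y2 ((1/2) *\<^sub>R (a1 + a2)) - L t2 z2 y2 a2)
    \<le> lH / 2 * B * norm (a2 - a1) - \<mu> * (norm (a2 - a1))\<^sup>2"
proof -
  let ?m = "(1/2) *\<^sub>R (a1 + a2)"
  have m: "?m \<in> A" using a by (rule mid_in_A)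
  have "?m - a2 = (1/2) *\<^sub>R (a1 - a2)" by (simp add: vec_eq_iff field_simps)
  then have nm: "norm (?m - a2) = norm (a2 - a1) / 2" by (simp add: norm_minus_commute)
  have "(L t2 z2 y2 ?m - L t2 z2 y2 a2) - (L t1 z1 y1 ?m - L t1 z1 y1 a2)
      \<le> lH * (\<bar>t1 - t2\<bar> + norm (z1 - z2) + norm (y1 - y2)) * norm (?m - a2)"
    using lH(2)[rule_format, OF t m a(2), of z1 y1 z2 y2] by linarith
  also have "\<dots> \<le> lH * B * norm (?m - a2)"
    using q lH(1) by (intro mult_right_mono mult_left_mono) auto
  also have "\<dots> = lH / 2 * B * norm (a2 - a1)" by (simp add: nm)
  finally show ?thesis using \<mu>[rule_format, OF t(1) a, of z1 y1] by (simp add: norm_minus_commute)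
qed

text \<open>The competitor replaces \<open>\<alpha>\<close> by the average of \<open>\<alpha> s\<close> and \<open>\<alpha> (s + \<delta>)\<close> on two short intervals of equal
  length starting at \<open>s1\<close> and at \<open>s1 + \<delta>\<close>: the gain is quadratic in \<open>\<alpha> (s + \<delta>) - \<alpha> s\<close>, the loss is at most
  \<open>\<delta>\<close> times it, since the shifts of the state produced on the two intervals nearly cancel.\<close>

lemma optimal_control_increment:
  assumes r: "0 < r"
  shows "\<exists>C\<ge>1. \<forall>t\<in>{t0..<T}. \<forall>w \<alpha> x s1 \<delta>. r-lipschitz_on {-b..0} w \<longrightarrow> (\<forall>\<theta>\<in>{-b..0}. norm (w \<theta>) \<le> r) \<longrightarrow>
     continuous_on {t..T} \<alpha> \<longrightarrow> (\<forall>s\<in>{t..T}. \<alpha> s \<in> A) \<longrightarrow> \<alpha> \<in> controls A t T \<longrightarrow> solves t w \<alpha> x \<longrightarrow>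
     (\<forall>\<beta>\<in>controls A t T. \<forall>y. solves t w \<beta> y \<longrightarrow> J t x \<alpha> \<le> J t y \<beta>) \<longrightarrow>
     t \<le> s1 \<longrightarrow> 0 < \<delta> \<longrightarrow> s1 + \<delta> < T \<longrightarrow> norm (\<alpha> (s1 + \<delta>) - \<alpha> s1) \<le> C * \<delta>"
proof -
  define R where "R = RB r"
  define M where "M = MB r"
  define d where "d = dd r"
  have R: "1 \<le> R" "0 \<le> R" "0 < R" using RB_ge(1)[of r] by (auto simp: R_def)
  have M: "1 \<le> M" "0 \<le> M" using MB_ge[of r] by (auto simp: M_def)
  have d: "0 < d" using dd(1)[OF r] by (simp add: d_def)
  have b: "0 < b" by (rule max_delay_pos)
  obtain lH where lH: "lH > 0" "\<forall>t1\<in>{t0..T}. \<forall>t2\<in>{t0..T}. \<forall>z1 y1 z2 y2. \<forall>a\<in>A. \<forall>a'\<in>A.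
     \<bar>(L t1 z1 y1 a - L t1 z1 y1 a') - (L t2 z2 y2 a - L t2 z2 y2 a')\<bar>
     \<le> lH * (\<bar>t1 - t2\<bar> + norm (z1 - z2) + norm (y1 - y2)) * norm (a - a')"
    using L_mixed_difference by (elim exE conjE)
  obtain \<mu> where \<mu>: "\<mu> > 0" "\<forall>t\<in>{t0..T}. \<forall>z y. \<forall>a1\<in>A. \<forall>a2\<in>A.
     \<mu> * (norm (a1 - a2))\<^sup>2 \<le> L t z y a1 + L t z y a2 - 2 * L t z y ((1/2) *\<^sub>R (a1 + a2))"
    using L_midpoint_convex by (elim exE conjE)
  obtain lL where lL: "lL > 0" "\<forall>t\<in>{t0..T}. \<forall>a\<in>A.
          \<forall>z\<in>cball 0 R. \<forall>y\<in>cball 0 R. \<forall>z'\<in>cball 0 R. \<forall>y'\<in>cball 0 R.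
          \<bar>L t z y a - L t z' y' a\<bar> \<le> lL * (norm (z - z') + norm (y - y'))"
    using L_lipschitz[THEN spec, THEN mp, OF R(3)] by (elim exE conjE)
  obtain cf where cf: "cf \<ge> 1" "\<forall>t\<in>{t0..T}. \<forall>t'\<in>{t0..T}. \<forall>a\<in>A. \<forall>a'\<in>A. \<forall>z\<in>cball 0 R. \<forall>z'\<in>cball 0 R. \<forall>y\<in>cball 0 R. \<forall>y'\<in>cball 0 R.
     norm (f t z y a - f t' z' y' a') \<le> cf * (\<bar>t - t'\<bar> + norm (z - z') + norm (y - y') + norm (a - a'))"
    using C1_lipschitz_on_ball[OF f_C1, of R] by (elim exE conjE)
  define My where "My = M * dL R M"
  define k1 where "k1 = lL * ((1 + M * tL) * lC M d + (1 / d) * lC M d) + gL R * (c1 M d * lC M d + lC M d)"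
  have lC0: "0 < lC M d" by (simp add: lC_def)
  have c10: "0 < c1 M d" using fL(1) tL(1) M d unfolding c1_def by (intro mult_pos_pos add_pos_pos add_pos_nonneg) auto
  have k1: "0 \<le> k1" unfolding k1_def using lC0 c10 lL(1) d M tL(1) gL_pos[OF R(3)]
    by (intro add_nonneg_nonneg mult_nonneg_nonneg) auto
  have My0: "0 \<le> My" using M tR(1)[OF R(2)] by (simp add: My_def dL_def)
  define k2 where "k2 = 2 * k1 * cf + lH / 2 * (1 + M + My)"
  have k2: "0 \<le> k2" using k1 cf(1) lH(1) M My0 by (simp add: k2_def)
  \<comment> \<open>The loss rate will be at most \<open>k2 * \<delta> * norm (D u)\<close> and the
    gain rate is \<open>\<mu> * (norm (D u))\<^sup>2\<close>; above the threshold
    \<open>C * \<delta>\<close> the gain exceeds the loss by a definite amount.\<close>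
  define C where "C = k2 / \<mu> + 1"
  have C1: "1 \<le> C" using k2 \<mu>(1) by (simp add: C_def)
  have main: "norm (\<alpha> (s1 + \<delta>) - \<alpha> s1) \<le> C * \<delta>"
    if t: "t \<in> {t0..<T}" and w: "r-lipschitz_on {-b..0} w" "\<forall>\<theta>\<in>{-b..0}. norm (w \<theta>) \<le> r"
      and \<alpha>c: "continuous_on {t..T} \<alpha>" and \<alpha>A: "\<forall>s\<in>{t..T}. \<alpha> s \<in> A" and \<alpha>: "\<alpha> \<in> controls A t T"
      and x: "solves t w \<alpha> x" and opt: "\<forall>\<beta>\<in>controls A t T. \<forall>y. solves t w \<beta> y \<longrightarrow> J t x \<alpha> \<le> J t y \<beta>"
      and s1: "t \<le> s1" and \<delta>: "0 < \<delta>" and s1T: "s1 + \<delta> < T" for t w \<alpha> x s1 \<delta>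
  proof (rule ccontr)
    assume "\<not> norm (\<alpha> (s1 + \<delta>) - \<alpha> s1) \<le> C * \<delta>"
    then have big: "C * \<delta> < norm (\<alpha> (s1 + \<delta>) - \<alpha> s1)" by simp
    have t': "t \<in> {t0..T}" "t0 \<le> t" "t \<le> T" using t by auto
    \<comment> \<open>The constant extension keeps the control continuous and in \<open>A\<close>
      while \<open>u + \<delta>\<close> may leave \<open>{t..T}\<close>.\<close>
    define a where "a = (\<lambda>u. \<alpha> (max t (min T u)))"
    have ac: "continuous_on S a" for S
      unfolding a_def using t' by (intro continuous_on_compose2[OF \<alpha>c] continuous_intros) auto
    have aA: "a u \<in> A" for u unfolding a_def using \<alpha>A t' by auto
    have a_eq: "a u = \<alpha> u" if "u \<in> {t..T}" for u using that by (auto simp: a_def)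
    define D where "D = (\<lambda>u. a (u + \<delta>) - a u)"
    have Dc: "continuous_on S D" for S
      unfolding D_def by (intro continuous_intros continuous_on_compose2[OF ac[of UNIV]]) auto
    have "C * \<delta> < norm (D s1)" using big s1 \<delta> s1T by (simp add: D_def a_eq)
    moreover have "isCont (\<lambda>u. norm (D u)) s1"
      using continuous_on_norm[OF Dc[of UNIV]] by (simp add: continuous_on_eq_continuous_at)
    ultimately have "\<forall>\<^sub>F u in at s1. C * \<delta> < norm (D u)"
      by (intro order_tendstoD(1)) (auto simp: isCont_def)
    then obtain \<rho> where \<rho>: "\<rho> > 0" "\<And>u. u \<noteq> s1 \<Longrightarrow> dist u s1 < \<rho> \<Longrightarrow> C * \<delta> < norm (D u)"
      unfolding eventually_at by auto
    \<comment> \<open>Short enough that the increment stays above the threshold on the first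
      interval, that the two intervals are disjoint, and that the second ends before
      \<open>T\<close>.\<close>
    define \<eta> where "\<eta> = min (\<rho> / 2) (min (\<delta> / 2) ((T - s1 - \<delta>) / 2))"
    have \<eta>: "0 < \<eta>" "\<eta> < \<rho>" "\<eta> < \<delta>" "s1 + \<delta> + \<eta> < T"
      using \<rho>(1) \<delta> s1T by (auto simp: \<eta>_def min_def field_simps)
    have bigD: "C * \<delta> < norm (D u)" if "u \<in> {s1..s1 + \<eta>}" for u
      using \<rho>(2)[of u] that \<eta> \<open>C * \<delta> < norm (D s1)\<close> by (cases "u = s1") (auto simp: dist_real_def)
    define mid where "mid = (\<lambda>u. (1/2) *\<^sub>R (a u + a (u + \<delta>)))"
    have midc: "continuous_on S mid" for S
      unfolding mid_def by (intro continuous_intros ac continuous_on_compose2[OF ac[of UNIV]]) auto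
    have midA: "mid u \<in> A" for u unfolding mid_def by (intro mid_in_A aA)
    define \<beta> where "\<beta> = (\<lambda>u. if u \<in> {s1..s1 + \<eta>} then mid u else if u \<in> {s1 + \<delta>..s1 + \<delta> + \<eta>} then mid (u - \<delta>) else a u)"
    have \<beta>A: "\<beta> u \<in> A" for u by (simp add: \<beta>_def midA aA)
    have "\<beta> \<in> borel_measurable borel"
      unfolding \<beta>_def
      by (intro measurable_If borel_measurable_continuous_onI midc ac continuous_on_compose2[OF midc[of UNIV]] continuous_intros) auto
    then have "\<beta> \<in> borel_measurable (lebesgue_on {t<..<T})"
      by (intro measurable_restrict_space1 measurable_completion) simp
    then have \<beta>: "\<beta> \<in> controls A t T" unfolding controls_def using \<beta>A by auto
    have wL: "w \<in> Lip_hist b" using w by (auto simp: Lip_hist_def)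
    obtain y where y: "solves t w \<beta> y" using trajectory_obtain[OF t'(1) \<beta> wL] by blast
    have wP: "w \<in> P_hist b r" using w by (intro P_histI) auto
    have wr: "\<And>\<theta>. \<theta> \<in> {-b..0} \<Longrightarrow> norm (w \<theta>) \<le> r" using w by blast
    have xM: "M-lipschitz_on {t - b..T} x" unfolding M_def by (rule trajectory_bounds(2)[OF t'(1) \<alpha> w(1) wr x order.refl])
    have yM: "M-lipschitz_on {t - b..T} y" unfolding M_def by (rule trajectory_bounds(2)[OF t'(1) \<beta> w(1) wr y order.refl])
    have xR: "norm (x s) \<le> R" if "s \<in> {t - b..T}" for s unfolding R_def by (rule trajectory_bounds(1)[OF t'(1) \<alpha> w(1) wr x that])
    have yR: "norm (y s) \<le> R" if "s \<in> {t - b..T}" for s unfolding R_def by (rule trajectory_bounds(1)[OF t'(1) \<beta> w(1) wr y that])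
    have sub: "{t..T} \<subseteq> {t - b..T}" using b by auto
    obtain N1 where N1: "negligible N1"
      "\<And>s. s \<in> {t<..<T} - N1 \<Longrightarrow> (x has_vector_derivative f s (x s) (delayed x s) (\<alpha> s)) (at s)"
      using trajectory_derivative_ae[OF x] by blast
    obtain N2 where N2: "negligible N2"
      "\<And>s. s \<in> {t<..<T} - N2 \<Longrightarrow> (y has_vector_derivative f s (y s) (delayed y s) (\<beta> s)) (at s)"
      using trajectory_derivative_ae[OF y] by blast
    obtain N3 where N3: "negligible N3" "\<And>s. s \<in> {t<..<T} - N3 \<Longrightarrow> \<exists>D\<ge>d. (dtime y has_real_derivative D) (at s)"
      using dtime_expanding[OF r t'(1) wP \<beta> y] unfolding d_def by blast
    define N where "N = N1 \<union> N2 \<union> N3 \<union> {s1, s1 + \<eta>, s1 + \<delta>, s1 + \<delta> + \<eta>}"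
    have N: "negligible N" unfolding N_def using N1(1) N2(1) N3(1) by (intro negligible_Un) auto
    define \<psi> where "\<psi> = (\<lambda>v. f t0 0 0 v)"
    \<comment> \<open>The change of velocity caused by averaging on the first interval; on the
      second interval the change is \<open>- \<gamma> (u - \<delta>)\<close>.\<close>
    define \<gamma> where "\<gamma> = (\<lambda>u. (1/2) *\<^sub>R (\<psi> (a (u + \<delta>)) - \<psi> (a u)))"
    have \<psi>L: "norm (\<psi> v - \<psi> v') \<le> cf * norm (v - v')" if "v \<in> A" "v' \<in> A" for v v'
      using cf(2)[rule_format, of t0 t0 v v' 0 0 0 0] that R(2) time_interval by (simp add: \<psi>_def)
    have \<psi>c: "continuous_on A \<psi>"
    proof (rule lipschitz_on_continuous_on[of cf])
      show "cf-lipschitz_on A \<psi>" using \<psi>L cf(1) by (intro lipschitz_onI) (auto simp: dist_norm)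
    qed
    have \<gamma>c: "continuous_on S \<gamma>" for S
      unfolding \<gamma>_def
      by (intro continuous_intros continuous_on_compose2[OF \<psi>c ac] continuous_on_compose2[OF \<psi>c continuous_on_compose2[OF ac[of UNIV]]])
         (use aA in \<open>auto intro!: continuous_intros\<close>)
    have \<gamma>D: "norm (\<gamma> u) \<le> cf / 2 * norm (D u)" for u
      using \<psi>L[OF aA aA, of "u + \<delta>" u] by (simp add: \<gamma>_def D_def)
    define G where "G = clip_integral s1 (s1 + \<eta>) \<gamma>"
    have "s1 < s1 + \<eta>" using \<eta> by simp
    note CI = clip_integral[OF \<gamma>c this, folded G_def]
    obtain BG where BG: "BG-lipschitz_on UNIV G" using CI(1) by blast
    \<comment> \<open>The accumulated change of velocity. Since the second interval undoes the
      first, \<open>E\<close> vanishes outside \<open>{s1..s1 + \<delta> + \<eta>}\<close>.\<close>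
    define E where "E = (\<lambda>s. G s - G (s - \<delta>))"
    define m where "m = integral {s1..s1 + \<eta>} (\<lambda>u. norm (\<gamma> u))"
    have m0: "0 \<le> m" unfolding m_def by (intro integral_nonneg integrable_continuous_real continuous_on_norm \<gamma>c) auto
    have EL: "(BG + BG)-lipschitz_on {t..T} E"
    proof -
      have "BG-lipschitz_on {t..T} (\<lambda>s. G (s - \<delta>))"
        using lipschitz_onD[OF BG] lipschitz_on_nonneg[OF BG]
        by (intro lipschitz_onI) (auto simp: dist_real_def dest!: spec2 intro: order_trans[OF lipschitz_onD[OF BG]])
      then show ?thesis unfolding E_def by (intro lipschitz_on_diff lipschitz_on_subset[OF BG]) auto
    qed
    have E_bound: "norm (E u) \<le> (if u \<in> {s1..s1 + \<delta> + \<eta>} then 2 * m else 0)" for u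
    proof -
      have "norm (G u - G (u - \<delta>)) \<le> m + m"
        using CI(3)[of u] CI(3)[of "u - \<delta>"] unfolding m_def by (intro order_trans[OF norm_triangle_ineq4] add_mono)
      moreover have "E u = 0" if "u < s1" using CI(4)[of u] CI(4)[of "u - \<delta>"] that \<delta> by (simp add: E_def)
      moreover have "E u = 0" if "s1 + \<delta> + \<eta> < u" using CI(5)[of u] CI(5)[of "u - \<delta>"] that \<delta> by (simp add: E_def)
      ultimately show ?thesis by (auto simp: E_def not_le)
    qed
    define P where "P = integral {t..T} (\<lambda>u. norm (E u))"
    have Ec: "continuous_on {t..T} E" using EL by (rule lipschitz_on_continuous_on)
    \<comment> \<open>The factor \<open>\<delta>\<close> comes from the length of the support of
      \<open>E\<close>, at most \<open>2 * \<delta>\<close>; it is what makes the loss comparable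
      with the gain.\<close>
    have P: "P \<le> 4 * \<delta> * m"
    proof -
      have sub: "{s1..s1 + \<delta> + \<eta>} \<subseteq> {t..T}" using s1 \<eta> by auto
      have i: "(\<lambda>u. if u \<in> {s1..s1 + \<delta> + \<eta>} then 2 * m else 0) integrable_on {t..T}"
        by (rule integral_if_in(2)[OF sub integrable_const_ivl])
      have "P \<le> integral {t..T} (\<lambda>u. if u \<in> {s1..s1 + \<delta> + \<eta>} then 2 * m else 0)"
        unfolding P_def by (intro integral_le i integrable_continuous_real continuous_on_norm Ec E_bound)
      also have "\<dots> = integral {s1..s1 + \<delta> + \<eta>} (\<lambda>u. 2 * m)" by (rule integral_if_in(1)[OF sub])
      also have "\<dots> = (\<delta> + \<eta>) * (2 * m)" using \<delta> \<eta> by simp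
      also have "\<dots> \<le> (2 * \<delta>) * (2 * m)" using \<eta> m0 by (intro mult_right_mono) auto
      finally show ?thesis by simp
    qed
    have P0: "0 \<le> P" unfolding P_def by (intro integral_nonneg integrable_continuous_real continuous_on_norm Ec) auto
    have Ed: "((\<lambda>s. y s - E s) has_vector_derivative f u (y u) (delayed y u) (\<alpha> u)) (at u)" if u: "u \<in> {t<..<T} - N" for u
    proof -
      have u': "u \<in> {t0..T}" "u \<in> {t..T}" using u t' by auto
      have ne: "u \<notin> {s1, s1 + \<eta>}" "u - \<delta> \<notin> {s1, s1 + \<eta>}" using u by (auto simp: N_def)
      have "((\<lambda>s. y s - (G s - G (s - \<delta>))) has_vector_derivative f u (y u) (delayed y u) (\<beta> u) -
         ((if u \<in> {s1<..<s1 + \<eta>} then \<gamma> u else 0) - (if u - \<delta> \<in> {s1<..<s1 + \<eta>} then \<gamma> (u - \<delta>) else 0))) (at u)"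
        using u by (intro has_vector_derivative_diff N2(2) CI(2)[OF ne(1)] has_vector_derivative_shift[OF CI(2)[OF ne(2)]]) (auto simp: N_def)
      moreover have "f u (y u) (delayed y u) (\<beta> u) -
         ((if u \<in> {s1<..<s1 + \<eta>} then \<gamma> u else 0) - (if u - \<delta> \<in> {s1<..<s1 + \<eta>} then \<gamma> (u - \<delta>) else 0)) = f u (y u) (delayed y u) (\<alpha> u)"
      proof (cases "u \<in> {s1<..<s1 + \<eta>}")
        case True
        have nin: "\<not> u - \<delta> \<in> {s1<..<s1 + \<eta>}" using True \<eta> by auto
        have "\<beta> u = (1/2) *\<^sub>R (a u + a (u + \<delta>))" using True \<eta> \<delta> by (auto simp: \<beta>_def mid_def)
        then show ?thesis
          unfolding if_P[OF True] if_not_P[OF nin]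
          using f_mid_eq[OF u'(1) aA aA, of "y u" "delayed y u" u "u + \<delta>"] a_eq[OF u'(2)] by (simp add: \<gamma>_def \<psi>_def)
      next
        case False
        then have nI: "u \<notin> {s1..s1 + \<eta>}" using ne(1) by auto
        show ?thesis
        proof (cases "u - \<delta> \<in> {s1<..<s1 + \<eta>}")
          case True
          then have "\<beta> u = (1/2) *\<^sub>R (a u + a (u - \<delta>))" using nI by (auto simp: \<beta>_def mid_def add.commute)
          then show ?thesis
            unfolding if_P[OF True] if_not_P[OF False]
            using f_mid_eq[OF u'(1) aA aA, of "y u" "delayed y u" u "u - \<delta>"] a_eq[OF u'(2)]
            by (simp add: \<gamma>_def \<psi>_def scaleR_diff_right)
        next
          case F2: False
          then have "u \<notin> {s1 + \<delta>..s1 + \<delta> + \<eta>}" using ne(2) by auto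
          then have "\<beta> u = a u" using nI by (simp only: \<beta>_def if_False)
          then show ?thesis using False F2 a_eq[OF u'(2)] by (simp only: if_False) simp
        qed
      qed
      ultimately show ?thesis by (simp only: E_def)
    qed
    have \<sigma>: "(dL R M)-lipschitz_on {t..T} (dtime y)"
      by (rule dtime_lipschitz[OF t'(2) lipschitz_on_subset[OF yM sub] _ R(2)]) (use yR sub in blast)
    have hist: "y s = x s" if "s \<in> {t - b..t}" for s
      using trajectory_history[OF x that] trajectory_history[OF y that] by simp
    have E0: "E t = 0" using CI(4)[of t] CI(4)[of "t - \<delta>"] s1 \<delta> by (simp add: E_def)
    have ET: "E T = 0" using E_bound[of T] \<eta> by (simp split: if_splits)
    have NA: "\<alpha> u \<in> A" if "u \<in> {t<..<T} - N" for u using \<alpha>A that by auto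
    have dx: "(x has_vector_derivative f u (x u) (delayed x u) (\<alpha> u)) (at u)" if "u \<in> {t<..<T} - N" for u
      using N1(2)[of u] that by (auto simp: N_def)
    have ex: "\<exists>D\<ge>d. (dtime y has_real_derivative D) (at u)" if "u \<in> {t<..<T} - N" for u
      using N3(2)[of u] that by (auto simp: N_def)
    note L1 = stability_L1[OF t'(1) xM yM hist E0 EL N NA dx Ed \<sigma> d ex, folded P_def]
    define e where "e = (\<lambda>s. y s - x s)"
    have ec: "continuous_on {t - b..T} e" unfolding e_def
      by (intro continuous_intros lipschitz_on_continuous_on[OF xM] lipschitz_on_continuous_on[OF yM])
    have ec': "continuous_on {t..T} e" by (rule continuous_on_subset[OF ec sub])
    have e\<sigma>: "continuous_on {t..T} (\<lambda>u. e (dtime y u))"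
      by (rule continuous_on_compose2[OF ec lipschitz_on_continuous_on[OF \<sigma>]]) (use dtime_in_range[OF _ t'(2)] in blast)
    have ie: "integral {t..T} (\<lambda>u. norm (e u)) \<le> lC M d * P"
    proof -
      have "integral {t..T} (\<lambda>u. norm (e u)) \<le> integral {t - b..T} (\<lambda>u. norm (e u))"
        using sub by (intro integral_subset_le integrable_continuous_real continuous_on_norm ec ec') auto
      then show ?thesis using L1(1) by (simp add: e_def)
    qed
    have ies: "integral {t..T} (\<lambda>u. norm (e (dtime y u))) \<le> (1 / d) * (lC M d * P)"
      using L1(3) by (simp add: e_def)
    have xc: "continuous_on {t..T} x" "continuous_on {t..T} (delayed x)" "continuous_on {t..T} y" "continuous_on {t..T} (delayed y)"
      using continuous_on_subset[OF lipschitz_on_continuous_on[OF xM] sub] continuous_on_subset[OF lipschitz_on_continuous_on[OF yM] sub]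
        continuous_on_delayed[OF t'(2) lipschitz_on_continuous_on[OF xM]] continuous_on_delayed[OF t'(2) lipschitz_on_continuous_on[OF yM]] by auto
    have int: "(\<lambda>s. L s (y s) (delayed y s) (\<beta> s)) integrable_on {t..T}"
      "(\<lambda>s. L s (x s) (delayed x s) (\<beta> s)) integrable_on {t..T}"
      "(\<lambda>s. L s (x s) (delayed x s) (\<alpha> s)) integrable_on {t..T}"
      using integrable_along(1)[OF L_cont t'(2) xc(3,4) \<beta>] integrable_along(1)[OF L_cont t'(2) xc(1,2) \<beta>]
         integrable_along(1)[OF L_cont t'(2) xc(1,2) \<alpha>] set_lebesgue_integral_eq_integral(1) by blast+
    have dR: "norm (delayed x u) \<le> R" "norm (delayed y u) \<le> R" if "u \<in> {t..T}" for u
      unfolding delayed_eq using dtime_in_range[OF that t'(2)] by (auto intro: xR yR)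
    have T1: "integral {t..T} (\<lambda>s. L s (y s) (delayed y s) (\<beta> s)) - integral {t..T} (\<lambda>s. L s (x s) (delayed x s) (\<beta> s))
       \<le> lL * ((1 + M * tL) * lC M d + (1 / d) * lC M d) * P"
    proof -
      have "integral {t..T} (\<lambda>s. L s (y s) (delayed y s) (\<beta> s) - L s (x s) (delayed x s) (\<beta> s))
          \<le> integral {t..T} (\<lambda>s. lL * ((1 + M * tL) * norm (e s) + norm (e (dtime y s))))"
      proof (intro integral_le integrable_diff int integrable_continuous_real continuous_intros ec' e\<sigma>)
        fix s assume s: "s \<in> {t..T}"
        have "L s (y s) (delayed y s) (\<beta> s) - L s (x s) (delayed x s) (\<beta> s) \<le> lL * (norm (y s - x s) + norm (delayed y s - delayed x s))"
          using lL(2)[rule_format, of s "\<beta> s" "y s" "delayed y s" "x s" "delayed x s"] s t' \<beta>A xR yR dR[OF s] sub by (simp add: subset_iff)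
        also have "\<dots> \<le> lL * ((1 + M * tL) * norm (e s) + norm (e (dtime y s)))"
          using delayed_diff[OF xM s t'(2), of y] lL(1) by (intro mult_left_mono) (auto simp: e_def algebra_simps)
        finally show "L s (y s) (delayed y s) (\<beta> s) - L s (x s) (delayed x s) (\<beta> s) \<le> lL * ((1 + M * tL) * norm (e s) + norm (e (dtime y s)))" .
      qed
      also have "\<dots> = lL * ((1 + M * tL) * integral {t..T} (\<lambda>s. norm (e s)) + integral {t..T} (\<lambda>s. norm (e (dtime y s))))"
        by (simp only: integral_mult_right)
           (subst Henstock_Kurzweil_Integration.integral_add, auto intro!: integrable_continuous_real continuous_intros ec' e\<sigma>)
      also have "\<dots> \<le> lL * ((1 + M * tL) * (lC M d * P) + (1 / d) * (lC M d * P))"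
        using ie ies lL(1) M tL(1) by (intro mult_left_mono add_mono) auto
      also have "\<dots> = lL * ((1 + M * tL) * lC M d + (1 / d) * lC M d) * P"
        by (simp only: distrib_left distrib_right mult_ac)
      finally show ?thesis using int by (simp add: Henstock_Kurzweil_Integration.integral_diff)
    qed
    have T3: "g (y T, segment_at y T) - g (x T, segment_at x T) \<le> gL R * (c1 M d * lC M d + lC M d) * P"
    proof -
      have "\<bar>g (segment_at y T 0, segment_at y T) - g (segment_at x T 0, segment_at x T)\<bar> \<le>
         gL R * (norm (segment_at y T 0 - segment_at x T 0) + integral {-b..0} (\<lambda>\<theta>. norm (segment_at y T \<theta> - segment_at x T \<theta>)))"
        using t' by (intro g_lipschitz_L1[OF R(3) segment_lipschitz[OF yM t'(3)] segment_lipschitz[OF xM t'(3)]])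
          (auto simp: segment_at_def intro!: xR yR)
      moreover have "integral {-b..0} (\<lambda>\<theta>. norm (segment_at y T \<theta> - segment_at x T \<theta>)) \<le> lC M d * P"
      proof -
        have "integral {-b..0} (\<lambda>\<theta>. norm (e (\<theta> + T))) = integral {-b + T..0 + T} (\<lambda>u. norm (e u))"
          by (rule integral_shift_Icc)
        also have "\<dots> \<le> integral {t - b..T} (\<lambda>u. norm (e u))"
          using t' b by (intro integral_subset_le integrable_continuous_real continuous_on_norm ec continuous_on_subset[OF ec]) auto
        finally show ?thesis using L1(1) by (simp add: e_def segment_at_def add.commute)
      qed
      moreover have "norm (segment_at y T 0 - segment_at x T 0) \<le> c1 M d * lC M d * P"
        using L1(2) ET by (simp add: segment_at_def)
      ultimately have "\<bar>g (segment_at y T 0, segment_at y T) - g (segment_at x T 0, segment_at x T)\<bar> \<le> gL R * (c1 M d * lC M d * P + lC M d * P)"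
        using gL_pos[OF R(3)] by (meson add_mono mult_left_mono order_less_imp_le order_trans)
      then show ?thesis by (simp add: segment_at_def algebra_simps)
    qed
    define \<Lambda>1 where "\<Lambda>1 = (\<lambda>u. L u (x u) (delayed x u) (mid u) - L u (x u) (delayed x u) (a u))"
    define \<Lambda>2 where "\<Lambda>2 = (\<lambda>u. L u (x u) (delayed x u) (mid (u - \<delta>)) - L u (x u) (delayed x u) (a u))"
    have I1: "{s1..s1 + \<eta>} \<subseteq> {t..T}" and I2: "{s1 + \<delta>..s1 + \<eta> + \<delta>} \<subseteq> {t..T}" using s1 \<eta> \<delta> by auto
    have tt: "{t..T} \<subseteq> {t0..T}" using t' by auto
    have c1: "continuous_on {t..T} \<Lambda>1" unfolding \<Lambda>1_def
      by (intro continuous_on_diff continuous_on_along[OF L_cont tt xc(1,2)] midc ac midA aA)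
    have c2: "continuous_on {t..T} \<Lambda>2" unfolding \<Lambda>2_def
      by (intro continuous_on_diff continuous_on_along[OF L_cont tt xc(1,2)] continuous_on_compose2[OF midc[of UNIV]] ac midA aA continuous_intros) auto
    have T2: "integral {t..T} (\<lambda>s. L s (x s) (delayed x s) (\<beta> s)) - integral {t..T} (\<lambda>s. L s (x s) (delayed x s) (\<alpha> s))
       \<le> integral {s1..s1 + \<eta>} (\<lambda>u. lH / 2 * ((1 + M + My) * \<delta>) * norm (D u) - \<mu> * (norm (D u))\<^sup>2)"
    proof -
      have i1: "(\<lambda>u. if u \<in> {s1..s1 + \<eta>} then \<Lambda>1 u else 0) integrable_on {t..T}"
        by (rule integral_if_in(2)[OF I1 integrable_continuous_real[OF continuous_on_subset[OF c1 I1]]])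
      have i2: "(\<lambda>u. if u \<in> {s1 + \<delta>..s1 + \<eta> + \<delta>} then \<Lambda>2 u else 0) integrable_on {t..T}"
        by (rule integral_if_in(2)[OF I2 integrable_continuous_real[OF continuous_on_subset[OF c2 I2]]])
      have "integral {t..T} (\<lambda>s. L s (x s) (delayed x s) (\<beta> s)) - integral {t..T} (\<lambda>s. L s (x s) (delayed x s) (\<alpha> s))
         = integral {t..T} (\<lambda>s. L s (x s) (delayed x s) (\<beta> s) - L s (x s) (delayed x s) (\<alpha> s))"
        using int by (simp add: Henstock_Kurzweil_Integration.integral_diff)
      also have "\<dots> = integral {t..T} (\<lambda>u. (if u \<in> {s1..s1 + \<eta>} then \<Lambda>1 u else 0) + (if u \<in> {s1 + \<delta>..s1 + \<eta> + \<delta>} then \<Lambda>2 u else 0))"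
      proof (rule integral_cong)
        fix u assume u: "u \<in> {t..T}"
        have "s1 + \<delta> + \<eta> = s1 + \<eta> + \<delta>" by simp
        moreover have "\<not> (u \<in> {s1..s1 + \<eta>} \<and> u \<in> {s1 + \<delta>..s1 + \<eta> + \<delta>})" using \<eta> by auto
        ultimately show "L u (x u) (delayed x u) (\<beta> u) - L u (x u) (delayed x u) (\<alpha> u) =
          (if u \<in> {s1..s1 + \<eta>} then \<Lambda>1 u else 0) + (if u \<in> {s1 + \<delta>..s1 + \<eta> + \<delta>} then \<Lambda>2 u else 0)"
          unfolding \<beta>_def \<Lambda>1_def \<Lambda>2_def a_eq[OF u] by (cases "u \<in> {s1..s1 + \<eta>}"; cases "u \<in> {s1 + \<delta>..s1 + \<eta> + \<delta>}") (simp_all only: if_True if_False, auto)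
      qed
      also have "\<dots> = integral {s1..s1 + \<eta>} \<Lambda>1 + integral {s1 + \<delta>..s1 + \<eta> + \<delta>} \<Lambda>2"
        unfolding Henstock_Kurzweil_Integration.integral_add[OF i1 i2] integral_if_in(1)[OF I1] integral_if_in(1)[OF I2] ..
      also have "integral {s1 + \<delta>..s1 + \<eta> + \<delta>} \<Lambda>2 = integral {s1..s1 + \<eta>} (\<lambda>u. \<Lambda>2 (u + \<delta>))"
        by (rule integral_shift_Icc[symmetric])
      also have "integral {s1..s1 + \<eta>} \<Lambda>1 + integral {s1..s1 + \<eta>} (\<lambda>u. \<Lambda>2 (u + \<delta>)) = integral {s1..s1 + \<eta>} (\<lambda>u. \<Lambda>1 u + \<Lambda>2 (u + \<delta>))"
        by (rule Henstock_Kurzweil_Integration.integral_add[symmetric])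
           (use I2 in \<open>auto intro!: integrable_continuous_real continuous_on_subset[OF c1 I1] continuous_on_compose2[OF c2] continuous_intros\<close>)
      also have "\<dots> \<le> integral {s1..s1 + \<eta>} (\<lambda>u. lH / 2 * ((1 + M + My) * \<delta>) * norm (D u) - \<mu> * (norm (D u))\<^sup>2)"
      proof (rule integral_le)
        show "(\<lambda>u. \<Lambda>1 u + \<Lambda>2 (u + \<delta>)) integrable_on {s1..s1 + \<eta>}"
          using I2 by (auto intro!: integrable_continuous_real continuous_intros continuous_on_subset[OF c1 I1] continuous_on_compose2[OF c2])
        show "(\<lambda>u. lH / 2 * ((1 + M + My) * \<delta>) * norm (D u) - \<mu> * (norm (D u))\<^sup>2) integrable_on {s1..s1 + \<eta>}"
          by (intro integrable_continuous_real continuous_intros Dc)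
        fix u assume u: "u \<in> {s1..s1 + \<eta>}"
        have u1: "u \<in> {t..T}" "u + \<delta> \<in> {t..T}" using u I1 I2 \<delta> \<eta> by auto
        have "norm (x u - x (u + \<delta>)) \<le> M * \<delta>"
          using lipschitz_onD[OF xM, of u "u + \<delta>"] u1 sub \<delta> by (auto simp: dist_norm)
        moreover have "norm (delayed x u - delayed x (u + \<delta>)) \<le> My * \<delta>"
          using lipschitz_onD[OF delayed_lipschitz[OF t'(2) xM xR R(2)] u1] sub \<delta> by (auto simp: dist_norm My_def)
        ultimately have q: "\<bar>u - (u + \<delta>)\<bar> + norm (x u - x (u + \<delta>)) + norm (delayed x u - delayed x (u + \<delta>)) \<le> (1 + M + My) * \<delta>"
          using \<delta> by (simp add: algebra_simps)
        have u2: "u \<in> {t0..T}" "u + \<delta> \<in> {t0..T}" using u1 t' by auto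
        show "\<Lambda>1 u + \<Lambda>2 (u + \<delta>) \<le> lH / 2 * ((1 + M + My) * \<delta>) * norm (D u) - \<mu> * (norm (D u))\<^sup>2"
          using exchange_cost_decrease[OF less_imp_le[OF lH(1)] lH(2) \<mu>(2) u2 aA[of u] aA[of "u + \<delta>"] q]
          unfolding \<Lambda>1_def \<Lambda>2_def mid_def D_def by simp
      qed
      finally show ?thesis .
    qed
    have mD: "m \<le> cf / 2 * integral {s1..s1 + \<eta>} (\<lambda>u. norm (D u))"
    proof -
      have "m \<le> integral {s1..s1 + \<eta>} (\<lambda>u. cf / 2 * norm (D u))"
        unfolding m_def by (intro integral_le integrable_continuous_real continuous_intros \<gamma>c Dc \<gamma>D)
      then show ?thesis by (simp only: integral_mult_right)
    qed
    have "J t x \<alpha> \<le> J t y \<beta>" using opt \<beta> y by blast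
    \<comment> \<open>Optimality makes the sum of the three cost differences nonnegative:
      \<open>k1 * P\<close> collects the changes of running and terminal cost caused by the state,
      the integral is the direct effect of exchanging the controls.\<close>
    then have "0 \<le> k1 * P + integral {s1..s1 + \<eta>} (\<lambda>u. lH / 2 * ((1 + M + My) * \<delta>) * norm (D u) - \<mu> * (norm (D u))\<^sup>2)"
      using T1 T2 T3 unfolding J_def k1_def distrib_right by linarith
    also have "k1 * P \<le> k1 * (4 * \<delta> * (cf / 2 * integral {s1..s1 + \<eta>} (\<lambda>u. norm (D u))))"
      using P mD k1 \<delta> by (intro mult_left_mono order_trans[OF P] mult_left_mono) auto
    also have "\<dots> = integral {s1..s1 + \<eta>} (\<lambda>u. (2 * k1 * cf) * \<delta> * norm (D u))"
      by (simp add: integral_mult_right mult_ac)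
    also have "\<dots> + integral {s1..s1 + \<eta>} (\<lambda>u. lH / 2 * ((1 + M + My) * \<delta>) * norm (D u) - \<mu> * (norm (D u))\<^sup>2)
       = integral {s1..s1 + \<eta>} (\<lambda>u. (2 * k1 * cf) * \<delta> * norm (D u) + (lH / 2 * ((1 + M + My) * \<delta>) * norm (D u) - \<mu> * (norm (D u))\<^sup>2))"
      by (intro Henstock_Kurzweil_Integration.integral_add[symmetric] integrable_continuous_real continuous_intros Dc)
    also have "\<dots> \<le> integral {s1..s1 + \<eta>} (\<lambda>u. - (C * \<mu> * \<delta>\<^sup>2))"
    proof (intro integral_le integrable_continuous_real continuous_intros Dc)
      fix u assume "u \<in> {s1..s1 + \<eta>}"
      note bD = bigD[OF this]
      have "k2 * \<delta> - \<mu> * norm (D u) \<le> - (\<mu> * \<delta>)"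
      proof -
        have "\<mu> * (C * \<delta>) \<le> \<mu> * norm (D u)" using bD \<mu>(1) by (intro mult_left_mono) auto
        moreover have "\<mu> * (C * \<delta>) = k2 * \<delta> + \<mu> * \<delta>" using \<mu>(1) by (simp add: C_def field_simps)
        ultimately show ?thesis by linarith
      qed
      then have "norm (D u) * (k2 * \<delta> - \<mu> * norm (D u)) \<le> norm (D u) * (- (\<mu> * \<delta>))" by (intro mult_left_mono) auto
      also have "\<dots> \<le> (C * \<delta>) * (- (\<mu> * \<delta>))" using bD \<mu>(1) \<delta> by (intro mult_right_mono_neg) auto
      finally show "(2 * k1 * cf) * \<delta> * norm (D u) + (lH / 2 * ((1 + M + My) * \<delta>) * norm (D u) - \<mu> * (norm (D u))\<^sup>2) \<le> - (C * \<mu> * \<delta>\<^sup>2)"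
        by (simp add: k2_def power2_eq_square algebra_simps add_divide_distrib)
    qed
    also have "\<dots> = - (\<eta> * (C * \<mu> * \<delta>\<^sup>2))" using \<eta> by simp
    also have "\<dots> < 0" using \<eta>(1) C1 \<mu>(1) \<delta> by simp
    finally show False by simp
  qed
  show ?thesis
    by (intro exI[of _ C] conjI ballI allI impI C1) (rule main; assumption)
qed

text \<open>The hypothesis provides some Lipschitz constant for each representative; the point is
  one constant for all \<open>t\<close> and all histories with bounds \<open>r\<close>. The
  increment estimate stops short of \<open>T\<close> and is extended by continuity.\<close>

theorem optimal_control_lipschitz:
  assumes r: "0 < r"
  shows "\<exists>C\<ge>1. \<forall>t\<in>{t0..<T}. \<forall>w \<alpha> \<alpha>'. r-lipschitz_on {-b..0} w \<longrightarrow> (\<forall>\<theta>\<in>{-b..0}. norm (w \<theta>) \<le> r) \<longrightarrow>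
     optimal_control A f L g \<tau> b T t w \<alpha> \<longrightarrow> lipschitz_representative t T \<alpha> \<alpha>' \<longrightarrow> C-lipschitz_on {t..T} \<alpha>'"
proof -
  obtain C where C: "1 \<le> C" "\<forall>t\<in>{t0..<T}. \<forall>w \<alpha> x s1 \<delta>. r-lipschitz_on {-b..0} w \<longrightarrow> (\<forall>\<theta>\<in>{-b..0}. norm (w \<theta>) \<le> r) \<longrightarrow>
     continuous_on {t..T} \<alpha> \<longrightarrow> (\<forall>s\<in>{t..T}. \<alpha> s \<in> A) \<longrightarrow> \<alpha> \<in> controls A t T \<longrightarrow> solves t w \<alpha> x \<longrightarrow>
     (\<forall>\<beta>\<in>controls A t T. \<forall>y. solves t w \<beta> y \<longrightarrow> J t x \<alpha> \<le> J t y \<beta>) \<longrightarrow>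
     t \<le> s1 \<longrightarrow> 0 < \<delta> \<longrightarrow> s1 + \<delta> < T \<longrightarrow> norm (\<alpha> (s1 + \<delta>) - \<alpha> s1) \<le> C * \<delta>"
    using optimal_control_increment[OF r] by (elim exE conjE)
  show ?thesis
  proof (intro exI[of _ C] conjI ballI allI impI C(1))
    fix t w \<alpha> \<alpha>'
    assume t: "t \<in> {t0..<T}" and w: "r-lipschitz_on {-b..0} w" "\<forall>\<theta>\<in>{-b..0}. norm (w \<theta>) \<le> r"
      and opt: "optimal_control A f L g \<tau> b T t w \<alpha>" and rep: "lipschitz_representative t T \<alpha> \<alpha>'"
    have wL: "w \<in> Lip_hist b" using w by (auto simp: Lip_hist_def)
    obtain x where x: "solves t w \<alpha>' x" "value_fn A f L g \<tau> b T t w = J t x \<alpha>'" "\<alpha>' \<in> controls A t T"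
      "\<And>s. s \<in> {t..T} \<Longrightarrow> \<alpha>' s \<in> A"
        using optimal_control_J[OF t wL opt rep] by blast
    have t': "t \<in> {t0..T}" using t by auto
    obtain K where K: "K-lipschitz_on {t..T} \<alpha>'" using rep by (auto simp: lipschitz_representative_def)
    have "J t x \<alpha>' \<le> J t y \<beta>" if "\<beta> \<in> controls A t T" "solves t w \<beta> y" for \<beta> y
      using value_le_J[OF t' wL that] x(2) by simp
    then have inc: "norm (\<alpha>' (s1 + \<delta>) - \<alpha>' s1) \<le> C * \<delta>" if "t \<le> s1" "0 < \<delta>" "s1 + \<delta> < T" for s1 \<delta>
      using C(2)[rule_format, OF t w(1) _ lipschitz_on_continuous_on[OF K] x(4) x(3) x(1) _ that] w(2) by blast
    have "C-lipschitz_on {t..<T} \<alpha>'"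
    proof (rule lipschitz_on_leI)
      fix s u assume "s \<in> {t..<T}" "u \<in> {t..<T}" "s \<le> u"
      then show "dist (\<alpha>' s) (\<alpha>' u) \<le> C * dist s u"
        using inc[of s "u - s"] by (cases "s = u") (auto simp: dist_norm norm_minus_commute)
    qed (use C(1) in simp)
    then have "C-lipschitz_on (closure {t..<T}) \<alpha>'"
      using t lipschitz_on_continuous_on[OF K] by (intro lipschitz_on_closure) auto
    then show "C-lipschitz_on {t..T} \<alpha>'" using t by simp
  qed
qed

end

section \<open>Piecewise regular functions and the norm of histories\<close>

text \<open>Expansion about the midpoint of \<open>p\<close> and \<open>q\<close> with the slope
  \<open>\<phi>\<close> there makes the linear terms cancel. Replacing the midpoint by
  \<open>m\<close> costs the Lipschitz constant of \<open>X\<close>.\<close>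

lemma second_difference_bound:
  fixes X :: "real \<Rightarrow> 'a::real_inner"
  assumes X: "K-lipschitz_on {l..u} X" and N: "negligible N"
    and der: "\<And>s. s \<in> {l<..<u} - N \<Longrightarrow> (X has_vector_derivative \<phi> s) (at s)"
    and \<phi>: "k-lipschitz_on {l..u} \<phi>" and pq: "p \<in> {l..u}" "q \<in> {l..u}" and m: "m \<in> {l..u}"
  shows "norm (X p + X q - 2 *\<^sub>R X m) \<le> k * (p - q)\<^sup>2 + K * \<bar>p + q - 2 * m\<bar>"
proof -
  have k: "0 \<le> k" using \<phi> by (rule lipschitz_on_nonneg)
  have *: "norm (X p + X q - 2 *\<^sub>R X ((p + q) / 2)) \<le> k * (p - q)\<^sup>2"
    if "p \<in> {l..u}" "q \<in> {l..u}" "p \<le> q" for p q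
  proof -
    define c where "c = (p + q) / 2"
    have c: "p \<le> c" "c \<le> q" "c - p = q - c" "c \<in> {l..u}" using that by (auto simp: c_def field_simps)
    have near: "norm (\<phi> s - \<phi> c) \<le> k * (q - p)" if "s \<in> {p..q}" for s
    proof -
      have "norm (\<phi> s - \<phi> c) \<le> k * \<bar>s - c\<bar>"
        using lipschitz_onD[OF \<phi>, of s c] that c \<open>p \<in> {l..u}\<close> \<open>q \<in> {l..u}\<close> by (auto simp: dist_norm)
      also have "\<dots> \<le> k * (q - p)" using that c k by (intro mult_left_mono) auto
      finally show ?thesis .
    qed
    have 1: "norm (X c - X p - (c - p) *\<^sub>R \<phi> c) \<le> k * (q - p) * (c - p)"
    proof (rule lipschitz_ae_linear_bound[OF lipschitz_on_subset[OF X] c(1) N])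
      fix s assume "s \<in> {p<..<c} - N"
      then show "\<exists>D. (X has_vector_derivative D) (at s) \<and> norm (D - \<phi> c) \<le> k * (q - p)"
        using that c by (intro exI[of _ "\<phi> s"] conjI der near) auto
    qed (use that c in auto)
    have 2: "norm (X q - X c - (q - c) *\<^sub>R \<phi> c) \<le> k * (q - p) * (q - c)"
    proof (rule lipschitz_ae_linear_bound[OF lipschitz_on_subset[OF X] c(2) N])
      fix s assume "s \<in> {c<..<q} - N"
      then show "\<exists>D. (X has_vector_derivative D) (at s) \<and> norm (D - \<phi> c) \<le> k * (q - p)"
        using that c by (intro exI[of _ "\<phi> s"] conjI der near) auto
    qed (use that c in auto)
    have "X p + X q - 2 *\<^sub>R X c = (X q - X c - (q - c) *\<^sub>R \<phi> c) - (X c - X p - (c - p) *\<^sub>R \<phi> c)"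
      unfolding c(3) by (simp add: scaleR_2)
    then have "norm (X p + X q - 2 *\<^sub>R X c) \<le> k * (q - p) * (q - c) + k * (q - p) * (c - p)"
      by (metis order_trans[OF norm_triangle_ineq4 add_mono[OF 2 1]])
    also have "\<dots> = k * (p - q)\<^sup>2" by (simp add: power2_eq_square algebra_simps)
    finally show ?thesis by (simp add: c_def)
  qed
  have mid: "norm (X p + X q - 2 *\<^sub>R X ((p + q) / 2)) \<le> k * (p - q)\<^sup>2"
    using *[OF pq] *[OF pq(2,1)] by (cases "p \<le> q") (auto simp: add.commute power2_commute)
  have "norm (2 *\<^sub>R X ((p + q) / 2) - 2 *\<^sub>R X m) = 2 * norm (X ((p + q) / 2) - X m)"
    by (simp flip: scaleR_diff_right)
  also have "\<dots> \<le> 2 * (K * \<bar>(p + q) / 2 - m\<bar>)"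
    using lipschitz_onD[OF X, of "(p + q) / 2" m] pq m by (auto simp: dist_norm)
  also have "\<dots> = K * \<bar>p + q - 2 * m\<bar>"
  proof -
    have "2 * ((p + q) / 2 - m) = p + q - 2 * m" by (simp add: field_simps)
    then have "2 * \<bar>(p + q) / 2 - m\<bar> = \<bar>p + q - 2 * m\<bar>" by (metis abs_mult abs_numeral)
    then show ?thesis by (metis mult.left_commute)
  qed
  finally have "norm (2 *\<^sub>R X ((p + q) / 2) - 2 *\<^sub>R X m) \<le> K * \<bar>p + q - 2 * m\<bar>" .
  then show ?thesis
    using mid norm_triangle_ineq[of "X p + X q - 2 *\<^sub>R X ((p + q) / 2)" "2 *\<^sub>R X ((p + q) / 2) - 2 *\<^sub>R X m"] by simp
qed

text \<open>Off a null set \<open>X\<close> has the derivative of the primitive of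
  \<open>\<phi>\<close>, so the two differ by a constant. For a continuous control the state
  equation thus holds at every interior time.\<close>

lemma ae_derivative_imp_derivative:
  fixes X :: "real \<Rightarrow> 'a::euclidean_space"
  assumes X: "K-lipschitz_on {l..u} X" and N: "negligible N"
    and der: "\<And>s. s \<in> {l<..<u} - N \<Longrightarrow> (X has_vector_derivative \<phi> s) (at s)"
    and \<phi>: "continuous_on {l..u} \<phi>" and s: "s \<in> {l<..<u}"
  shows "(X has_vector_derivative \<phi> s) (at s)"
proof -
  obtain B where B: "\<And>s. s \<in> {l..u} \<Longrightarrow> norm (\<phi> s) \<le> B" "0 \<le> B"
    using continuous_on_Icc_bounded[OF \<phi>] by blast
  have lip: "B-lipschitz_on {l..u} (\<lambda>s. integral {l..s} \<phi>)"
    by (rule continuous_indefinite_integral_lipschitz[OF \<phi> B])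
  have eq: "X v = X l + integral {l..v} \<phi>" if v: "v \<in> {l<..<u}" for v
  proof -
    have "norm ((X v - integral {l..v} \<phi>) - (X l - integral {l..l} \<phi>)) \<le> integral {l..v} (\<lambda>_. 0)"
    proof (rule lipschitz_ae_integral_bound[OF _ _ N])
      show "(K + B)-lipschitz_on {l..v} (\<lambda>s. X s - integral {l..s} \<phi>)"
        using v by (intro lipschitz_on_diff lipschitz_on_subset[OF X] lipschitz_on_subset[OF lip]) auto
      fix z assume z: "z \<in> {l<..<v} - N"
      have "((\<lambda>s. X s - integral {l..s} \<phi>) has_vector_derivative \<phi> z - \<phi> z) (at z)"
        using z v by (intro has_vector_derivative_diff der integral_has_vector_derivative_interior[OF \<phi>]) auto
      then show "\<exists>D. ((\<lambda>s. X s - integral {l..s} \<phi>) has_vector_derivative D) (at z) \<and> norm D \<le> 0"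
        by (intro exI[of _ "\<phi> z - \<phi> z"]) auto
    qed (use v in auto)
    then show ?thesis by (simp add: algebra_simps)
  qed
  have "((\<lambda>v. X l + integral {l..v} \<phi>) has_vector_derivative 0 + \<phi> s) (at s)"
    by (intro has_vector_derivative_add has_vector_derivative_const integral_has_vector_derivative_interior[OF \<phi> s])
  then have "(X has_vector_derivative 0 + \<phi> s) (at s)"
    by (rule has_vector_derivative_transform_within_open[of _ _ _ "{l<..<u}"]) (use s eq in auto)
  then show ?thesis by simp
qed

lemma lipschitz_derivative_bound:
  fixes X :: "real \<Rightarrow> 'a::real_normed_vector"
  assumes X: "K-lipschitz_on {l..u} X" and der: "(X has_vector_derivative D) (at s)" and s: "s \<in> {l<..<u}"
  shows "norm D \<le> K"
proof (rule field_le_epsilon)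
  fix e :: real assume "0 < e"
  then obtain d where d: "d > 0" "\<And>y. norm (y - s) < d \<Longrightarrow> norm (X y - X s - (y - s) *\<^sub>R D) \<le> e * norm (y - s)"
    using der unfolding has_vector_derivative_def has_derivative_at_alt by blast
  define c where "c = min (d / 2) ((u - s) / 2)"
  have c: "0 < c" "c < d" "s + c < u" using d(1) s by (auto simp: c_def min_def field_simps)
  have "norm (X (s + c) - X s - c *\<^sub>R D) \<le> e * c" using d(2)[of "s + c"] c by simp
  moreover have "norm (X (s + c) - X s) \<le> K * c"
    using lipschitz_onD[OF X, of "s + c" s] s c by (auto simp: dist_norm)
  moreover have "norm (c *\<^sub>R D) \<le> norm (X (s + c) - X s) + norm (X (s + c) - X s - c *\<^sub>R D)"
    using norm_triangle_ineq4[of "X (s + c) - X s" "X (s + c) - X s - c *\<^sub>R D"] by simp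
  ultimately have "c * norm D \<le> c * (K + e)" using c(1) by (simp add: algebra_simps)
  then show "norm D \<le> K + e" using c(1) by simp
qed

text \<open>Young's inequality with weight \<open>k\<close> stands in for Cauchy-Schwarz:
  \<open>k = 1 / H\<close> gives the constant \<open>(1 + b) / 2\<close>, and for
  \<open>H = 0\<close> the weight tends to infinity.\<close>

lemma integral_le_L2_bound:
  fixes \<phi> :: "real \<Rightarrow> real"
  assumes cont: "continuous_on {-b..0} \<phi>" and "0 < b" and H: "0 \<le> H"
    and sq: "integral {-b..0} (\<lambda>\<theta>. (\<phi> \<theta>)\<^sup>2) \<le> H\<^sup>2"
  shows "integral {-b..0} \<phi> \<le> (1 + b) / 2 * H"
proof -
  have *: "integral {-b..0} \<phi> \<le> k / 2 * H\<^sup>2 + b / (2 * k)" if "k > 0" for k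
  proof -
    have "integral {-b..0} \<phi> \<le> integral {-b..0} (\<lambda>\<theta>. k / 2 * (\<phi> \<theta>)\<^sup>2 + 1 / (2 * k))"
    proof (intro integral_le integrable_continuous_real continuous_intros cont)
      fix \<theta>
      have "0 \<le> (k * \<phi> \<theta> - 1)\<^sup>2" by simp
      then have "2 * k * \<phi> \<theta> \<le> k\<^sup>2 * (\<phi> \<theta>)\<^sup>2 + 1" by (simp add: power2_eq_square algebra_simps)
      then have "(2 * k * \<phi> \<theta>) / (2 * k) \<le> (k\<^sup>2 * (\<phi> \<theta>)\<^sup>2 + 1) / (2 * k)" using that by (intro divide_right_mono) auto
      then show "\<phi> \<theta> \<le> k / 2 * (\<phi> \<theta>)\<^sup>2 + 1 / (2 * k)"
        using that by (simp add: add_divide_distrib power2_eq_square)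
    qed
    also have "\<dots> = k / 2 * integral {-b..0} (\<lambda>\<theta>. (\<phi> \<theta>)\<^sup>2) + integral {-b..0} (\<lambda>\<theta>. 1 / (2 * k))"
      by (subst Henstock_Kurzweil_Integration.integral_add) (auto intro!: integrable_continuous_real continuous_intros cont)
    also have "\<dots> \<le> k / 2 * H\<^sup>2 + b / (2 * k)"
      using sq that \<open>0 < b\<close> by (intro add_mono mult_left_mono) auto
    finally show ?thesis .
  qed
  show ?thesis
  proof (cases "H = 0")
    case True
    have "integral {-b..0} \<phi> \<le> 0 + e" if "e > 0" for e
      using *[of "b / (2 * e)"] True that \<open>0 < b\<close> by simp
    then have "integral {-b..0} \<phi> \<le> 0" by (rule field_le_epsilon)
    then show ?thesis using True by simp
  next
    case False
    then have "H > 0" using H by simp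
    then have "1 / H / 2 * H\<^sup>2 + b / (2 * (1 / H)) = (1 + b) / 2 * H" by (simp add: power2_eq_square field_simps)
    then show ?thesis using *[of "1 / H"] \<open>H > 0\<close> by simp
  qed
qed

lemma integral_if_const_le:
  fixes c :: real
  assumes "0 \<le> c" "p \<le> q"
  shows "integral {l..u} (\<lambda>s. if s \<in> {p..q} then c else 0) \<le> c * (q - p)"
proof -
  have "integral {l..u} (\<lambda>s. if s \<in> {p..q} then c else 0) = integral {max p l..min q u} (\<lambda>_. c)"
    by (simp only: Henstock_Kurzweil_Integration.integral_restrict_Int Int_atLeastAtMost)
  also have "\<dots> \<le> c * (q - p)"
  proof (cases "max p l \<le> min q u")
    case True
    then have "integral {max p l..min q u} (\<lambda>_. c) = c * (min q u - max p l)" by (simp add: mult.commute)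
    also have "\<dots> \<le> c * (q - p)" using assms(1) by (intro mult_left_mono) auto
    finally show ?thesis .
  next
    case False
    then show ?thesis using assms by simp
  qed
  finally show ?thesis .
qed

text \<open>The end points and the members of \<open>F\<close> between them, in sorted order, form
  the partition that \<open>W_hist\<close> asks for.\<close>

lemma partition_avoiding_finite:
  fixes F :: "real set"
  assumes "finite F" "p < q"
  shows "\<exists>(n::nat) \<theta>. \<theta> 0 = p \<and> \<theta> n = q \<and> (\<forall>j<n. \<theta> j < \<theta> (Suc j)) \<and>
    (\<forall>j<n. {\<theta> j<..<\<theta> (Suc j)} \<inter> F = {}) \<and> (\<forall>j\<le>n. \<theta> j \<in> {p..q})"
proof -
  define G where "G = insert p (insert q (F \<inter> {p..q}))"
  define xs where "xs = sorted_list_of_set G"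
  have fin: "finite G" using assms by (simp add: G_def)
  have set: "set xs = G" using fin by (simp add: xs_def)
  have sorted: "sorted xs" "distinct xs" by (simp_all add: xs_def)
  have lt: "xs ! i < xs ! j" if "i < j" "j < length xs" for i j
    by (rule sorted_wrt_nth_less[of "(<)" xs]) (use that in \<open>simp_all add: xs_def\<close>)
  define n where "n = length xs - 1"
  have ne: "xs \<noteq> []" using set by (auto simp: G_def)
  then have len: "length xs = Suc n" by (simp add: n_def)
  have range: "xs ! j \<in> {p..q}" if "j \<le> n" for j
  proof -
    have "xs ! j \<in> G" unfolding set[symmetric] using that len by (intro nth_mem) simp
    then show ?thesis using \<open>p < q\<close> by (auto simp: G_def)
  qed
  have "p \<in> set xs" "q \<in> set xs" unfolding set by (simp_all add: G_def)
  then obtain i k where i: "i < length xs" "xs ! i = p" and k: "k < length xs" "xs ! k = q"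
    unfolding in_set_conv_nth by blast
  have "i = 0" using lt[of 0 i] i range[of 0] by (cases "i = 0") simp_all
  have "k = n" using lt[of k n] k range[of n] len by (cases "k = n") simp_all
  show ?thesis
  proof (intro exI[of _ n] exI[of _ "\<lambda>j. xs ! j"] conjI allI impI)
    show "xs ! 0 = p" "xs ! n = q" using i k \<open>i = 0\<close> \<open>k = n\<close> by auto
    fix j assume j: "j < n"
    show "xs ! j < xs ! Suc j" using j len by (intro lt) auto
    show "{xs ! j<..<xs ! Suc j} \<inter> F = {}"
    proof (rule equals0I)
      fix z assume z: "z \<in> {xs ! j<..<xs ! Suc j} \<inter> F"
      moreover have "xs ! j \<in> {p..q}" "xs ! Suc j \<in> {p..q}" by (rule range, use j in simp)+
      ultimately have "z \<in> G" by (auto simp: G_def)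
      then obtain l where l: "l < length xs" "xs ! l = z" unfolding set[symmetric] in_set_conv_nth by blast
      have "l \<le> j \<or> Suc j \<le> l" by linarith
      then show False
      proof
        assume "l \<le> j"
        then have "xs ! l \<le> xs ! j" using sorted(1) j len by (intro sorted_nth_mono) auto
        then show False using z l by auto
      next
        assume "Suc j \<le> l"
        then have "xs ! Suc j \<le> xs ! l" using sorted(1) l by (intro sorted_nth_mono) auto
        then show False using z l by auto
      qed
    qed
  qed (rule range)
qed

text \<open>At points of \<open>F\<close> and at the end points \<open>hist_deriv\<close> may differ
  from \<open>D\<close>. As these are finitely many, it inherits from \<open>D\<close> the
  measurability that the estimate of the essential supremum requires; its bound is the Lipschitz
  constant of \<open>u\<close>.\<close>

lemma W_histI:
  fixes u D :: "real \<Rightarrow> 'a::euclidean_space"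
  assumes b: "0 < b" and u: "r-lipschitz_on {-b..0} u" and bd: "\<And>\<theta>. \<theta> \<in> {-b..0} \<Longrightarrow> norm (u \<theta>) \<le> r"
    and F: "finite F" and der: "\<And>\<theta>. \<theta> \<in> {-b<..<0} - F \<Longrightarrow> (u has_vector_derivative D \<theta>) (at \<theta>)"
    and D: "D \<in> borel_measurable borel"
    and lip: "\<And>p q. \<lbrakk>p \<in> {-b..0}; q \<in> {-b..0}; p < q; {p<..<q} \<inter> F = {}\<rbrakk> \<Longrightarrow> r-lipschitz_on {p<..<q} D"
  shows "u \<in> W_hist b r"
    and "\<And>\<theta>. \<theta> \<in> {-b<..<0} - F \<Longrightarrow> hist_deriv b u \<theta> = D \<theta>"
proof -
  show hd: "hist_deriv b u \<theta> = D \<theta>" if "\<theta> \<in> {-b<..<0} - F" for \<theta>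
    unfolding hist_deriv_def using der[OF that] that
    by (subst at_within_Icc_at) (auto intro: vector_derivative_at)
  define X where "X = (F \<inter> {-b..0}) \<union> {-b, 0}"
  have X: "finite X" "X \<subseteq> {-b..0}" using F b by (auto simp: X_def)
  have hdX: "hist_deriv b u \<theta> = D \<theta>" if "\<theta> \<in> {-b..0}" "\<theta> \<notin> X" for \<theta>
    using that by (intro hd) (auto simp: X_def)
  have "D \<in> borel_measurable (lebesgue_on {-b..0})"
    using D by (intro measurable_restrict_space1 measurable_completion) simp
  then have meas: "hist_deriv b u \<in> borel_measurable (lebesgue_on {-b..0})"
  proof (rule measurable_discrete_difference)
    show "countable X" using X(1) by (rule countable_finite)
    show "{x} \<in> sets (lebesgue_on {-b..0})" if "x \<in> X" for x
      using that X(2) by (auto simp: sets_restrict_space)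
    show "D x = hist_deriv b u x" if "x \<in> space (lebesgue_on {-b..0})" "x \<notin> X" for x
      using that hdX by (auto simp: space_restrict_space)
  qed auto
  have Dr: "norm (D \<theta>) \<le> r" if "\<theta> \<in> {-b<..<0} - F" for \<theta>
    using that by (intro lipschitz_derivative_bound[OF u der[OF that]]) auto
  have "norm_Linf b (hist_deriv b u) \<le> ereal r"
  proof (rule norm_Linf_leI[OF meas])
    show "negligible X" using X(1) by (rule negligible_finite)
    fix \<theta> assume "\<theta> \<in> {-b..0} - X"
    then have \<theta>: "\<theta> \<in> {-b<..<0} - F" by (auto simp: X_def)
    show "norm (hist_deriv b u \<theta>) \<le> r" unfolding hd[OF \<theta>] by (rule Dr[OF \<theta>])
  qed
  then have V: "u \<in> V_hist b r" using P_histI[OF u bd] by (simp add: V_hist_def)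
  have "-b < 0" using b by simp
  from partition_avoiding_finite[OF F this] obtain n :: nat and \<theta> where \<theta>01: "\<theta> 0 = -b" "\<theta> n = 0"
    and \<theta>': "\<forall>j<n. \<theta> j < \<theta> (Suc j)" "\<forall>j<n. {\<theta> j<..<\<theta> (Suc j)} \<inter> F = {}" "\<forall>j\<le>n. \<theta> j \<in> {-b..0}"
    by (elim exE conjE)
  note \<theta> = \<theta>01 \<theta>'[rule_format]
  have sub: "\<xi> \<in> {-b<..<0} - F" if "j < n" "\<xi> \<in> {\<theta> j<..<\<theta> (Suc j)}" for j \<xi>
  proof -
    have "\<theta> j \<in> {-b..0}" "\<theta> (Suc j) \<in> {-b..0}" using \<theta>(5)[of j] \<theta>(5)[of "Suc j"] that(1) by auto
    then show ?thesis using that(2) \<theta>(4)[OF that(1)] by auto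
  qed
  show "u \<in> W_hist b r"
    unfolding W_hist_def
  proof (rule CollectI, intro conjI V exI[of _ n] exI[of _ \<theta>] allI impI ballI \<theta>(1,2))
    fix j assume j: "j < n"
    show "\<theta> j < \<theta> (Suc j)" by (rule \<theta>(3)[OF j])
    show "u differentiable (at \<xi> within {-b..0})" if "\<xi> \<in> {\<theta> j<..<\<theta> (Suc j)}" for \<xi>
      using der[OF sub[OF j that]] differentiableI_vector differentiable_at_withinI by blast
    have "r-lipschitz_on {\<theta> j<..<\<theta> (Suc j)} D"
      using \<theta>(5)[of j] \<theta>(5)[of "Suc j"] j by (intro lip \<theta>(3,4)) auto
    then show "r-lipschitz_on {\<theta> j<..<\<theta> (Suc j)} (hist_deriv b u)"
      by (rule lipschitz_on_transform) (rule hd[OF sub[OF j]])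
  qed
qed

text \<open>The last bound is the one-dimensional Sobolev embedding:
  \<open>norm (w \<theta>)\<close> is compared with the mean of \<open>norm (w s)\<close>, up to an
  oscillation bounded by the integral of the derivative. Integrating over the interval and dividing
  by \<open>b\<close> produces the constant.\<close>

lemma norm_H1_W':
  fixes w :: "real \<Rightarrow> 'a::euclidean_space"
  assumes w: "w \<in> W'_hist b r" and b: "0 < b" and r: "0 < r"
  shows "(norm_H1 b w)\<^sup>2 = integral {-b..0} (\<lambda>\<theta>. (norm (w \<theta>))\<^sup>2) + integral {-b..0} (\<lambda>\<theta>. (norm (hist_deriv b w \<theta>))\<^sup>2)"
    and "0 \<le> norm_H1 b w"
    and "integral {-b..0} (\<lambda>\<theta>. (norm (hist_deriv b w \<theta>))\<^sup>2) \<le> (norm_H1 b w)\<^sup>2"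
    and "integral {-b..0} (\<lambda>\<theta>. norm (hist_deriv b w \<theta>)) \<le> (1 + b) / 2 * norm_H1 b w"
    and "\<And>\<theta>. \<theta> \<in> {-b..0} \<Longrightarrow> norm (w \<theta>) \<le> (1 + b)\<^sup>2 / (2 * b) * norm_H1 b w"
proof -
  note reg = W'_hist_regular[OF w b r]
  have c: "continuous_on {-b..0} w" "continuous_on {-b..0} (hist_deriv b w)"
    using reg(4,5) lipschitz_on_continuous_on by blast+
  have e1: "(LINT \<theta>:{-b..0}|lebesgue. (norm (w \<theta>))\<^sup>2) = integral {-b..0} (\<lambda>\<theta>. (norm (w \<theta>))\<^sup>2)"
    by (intro set_lebesgue_integral_eq_integral(2) absolutely_integrable_continuous_real continuous_intros c)
  have e2: "(LINT \<theta>:{-b..0}|lebesgue. (norm (hist_deriv b w \<theta>))\<^sup>2) = integral {-b..0} (\<lambda>\<theta>. (norm (hist_deriv b w \<theta>))\<^sup>2)"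
    by (intro set_lebesgue_integral_eq_integral(2) absolutely_integrable_continuous_real continuous_intros c)
  have n1: "0 \<le> integral {-b..0} (\<lambda>\<theta>. (norm (w \<theta>))\<^sup>2)" and n2: "0 \<le> integral {-b..0} (\<lambda>\<theta>. (norm (hist_deriv b w \<theta>))\<^sup>2)"
    by (intro integral_nonneg integrable_continuous_real continuous_intros c; simp)+
  show eq: "(norm_H1 b w)\<^sup>2 = integral {-b..0} (\<lambda>\<theta>. (norm (w \<theta>))\<^sup>2) + integral {-b..0} (\<lambda>\<theta>. (norm (hist_deriv b w \<theta>))\<^sup>2)"
    unfolding norm_H1_def e1 e2 using n1 n2 by simp
  show H0: "0 \<le> norm_H1 b w" unfolding norm_H1_def e1 e2 using n1 n2 by simp
  show s2: "integral {-b..0} (\<lambda>\<theta>. (norm (hist_deriv b w \<theta>))\<^sup>2) \<le> (norm_H1 b w)\<^sup>2" using eq n1 by simp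
  have s1: "integral {-b..0} (\<lambda>\<theta>. (norm (w \<theta>))\<^sup>2) \<le> (norm_H1 b w)\<^sup>2" using eq n2 by simp
  show i2: "integral {-b..0} (\<lambda>\<theta>. norm (hist_deriv b w \<theta>)) \<le> (1 + b) / 2 * norm_H1 b w"
    by (rule integral_le_L2_bound[OF continuous_on_norm[OF c(2)] b H0 s2])
  have i1: "integral {-b..0} (\<lambda>\<theta>. norm (w \<theta>)) \<le> (1 + b) / 2 * norm_H1 b w"
    by (rule integral_le_L2_bound[OF continuous_on_norm[OF c(1)] b H0 s1])
  have der: "(w has_vector_derivative hist_deriv b w s) (at s)" if "s \<in> {-b<..<0}" for s
    using reg(1)[of s] that by (auto simp: at_within_Icc_at)
  have osc: "norm (w q - w p) \<le> (1 + b) / 2 * norm_H1 b w" if "p \<in> {-b..0}" "q \<in> {-b..0}" "p \<le> q" for p q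
  proof -
    have sub: "{p..q} \<subseteq> {-b..0}" using that by auto
    have "norm (w q - w p) \<le> integral {p..q} (\<lambda>\<theta>. norm (hist_deriv b w \<theta>))"
    proof (rule lipschitz_ae_integral_bound[OF lipschitz_on_subset[OF reg(5) sub] that(3) negligible_empty
            continuous_on_norm[OF continuous_on_subset[OF c(2) sub]]])
      fix s assume "s \<in> {p<..<q} - {}"
      then show "\<exists>D. (w has_vector_derivative D) (at s) \<and> norm D \<le> norm (hist_deriv b w s)"
        using that by (intro exI[of _ "hist_deriv b w s"] conjI der) auto
    qed
    also have "\<dots> \<le> integral {-b..0} (\<lambda>\<theta>. norm (hist_deriv b w \<theta>))"
      by (intro integral_subset_le sub integrable_continuous_real continuous_on_norm c continuous_on_subset[OF c(2) sub]) auto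
    finally show ?thesis using i2 by linarith
  qed
  show "norm (w \<theta>) \<le> (1 + b)\<^sup>2 / (2 * b) * norm_H1 b w" if \<theta>: "\<theta> \<in> {-b..0}" for \<theta>
  proof -
    have le: "norm (w \<theta>) \<le> norm (w s) + (1 + b) / 2 * norm_H1 b w" if s: "s \<in> {-b..0}" for s
      using osc[OF s \<theta>] osc[OF \<theta> s] norm_triangle_ineq2[of "w \<theta>" "w s"] by (cases "s \<le> \<theta>") (auto simp: norm_minus_commute)
    have "integral {-b..0} (\<lambda>s. norm (w \<theta>)) \<le> integral {-b..0} (\<lambda>s. norm (w s) + (1 + b) / 2 * norm_H1 b w)"
      by (intro integral_le integrable_continuous_real continuous_intros c le)
    also have "\<dots> = integral {-b..0} (\<lambda>s. norm (w s)) + integral {-b..0} (\<lambda>s. (1 + b) / 2 * norm_H1 b w)"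
      by (intro Henstock_Kurzweil_Integration.integral_add integrable_continuous_real continuous_intros c)
    also have "integral {-b..0} (\<lambda>s. (1 + b) / 2 * norm_H1 b w) = b * ((1 + b) / 2 * norm_H1 b w)"
      using b by (subst integral_const_real) simp
    also have "integral {-b..0} (\<lambda>s. norm (w \<theta>)) = b * norm (w \<theta>)" using b by (subst integral_const_real) simp
    finally have "b * norm (w \<theta>) \<le> (1 + b) / 2 * norm_H1 b w + b * ((1 + b) / 2 * norm_H1 b w)"
      using i1 by linarith
    also have "\<dots> = (1 + b)\<^sup>2 / 2 * norm_H1 b w" by (simp add: power2_eq_square algebra_simps add_divide_distrib)
    finally have "norm (w \<theta>) \<le> ((1 + b)\<^sup>2 / 2 * norm_H1 b w) / b" using b by (simp add: pos_le_divide_eq mult_ac)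
    then show ?thesis by simp
  qed
qed

section \<open>Trajectories with perturbed initial data\<close>

lemma norm_diff_via: "norm (p - q) \<le> norm (p - m) + norm (m - q :: 'a::real_normed_vector)"
  using dist_triangle[of p q m] by (simp add: dist_norm)

lemma second_difference_via_midpoint:
  fixes p q m z X Y u :: real
  assumes "\<bar>p + q - 2 * m\<bar> \<le> X" "\<bar>m - z\<bar> \<le> Y / 2"
  shows "\<bar>u - p + (u - q) - 2 * (u - z)\<bar> \<le> X + Y"
  using assms unfolding abs_le_iff by auto

context smooth_delay_control_problem
begin

definition "fC R = (SOME C. C \<ge> 1 \<and> (\<forall>t\<in>{t0..T}. \<forall>t'\<in>{t0..T}. \<forall>a\<in>A. \<forall>a'\<in>A. \<forall>z\<in>cball 0 R. \<forall>z'\<in>cball 0 R. \<forall>y\<in>cball 0 R. \<forall>y'\<in>cball 0 R.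
     norm (f t z y a - f t' z' y' a') \<le> C * (\<bar>t - t'\<bar> + norm (z - z') + norm (y - y') + norm (a - a'))))"

lemma fC:
  shows "1 \<le> fC R"
    and "\<lbrakk>t \<in> {t0..T}; t' \<in> {t0..T}; a \<in> A; a' \<in> A; norm z \<le> R; norm z' \<le> R; norm y \<le> R; norm y' \<le> R\<rbrakk> \<Longrightarrow>
     norm (f t z y a - f t' z' y' a') \<le> fC R * (\<bar>t - t'\<bar> + norm (z - z') + norm (y - y') + norm (a - a'))"
proof -
  note D = someI_ex[OF C1_lipschitz_on_ball[OF f_C1, of R], folded fC_def]
  show "1 \<le> fC R" by (rule D[THEN conjunct1])
  show "norm (f t z y a - f t' z' y' a') \<le> fC R * (\<bar>t - t'\<bar> + norm (z - z') + norm (y - y') + norm (a - a'))"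
    if "t \<in> {t0..T}" "t' \<in> {t0..T}" "a \<in> A" "a' \<in> A" "norm z \<le> R" "norm z' \<le> R" "norm y \<le> R" "norm y' \<le> R"
    using D[THEN conjunct2, rule_format, OF that(1-4)] that(5-8) by simp
qed

definition "LC R = (SOME C. C \<ge> 1 \<and> (\<forall>t\<in>{t0..T}. \<forall>t'\<in>{t0..T}. \<forall>a\<in>A. \<forall>a'\<in>A. \<forall>z\<in>cball 0 R. \<forall>z'\<in>cball 0 R. \<forall>y\<in>cball 0 R. \<forall>y'\<in>cball 0 R.
     norm (L t z y a - L t' z' y' a') \<le> C * (\<bar>t - t'\<bar> + norm (z - z') + norm (y - y') + norm (a - a'))))"

lemma LC:
  shows "1 \<le> LC R"
    and "\<lbrakk>t \<in> {t0..T}; t' \<in> {t0..T}; a \<in> A; a' \<in> A; norm z \<le> R; norm z' \<le> R; norm y \<le> R; norm y' \<le> R\<rbrakk> \<Longrightarrow>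
     \<bar>L t z y a - L t' z' y' a'\<bar> \<le> LC R * (\<bar>t - t'\<bar> + norm (z - z') + norm (y - y') + norm (a - a'))"
proof -
  note D = someI_ex[OF C1_lipschitz_on_ball[OF L_C1, of R], folded LC_def]
  show "1 \<le> LC R" by (rule D[THEN conjunct1])
  show "\<bar>L t z y a - L t' z' y' a'\<bar> \<le> LC R * (\<bar>t - t'\<bar> + norm (z - z') + norm (y - y') + norm (a - a'))"
    if "t \<in> {t0..T}" "t' \<in> {t0..T}" "a \<in> A" "a' \<in> A" "norm z \<le> R" "norm z' \<le> R" "norm y \<le> R" "norm y' \<le> R"
    using D[THEN conjunct2, rule_format, OF that(1-4)] that(5-8) by simp
qed

definition "fD R = (SOME \<gamma>. 0 < \<gamma> \<and> (\<forall>t\<in>{t0..T}. \<forall>a\<in>A.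
          \<forall>z1\<in>cball 0 R. \<forall>z2\<in>cball 0 R. \<forall>y1\<in>cball 0 R. \<forall>y2\<in>cball 0 R.
          norm (f t z1 y1 a + f t z2 y2 a - 2 *\<^sub>R f t ((1/2) *\<^sub>R (z1 + z2)) ((1/2) *\<^sub>R (y1 + y2)) a)
            \<le> \<gamma> * ((norm (z1 - z2))\<^sup>2 + (norm (y1 - y2))\<^sup>2)))"

lemma fD:
  assumes "0 < R"
  shows "0 < fD R"
    and "\<lbrakk>t \<in> {t0..T}; a \<in> A; norm z1 \<le> R; norm z2 \<le> R; norm y1 \<le> R; norm y2 \<le> R\<rbrakk> \<Longrightarrow>
     norm (f t z1 y1 a + f t z2 y2 a - 2 *\<^sub>R f t ((1/2) *\<^sub>R (z1 + z2)) ((1/2) *\<^sub>R (y1 + y2)) a)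
            \<le> fD R * ((norm (z1 - z2))\<^sup>2 + (norm (y1 - y2))\<^sup>2)"
proof -
  note D = someI_ex[OF f_second_difference[THEN spec, THEN mp, OF assms], folded fD_def]
  show "0 < fD R" by (rule D[THEN conjunct1])
  show "norm (f t z1 y1 a + f t z2 y2 a - 2 *\<^sub>R f t ((1/2) *\<^sub>R (z1 + z2)) ((1/2) *\<^sub>R (y1 + y2)) a)
            \<le> fD R * ((norm (z1 - z2))\<^sup>2 + (norm (y1 - y2))\<^sup>2)"
    if "t \<in> {t0..T}" "a \<in> A" "norm z1 \<le> R" "norm z2 \<le> R" "norm y1 \<le> R" "norm y2 \<le> R"
    by (rule D[THEN conjunct2, rule_format, OF that(1,2)]) (use that(3-6) in simp_all)
qed

definition "LD R = (SOME \<gamma>. 0 < \<gamma> \<and> (\<forall>t\<in>{t0..T}. \<forall>a\<in>A.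
          \<forall>z1\<in>cball 0 R. \<forall>z2\<in>cball 0 R. \<forall>y1\<in>cball 0 R. \<forall>y2\<in>cball 0 R.
          \<bar>L t z1 y1 a + L t z2 y2 a - 2 * L t ((1/2) *\<^sub>R (z1 + z2)) ((1/2) *\<^sub>R (y1 + y2)) a\<bar>
            \<le> \<gamma> * ((norm (z1 - z2))\<^sup>2 + (norm (y1 - y2))\<^sup>2)))"

lemma LD:
  assumes "0 < R"
  shows "0 < LD R"
    and "\<lbrakk>t \<in> {t0..T}; a \<in> A; norm z1 \<le> R; norm z2 \<le> R; norm y1 \<le> R; norm y2 \<le> R\<rbrakk> \<Longrightarrow>
     \<bar>L t z1 y1 a + L t z2 y2 a - 2 * L t ((1/2) *\<^sub>R (z1 + z2)) ((1/2) *\<^sub>R (y1 + y2)) a\<bar>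
            \<le> LD R * ((norm (z1 - z2))\<^sup>2 + (norm (y1 - y2))\<^sup>2)"
proof -
  note D = someI_ex[OF L_second_difference[THEN spec, THEN mp, OF assms], folded LD_def]
  show "0 < LD R" by (rule D[THEN conjunct1])
  show "\<bar>L t z1 y1 a + L t z2 y2 a - 2 * L t ((1/2) *\<^sub>R (z1 + z2)) ((1/2) *\<^sub>R (y1 + y2)) a\<bar>
            \<le> LD R * ((norm (z1 - z2))\<^sup>2 + (norm (y1 - y2))\<^sup>2)"
    if "t \<in> {t0..T}" "a \<in> A" "norm z1 \<le> R" "norm z2 \<le> R" "norm y1 \<le> R" "norm y2 \<le> R"
    by (rule D[THEN conjunct2, rule_format, OF that(1,2)]) (use that(3-6) in simp_all)
qed

definition "tD R = (SOME \<gamma>. 0 < \<gamma> \<and> (\<forall>t\<in>{t0..T}. \<forall>z1\<in>cball 0 R. \<forall>z2\<in>cball 0 R.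
          \<bar>\<tau> t z1 + \<tau> t z2 - 2 * \<tau> t ((1/2) *\<^sub>R (z1 + z2))\<bar> \<le> \<gamma> * (norm (z1 - z2))\<^sup>2))"

lemma tD:
  assumes "0 < R"
  shows "0 < tD R"
    and "\<lbrakk>t \<in> {t0..T}; norm z1 \<le> R; norm z2 \<le> R\<rbrakk> \<Longrightarrow>
     \<bar>\<tau> t z1 + \<tau> t z2 - 2 * \<tau> t ((1/2) *\<^sub>R (z1 + z2))\<bar> \<le> tD R * (norm (z1 - z2))\<^sup>2"
proof -
  note D = someI_ex[OF delay_second_difference[THEN spec, THEN mp, OF assms], folded tD_def]
  show "0 < tD R" by (rule D[THEN conjunct1])
  show "\<bar>\<tau> t z1 + \<tau> t z2 - 2 * \<tau> t ((1/2) *\<^sub>R (z1 + z2))\<bar> \<le> tD R * (norm (z1 - z2))\<^sup>2"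
    if "t \<in> {t0..T}" "norm z1 \<le> R" "norm z2 \<le> R"
    by (rule D[THEN conjunct2, rule_format, OF that(1)]) (use that(2-3) in simp_all)
qed

lemma stability_same_control:
  assumes a: "a \<in> {t0..T}" and x1: "M-lipschitz_on {a - b..T} x1" and x2: "M-lipschitz_on {a - b..T} x2"
    and hist: "\<And>s. s \<in> {a - b..a} \<Longrightarrow> norm (x2 s - x1 s) \<le> \<eta>" and \<alpha>: "\<And>u. \<alpha> u \<in> A"
    and d1: "\<And>u. u \<in> {a<..<T} \<Longrightarrow> (x1 has_vector_derivative f u (x1 u) (delayed x1 u) (\<alpha> u)) (at u)"
    and d2: "\<And>u. u \<in> {a<..<T} \<Longrightarrow> (x2 has_vector_derivative f u (x2 u) (delayed x2 u) (\<alpha> u)) (at u)"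
    and s: "s \<in> {a - b..T}"
  shows "norm (x2 s - x1 s) \<le> sC M * \<eta>"
proof (rule stability[OF a x1 x2 hist, where E = "\<lambda>_. 0" and KE = 0 and N = "{}" and \<alpha> = \<alpha>])
  have "a \<in> {a - b..a}" using max_delay_pos by simp
  then show "norm (0 :: real ^ 'n) \<le> \<eta>" using order_trans[OF norm_ge_zero hist[OF \<open>a \<in> {a - b..a}\<close>]] by simp
  show "0-lipschitz_on {a..T} (\<lambda>_. 0 :: real ^ 'n)" by (simp add: lipschitz_on_def)
qed (use \<alpha> d1 d2 s in \<open>simp_all\<close>)

lemma trajectory_classical:
  assumes x: "solves t w \<alpha> x" and t: "t \<in> {t0..T}" and \<alpha>c: "continuous_on {t..T} \<alpha>" and \<alpha>A: "\<And>u. \<alpha> u \<in> A"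
    and s: "s \<in> {t<..<T}"
  shows "(x has_vector_derivative f s (x s) (delayed x s) (\<alpha> s)) (at s)"
proof -
  obtain K where K: "K-lipschitz_on {t - b..T} x" using x by (auto simp: is_trajectory_def)
  have sub: "{t..T} \<subseteq> {t - b..T}" using max_delay_pos by auto
  obtain N where N: "negligible N"
    "\<And>s. s \<in> {t<..<T} - N \<Longrightarrow> (x has_vector_derivative f s (x s) (delayed x s) (\<alpha> s)) (at s)"
    using trajectory_derivative_ae[OF x] by blast
  have tt: "{t..T} \<subseteq> {t0..T}" "t0 \<le> t" using t by auto
  have "continuous_on {t..T} (\<lambda>s. f s (x s) (delayed x s) (\<alpha> s))"
    by (intro continuous_on_along[OF f_cont tt(1)] continuous_on_subset[OF lipschitz_on_continuous_on[OF K] sub]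
        continuous_on_delayed[OF tt(2) lipschitz_on_continuous_on[OF K]] \<alpha>c \<alpha>A)
  from ae_derivative_imp_derivative[OF lipschitz_on_subset[OF K sub] N(1) N(2) this s] show ?thesis .
qed

lemma history_derivative:
  assumes x: "solves t w \<alpha> x" and w: "\<And>\<theta>. \<theta> \<in> {-b..0} \<Longrightarrow> (w has_vector_derivative v \<theta>) (at \<theta> within {-b..0})"
    and s: "s \<in> {t - b<..<t}"
  shows "(x has_vector_derivative v (s - t)) (at s)"
proof -
  have "(w has_vector_derivative v (s - t)) (at (s - t))"
    using w[of "s - t"] s by (auto simp: at_within_Icc_at)
  then have "((\<lambda>s. w (s - t)) has_vector_derivative v (s - t)) (at s)" by (rule has_vector_derivative_shift)
  then show ?thesis
    by (rule has_vector_derivative_transform_within_open[of _ _ _ "{t - b<..<t}"])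
       (use s trajectory_history[OF x] in auto)
qed

end

text \<open>No time, step or history is fixed here: whatever is defined in this locale depends,
  besides the data, only on \<open>r\<close> and on the Lipschitz bound \<open>K\<close> of the
  controls, as the order of quantifiers in the theorem requires.\<close>

locale semiconc_const = smooth_delay_control_problem t0 T A f L g \<tau> b
  for t0 T :: real
    and A :: "(real ^ 'm) set"
    and f :: "real \<Rightarrow> real ^ 'n \<Rightarrow> real ^ 'n \<Rightarrow> real ^ 'm \<Rightarrow> real ^ 'n"
    and L :: "real \<Rightarrow> real ^ 'n \<Rightarrow> real ^ 'n \<Rightarrow> real ^ 'm \<Rightarrow> real"
    and g :: "(real ^ 'n) \<times> (real \<Rightarrow> real ^ 'n) \<Rightarrow> real"
    and \<tau> :: "real \<Rightarrow> real ^ 'n \<Rightarrow> real"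
    and b :: real +
  fixes r K :: real
  assumes r_pos: "0 < r" and K_ge: "1 \<le> K"
begin

text \<open>The histories \<open>w + w0\<close> and \<open>w - w0\<close> have size and Lipschitz
  constant at most \<open>2 * r\<close>, hence the radius. In multiples of \<open>eps\<close>,
  \<open>C1\<close> and \<open>C2\<close> bound the distance of the trajectories on the history and
  everywhere, \<open>C3\<close> that of their delayed states, \<open>C6\<close> that of their
  velocities.\<close>

definition "RR = RB (2 * r)"
definition "MM = MB (2 * r)"
definition "DD = dd (2 * r)"
definition "cS = (1 + b)\<^sup>2 / (2 * b)"
definition "C1 = 2 * cS + 5 * MM"
definition "C2 = sC MM * C1"
definition "C3 = C2 * (1 + MM * tL)"
text \<open>The summands measure, in multiples of \<open>h\<close>, how far time, state, delayed
  state and control along \<open>xm\<close> near \<open>t\<close> are from those in the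
  compatibility condition. \<open>C5\<close> is the resulting distance of velocities;
  \<open>C7\<close> and \<open>C8\<close> add the variation of the derivatives of the
  histories.\<close>

definition "C4 = 1 + 2 * MM + MM * (2 + tR RR * (1 + 2 * MM)) + K"
definition "C5 = fC RR * C4"
definition "C6 = fL * (C2 + C3)"
definition "C7 = C5 + 4 * r"
definition "C8 = C5 + C6 + 2 * r"
definition "C9 = 2 * C7 + 2 * C8 + 4"
definition "C10 = 2 * C7 + 2 * C5 + 2 * C6"
text \<open>\<open>kap * eps\<close> bounds the distance between delayed times along different
  trajectories at the same instant, hence the width of the zone around \<open>t\<close> in which
  these may straddle the kink of \<open>x\<close>.\<close>

definition "kap = tL * C2"
definition "kF = fC RR * (1 + MM + MM * dL RR MM + K)"
definition "C11 = C5 + 2 * r + r * (kap + 2)"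
definition "C12 = (kF + r) * kap\<^sup>2 + MM * tD RR * C2\<^sup>2 + MM * tL + kap * C11 + kap * C6"
definition "C13 = 3 * MM * kap + kap"

lemma const_bounds:
  shows "1 \<le> RR" "0 \<le> RR" "0 < RR" "1 \<le> MM" "0 \<le> MM" "2 * r \<le> MM" "0 < DD" "0 < b" "0 < cS" "1 \<le> C1" "1 \<le> C2" "0 < C2" "0 < C3" "1 \<le> fC RR"
    "1 \<le> C4" "1 \<le> C5" "0 \<le> C6" "0 \<le> C7" "0 \<le> C8" "0 < C9" "0 \<le> C10" "0 < kap" "0 \<le> kF" "0 \<le> C11" "0 \<le> C12" "0 \<le> C13"
proof -
  show R: "1 \<le> RR" "0 \<le> RR" "0 < RR" using RB_ge(1)[of "2 * r"] by (auto simp: RR_def)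
  show M: "1 \<le> MM" "0 \<le> MM" "2 * r \<le> MM" by (auto simp: MM_def MB_def)
  show "0 < DD" using dd(1)[of "2 * r"] r_pos by (simp add: DD_def)
  show b: "0 < b" by (rule max_delay_pos)
  then show cS: "0 < cS" by (simp add: cS_def)
  show C1: "1 \<le> C1" using cS M by (simp add: C1_def)
  have "1 * 1 \<le> sC MM * C1" using sC_ge1[OF M(2)] C1 by (intro mult_mono) auto
  then show C2: "1 \<le> C2" "0 < C2" by (simp_all add: C2_def)
  show C3: "0 < C3" using C2 M(2) tL(1) unfolding C3_def by (intro mult_pos_pos add_pos_nonneg) auto
  show fc: "1 \<le> fC RR" by (rule fC(1))
  have tR1: "1 \<le> tR RR" by (rule tR(1)[OF R(2)])
  have "0 \<le> MM * (2 + tR RR * (1 + 2 * MM))" using M tR1 by (intro mult_nonneg_nonneg add_nonneg_nonneg) auto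
  then show C4: "1 \<le> C4" using M K_ge by (simp add: C4_def)
  have "1 * 1 \<le> fC RR * C4" using fc C4 by (intro mult_mono) auto
  then show C5: "1 \<le> C5" by (simp add: C5_def)
  show C6: "0 \<le> C6" using fL(1) C2 C3 by (simp add: C6_def)
  show C7: "0 \<le> C7" using C5 r_pos by (simp add: C7_def)
  show C8: "0 \<le> C8" using C5 C6 r_pos by (simp add: C8_def)
  show "0 < C9" using C7 C8 by (simp add: C9_def)
  show "0 \<le> C10" using C7 C5 C6 by (simp add: C10_def)
  show kap: "0 < kap" using tL(1) C2 by (simp add: kap_def)
  have "0 \<le> dL RR MM" using tR1 M by (simp add: dL_def)
  then show kF: "0 \<le> kF" using fc M K_ge unfolding kF_def by (intro mult_nonneg_nonneg add_nonneg_nonneg) auto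
  show C11: "0 \<le> C11" using C5 r_pos kap by (simp add: C11_def)
  show "0 \<le> C12" unfolding C12_def using kF r_pos M tD(1)[OF R(3)] tL(1) kap C11 C6
    by (intro add_nonneg_nonneg mult_nonneg_nonneg) auto
  show "0 \<le> C13" using M kap by (simp add: C13_def)
qed

end

text \<open>One configuration of the perturbation. The control is Lipschitz with values in
  \<open>A\<close> on the whole line, since \<open>xm\<close> starts before \<open>t\<close>. The
  condition \<open>compat\<close> is membership in the solution manifold with the derivative of the
  difference written out.\<close>

locale semiconc = semiconc_const t0 T A f L g \<tau> b r K
  for t0 T :: real
    and A :: "(real ^ 'm) set"
    and f :: "real \<Rightarrow> real ^ 'n \<Rightarrow> real ^ 'n \<Rightarrow> real ^ 'm \<Rightarrow> real ^ 'n"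
    and L :: "real \<Rightarrow> real ^ 'n \<Rightarrow> real ^ 'n \<Rightarrow> real ^ 'm \<Rightarrow> real"
    and g :: "(real ^ 'n) \<times> (real \<Rightarrow> real ^ 'n) \<Rightarrow> real"
    and \<tau> :: "real \<Rightarrow> real ^ 'n \<Rightarrow> real"
    and b r K :: real +
  fixes h t :: real and w w0 :: "real \<Rightarrow> real ^ 'n" and \<alpha> :: "real \<Rightarrow> real ^ 'm" and x xp xm :: "real \<Rightarrow> real ^ 'n"
  assumes h_pos: "0 < h" and t_low: "t0 \<le> t - h" and t_up: "t + h \<le> T"
    and w: "w \<in> W'_hist b r" and w0: "w0 \<in> W'_hist b r"
    and \<alpha>_lip: "K-lipschitz_on UNIV \<alpha>" and \<alpha>A: "\<And>u. \<alpha> u \<in> A"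
    and compat: "hist_deriv b w 0 - hist_deriv b w0 0 =
       f t (w 0 - w0 0) (w (- \<tau> t (w 0 - w0 0)) - w0 (- \<tau> t (w 0 - w0 0))) (\<alpha> t)"
    and x: "solves t w \<alpha> x" and xp: "solves (t + h) (\<lambda>\<theta>. w \<theta> + w0 \<theta>) \<alpha> xp"
    and xm: "solves (t - h) (\<lambda>\<theta>. w \<theta> - w0 \<theta>) \<alpha> xm"
begin

abbreviation "v \<equiv> hist_deriv b w"
abbreviation "v0 \<equiv> hist_deriv b w0"
definition "H = norm_H1 b w0"
definition "eps = h + H"
definition "S s = xp s + xm s - 2 *\<^sub>R x s"
text \<open>The left velocity of \<open>xm\<close> at \<open>t - h\<close>. By \<open>compat\<close>
  it is also \<open>f\<close> at time \<open>t\<close> with the state and delayed state of that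
  history, which makes it the common reference velocity on \<open>{t - h..t + h}\<close>.\<close>

definition "F0 = v 0 - v0 0"

lemma H_nonneg: "0 \<le> H"
  unfolding H_def by (rule norm_H1_W'(2)[OF w0 max_delay_pos r_pos])

lemma eps: "0 < eps" "h \<le> eps" "H \<le> eps" "0 \<le> eps"
  using H_nonneg h_pos by (auto simp: eps_def)

lemma t_range: "t \<in> {t0..T}" "t + h \<in> {t0..T}" "t - h \<in> {t0..T}" "t0 \<le> t" "t0 \<le> t + h"
  using h_pos t_low t_up by auto

lemmas w_reg = W'_hist_regular[OF w max_delay_pos r_pos]
lemmas w0_reg = W'_hist_regular[OF w0 max_delay_pos r_pos]

lemma w0_sup: "\<theta> \<in> {-b..0} \<Longrightarrow> norm (w0 \<theta>) \<le> cS * H"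
  unfolding cS_def H_def by (rule norm_H1_W'(5)[OF w0 max_delay_pos r_pos])

lemma \<alpha>_cont: "continuous_on X \<alpha>"
  using continuous_on_subset[OF lipschitz_on_continuous_on[OF \<alpha>_lip]] by blast

lemma \<alpha>_controls: "\<alpha> \<in> controls A s T"
  unfolding controls_def using \<alpha>A by (auto intro!: continuous_imp_measurable_on_sets_lebesgue \<alpha>_cont)

lemma \<alpha>_diff: "norm (\<alpha> s - \<alpha> u) \<le> K * \<bar>s - u\<bar>"
  using lipschitz_onD[OF \<alpha>_lip, of s u] by (simp add: dist_norm)

section \<open>Uniform bounds and first order closeness of the three trajectories\<close>

lemma traj_lip: "MM-lipschitz_on {t - b..T} x" "MM-lipschitz_on {t + h - b..T} xp" "MM-lipschitz_on {t - h - b..T} xm"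
  and traj_bound: "\<And>s. s \<in> {t - b..T} \<Longrightarrow> norm (x s) \<le> RR" "\<And>s. s \<in> {t + h - b..T} \<Longrightarrow> norm (xp s) \<le> RR"
     "\<And>s. s \<in> {t - h - b..T} \<Longrightarrow> norm (xm s) \<le> RR"
proof -
  have lw: "(2 * r)-lipschitz_on {-b..0} w" using w_reg(5) by (rule lipschitz_on_le) (use r_pos in simp)
  have lp: "(2 * r)-lipschitz_on {-b..0} (\<lambda>\<theta>. w \<theta> + w0 \<theta>)" and lm: "(2 * r)-lipschitz_on {-b..0} (\<lambda>\<theta>. w \<theta> - w0 \<theta>)"
    using lipschitz_on_add[OF w_reg(5) w0_reg(5)] lipschitz_on_diff[OF w_reg(5) w0_reg(5)] by simp_all
  have bw: "norm (w \<theta>) \<le> 2 * r" "norm (w \<theta> + w0 \<theta>) \<le> 2 * r" "norm (w \<theta> - w0 \<theta>) \<le> 2 * r" if "\<theta> \<in> {-b..0}" for \<theta>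
    using w_reg(2)[OF that] w0_reg(2)[OF that] norm_triangle_ineq[of "w \<theta>" "w0 \<theta>"] norm_triangle_ineq4[of "w \<theta>" "w0 \<theta>"] r_pos by linarith+
  show "MM-lipschitz_on {t - b..T} x" unfolding MM_def
    by (rule trajectory_bounds(2)[OF t_range(1) \<alpha>_controls lw bw(1) x order.refl])
  show "MM-lipschitz_on {t + h - b..T} xp" unfolding MM_def
    by (rule trajectory_bounds(2)[OF t_range(2) \<alpha>_controls lp bw(2) xp order.refl])
  show "MM-lipschitz_on {t - h - b..T} xm" unfolding MM_def
    by (rule trajectory_bounds(2)[OF t_range(3) \<alpha>_controls lm bw(3) xm order.refl])
  show "norm (x s) \<le> RR" if "s \<in> {t - b..T}" for s unfolding RR_def
    by (rule trajectory_bounds(1)[OF t_range(1) \<alpha>_controls lw bw(1) x that])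
  show "norm (xp s) \<le> RR" if "s \<in> {t + h - b..T}" for s unfolding RR_def
    by (rule trajectory_bounds(1)[OF t_range(2) \<alpha>_controls lp bw(2) xp that])
  show "norm (xm s) \<le> RR" if "s \<in> {t - h - b..T}" for s unfolding RR_def
    by (rule trajectory_bounds(1)[OF t_range(3) \<alpha>_controls lm bw(3) xm that])
qed

lemma traj_diff: "s \<in> {t - b..T} \<Longrightarrow> u \<in> {t - b..T} \<Longrightarrow> norm (x s - x u) \<le> MM * \<bar>s - u\<bar>"
  "s \<in> {t + h - b..T} \<Longrightarrow> u \<in> {t + h - b..T} \<Longrightarrow> norm (xp s - xp u) \<le> MM * \<bar>s - u\<bar>"
  "s \<in> {t - h - b..T} \<Longrightarrow> u \<in> {t - h - b..T} \<Longrightarrow> norm (xm s - xm u) \<le> MM * \<bar>s - u\<bar>"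
  using lipschitz_onD[OF traj_lip(1)] lipschitz_onD[OF traj_lip(2)] lipschitz_onD[OF traj_lip(3)] by (simp_all add: dist_norm)

lemma traj_deriv: "s \<in> {t<..<T} \<Longrightarrow> (x has_vector_derivative f s (x s) (delayed x s) (\<alpha> s)) (at s)"
  "s \<in> {t + h<..<T} \<Longrightarrow> (xp has_vector_derivative f s (xp s) (delayed xp s) (\<alpha> s)) (at s)"
  "s \<in> {t - h<..<T} \<Longrightarrow> (xm has_vector_derivative f s (xm s) (delayed xm s) (\<alpha> s)) (at s)"
  using trajectory_classical[OF x t_range(1) \<alpha>_cont \<alpha>A] trajectory_classical[OF xp t_range(2) \<alpha>_cont \<alpha>A]
    trajectory_classical[OF xm t_range(3) \<alpha>_cont \<alpha>A] by blast+

lemma hist_deriv_traj: "s \<in> {t - b<..<t} \<Longrightarrow> (x has_vector_derivative v (s - t)) (at s)"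
  "s \<in> {t + h - b<..<t + h} \<Longrightarrow> (xp has_vector_derivative (v (s - (t + h)) + v0 (s - (t + h)))) (at s)"
  "s \<in> {t - h - b<..<t - h} \<Longrightarrow> (xm has_vector_derivative (v (s - (t - h)) - v0 (s - (t - h)))) (at s)"
proof -
  show "(x has_vector_derivative v (s - t)) (at s)" if "s \<in> {t - b<..<t}"
    by (rule history_derivative[OF x w_reg(1) that])
  show "(xp has_vector_derivative (v (s - (t + h)) + v0 (s - (t + h)))) (at s)" if "s \<in> {t + h - b<..<t + h}"
    by (rule history_derivative[OF xp _ that, of "\<lambda>\<theta>. v \<theta> + v0 \<theta>"]) (intro has_vector_derivative_add w_reg(1) w0_reg(1))
  show "(xm has_vector_derivative (v (s - (t - h)) - v0 (s - (t - h)))) (at s)" if "s \<in> {t - h - b<..<t - h}"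
    by (rule history_derivative[OF xm _ that, of "\<lambda>\<theta>. v \<theta> - v0 \<theta>"]) (intro has_vector_derivative_diff w_reg(1) w0_reg(1))
qed

lemma v_diff: "\<theta> \<in> {-b..0} \<Longrightarrow> \<theta>' \<in> {-b..0} \<Longrightarrow> norm (v \<theta> - v \<theta>') \<le> r * \<bar>\<theta> - \<theta>'\<bar>"
  "\<theta> \<in> {-b..0} \<Longrightarrow> \<theta>' \<in> {-b..0} \<Longrightarrow> norm (v0 \<theta> - v0 \<theta>') \<le> r * \<bar>\<theta> - \<theta>'\<bar>"
  using lipschitz_onD[OF w_reg(4)] lipschitz_onD[OF w0_reg(4)] by (simp_all add: dist_norm)

lemma traj_hist: "s \<in> {t - b..t} \<Longrightarrow> x s = w (s - t)"
  "s \<in> {t + h - b..t + h} \<Longrightarrow> xp s = w (s - (t + h)) + w0 (s - (t + h))"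
  "s \<in> {t - h - b..t - h} \<Longrightarrow> xm s = w (s - (t - h)) - w0 (s - (t - h))"
  using trajectory_history[OF x] trajectory_history[OF xp] trajectory_history[OF xm] by simp_all

text \<open>On the history intervals the trajectories are compared after shifting time by
  \<open>h\<close> or \<open>2 * h\<close>. Each shift costs a multiple of \<open>MM * h\<close>,
  and the shifted values differ by \<open>w0\<close> or twice \<open>w0\<close>, bounded by the
  Sobolev embedding. \<open>stability_same_control\<close> carries this to \<open>T\<close>.\<close>

lemma traj_close:
  shows "s \<in> {t - b..T} \<Longrightarrow> norm (xm s - x s) \<le> C2 * eps"
    and "s \<in> {t + h - b..T} \<Longrightarrow> norm (xp s - x s) \<le> C2 * eps"
    and "s \<in> {t + h - b..T} \<Longrightarrow> norm (xp s - xm s) \<le> C2 * eps"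
proof -
  have h: "0 < h" by (rule h_pos)
  have M: "0 \<le> MM" by (rule const_bounds)
  have cSH: "cS * H \<le> cS * eps" "MM * h \<le> MM * eps" "0 \<le> cS * eps" "0 \<le> MM * eps"
    using const_bounds(9) M eps by (auto intro!: mult_left_mono)
  have C1: "C1 * eps = 2 * (cS * eps) + 5 * (MM * eps)" by (simp add: C1_def algebra_simps)
  show "norm (xm s - x s) \<le> C2 * eps" if s: "s \<in> {t - b..T}"
    unfolding C2_def mult.assoc
  proof (rule stability_same_control[OF t_range(1) traj_lip(1) _ _ \<alpha>A traj_deriv(1) traj_deriv(3) s])
    show "MM-lipschitz_on {t - b..T} xm" by (rule lipschitz_on_subset[OF traj_lip(3)]) (use h in auto)
    fix s assume s: "s \<in> {t - b..t}"
    have "norm (xm s - xm (s - h)) \<le> MM * h" using traj_diff(3)[of s "s - h"] s h t_range by auto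
    moreover have "xm (s - h) = w (s - t) - w0 (s - t)" using traj_hist(3)[of "s - h"] s by simp
    moreover have "x s = w (s - t)" by (rule traj_hist(1)[OF s])
    moreover have "norm (w0 (s - t)) \<le> cS * H" using s by (intro w0_sup) auto
    moreover have "norm (xm s - x s) \<le> norm (xm s - xm (s - h)) + norm (xm (s - h) - x s)"
      using norm_triangle_ineq[of "xm s - xm (s - h)" "xm (s - h) - x s"] by simp
    ultimately show "norm (xm s - x s) \<le> C1 * eps" unfolding C1 using cSH by simp
  qed (use h in auto)
  have J: "norm (xp s - x s) \<le> C1 * eps" "norm (xp s - xm s) \<le> C1 * eps" if s: "s \<in> {t + h - b..t + h}" for s
  proof -
    have e: "xp s = w (s - (t + h)) + w0 (s - (t + h))" by (rule traj_hist(2)[OF s])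
    have e2: "x (s - h) = w (s - (t + h))" using traj_hist(1)[of "s - h"] s by (simp add: algebra_simps)
    have e3: "xm (s - 2 * h) = w (s - (t + h)) - w0 (s - (t + h))" using traj_hist(3)[of "s - 2 * h"] s by (simp add: algebra_simps)
    have n0: "norm (w0 (s - (t + h))) \<le> cS * H" using s by (intro w0_sup) auto
    have d1: "norm (x (s - h) - x s) \<le> MM * h" using traj_diff(1)[of "s - h" s] s h t_range by auto
    have d2: "norm (xm (s - 2 * h) - xm s) \<le> MM * (2 * h)" using traj_diff(3)[of "s - 2 * h" s] s h t_range by auto
    have "xp s - x s = w0 (s - (t + h)) + (x (s - h) - x s)" using e e2 by simp
    then have "norm (xp s - x s) \<le> norm (w0 (s - (t + h))) + norm (x (s - h) - x s)" by (metis norm_triangle_ineq)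
    then have "norm (xp s - x s) \<le> cS * H + MM * h" using n0 d1 by linarith
    then show "norm (xp s - x s) \<le> C1 * eps" unfolding C1 using cSH by linarith
    have "xp s - xm s = 2 *\<^sub>R w0 (s - (t + h)) + (xm (s - 2 * h) - xm s)" using e e3 by (simp add: scaleR_2)
    then have "norm (xp s - xm s) \<le> norm (2 *\<^sub>R w0 (s - (t + h))) + norm (xm (s - 2 * h) - xm s)" by (metis norm_triangle_ineq)
    then have "norm (xp s - xm s) \<le> 2 * (cS * H) + MM * (2 * h)" using n0 d2 by simp
    then show "norm (xp s - xm s) \<le> C1 * eps" unfolding C1 using cSH by linarith
  qed
  have sub: "MM-lipschitz_on {t + h - b..T} x" "MM-lipschitz_on {t + h - b..T} xm"
    by (rule lipschitz_on_subset[OF traj_lip(1)], use h in auto) (rule lipschitz_on_subset[OF traj_lip(3)], use h in auto)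
  show "norm (xp s - x s) \<le> C2 * eps" if s: "s \<in> {t + h - b..T}"
    unfolding C2_def mult.assoc
    by (rule stability_same_control[OF t_range(2) sub(1) traj_lip(2) J(1) \<alpha>A traj_deriv(1) traj_deriv(2) s]) (use h in auto)
  show "norm (xp s - xm s) \<le> C2 * eps" if s: "s \<in> {t + h - b..T}"
    unfolding C2_def mult.assoc
    by (rule stability_same_control[OF t_range(2) sub(2) traj_lip(2) J(2) \<alpha>A traj_deriv(3) traj_deriv(2) s]) (use h in auto)
qed

text \<open>For the third bound, the second order condition on \<open>\<tau>\<close> is applied with
  the midpoint of \<open>xp u\<close> and \<open>xm u\<close>, which differs from \<open>x u\<close>
  by half of \<open>S u\<close>; this is where \<open>S\<close> enters the delayed times
  linearly.\<close>

lemma dtime_close: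
  assumes u: "u \<in> {t + h..T}"
  shows "\<bar>dtime xp u - dtime xm u\<bar> \<le> kap * eps" "\<bar>dtime xp u - dtime x u\<bar> \<le> kap * eps"
    and "\<bar>dtime xp u + dtime xm u - 2 * dtime x u\<bar> \<le> tD RR * C2\<^sup>2 * eps\<^sup>2 + tL * norm (S u)"
proof -
  have b: "0 < b" by (rule max_delay_pos)
  have u0: "u \<in> {t0..T}" and u': "u \<in> {t + h - b..T}" and um: "u \<in> {t - h - b..T}" using u t_range h_pos b by auto
  have "\<bar>dtime xp u - dtime xm u\<bar> \<le> tL * norm (xp u - xm u)" using tL(2)[OF u0, of "xp u" "xm u"] by (simp add: dtime_def)
  also have "\<dots> \<le> tL * (C2 * eps)" using traj_close(3)[OF u'] tL(1) by (intro mult_left_mono) auto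
  finally show "\<bar>dtime xp u - dtime xm u\<bar> \<le> kap * eps" by (simp add: kap_def mult.assoc)
  have "\<bar>dtime xp u - dtime x u\<bar> \<le> tL * norm (xp u - x u)" using tL(2)[OF u0, of "xp u" "x u"] by (simp add: dtime_def)
  also have "\<dots> \<le> tL * (C2 * eps)" using traj_close(2)[OF u'] tL(1) by (intro mult_left_mono) auto
  finally show "\<bar>dtime xp u - dtime x u\<bar> \<le> kap * eps" by (simp add: kap_def mult.assoc)
  let ?m = "(1/2) *\<^sub>R (xp u + xm u)"
  have "\<bar>\<tau> u (xp u) + \<tau> u (xm u) - 2 * \<tau> u ?m\<bar> \<le> tD RR * (norm (xp u - xm u))\<^sup>2"
    by (rule tD(2)[OF const_bounds(3) u0 traj_bound(2)[OF u'] traj_bound(3)[OF um]])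
  also have "\<dots> \<le> tD RR * (C2 * eps)\<^sup>2"
    using traj_close(3)[OF u'] tD(1)[OF const_bounds(3)] by (intro mult_left_mono power_mono) auto
  finally have 1: "\<bar>\<tau> u (xp u) + \<tau> u (xm u) - 2 * \<tau> u ?m\<bar> \<le> tD RR * C2\<^sup>2 * eps\<^sup>2" by (simp add: power_mult_distrib)
  have "?m - x u = (1/2) *\<^sub>R S u" by (simp add: S_def vec_eq_iff field_simps)
  then have 2: "\<bar>\<tau> u ?m - \<tau> u (x u)\<bar> \<le> tL * norm (S u) / 2" using tL(2)[OF u0, of ?m "x u"] by simp
  show "\<bar>dtime xp u + dtime xm u - 2 * dtime x u\<bar> \<le> tD RR * C2\<^sup>2 * eps\<^sup>2 + tL * norm (S u)"
    unfolding dtime_def by (rule second_difference_via_midpoint[OF 1 2])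
qed

lemma delayed_close:
  assumes u: "u \<in> {t + h..T}"
  shows "norm (delayed xp u - delayed xm u) \<le> C3 * eps"
proof -
  have "norm (delayed xp u - delayed xm u) \<le> norm (xp (dtime xp u) - xm (dtime xp u)) + MM * tL * norm (xp u - xm u)"
    using h_pos by (intro delayed_diff[OF lipschitz_on_subset[OF traj_lip(3)] u t_range(5)]) auto
  also have "\<dots> \<le> C2 * eps + MM * tL * (C2 * eps)"
    using dtime_in_range[OF u t_range(5), of xp] u max_delay_pos const_bounds(5) tL(1)
    by (intro add_mono mult_left_mono traj_close(3)) auto
  finally show ?thesis by (simp add: C3_def algebra_simps)
qed

lemma delayed_close_m:
  assumes u: "u \<in> {t..T}"
  shows "norm (delayed xm u - delayed x u) \<le> C3 * eps"
proof -
  have "norm (delayed xm u - delayed x u) \<le> norm (xm (dtime xm u) - x (dtime xm u)) + MM * tL * norm (xm u - x u)"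
    by (rule delayed_diff[OF traj_lip(1) u t_range(4)])
  also have "\<dots> \<le> C2 * eps + MM * tL * (C2 * eps)"
    using dtime_in_range[OF u t_range(4), of xm] u max_delay_pos const_bounds(5) tL(1)
    by (intro add_mono mult_left_mono traj_close(1)) auto
  finally show ?thesis by (simp add: C3_def algebra_simps)
qed

lemma deriv_close_m:
  assumes u: "u \<in> {t..T}"
  shows "norm (f u (xm u) (delayed xm u) (\<alpha> u) - f u (x u) (delayed x u) (\<alpha> u)) \<le> C6 * eps"
proof -
  have "norm (f u (xm u) (delayed xm u) (\<alpha> u) - f u (x u) (delayed x u) (\<alpha> u))
     \<le> fL * (norm (xm u - x u) + norm (delayed xm u - delayed x u))"
    using u t_range by (intro fL(2) \<alpha>A) auto
  also have "\<dots> \<le> fL * (C2 * eps + C3 * eps)"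
    using traj_close(1)[of u] u max_delay_pos delayed_close_m[OF u] fL(1) by (intro mult_left_mono add_mono) auto
  finally show ?thesis by (simp add: C6_def algebra_simps)
qed

lemma deriv_close_p:
  assumes u: "u \<in> {t + h..T}"
  shows "norm (f u (xp u) (delayed xp u) (\<alpha> u) - f u (xm u) (delayed xm u) (\<alpha> u)) \<le> C6 * eps"
proof -
  have "norm (f u (xp u) (delayed xp u) (\<alpha> u) - f u (xm u) (delayed xm u) (\<alpha> u))
     \<le> fL * (norm (xp u - xm u) + norm (delayed xp u - delayed xm u))"
    using u t_range by (intro fL(2) \<alpha>A) auto
  also have "\<dots> \<le> fL * (C2 * eps + C3 * eps)"
    using traj_close(3)[of u] u max_delay_pos delayed_close[OF u] fL(1) by (intro mult_left_mono add_mono) auto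
  finally show ?thesis by (simp add: C6_def algebra_simps)
qed

text \<open>The arguments of f and L along xm stay within O(h) of those at time t in the compatibility condition.\<close>

lemma args_near_start:
  assumes s: "s \<in> {t - h..t + h}"
  shows "\<bar>s - t\<bar> + norm (xm s - (w 0 - w0 0)) + norm (delayed xm s - (w (- \<tau> t (w 0 - w0 0)) - w0 (- \<tau> t (w 0 - w0 0))))
     + norm (\<alpha> s - \<alpha> t) \<le> C4 * h"
    and "norm (xm s) \<le> RR" "norm (w 0 - w0 0) \<le> RR" "norm (delayed xm s) \<le> RR"
    and "norm (w (- \<tau> t (w 0 - w0 0)) - w0 (- \<tau> t (w 0 - w0 0))) \<le> RR" and "s \<in> {t0..T}"
proof -
  have b: "0 < b" by (rule max_delay_pos)
  show s0: "s \<in> {t0..T}" using s t_low t_up by auto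
  define z where "z = w 0 - w0 0"
  \<comment> \<open>The time at which \<open>xm\<close> takes the delayed value occurring in
    \<open>compat\<close>; the delay is frozen at \<open>\<tau> t z\<close>, so that
    \<open>q\<close> lies in the history of \<open>xm\<close>.\<close>
  define q where "q = t - h - \<tau> t z"
  have z: "z = xm (t - h)" using traj_hist(3)[of "t - h"] b by (simp add: z_def)
  have \<tau>z: "\<tau> t z \<in> {0..b}" using delay_ge[OF t_range(1)] delay_le[OF t_range(1)] by auto
  have q: "q \<in> {t - h - b..t - h}" using \<tau>z by (auto simp: q_def)
  have y: "xm q = w (- \<tau> t z) - w0 (- \<tau> t z)" using traj_hist(3)[OF q] by (simp add: q_def)
  have sm: "s \<in> {t - h - b..T}" and th: "t - h \<in> {t - h - b..T}" using s b t_up h_pos by auto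
  have qm: "q \<in> {t - h - b..T}" using q th by auto
  have sh: "s \<in> {t - h..T}" using s t_up by auto
  have tl: "t0 \<le> t - h" by (rule t_low)
  have ds: "dtime xm s \<in> {t - h - b..T}" by (rule dtime_in_range[OF sh tl])
  show bs: "norm (xm s) \<le> RR" by (rule traj_bound(3)[OF sm])
  have bz: "norm z \<le> RR" unfolding z by (rule traj_bound(3)[OF th])
  then show "norm (w 0 - w0 0) \<le> RR" by (simp add: z_def)
  show "norm (delayed xm s) \<le> RR" unfolding delayed_eq by (rule traj_bound(3)[OF ds])
  show "norm (w (- \<tau> t (w 0 - w0 0)) - w0 (- \<tau> t (w 0 - w0 0))) \<le> RR"
    using traj_bound(3)[OF qm] y by (simp add: z_def)
  have 1: "\<bar>s - t\<bar> \<le> h" using s by auto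
  have 2: "norm (xm s - z) \<le> MM * (2 * h)"
  proof -
    have "norm (xm s - xm (t - h)) \<le> MM * \<bar>s - (t - h)\<bar>" by (rule traj_diff(3)[OF sm th])
    also have "\<dots> \<le> MM * (2 * h)" using s const_bounds(5) by (intro mult_left_mono) auto
    finally show ?thesis by (simp add: z)
  qed
  have "\<bar>\<tau> s (xm s) - \<tau> t z\<bar> \<le> tR RR * (\<bar>s - t\<bar> + norm (xm s - z))"
    by (rule tR(2)[OF const_bounds(2) s0 t_range(1) bs bz])
  also have "\<dots> \<le> tR RR * (h + MM * (2 * h))" using 1 2 tR(1)[OF const_bounds(2)] by (intro mult_left_mono add_mono) auto
  finally have 3: "\<bar>\<tau> s (xm s) - \<tau> t z\<bar> \<le> tR RR * (h + MM * (2 * h))" .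
  have 4: "\<bar>dtime xm s - q\<bar> \<le> 2 * h + tR RR * (h + MM * (2 * h))"
    using 3 s unfolding dtime_def q_def by (auto simp: abs_le_iff)
  have "norm (xm (dtime xm s) - xm q) \<le> MM * \<bar>dtime xm s - q\<bar>" by (rule traj_diff(3)[OF ds qm])
  also have "\<dots> \<le> MM * (2 * h + tR RR * (h + MM * (2 * h)))" using 4 const_bounds(5) by (intro mult_left_mono) auto
  finally have 5: "norm (delayed xm s - (w (- \<tau> t z) - w0 (- \<tau> t z))) \<le> MM * (2 * h + tR RR * (h + MM * (2 * h)))"
    by (simp add: delayed_eq y)
  have "norm (\<alpha> s - \<alpha> t) \<le> K * \<bar>s - t\<bar>" by (rule \<alpha>_diff)
  also have "\<dots> \<le> K * h" using 1 K_ge by (intro mult_left_mono) auto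
  finally have 6: "norm (\<alpha> s - \<alpha> t) \<le> K * h" .
  have "C4 * h = h + MM * (2 * h) + MM * (2 * h + tR RR * (h + MM * (2 * h))) + K * h"
    by (simp add: C4_def algebra_simps)
  then show "\<bar>s - t\<bar> + norm (xm s - (w 0 - w0 0)) + norm (delayed xm s - (w (- \<tau> t (w 0 - w0 0)) - w0 (- \<tau> t (w 0 - w0 0))))
     + norm (\<alpha> s - \<alpha> t) \<le> C4 * h"
    using 1 2 5 6 unfolding z_def by linarith
qed

section \<open>Second difference on the history interval of the latest trajectory\<close>

lemma deriv_near_start:
  assumes s: "s \<in> {t - h..t + h}"
  shows "norm (f s (xm s) (delayed xm s) (\<alpha> s) - F0) \<le> C5 * h"
proof -
  note a = args_near_start[OF s]
  have "norm (f s (xm s) (delayed xm s) (\<alpha> s) - F0) \<le> fC RR * (\<bar>s - t\<bar> + norm (xm s - (w 0 - w0 0)) +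
      norm (delayed xm s - (w (- \<tau> t (w 0 - w0 0)) - w0 (- \<tau> t (w 0 - w0 0)))) + norm (\<alpha> s - \<alpha> t))"
    unfolding F0_def compat by (rule fC(2)[OF a(6) t_range(1) \<alpha>A \<alpha>A a(2,3,4,5)])
  also have "\<dots> \<le> fC RR * (C4 * h)" using a(1) const_bounds(14) by (intro mult_left_mono) auto
  finally show ?thesis by (simp add: C5_def mult.assoc)
qed

text \<open>Before \<open>t - h\<close> the velocity is that of the history and varies with
  Lipschitz constant \<open>r\<close>. The window reaches past \<open>t - h\<close> only if
  \<open>\<theta>\<close> is within \<open>2 * h\<close> of \<open>0\<close>; there the velocity is
  near \<open>F0\<close>, and \<open>F0\<close> is near
  \<open>v \<theta> - v0 \<theta>\<close>.\<close>

lemma xm_deriv_near: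
  assumes \<theta>: "\<theta> \<in> {-b..0}" and u: "u \<in> {t + h + \<theta> - 2 * h..t + h + \<theta>}" "u \<noteq> t - h" "u \<in> {t - h - b<..<T}"
  shows "\<exists>D. (xm has_vector_derivative D) (at u) \<and> norm (D - (v \<theta> - v0 \<theta>)) \<le> C7 * h"
proof (cases "u < t - h")
  case True
  let ?\<xi> = "u - (t - h)"
  have \<xi>: "?\<xi> \<in> {-b..0}" "\<bar>?\<xi> - \<theta>\<bar> \<le> 2 * h" using True u \<theta> by auto
  have "norm ((v ?\<xi> - v0 ?\<xi>) - (v \<theta> - v0 \<theta>)) \<le> norm (v ?\<xi> - v \<theta>) + norm (v0 ?\<xi> - v0 \<theta>)"
    using norm_triangle_ineq4[of "v ?\<xi> - v \<theta>" "v0 ?\<xi> - v0 \<theta>"] by (simp add: algebra_simps)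
  also have "\<dots> \<le> r * \<bar>?\<xi> - \<theta>\<bar> + r * \<bar>?\<xi> - \<theta>\<bar>" by (intro add_mono v_diff \<xi> \<theta>)
  also have "\<dots> \<le> r * (2 * h) + r * (2 * h)" using \<xi>(2) r_pos by (intro add_mono mult_left_mono) auto
  also have "\<dots> \<le> C7 * h" using const_bounds(16) h_pos by (simp add: C7_def algebra_simps)
  finally show ?thesis using hist_deriv_traj(3)[of u] True u by auto
next
  case False
  then have u': "u \<in> {t - h<..<T}" "u \<in> {t - h..t + h}" using u \<theta> by auto
  have \<theta>h: "\<bar>\<theta>\<bar> \<le> 2 * h" using False u \<theta> by auto
  have z: "(0::real) \<in> {-b..0}" using max_delay_pos by simp
  have "norm (F0 - (v \<theta> - v0 \<theta>)) \<le> norm (v 0 - v \<theta>) + norm (v0 0 - v0 \<theta>)"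
    using norm_triangle_ineq4[of "v 0 - v \<theta>" "v0 0 - v0 \<theta>"] by (simp add: F0_def algebra_simps)
  also have "\<dots> \<le> r * \<bar>0 - \<theta>\<bar> + r * \<bar>0 - \<theta>\<bar>" by (intro add_mono v_diff z \<theta>)
  also have "\<dots> \<le> r * (2 * h) + r * (2 * h)" using \<theta>h r_pos by (intro add_mono mult_left_mono) auto
  finally have "norm (F0 - (v \<theta> - v0 \<theta>)) \<le> r * (2 * h) + r * (2 * h)" .
  moreover have "norm (f u (xm u) (delayed xm u) (\<alpha> u) - (v \<theta> - v0 \<theta>)) \<le> norm (f u (xm u) (delayed xm u) (\<alpha> u) - F0) + norm (F0 - (v \<theta> - v0 \<theta>))"
    by (rule norm_diff_via)
  moreover have "C7 * h = C5 * h + (r * (2 * h) + r * (2 * h))" by (simp add: C7_def algebra_simps)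
  ultimately have "norm (f u (xm u) (delayed xm u) (\<alpha> u) - (v \<theta> - v0 \<theta>)) \<le> C7 * h"
    using deriv_near_start[OF u'(2)] by linarith
  then show ?thesis using traj_deriv(3)[OF u'(1)] by blast
qed

text \<open>The comparison goes through \<open>xm\<close>, to which \<open>compat\<close> applies.
  Just left of \<open>t\<close> the velocity of \<open>x\<close> is near \<open>v 0\<close>, and
  \<open>F0 = v 0 - v0 0\<close>: this exposes the kink of \<open>x\<close>.\<close>

lemma x_deriv_near_right:
  assumes u: "u \<in> {t<..<t + h}"
  shows "(x has_vector_derivative f u (x u) (delayed x u) (\<alpha> u)) (at u)"
    and "norm (f u (x u) (delayed x u) (\<alpha> u) - F0) \<le> (C5 + C6) * eps"
proof -
  show "(x has_vector_derivative f u (x u) (delayed x u) (\<alpha> u)) (at u)" using u t_up by (intro traj_deriv(1)) auto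
  have "norm (f u (xm u) (delayed xm u) (\<alpha> u) - F0) \<le> C5 * h" using u h_pos by (intro deriv_near_start) auto
  also have "\<dots> \<le> C5 * eps" using const_bounds(16) eps by (intro mult_left_mono) auto
  finally have 1: "norm (f u (xm u) (delayed xm u) (\<alpha> u) - F0) \<le> C5 * eps" .
  have 2: "norm (f u (xm u) (delayed xm u) (\<alpha> u) - f u (x u) (delayed x u) (\<alpha> u)) \<le> C6 * eps"
    using u t_up by (intro deriv_close_m) auto
  have "norm (f u (x u) (delayed x u) (\<alpha> u) - F0) \<le> norm (f u (xm u) (delayed xm u) (\<alpha> u) - F0)
     + norm (f u (xm u) (delayed xm u) (\<alpha> u) - f u (x u) (delayed x u) (\<alpha> u))"
    using norm_triangle_ineq4[of "f u (xm u) (delayed xm u) (\<alpha> u) - F0" "f u (xm u) (delayed xm u) (\<alpha> u) - f u (x u) (delayed x u) (\<alpha> u)"] by simp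
  then show "norm (f u (x u) (delayed x u) (\<alpha> u) - F0) \<le> (C5 + C6) * eps" using 1 2 by (simp add: distrib_right)
qed

text \<open>In its history \<open>xp\<close> is \<open>w + w0\<close>; \<open>xm\<close> shifted
  back by \<open>2 * h\<close> is \<open>w - w0\<close>, and \<open>x\<close> shifted back by
  \<open>h\<close> is \<open>w\<close>. These values cancel and only increments in time
  remain.\<close>

lemma S_history_eq:
  assumes \<theta>: "\<theta> \<in> {-b..0}"
  shows "S (t + h + \<theta>) = (xm (t + h + \<theta>) - xm (t + h + \<theta> - 2 * h)) - 2 *\<^sub>R (x (t + h + \<theta>) - x (t + h + \<theta> - h))"
proof -
  have "xp (t + h + \<theta>) = w \<theta> + w0 \<theta>" using traj_hist(2)[of "t + h + \<theta>"] \<theta> by simp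
  moreover have "xm (t + h + \<theta> - 2 * h) = w \<theta> - w0 \<theta>" using traj_hist(3)[of "t + h + \<theta> - 2 * h"] \<theta> by (simp add: algebra_simps)
  moreover have "x (t + h + \<theta> - h) = w \<theta>" using traj_hist(1)[of "t + h + \<theta> - h"] \<theta> by simp
  ultimately show ?thesis by (simp add: S_def scaleR_2 algebra_simps)
qed

lemma xm_increment:
  assumes \<theta>: "\<theta> \<in> {-b..0}"
  shows "norm (xm (t + h + \<theta>) - xm (t + h + \<theta> - 2 * h) - (2 * h) *\<^sub>R (v \<theta> - v0 \<theta>)) \<le> C7 * h * (2 * h)"
proof -
  have b: "0 < b" by (rule max_delay_pos)
  have "norm (xm (t + h + \<theta>) - xm (t + h + \<theta> - 2 * h) - (t + h + \<theta> - (t + h + \<theta> - 2 * h)) *\<^sub>R (v \<theta> - v0 \<theta>))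
     \<le> C7 * h * (t + h + \<theta> - (t + h + \<theta> - 2 * h))"
  proof (rule lipschitz_ae_linear_bound[OF lipschitz_on_subset[OF traj_lip(3)] _ negligible_finite[of "{t - h}"]])
    fix s assume s: "s \<in> {t + h + \<theta> - 2 * h<..<t + h + \<theta>} - {t - h}"
    show "\<exists>D. (xm has_vector_derivative D) (at s) \<and> norm (D - (v \<theta> - v0 \<theta>)) \<le> C7 * h"
      using s \<theta> t_up by (intro xm_deriv_near) auto
  qed (use \<theta> h_pos t_up in auto)
  then show ?thesis by simp
qed

text \<open>The increments of \<open>xm\<close> over \<open>2 * h\<close> and of \<open>x\<close>
  over \<open>h\<close> have slopes near \<open>v \<theta> - v0 \<theta>\<close> and
  \<open>v \<theta>\<close>, which leaves \<open>2 * h\<close> times \<open>v0 \<theta>\<close>.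
  Beyond the kink the slope of \<open>x\<close> is off by another \<open>norm (v0 \<theta>)\<close>,
  which the bound absorbs. The term \<open>eps * norm (v0 \<theta>)\<close> becomes quadratic only
  after integration.\<close>

lemma S_history_bound:
  assumes \<theta>: "\<theta> \<in> {-b..0}"
  shows "norm (S (t + h + \<theta>)) \<le> C9 * eps * (eps + norm (v0 \<theta>))"
proof -
  have b: "0 < b" by (rule max_delay_pos)
  have near: "\<exists>D. (x has_vector_derivative D) (at u) \<and> norm (D - v \<theta>) \<le> C8 * eps + norm (v0 \<theta>)"
    if u: "u \<in> {t + h + \<theta> - h<..<t + h + \<theta>} - {t}" for u
  proof (cases "u < t")
    case True
    have "norm (v (u - t) - v \<theta>) \<le> r * \<bar>u - t - \<theta>\<bar>" using True u \<theta> by (intro v_diff) auto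
    also have "\<dots> \<le> r * h" using u r_pos by (intro mult_left_mono) auto
    also have "\<dots> \<le> r * eps" using r_pos eps by (intro mult_left_mono) auto
    also have "\<dots> \<le> C8 * eps" using const_bounds(16,17) r_pos eps(4) by (intro mult_right_mono) (auto simp: C8_def)
    finally have "norm (v (u - t) - v \<theta>) \<le> C8 * eps + norm (v0 \<theta>)" by (simp add: add_increasing2)
    moreover have "(x has_vector_derivative v (u - t)) (at u)" using True u \<theta> by (intro hist_deriv_traj(1)) auto
    ultimately show ?thesis by blast
  next
    case False
    then have u': "u \<in> {t<..<t + h}" using u \<theta> by auto
    have z: "(0::real) \<in> {-b..0}" using b by simp
    have \<theta>h: "\<bar>\<theta>\<bar> \<le> h" using u' u \<theta> by auto
    have rh: "r * \<bar>0 - \<theta>\<bar> \<le> r * eps" using \<theta>h eps r_pos by (intro mult_left_mono) auto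
    have eq: "F0 - v \<theta> = (v 0 - v \<theta>) - (v0 0 - v0 \<theta>) - v0 \<theta>" by (simp add: F0_def)
    have "norm (F0 - v \<theta>) \<le> norm (v 0 - v \<theta>) + norm (v0 0 - v0 \<theta>) + norm (v0 \<theta>)"
      unfolding eq using norm_triangle_ineq4[of "(v 0 - v \<theta>) - (v0 0 - v0 \<theta>)" "v0 \<theta>"] norm_triangle_ineq4[of "v 0 - v \<theta>" "v0 0 - v0 \<theta>"] by linarith
    then have "norm (F0 - v \<theta>) \<le> 2 * (r * eps) + norm (v0 \<theta>)"
      using v_diff(1)[OF z \<theta>] v_diff(2)[OF z \<theta>] rh by linarith
    moreover have "norm (f u (x u) (delayed x u) (\<alpha> u) - v \<theta>) \<le> norm (f u (x u) (delayed x u) (\<alpha> u) - F0) + norm (F0 - v \<theta>)"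
      by (rule norm_diff_via)
    moreover have "C8 * eps = (C5 + C6) * eps + 2 * (r * eps)" by (simp add: C8_def algebra_simps)
    ultimately have "norm (f u (x u) (delayed x u) (\<alpha> u) - v \<theta>) \<le> C8 * eps + norm (v0 \<theta>)"
      using x_deriv_near_right(2)[OF u'] by linarith
    then show ?thesis using x_deriv_near_right(1)[OF u'] by blast
  qed
  have "norm (x (t + h + \<theta>) - x (t + h + \<theta> - h) - (t + h + \<theta> - (t + h + \<theta> - h)) *\<^sub>R v \<theta>)
     \<le> (C8 * eps + norm (v0 \<theta>)) * (t + h + \<theta> - (t + h + \<theta> - h))"
    by (rule lipschitz_ae_linear_bound[OF lipschitz_on_subset[OF traj_lip(1)] _ negligible_finite[of "{t}"] near])
       (use \<theta> h_pos t_up in auto)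
  then have 1: "norm (x (t + h + \<theta>) - x (t + h + \<theta> - h) - h *\<^sub>R v \<theta>) \<le> (C8 * eps + norm (v0 \<theta>)) * h" by simp
  note 2 = xm_increment[OF \<theta>]
  let ?A = "xm (t + h + \<theta>) - xm (t + h + \<theta> - 2 * h) - (2 * h) *\<^sub>R (v \<theta> - v0 \<theta>)"
  let ?B = "x (t + h + \<theta>) - x (t + h + \<theta> - h) - h *\<^sub>R v \<theta>"
  have "S (t + h + \<theta>) = ?A - 2 *\<^sub>R ?B - (2 * h) *\<^sub>R v0 \<theta>"
    unfolding S_history_eq[OF \<theta>] by (simp add: scaleR_diff_right)
  then have "norm (S (t + h + \<theta>)) \<le> norm ?A + norm (2 *\<^sub>R ?B) + norm ((2 * h) *\<^sub>R v0 \<theta>)"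
    using norm_triangle_ineq4[of "?A - 2 *\<^sub>R ?B" "(2 * h) *\<^sub>R v0 \<theta>"] norm_triangle_ineq4[of ?A "2 *\<^sub>R ?B"] by simp
  also have "\<dots> \<le> C7 * h * (2 * h) + 2 * ((C8 * eps + norm (v0 \<theta>)) * h) + 2 * h * norm (v0 \<theta>)"
    using 1 2 h_pos by simp
  also have "\<dots> = h * (2 * C7 * h + 2 * C8 * eps + 4 * norm (v0 \<theta>))" by (simp add: algebra_simps)
  also have "\<dots> \<le> eps * (2 * C7 * eps + 2 * C8 * eps + 4 * norm (v0 \<theta>))"
    using eps h_pos const_bounds(18,19) by (intro mult_mono add_mono mult_left_mono) auto
  also have "\<dots> \<le> eps * (C9 * (eps + norm (v0 \<theta>)))"
  proof (intro mult_left_mono)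
    have "0 \<le> (2 * C7 + 2 * C8) * norm (v0 \<theta>)" using const_bounds(18,19) by simp
    then show "2 * C7 * eps + 2 * C8 * eps + 4 * norm (v0 \<theta>) \<le> C9 * (eps + norm (v0 \<theta>))"
      using eps(4) by (simp add: C9_def algebra_simps)
  qed (rule eps(4))
  finally show ?thesis by (simp add: mult_ac)
qed

text \<open>For \<open>\<theta> = 0\<close> the increment of \<open>x\<close> runs over
  \<open>{t..t + h}\<close>, to the right of its kink, with slope near \<open>F0\<close>, and so
  does that of \<open>xm\<close> over \<open>{t - h..t + h}\<close>. No term in \<open>v0\<close> is
  left, so this initial value for Gronwall's inequality is quadratic pointwise.\<close>

lemma S_start_bound: "norm (S (t + h)) \<le> C10 * eps\<^sup>2"
proof -
  have b: "0 < b" by (rule max_delay_pos)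
  have z: "(0::real) \<in> {-b..0}" using b by simp
  have "norm (x (t + h) - x t - (t + h - t) *\<^sub>R F0) \<le> (C5 + C6) * eps * (t + h - t)"
  proof (rule lipschitz_ae_linear_bound[OF lipschitz_on_subset[OF traj_lip(1)] _ negligible_empty])
    fix u assume "u \<in> {t<..<t + h} - {}"
    then have u: "u \<in> {t<..<t + h}" by simp
    show "\<exists>D. (x has_vector_derivative D) (at u) \<and> norm (D - F0) \<le> (C5 + C6) * eps"
      using x_deriv_near_right[OF u] by blast
  qed (use b h_pos t_up in auto)
  then have 1: "norm (x (t + h) - x t - h *\<^sub>R F0) \<le> (C5 + C6) * eps * h" by simp
  have 2: "norm (xm (t + h) - xm (t + h - 2 * h) - (2 * h) *\<^sub>R F0) \<le> C7 * h * (2 * h)"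
    using xm_increment[OF z] by (simp add: F0_def)
  let ?A = "xm (t + h) - xm (t + h - 2 * h) - (2 * h) *\<^sub>R F0"
  let ?B = "x (t + h) - x t - h *\<^sub>R F0"
  have "S (t + h) = ?A - 2 *\<^sub>R ?B" using S_history_eq[OF z] by (simp add: scaleR_diff_right)
  then have "norm (S (t + h)) \<le> norm ?A + 2 * norm ?B" using norm_triangle_ineq4[of ?A "2 *\<^sub>R ?B"] by simp
  also have "\<dots> \<le> C7 * h * (2 * h) + 2 * ((C5 + C6) * eps * h)" using 1 2 by simp
  also have "\<dots> = h * (2 * C7 * h + 2 * (C5 + C6) * eps)" by (simp add: algebra_simps)
  also have "\<dots> \<le> eps * (2 * C7 * eps + 2 * (C5 + C6) * eps)"
    using eps h_pos const_bounds(16,17,18) by (intro mult_mono add_mono mult_left_mono) auto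
  also have "\<dots> = C10 * eps\<^sup>2" by (simp add: C10_def power2_eq_square algebra_simps)
  finally show ?thesis .
qed

end

section \<open>Second differences of the state\<close>

lemma lipschitz_ae_interval_bound:
  fixes X :: "real \<Rightarrow> 'a::real_inner"
  assumes X: "K-lipschitz_on {min p q..max p q} X" and N: "negligible N"
    and der: "\<And>s. s \<in> {min p q<..<max p q} - N \<Longrightarrow> \<exists>D. (X has_vector_derivative D) (at s) \<and> norm D \<le> B"
  shows "norm (X p - X q) \<le> B * \<bar>p - q\<bar>"
proof -
  have "norm (X (max p q) - X (min p q) - (max p q - min p q) *\<^sub>R 0) \<le> B * (max p q - min p q)"
    by (rule lipschitz_ae_linear_bound[OF X _ N]) (use der in auto)
  then show ?thesis by (cases "p \<le> q") (auto simp: norm_minus_commute)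
qed

lemma integrable_if_const:
  fixes c p q l u :: real
  shows "(\<lambda>s. if s \<in> {p..q} then c else 0) integrable_on {l..u}"
  unfolding Henstock_Kurzweil_Integration.integrable_restrict_Int Int_atLeastAtMost by (rule integrable_const_ivl)

context semiconc_const
begin

text \<open>\<open>CQ * eps\<close> bounds the integral of \<open>Q\<close>, and
  \<open>ZJ * eps\<^sup>2\<close> the part of the integral of \<open>Z\<close> other than that of
  \<open>S\<close> after \<open>t + h\<close>. \<open>C16\<close> and \<open>C17\<close> are the
  coefficients of the integral inequality for \<open>S\<close>, where \<open>1 / DD\<close> is the
  price of integrating along the delayed time, and \<open>C18\<close> is its Gronwall bound.\<close>

definition "CQ = (1 + b) / 2 + r + 8 * kap"
definition "ZJ = C9 * (b + (1 + b) / 2) + CQ"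
definition "C14 = fD RR * (C2\<^sup>2 + C3\<^sup>2) + fL * C12"
definition "C15 = fL * (1 + C12 + C13)"
definition "C16 = C10 + C14 * (T - t0) + C15 / DD * ZJ"
definition "C17 = C15 + C15 / DD"
definition "C18 = 2 * C16 * (T - t0) * exp (2 * C17 * (T - t0))"
definition "C19 = C16 + C17 * C18"
definition "C20 = C12 * (T - t0) + C12 * C18 + (1 + C13) / DD * (ZJ + C18)"

lemma const_bounds2:
  "0 \<le> CQ" "0 \<le> ZJ" "0 \<le> C14" "0 < C15" "0 \<le> C16" "0 < C17" "0 \<le> C18" "0 \<le> C19" "0 \<le> C20" "0 \<le> T - t0"
proof -
  note c = const_bounds
  show T: "0 \<le> T - t0" using time_interval by simp
  show Q: "0 \<le> CQ" using c(8,22) r_pos by (simp add: CQ_def)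
  show Z: "0 \<le> ZJ" using Q c(8,20) by (simp add: ZJ_def)
  show 14: "0 \<le> C14" using fD(1)[OF c(3)] fL(1) c(25) by (simp add: C14_def)
  show 15: "0 < C15" using fL(1) c(25,26) unfolding C15_def by (intro mult_pos_pos) auto
  show 16: "0 \<le> C16" using c(7,21) 14 15 Z T by (simp add: C16_def)
  show 17: "0 < C17" using 15 c(7) by (simp add: C17_def add_pos_pos)
  show 18: "0 \<le> C18" using 16 T by (simp add: C18_def)
  show "0 \<le> C19" using 16 17 18 by (simp add: C19_def)
  show "0 \<le> C20" using c(7,25,26) T 18 Z by (simp add: C20_def)
qed

end

context semiconc
begin

text \<open>Second differences of the delayed states fail to be \<open>O(eps\<^sup>2)\<close> where the derivative of the history
  perturbation is large and where the delayed times straddle \<open>t\<close>. Both sets of times are seen by \<open>eps * Q\<close>,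
  whose integral is still \<open>O(eps\<^sup>2)\<close>. The cut-offs only serve to make \<open>Q\<close> continuous.\<close>

definition "Q s = max 0 (norm (v0 (max (-b) (min 0 (s - (t + h))))) - r / eps * max 0 (s - (t + h)))
   + max 0 (2 - \<bar>s - t\<bar> / (kap * eps))"

lemma ke_pos: "0 < kap * eps"
  using const_bounds(22) eps(1) by simp

lemma Q_nonneg: "0 \<le> Q s"
  by (simp add: Q_def)

lemma v0_cont: "continuous_on {-b..0} v0" and v_cont: "continuous_on {-b..0} v"
  using lipschitz_on_continuous_on[OF w0_reg(4)] lipschitz_on_continuous_on[OF w_reg(4)] .

lemma Q_cont: "continuous_on X Q"
  unfolding Q_def[abs_def]
proof (intro continuous_intros continuous_on_compose2[OF v0_cont])
  show "(\<lambda>x. max (- b) (min 0 (x - (t + h)))) ` X \<subseteq> {- b..0}" using max_delay_pos by auto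
qed (use ke_pos in auto)

lemma Q_ge_hist:
  assumes "s \<in> {t + h - b..t + h}" shows "norm (v0 (s - (t + h))) \<le> Q s"
proof -
  have "max (-b) (min 0 (s - (t + h))) = s - (t + h)" "max 0 (s - (t + h)) = 0" using assms by auto
  then show ?thesis by (simp add: Q_def add_increasing2)
qed

lemma Q_ge_bump:
  assumes "\<bar>s - t\<bar> \<le> kap * eps" shows "1 \<le> Q s"
proof -
  have "\<bar>s - t\<bar> / (kap * eps) \<le> 1" using assms ke_pos by (simp add: divide_le_eq)
  then have "1 \<le> max 0 (2 - \<bar>s - t\<bar> / (kap * eps))" by simp
  then show ?thesis by (simp add: Q_def add_increasing)
qed

lemma v0_L1: "integral {t + h - b..t + h} (\<lambda>s. norm (v0 (s - (t + h)))) \<le> (1 + b) / 2 * H"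
proof -
  have "integral {-b..0} (\<lambda>\<theta>. norm (v0 (\<theta> + (t + h) - (t + h)))) = integral {-b + (t + h)..0 + (t + h)} (\<lambda>s. norm (v0 (s - (t + h))))"
    by (rule integral_shift_Icc[where h = "\<lambda>s. norm (v0 (s - (t + h)))"])
  moreover have "-b + (t + h) = t + h - b" by simp
  ultimately show ?thesis using norm_H1_W'(4)[OF w0 max_delay_pos r_pos] by (simp add: H_def)
qed

lemma v0_shift_cont: "continuous_on {t + h - b..t + h} (\<lambda>s. v0 (s - (t + h)))"
  by (intro continuous_on_compose2[OF v0_cont] continuous_intros) auto

text \<open>The three summands of \<open>CQ\<close> are the L1 norm of \<open>v0\<close> through
  \<open>norm_H1\<close>, a tail of height at most \<open>r\<close> and length \<open>eps\<close>
  beyond \<open>t + h\<close>, and a bump of height at most \<open>2\<close> on an interval of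
  length \<open>4 * kap * eps\<close>.\<close>

lemma Q_integral: "integral {t + h - b..T} Q \<le> CQ * eps"
proof -
  let ?J = "{t + h - b..t + h}"
  let ?B = "\<lambda>s. ((if s \<in> ?J then norm (v0 (s - (t + h))) else 0) + (if s \<in> {t + h..t + h + eps} then r else 0))
      + (if s \<in> {t - 2 * (kap * eps)..t + 2 * (kap * eps)} then 2 else 0)"
  have J: "?J \<subseteq> {t + h - b..T}" using t_up by auto
  have i1: "(\<lambda>s. if s \<in> ?J then norm (v0 (s - (t + h))) else 0) integrable_on {t + h - b..T}"
    by (rule integral_if_in(2)[OF J integrable_continuous_real[OF continuous_on_norm[OF v0_shift_cont]]])
  have "integral {t + h - b..T} Q \<le> integral {t + h - b..T} ?B"
  proof (intro integral_le integrable_add i1 integrable_if_const integrable_continuous_real Q_cont)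
    fix s assume s: "s \<in> {t + h - b..T}"
    have 1: "max 0 (norm (v0 (max (-b) (min 0 (s - (t + h))))) - r / eps * max 0 (s - (t + h))) \<le>
      (if s \<in> ?J then norm (v0 (s - (t + h))) else 0) + (if s \<in> {t + h..t + h + eps} then r else 0)"
    proof (cases "s \<le> t + h")
      case True
      then have "max (-b) (min 0 (s - (t + h))) = s - (t + h)" "max 0 (s - (t + h)) = 0" "s \<in> ?J" using s by auto
      then show ?thesis using r_pos by simp
    next
      case False
      then have eq: "max (-b) (min 0 (s - (t + h))) = 0" "max 0 (s - (t + h)) = s - (t + h)" "s \<notin> ?J" using max_delay_pos by auto
      have v: "norm (v0 0) \<le> r" using w0_reg(3)[of 0] max_delay_pos by auto
      have nn: "0 \<le> r / eps * (s - (t + h))" using False r_pos eps(1) by simp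
      show ?thesis
      proof (cases "s \<le> t + h + eps")
        case True
        then have "s \<in> {t + h..t + h + eps}" using False by auto
        moreover have "max 0 (norm (v0 0) - r / eps * (s - (t + h))) \<le> r" using v nn r_pos by (intro max.boundedI) linarith+
        ultimately show ?thesis unfolding eq(1,2) if_not_P[OF eq(3)] by simp
      next
        case F2: False
        have "r / eps * eps \<le> r / eps * (s - (t + h))" using F2 r_pos eps(1) by (intro mult_left_mono) auto
        then have "r \<le> r / eps * (s - (t + h))" using eps(1) by simp
        moreover have "s \<notin> {t + h..t + h + eps}" using F2 by auto
        ultimately show ?thesis unfolding eq(1,2) if_not_P[OF eq(3)] using v r_pos by simp
      qed
    qed
    have 2: "max 0 (2 - \<bar>s - t\<bar> / (kap * eps)) \<le> (if s \<in> {t - 2 * (kap * eps)..t + 2 * (kap * eps)} then 2 else 0)"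
    proof (cases "s \<in> {t - 2 * (kap * eps)..t + 2 * (kap * eps)}")
      case True
      then show ?thesis using ke_pos by simp
    next
      case False
      then have "2 * (kap * eps) \<le> \<bar>s - t\<bar>" by auto
      then have "2 \<le> \<bar>s - t\<bar> / (kap * eps)" using ke_pos by (simp add: pos_le_divide_eq)
      then show ?thesis unfolding if_not_P[OF False] by simp
    qed
    show "Q s \<le> ?B s" unfolding Q_def by (rule add_mono[OF 1 2])
  qed
  also have "\<dots> = (integral {t + h - b..T} (\<lambda>s. if s \<in> ?J then norm (v0 (s - (t + h))) else 0)
      + integral {t + h - b..T} (\<lambda>s. if s \<in> {t + h..t + h + eps} then r else 0))
      + integral {t + h - b..T} (\<lambda>s. if s \<in> {t - 2 * (kap * eps)..t + 2 * (kap * eps)} then 2 else 0)"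
    by (subst Henstock_Kurzweil_Integration.integral_add[OF integrable_add[OF i1 integrable_if_const] integrable_if_const])
       (subst Henstock_Kurzweil_Integration.integral_add[OF i1 integrable_if_const], rule refl)
  also have "\<dots> \<le> ((1 + b) / 2 * H + r * (t + h + eps - (t + h))) + 2 * (t + 2 * (kap * eps) - (t - 2 * (kap * eps)))"
    unfolding integral_if_in(1)[OF J]
    using r_pos eps ke_pos h_pos by (intro add_mono v0_L1 integral_if_const_le) auto
  also have "\<dots> \<le> CQ * eps"
  proof -
    have "(1 + b) / 2 * H \<le> (1 + b) / 2 * eps" using eps max_delay_pos by (intro mult_left_mono) auto
    then show ?thesis by (simp add: CQ_def algebra_simps)
  qed
  finally show ?thesis .
qed

section \<open>Second differences of the delayed states\<close>

lemma rhs_lipschitz: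
  assumes c: "t0 \<le> c" and y: "MM-lipschitz_on {c - b..T} y" and yb: "\<And>s. s \<in> {c - b..T} \<Longrightarrow> norm (y s) \<le> RR"
  shows "kF-lipschitz_on {c..T} (\<lambda>s. f s (y s) (delayed y s) (\<alpha> s))"
proof (rule lipschitz_onI)
  have b: "0 < b" by (rule max_delay_pos)
  fix s u assume s: "s \<in> {c..T}" "u \<in> {c..T}"
  have s0: "s \<in> {t0..T}" "u \<in> {t0..T}" using s c by auto
  have sb: "s \<in> {c - b..T}" "u \<in> {c - b..T}" using s b by auto
  have yb': "norm (y s) \<le> RR" if "s \<in> {c..T}" for s using yb[of s] that b by auto
  have db: "norm (delayed y s) \<le> RR" "norm (delayed y u) \<le> RR"
    unfolding delayed_eq by (rule yb[OF dtime_in_range[OF s(1) c]], rule yb[OF dtime_in_range[OF s(2) c]])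
  have 1: "norm (y s - y u) \<le> MM * \<bar>s - u\<bar>" using lipschitz_onD[OF y sb] by (simp add: dist_norm)
  have 2: "norm (delayed y s - delayed y u) \<le> MM * dL RR MM * \<bar>s - u\<bar>"
    using lipschitz_onD[OF delayed_lipschitz[OF c y yb' const_bounds(2)] s] by (simp add: dist_norm)
  have "norm (f s (y s) (delayed y s) (\<alpha> s) - f u (y u) (delayed y u) (\<alpha> u)) \<le>
     fC RR * (\<bar>s - u\<bar> + norm (y s - y u) + norm (delayed y s - delayed y u) + norm (\<alpha> s - \<alpha> u))"
    by (rule fC(2)[OF s0 \<alpha>A \<alpha>A yb[OF sb(1)] yb[OF sb(2)] db])
  also have "\<dots> \<le> fC RR * (\<bar>s - u\<bar> + MM * \<bar>s - u\<bar> + MM * dL RR MM * \<bar>s - u\<bar> + K * \<bar>s - u\<bar>)"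
    using const_bounds(14) by (intro mult_left_mono add_mono 1 2 \<alpha>_diff) auto
  also have "\<dots> = kF * \<bar>s - u\<bar>" by (simp add: kF_def algebra_simps)
  finally show "dist (f s (y s) (delayed y s) (\<alpha> s)) (f u (y u) (delayed y u) (\<alpha> u)) \<le> kF * dist s u"
    by (simp add: dist_norm)
qed (rule const_bounds(23))

definition "D2 u = delayed xp u + delayed xm u - 2 *\<^sub>R delayed x u"

lemma V_lipschitz: "(MM + MM)-lipschitz_on {t - b..T} (\<lambda>s. xm s - x s)"
  using h_pos by (intro lipschitz_on_diff traj_lip(1) lipschitz_on_subset[OF traj_lip(3)]) auto

text \<open>Left of \<open>t\<close> the velocity of \<open>xm - x\<close> is the negative of
  \<open>v0\<close> up to order \<open>eps\<close>: on the history of \<open>xm\<close> directly,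
  and between \<open>t - h\<close> and \<open>t\<close> because \<open>xm\<close> then moves with
  about \<open>F0\<close> while \<open>x\<close> still follows its history. The Lipschitz bound on
  \<open>v0\<close> allows evaluating it at the single point given by \<open>q\<close>.\<close>

lemma V_bound_left:
  assumes q: "q \<in> {t + h - b..<t}" and p: "p \<in> {t + h - b..<t}" and pq: "\<bar>q - p\<bar> \<le> kap * eps"
  shows "norm ((xm p - x p) - (xm q - x q)) \<le> (norm (v0 (q - (t + h))) + C11 * eps) * \<bar>p - q\<bar>"
proof (rule lipschitz_ae_interval_bound[where X = "\<lambda>s. xm s - x s", OF lipschitz_on_subset[OF V_lipschitz] negligible_finite[of "{t - h}"]])
  show "{min p q..max p q} \<subseteq> {t - b..T}" using p q h_pos t_up by auto
  fix s assume s: "s \<in> {min p q<..<max p q} - {t - h}"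
  have sq: "\<bar>s - q\<bar> \<le> kap * eps" "s < t" "t + h - b < s" using s pq p q by auto
  have \<theta>q: "q - (t + h) \<in> {-b..0}" using q h_pos by auto
  have dx: "(x has_vector_derivative v (s - t)) (at s)" using sq h_pos by (intro hist_deriv_traj(1)) auto
  have re: "r * h \<le> r * eps" and rk: "r * (kap * eps + 2 * h) \<le> r * ((kap + 2) * eps)"
    using r_pos eps by (auto intro!: mult_left_mono simp: algebra_simps)
  have C11: "C11 * eps = C5 * eps + 2 * (r * eps) + r * ((kap + 2) * eps)" by (simp add: C11_def algebra_simps)
  have C5: "C5 * h \<le> C5 * eps" "0 \<le> C5 * eps" using const_bounds(16) eps by (auto intro!: mult_left_mono)
  have re0: "0 \<le> r * eps" using r_pos eps by simp
  show "\<exists>D. ((\<lambda>s. xm s - x s) has_vector_derivative D) (at s) \<and> norm D \<le> norm (v0 (q - (t + h))) + C11 * eps"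
  proof (cases "s < t - h")
    case True
    let ?\<xi> = "s - (t - h)"
    have \<xi>: "?\<xi> \<in> {-b..0}" "s - t \<in> {-b..0}" using True sq h_pos by auto
    have dm: "(xm has_vector_derivative (v ?\<xi> - v0 ?\<xi>)) (at s)" using True sq h_pos by (intro hist_deriv_traj(3)) auto
    have 1: "norm (v ?\<xi> - v (s - t)) \<le> r * h" using v_diff(1)[OF \<xi>] h_pos by simp
    have "norm (v0 ?\<xi> - v0 (q - (t + h))) \<le> r * \<bar>?\<xi> - (q - (t + h))\<bar>" by (rule v_diff(2)[OF \<xi>(1) \<theta>q])
    also have "\<dots> \<le> r * (kap * eps + 2 * h)" using sq(1) h_pos r_pos by (intro mult_left_mono) auto
    finally have 2: "norm (v0 ?\<xi> - v0 (q - (t + h))) \<le> r * (kap * eps + 2 * h)" .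
    have "norm ((v ?\<xi> - v0 ?\<xi>) - v (s - t)) \<le> norm (v ?\<xi> - v (s - t)) + norm (v0 ?\<xi>)"
      using norm_triangle_ineq4[of "v ?\<xi> - v (s - t)" "v0 ?\<xi>"] by (simp add: algebra_simps)
    moreover have "norm (v0 ?\<xi>) \<le> norm (v0 (q - (t + h))) + norm (v0 ?\<xi> - v0 (q - (t + h)))" by (rule norm_triangle_sub)
    ultimately have "norm ((v ?\<xi> - v0 ?\<xi>) - v (s - t)) \<le> norm (v0 (q - (t + h))) + C11 * eps"
      using 1 2 re rk C11 C5 re0 by linarith
    then show ?thesis using has_vector_derivative_diff[OF dm dx] by blast
  next
    case False
    then have sI: "s \<in> {t - h<..<T}" "s \<in> {t - h..t + h}" using s sq t_up h_pos by auto
    note dm = traj_deriv(3)[OF sI(1)]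
    let ?F = "f s (xm s) (delayed xm s) (\<alpha> s)"
    have z: "(0::real) \<in> {-b..0}" "s - t \<in> {-b..0}" using sq max_delay_pos h_pos by auto
    have "norm (v 0 - v (s - t)) \<le> r * \<bar>0 - (s - t)\<bar>" by (rule v_diff(1)[OF z])
    also have "\<dots> \<le> r * h" using sI sq(2) r_pos by (intro mult_left_mono) auto
    finally have 1: "norm (v 0 - v (s - t)) \<le> r * h" .
    have "norm (v0 0 - v0 (q - (t + h))) \<le> r * \<bar>0 - (q - (t + h))\<bar>" by (rule v_diff(2)[OF z(1) \<theta>q])
    also have "\<dots> \<le> r * (kap * eps + 2 * h)" using sq(1) sI q h_pos r_pos by (intro mult_left_mono) auto
    finally have 2: "norm (v0 0 - v0 (q - (t + h))) \<le> r * (kap * eps + 2 * h)" .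
    have 3: "norm (v0 0) \<le> norm (v0 (q - (t + h))) + norm (v0 0 - v0 (q - (t + h)))" by (rule norm_triangle_sub)
    have "norm (F0 - v (s - t)) \<le> norm (v 0 - v (s - t)) + norm (v0 0)"
      using norm_triangle_ineq4[of "v 0 - v (s - t)" "v0 0"] by (simp add: F0_def algebra_simps)
    moreover have "norm (?F - v (s - t)) \<le> norm (?F - F0) + norm (F0 - v (s - t))" by (rule norm_diff_via)
    ultimately have "norm (?F - v (s - t)) \<le> norm (v0 (q - (t + h))) + C11 * eps"
      using deriv_near_start[OF sI(2)] 1 2 3 re rk C11 C5 re0 by linarith
    then show ?thesis using has_vector_derivative_diff[OF dm dx] by blast
  qed
qed simp

text \<open>With \<open>p\<close>, \<open>q\<close>, \<open>m\<close> the delayed times of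
  \<open>xm\<close>, \<open>xp\<close>, \<open>x\<close>, the second difference is
  \<open>S q\<close>, plus a second difference of \<open>x\<close> at \<open>p\<close>,
  \<open>q\<close>, \<open>m\<close>, plus an increment of \<open>xm - x\<close> between
  \<open>q\<close> and \<open>p\<close>. Anchoring \<open>S\<close> and \<open>Q\<close> at
  \<open>q\<close> matches \<open>integral_dtime_xp\<close>, which integrates along the delayed time
  of \<open>xp\<close>.\<close>

lemma D2_bound:
  assumes u: "u \<in> {t + h..T}"
  shows "norm (D2 u) \<le> norm (S (dtime xp u)) + C12 * (eps\<^sup>2 + norm (S u)) + C13 * eps * Q (dtime xp u)"
proof -
  define p where "p = dtime xm u"
  define q where "q = dtime xp u"
  define m where "m = dtime x u"
  have rng: "p \<in> {t + h - b..T}" "q \<in> {t + h - b..T}" "m \<in> {t + h - b..T}"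
    unfolding p_def q_def m_def by (rule dtime_in_range[OF u t_range(5)])+
  then have rng': "p \<in> {t - b..T}" "q \<in> {t - b..T}" "m \<in> {t - b..T}" "p \<in> {t - h - b..T}" "q \<in> {t - h - b..T}" using h_pos by auto
  note c = dtime_close[OF u, folded p_def q_def m_def]
  note cb = const_bounds
  have e2: "eps\<^sup>2 = eps * eps" by (simp add: power2_eq_square)
  define R1 where "R1 = xm p - xm q + 2 *\<^sub>R (x q - x m)"
  have D2: "D2 u = S q + R1" by (simp add: D2_def R1_def delayed_eq S_def p_def q_def m_def scaleR_diff_right)
  have pq2: "(p - q)\<^sup>2 \<le> (kap * eps)\<^sup>2"
    using c(1) ke_pos by (intro power2_le_iff_abs_le[THEN iffD2]) (auto simp: abs_minus_commute)
  have spread: "MM * \<bar>p + q - 2 * m\<bar> \<le> MM * tD RR * C2\<^sup>2 * eps\<^sup>2 + MM * tL * norm (S u)"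
  proof -
    have "MM * \<bar>p + q - 2 * m\<bar> \<le> MM * (tD RR * C2\<^sup>2 * eps\<^sup>2 + tL * norm (S u))"
      using c(3) cb(5) by (intro mult_left_mono) (auto simp: add.commute)
    then show ?thesis by (simp add: algebra_simps)
  qed
  have R1_split: "R1 = (x p + x q - 2 *\<^sub>R x m) + ((xm p - x p) - (xm q - x q))"
    by (simp add: R1_def scaleR_2 scaleR_diff_right)
  have nonneg: "0 \<le> C12 * (eps\<^sup>2 + norm (S u))" "0 \<le> C13 * eps * Q q"
    using cb(25,26) Q_nonneg eps by simp_all
  have key: "norm R1 \<le> C12 * (eps\<^sup>2 + norm (S u)) + C13 * eps * Q q"
    if X: "norm (x p + x q - 2 *\<^sub>R x m) \<le> (kF + r) * (p - q)\<^sup>2 + MM * \<bar>p + q - 2 * m\<bar>"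
      and V: "norm ((xm p - x p) - (xm q - x q)) \<le> kap * C11 * eps\<^sup>2 + kap * C6 * eps\<^sup>2 + kap * eps * Q q"
  proof -
    have "(kF + r) * (p - q)\<^sup>2 \<le> (kF + r) * (kap\<^sup>2 * eps\<^sup>2)"
      using pq2 cb(23) r_pos by (intro mult_left_mono) (auto simp: power_mult_distrib)
    then have "norm R1 \<le> ((kF + r) * kap\<^sup>2 + MM * tD RR * C2\<^sup>2 + kap * C11 + kap * C6) * eps\<^sup>2 + MM * tL * norm (S u) + kap * eps * Q q"
      using norm_triangle_ineq[of "x p + x q - 2 *\<^sub>R x m" "(xm p - x p) - (xm q - x q)"] X V spread
      unfolding R1_split by (simp add: algebra_simps)
    also have "\<dots> \<le> C12 * eps\<^sup>2 + C12 * norm (S u) + C13 * eps * Q q"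
    proof (intro add_mono mult_right_mono)
      show "(kF + r) * kap\<^sup>2 + MM * tD RR * C2\<^sup>2 + kap * C11 + kap * C6 \<le> C12"
        using cb(5) tL(1) by (simp add: C12_def)
      show "MM * tL \<le> C12" unfolding C12_def
        using cb(5,17,22,23,24) r_pos tD(1)[OF cb(3)] by simp
      show "kap \<le> C13" using cb(5,22) by (simp add: C13_def)
    qed (use eps Q_nonneg in auto)
    finally show ?thesis by (simp add: distrib_left)
  qed
  have "norm R1 \<le> C12 * (eps\<^sup>2 + norm (S u)) + C13 * eps * Q q"
  \<comment> \<open>In this zone the delayed times may lie on both sides of \<open>t\<close>;
    Lipschitz bounds of order \<open>eps\<close> are used there, absorbed by the bump, where
    \<open>Q\<close> is at least \<open>1\<close>. Otherwise all three lie strictly on one side,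
    \<open>p\<close> and \<open>m\<close> being within \<open>kap * eps\<close> of \<open>q\<close>,
    and \<open>x\<close> has a Lipschitz derivative on that side.\<close>
  proof (cases "\<bar>q - t\<bar> \<le> kap * eps")
    case True
    have "norm (xm p - xm q) \<le> MM * (kap * eps)"
      using traj_diff(3)[OF rng'(4,5)] c(1) mult_left_mono[OF _ cb(5), of "\<bar>p - q\<bar>" "kap * eps"] by (simp add: abs_minus_commute)
    moreover have "norm (x q - x m) \<le> MM * (kap * eps)"
      using traj_diff(1)[OF rng'(2,3)] c(2) mult_left_mono[OF _ cb(5), of "\<bar>q - m\<bar>" "kap * eps"] by simp
    moreover have "norm R1 \<le> norm (xm p - xm q) + 2 * norm (x q - x m)"
      unfolding R1_def using norm_triangle_ineq[of "xm p - xm q" "2 *\<^sub>R (x q - x m)"] by simp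
    ultimately have "norm R1 \<le> 3 * MM * kap * eps * 1" by simp
    also have "\<dots> \<le> C13 * eps * Q q"
    proof (rule mult_mono[OF _ Q_ge_bump[OF True]])
      show "3 * MM * kap * eps \<le> C13 * eps" using cb(22) eps by (simp add: C13_def distrib_right)
      show "0 \<le> C13 * eps" using cb(26) eps by simp
    qed simp
    finally show ?thesis using nonneg(1) by linarith
  next
    case False
    show ?thesis
    proof (cases "q < t")
      case True
      then have lt: "q < t - kap * eps" using False by linarith
      have pm: "p < t" "m < t" using c(1,2) lt by linarith+
      show ?thesis
      proof (rule key)
        have "norm (x p + x q - 2 *\<^sub>R x m) \<le> r * (p - q)\<^sup>2 + MM * \<bar>p + q - 2 * m\<bar>"
        proof (rule second_difference_bound[OF lipschitz_on_subset[OF traj_lip(1)] negligible_empty])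
          show "r-lipschitz_on {t - b..t} (\<lambda>s. v (s - t))"
          proof (rule lipschitz_onI)
            fix s u assume "s \<in> {t - b..t}" "u \<in> {t - b..t}"
            then show "dist (v (s - t)) (v (u - t)) \<le> r * dist s u"
              using v_diff(1)[of "s - t" "u - t"] by (simp add: dist_norm)
          qed (use r_pos in simp)
          show "(x has_vector_derivative v (s - t)) (at s)" if "s \<in> {t - b<..<t} - {}" for s
            using that by (intro hist_deriv_traj(1)) auto
        qed (use rng' True pm t_range in auto)
        moreover have "r * (p - q)\<^sup>2 \<le> (kF + r) * (p - q)\<^sup>2" using cb(23) by (intro mult_right_mono) auto
        ultimately show "norm (x p + x q - 2 *\<^sub>R x m) \<le> (kF + r) * (p - q)\<^sup>2 + MM * \<bar>p + q - 2 * m\<bar>" by linarith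
        have qp: "\<bar>q - p\<bar> \<le> kap * eps" by (rule c(1))
        have "norm ((xm p - x p) - (xm q - x q)) \<le> (norm (v0 (q - (t + h))) + C11 * eps) * \<bar>p - q\<bar>"
          by (rule V_bound_left) (use rng True pm qp in auto)
        also have "\<dots> \<le> (Q q + C11 * eps) * (kap * eps)"
        proof (intro mult_mono add_right_mono)
          show "norm (v0 (q - (t + h))) \<le> Q q" using rng True h_pos by (intro Q_ge_hist) auto
          show "\<bar>p - q\<bar> \<le> kap * eps" using qp by (simp add: abs_minus_commute)
          show "0 \<le> Q q + C11 * eps" using Q_nonneg[of q] cb(24) eps by simp
        qed simp
        also have "\<dots> = kap * C11 * eps\<^sup>2 + kap * eps * Q q" by (simp add: e2 algebra_simps)
        also have "\<dots> \<le> kap * C11 * eps\<^sup>2 + kap * C6 * eps\<^sup>2 + kap * eps * Q q" using cb(17,22) by simp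
        finally show "norm ((xm p - x p) - (xm q - x q)) \<le> kap * C11 * eps\<^sup>2 + kap * C6 * eps\<^sup>2 + kap * eps * Q q" .
      qed
    next
      case F2: False
      then have gt: "t + kap * eps < q" using False by linarith
      have pm: "t < p" "t < m" using c(1,2) gt by linarith+
      have qt: "t < q" using gt ke_pos by linarith
      show ?thesis
      proof (rule key)
        have sub: "{t..T} \<subseteq> {t - b..T}" using max_delay_pos by auto
        have "norm (x p + x q - 2 *\<^sub>R x m) \<le> kF * (p - q)\<^sup>2 + MM * \<bar>p + q - 2 * m\<bar>"
        proof (rule second_difference_bound[OF lipschitz_on_subset[OF traj_lip(1) sub] negligible_empty])
          show "kF-lipschitz_on {t..T} (\<lambda>s. f s (x s) (delayed x s) (\<alpha> s))"
            by (rule rhs_lipschitz[OF t_range(4) traj_lip(1) traj_bound(1)])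
          show "(x has_vector_derivative f s (x s) (delayed x s) (\<alpha> s)) (at s)" if "s \<in> {t<..<T} - {}" for s
            using that by (intro traj_deriv(1)) auto
        qed (use rng' pm qt in auto)
        moreover have "kF * (p - q)\<^sup>2 \<le> (kF + r) * (p - q)\<^sup>2" using r_pos by (intro mult_right_mono) auto
        ultimately show "norm (x p + x q - 2 *\<^sub>R x m) \<le> (kF + r) * (p - q)\<^sup>2 + MM * \<bar>p + q - 2 * m\<bar>" by linarith
        have "norm ((xm p - x p) - (xm q - x q)) \<le> C6 * eps * \<bar>p - q\<bar>"
        proof (rule lipschitz_ae_interval_bound[where X = "\<lambda>s. xm s - x s", OF lipschitz_on_subset[OF V_lipschitz] negligible_empty])
          show "{min p q..max p q} \<subseteq> {t - b..T}" using rng' by auto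
          fix s assume "s \<in> {min p q<..<max p q} - {}"
          then have s: "s \<in> {t<..<T}" using pm qt rng' by auto
          have sm: "s \<in> {t - h<..<T}" using s h_pos by auto
          show "\<exists>D. ((\<lambda>s. xm s - x s) has_vector_derivative D) (at s) \<and> norm D \<le> C6 * eps"
            using has_vector_derivative_diff[OF traj_deriv(3)[OF sm] traj_deriv(1)[OF s]] deriv_close_m[of s] s by auto
        qed
        also have "\<dots> \<le> C6 * eps * (kap * eps)" using c(1) cb(17) eps by (intro mult_left_mono) (auto simp: abs_minus_commute)
        also have "\<dots> = kap * C6 * eps\<^sup>2" by (simp add: e2)
        also have "\<dots> \<le> kap * C11 * eps\<^sup>2 + kap * C6 * eps\<^sup>2 + kap * eps * Q q"
          using cb(22,24) eps Q_nonneg[of q] by simp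
        finally show "norm ((xm p - x p) - (xm q - x q)) \<le> kap * C11 * eps\<^sup>2 + kap * C6 * eps\<^sup>2 + kap * eps * Q q" .
      qed
    qed
  qed
  then show ?thesis unfolding D2 q_def[symmetric] using norm_triangle_ineq[of "S q" R1] by linarith
qed

section \<open>Integral inequality and Gronwall bound for the second difference of the
  states\<close>

lemma S_cont: "continuous_on {t + h - b..T} S"
  unfolding S_def[abs_def] using h_pos
  by (intro continuous_intros continuous_on_subset[OF lipschitz_on_continuous_on[OF traj_lip(1)]]
      lipschitz_on_continuous_on[OF traj_lip(2)] continuous_on_subset[OF lipschitz_on_continuous_on[OF traj_lip(3)]]) auto

text \<open>The factor \<open>eps\<close> in front of \<open>norm (v0 \<theta>)\<close> in the
  pointwise bound meets an L1 norm of order \<open>eps\<close>.\<close>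

lemma S_hist_integral: "integral {t + h - b..t + h} (\<lambda>s. norm (S s)) \<le> C9 * (b + (1 + b) / 2) * eps\<^sup>2"
proof -
  have b: "0 < b" by (rule max_delay_pos)
  have "integral {t + h - b..t + h} (\<lambda>s. norm (S s)) \<le> integral {t + h - b..t + h} (\<lambda>s. C9 * eps * (eps + norm (v0 (s - (t + h)))))"
  proof (intro integral_le integrable_continuous_real continuous_intros v0_shift_cont continuous_on_subset[OF S_cont])
    fix s assume "s \<in> {t + h - b..t + h}"
    then show "norm (S s) \<le> C9 * eps * (eps + norm (v0 (s - (t + h))))" using S_history_bound[of "s - (t + h)"] by simp
  qed (use t_up in auto)
  also have "\<dots> = C9 * eps * (b * eps + integral {t + h - b..t + h} (\<lambda>s. norm (v0 (s - (t + h)))))"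
    using b by (subst integral_mult_right, subst Henstock_Kurzweil_Integration.integral_add)
      (auto intro!: integrable_continuous_real continuous_intros v0_shift_cont)
  also have "\<dots> \<le> C9 * eps * (b * eps + (1 + b) / 2 * eps)"
  proof (intro mult_left_mono add_left_mono)
    have "(1 + b) / 2 * H \<le> (1 + b) / 2 * eps" using eps b by (intro mult_left_mono) auto
    then show "integral {t + h - b..t + h} (\<lambda>s. norm (v0 (s - (t + h)))) \<le> (1 + b) / 2 * eps" using v0_L1 by linarith
    show "0 \<le> C9 * eps" using const_bounds(20) eps by simp
  qed
  also have "\<dots> = C9 * (b + (1 + b) / 2) * eps\<^sup>2" by (simp add: power2_eq_square algebra_simps)
  finally show ?thesis .
qed

lemma dtime_xp_lipschitz: "(dL RR MM)-lipschitz_on {t + h..T} (dtime xp)"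
proof (rule dtime_lipschitz[OF t_range(5) lipschitz_on_subset[OF traj_lip(2)] _ const_bounds(2)])
  show "norm (xp s) \<le> RR" if "s \<in> {t + h..T}" for s using that max_delay_pos by (intro traj_bound(2)) auto
qed (use max_delay_pos in auto)

text \<open>The monotone delay assumption enters the second difference estimates here, along
  \<open>xp\<close>, whose history has size at most \<open>2 * r\<close>.\<close>

lemma integral_dtime_xp:
  assumes s: "s \<in> {t + h..T}" and cont: "continuous_on {t + h - b..T} \<phi>" and nonneg: "\<And>s. s \<in> {t + h - b..T} \<Longrightarrow> 0 \<le> \<phi> s"
  shows "integral {t + h..s} (\<lambda>u. \<phi> (dtime xp u)) \<le> (1 / DD) * integral {t + h - b..s} \<phi>"
proof -
  have wp: "(\<lambda>\<theta>. w \<theta> + w0 \<theta>) \<in> P_hist b (2 * r)"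
  proof (rule P_histI[of "r + r"])
    show "(r + r)-lipschitz_on {-b..0} (\<lambda>\<theta>. w \<theta> + w0 \<theta>)" by (intro lipschitz_on_add w_reg(5) w0_reg(5))
    show "norm (w \<theta> + w0 \<theta>) \<le> 2 * r" if "\<theta> \<in> {-b..0}" for \<theta>
      using w_reg(2)[OF that] w0_reg(2)[OF that] norm_triangle_ineq[of "w \<theta>" "w0 \<theta>"] by linarith
  qed
  have r2: "0 < 2 * r" using r_pos by simp
  obtain N where N: "negligible N" "\<And>s. s \<in> {t + h<..<T} - N \<Longrightarrow> \<exists>D\<ge>DD. (dtime xp has_real_derivative D) (at s)"
    using dtime_expanding[OF r2 t_range(2) wp \<alpha>_controls xp] unfolding DD_def by blast
  have "DD * integral {t + h..s} (\<lambda>u. \<phi> (dtime xp u)) \<le> integral {t + h - b..s} \<phi>"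
  proof (rule integral_comp_expanding_le[OF lipschitz_on_subset[OF dtime_xp_lipschitz] _ N(1)])
    show "\<exists>D\<ge>DD. (dtime xp has_real_derivative D) (at u)" if "u \<in> {t + h<..<s} - N" for u
      using that s by (intro N(2)) auto
    show "dtime xp ` {t + h..s} \<subseteq> {t + h - b..s}"
    proof (rule image_subsetI)
      fix u assume "u \<in> {t + h..s}"
      then show "dtime xp u \<in> {t + h - b..s}" using dtime_bounds[of u xp] s t_range by auto
    qed
    show "continuous_on {t + h - b..s} \<phi>" using s by (intro continuous_on_subset[OF cont]) auto
    show "0 \<le> \<phi> u" if "u \<in> {t + h - b..s}" for u using that s by (intro nonneg) auto
  qed (use s const_bounds(7) in auto)
  then show ?thesis using const_bounds(7) by (simp add: field_simps)
qed

text \<open>The part of the bound on \<open>D2\<close> that is evaluated at the delayed time of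
  \<open>xp\<close>, up to the factor \<open>1 + C13\<close>.\<close>

definition "Z s = norm (S s) + eps * Q s"

lemma Z_cont: "continuous_on {t + h - b..T} Z"
  unfolding Z_def[abs_def] by (intro continuous_intros S_cont Q_cont)

lemma Z_nonneg: "0 \<le> Z s"
  using Q_nonneg eps by (simp add: Z_def)

lemma Z_integral:
  assumes s: "s \<in> {t + h..T}"
  shows "integral {t + h - b..s} Z \<le> ZJ * eps\<^sup>2 + integral {t + h..s} (\<lambda>u. norm (S u))"
proof -
  have b: "0 < b" by (rule max_delay_pos)
  have cS: "continuous_on {t + h - b..s} S" using s by (intro continuous_on_subset[OF S_cont]) auto
  have "integral {t + h - b..s} Z = integral {t + h - b..s} (\<lambda>s. norm (S s)) + eps * integral {t + h - b..s} Q"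
    unfolding Z_def[abs_def]
    by (subst Henstock_Kurzweil_Integration.integral_add) (auto intro!: integrable_continuous_real continuous_intros cS Q_cont)
  moreover have "integral {t + h - b..s} (\<lambda>s. norm (S s)) = integral {t + h - b..t + h} (\<lambda>s. norm (S s)) + integral {t + h..s} (\<lambda>s. norm (S s))"
    using s b by (intro Henstock_Kurzweil_Integration.integral_combine[symmetric] integrable_continuous_real continuous_on_norm cS) auto
  moreover have "eps * integral {t + h - b..s} Q \<le> eps * (CQ * eps)"
  proof (intro mult_left_mono)
    have "integral {t + h - b..s} Q \<le> integral {t + h - b..T} Q"
      using s by (intro integral_subset_le integrable_continuous_real Q_cont) (auto intro: Q_nonneg)
    then show "integral {t + h - b..s} Q \<le> CQ * eps" using Q_integral by linarith
  qed (use eps in simp)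
  moreover have "ZJ * eps\<^sup>2 = C9 * (b + (1 + b) / 2) * eps\<^sup>2 + eps * (CQ * eps)" by (simp add: ZJ_def power2_eq_square algebra_simps)
  ultimately show ?thesis using S_hist_integral by linarith
qed

lemma D2_bound_Z:
  assumes u: "u \<in> {t + h..T}"
  shows "norm (D2 u) \<le> C12 * eps\<^sup>2 + C12 * norm (S u) + (1 + C13) * Z (dtime xp u)"
proof -
  have "norm (S (dtime xp u)) + C13 * eps * Q (dtime xp u) \<le> (1 + C13) * Z (dtime xp u)"
    using const_bounds(26) eps(4) Q_nonneg[of "dtime xp u"] by (simp add: Z_def algebra_simps)
  then show ?thesis using D2_bound[OF u] by (simp add: algebra_simps)
qed

lemma midpoint_diffs: "(1/2) *\<^sub>R (xp u + xm u) - x u = (1/2) *\<^sub>R S u"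
  "(1/2) *\<^sub>R (delayed xp u + delayed xm u) - delayed x u = (1/2) *\<^sub>R D2 u"
  by (simp_all add: S_def D2_def vec_eq_iff field_simps)

lemma state_bounds:
  assumes u: "u \<in> {t + h..T}"
  shows "norm (x u) \<le> RR" "norm (xp u) \<le> RR" "norm (xm u) \<le> RR"
    "norm (delayed x u) \<le> RR" "norm (delayed xp u) \<le> RR" "norm (delayed xm u) \<le> RR"
    "(norm (xp u - xm u))\<^sup>2 + (norm (delayed xp u - delayed xm u))\<^sup>2 \<le> (C2\<^sup>2 + C3\<^sup>2) * eps\<^sup>2"
proof -
  have b: "0 < b" by (rule max_delay_pos)
  have sub: "s \<in> {t + h - b..T} \<Longrightarrow> s \<in> {t - b..T}" "s \<in> {t + h - b..T} \<Longrightarrow> s \<in> {t - h - b..T}" for s using h_pos by auto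
  have u': "u \<in> {t + h - b..T}" using u b by auto
  show "norm (x u) \<le> RR" "norm (xp u) \<le> RR" "norm (xm u) \<le> RR"
    by (rule traj_bound(1)[OF sub(1)[OF u']], rule traj_bound(2)[OF u'], rule traj_bound(3)[OF sub(2)[OF u']])
  note d = dtime_in_range[OF u t_range(5)]
  show "norm (delayed x u) \<le> RR" "norm (delayed xp u) \<le> RR" "norm (delayed xm u) \<le> RR"
    unfolding delayed_eq by (rule traj_bound(1)[OF sub(1)[OF d]], rule traj_bound(2)[OF d], rule traj_bound(3)[OF sub(2)[OF d]])
  have "(norm (xp u - xm u))\<^sup>2 \<le> (C2 * eps)\<^sup>2" by (intro power_mono traj_close(3)[OF u']) simp
  moreover have "(norm (delayed xp u - delayed xm u))\<^sup>2 \<le> (C3 * eps)\<^sup>2" by (intro power_mono delayed_close[OF u]) simp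
  ultimately show "(norm (xp u - xm u))\<^sup>2 + (norm (delayed xp u - delayed xm u))\<^sup>2 \<le> (C2\<^sup>2 + C3\<^sup>2) * eps\<^sup>2"
    by (simp add: power_mult_distrib distrib_right)
qed

text \<open>\<open>f\<close> at the mean of the arguments along \<open>xp\<close> and
  \<open>xm\<close> serves as intermediate value: the second order condition on \<open>f\<close>
  compares it with the velocities of \<open>xp\<close> and \<open>xm\<close>, Lipschitz continuity
  with that of \<open>x\<close>, the arguments differing by half of \<open>S u\<close> and of
  \<open>D2 u\<close>.\<close>

lemma S_deriv_bound:
  assumes u: "u \<in> {t + h<..<T}"
  shows "\<exists>D. (S has_vector_derivative D) (at u) \<and>
     norm D \<le> C14 * eps\<^sup>2 + C15 * norm (S u) + C15 * Z (dtime xp u)"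
proof -
  have u': "u \<in> {t + h..T}" "u \<in> {t<..<T}" "u \<in> {t - h<..<T}" "u \<in> {t0..T}" using u h_pos t_range by auto
  note sb = state_bounds[OF u'(1)]
  let ?fp = "f u (xp u) (delayed xp u) (\<alpha> u)" and ?fm = "f u (xm u) (delayed xm u) (\<alpha> u)" and ?fx = "f u (x u) (delayed x u) (\<alpha> u)"
  let ?mid = "f u ((1/2) *\<^sub>R (xp u + xm u)) ((1/2) *\<^sub>R (delayed xp u + delayed xm u)) (\<alpha> u)"
  have D: "(S has_vector_derivative ?fp + ?fm - 2 *\<^sub>R ?fx) (at u)"
    unfolding S_def[abs_def]
    by (intro has_vector_derivative_diff has_vector_derivative_add traj_deriv u u'
        bounded_linear.has_vector_derivative[OF bounded_linear_scaleR_right])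
  have 1: "norm (?fp + ?fm - 2 *\<^sub>R ?mid) \<le> fD RR * ((C2\<^sup>2 + C3\<^sup>2) * eps\<^sup>2)"
    by (rule order_trans[OF fD(2)[OF const_bounds(3) u'(4) \<alpha>A[of u] sb(2,3,5,6)]
          mult_left_mono[OF sb(7) less_imp_le[OF fD(1)[OF const_bounds(3)]]]])
  have "norm (?mid - ?fx) \<le> fL * (norm ((1/2) *\<^sub>R S u) + norm ((1/2) *\<^sub>R D2 u))"
    using fL(2)[OF u'(4) \<alpha>A, of "(1/2) *\<^sub>R (xp u + xm u)" "(1/2) *\<^sub>R (delayed xp u + delayed xm u)" u "x u" "delayed x u"]
    unfolding midpoint_diffs .
  then have 2: "2 * norm (?mid - ?fx) \<le> fL * (norm (S u) + norm (D2 u))" by (simp add: algebra_simps)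
  have "norm (?fp + ?fm - 2 *\<^sub>R ?fx) \<le> norm (?fp + ?fm - 2 *\<^sub>R ?mid) + 2 * norm (?mid - ?fx)"
  proof -
    have "?fp + ?fm - 2 *\<^sub>R ?fx = (?fp + ?fm - 2 *\<^sub>R ?mid) + 2 *\<^sub>R (?mid - ?fx)" by (simp add: scaleR_diff_right)
    then have "norm (?fp + ?fm - 2 *\<^sub>R ?fx) \<le> norm (?fp + ?fm - 2 *\<^sub>R ?mid) + norm (2 *\<^sub>R (?mid - ?fx))"
      using norm_triangle_ineq[of "?fp + ?fm - 2 *\<^sub>R ?mid" "2 *\<^sub>R (?mid - ?fx)"] by (simp only:)
    moreover have "norm (2 *\<^sub>R (?mid - ?fx)) = 2 * norm (?mid - ?fx)" by (simp only: norm_scaleR abs_numeral)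
    ultimately show ?thesis by linarith
  qed
  also have "\<dots> \<le> fD RR * ((C2\<^sup>2 + C3\<^sup>2) * eps\<^sup>2) + fL * (norm (S u) + norm (D2 u))" using 1 2 by linarith
  also have "\<dots> \<le> fD RR * ((C2\<^sup>2 + C3\<^sup>2) * eps\<^sup>2) + fL * (norm (S u) + (C12 * eps\<^sup>2 + C12 * norm (S u) + (1 + C13) * Z (dtime xp u)))"
    using D2_bound_Z[OF u'(1)] fL(1) by (intro add_left_mono mult_left_mono) auto
  also have "\<dots> \<le> C14 * eps\<^sup>2 + C15 * norm (S u) + C15 * Z (dtime xp u)"
  proof -
    have "0 \<le> fL * C13 * norm (S u)" "0 \<le> fL * C12 * Z (dtime xp u)" using fL(1) const_bounds(25,26) Z_nonneg by simp_all
    then show ?thesis by (simp add: C14_def C15_def algebra_simps)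
  qed
  finally show ?thesis using D by blast
qed

lemma S_lipschitz: "((MM + MM) + 2 * MM)-lipschitz_on {t + h - b..T} S"
proof -
  have "(\<bar>2\<bar> * MM)-lipschitz_on {t + h - b..T} (\<lambda>s. 2 *\<^sub>R x s)"
    using h_pos by (intro lipschitz_on_cmult lipschitz_on_subset[OF traj_lip(1)]) auto
  then show ?thesis unfolding S_def[abs_def] using h_pos
    by (intro lipschitz_on_diff lipschitz_on_add traj_lip(2) lipschitz_on_subset[OF traj_lip(3)]) auto
qed

definition "Y s = integral {t + h..s} (\<lambda>u. norm (S u))"

lemma S_cont': "continuous_on {t + h..T} S"
  using max_delay_pos by (intro continuous_on_subset[OF S_cont]) auto

lemma Z_dtime_cont: "continuous_on {t + h..T} (\<lambda>u. Z (dtime xp u))"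
  by (rule continuous_on_compose2[OF Z_cont lipschitz_on_continuous_on[OF dtime_xp_lipschitz]])
     (use dtime_in_range[OF _ t_range(5)] in blast)

text \<open>The term \<open>Z (dtime xp u)\<close> is not estimated pointwise; integrated, it is at
  most \<open>1 / DD\<close> times the integral of \<open>Z\<close>, whose only unknown part is
  \<open>Y\<close>. The result is a closed inequality between \<open>S\<close> and its own
  integral.\<close>

lemma S_integral_inequality:
  assumes s: "s \<in> {t + h..T}"
  shows "norm (S s) \<le> C16 * eps\<^sup>2 + C17 * Y s"
proof -
  have b: "0 < b" by (rule max_delay_pos)
  have sub: "{t + h..s} \<subseteq> {t + h..T}" using s by auto
  have c: "continuous_on {t + h..s} S" "continuous_on {t + h..s} (\<lambda>u. Z (dtime xp u))"
    by (rule continuous_on_subset[OF S_cont' sub], rule continuous_on_subset[OF Z_dtime_cont sub])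
  have "norm (S s - S (t + h)) \<le> integral {t + h..s} (\<lambda>u. C14 * eps\<^sup>2 + C15 * norm (S u) + C15 * Z (dtime xp u))"
  proof (rule lipschitz_ae_integral_bound[OF lipschitz_on_subset[OF S_lipschitz] _ negligible_empty])
    show "\<exists>D. (S has_vector_derivative D) (at u) \<and> norm D \<le> C14 * eps\<^sup>2 + C15 * norm (S u) + C15 * Z (dtime xp u)"
      if "u \<in> {t + h<..<s} - {}" for u
      using that s by (intro S_deriv_bound) auto
  qed (use s b c in \<open>auto intro!: continuous_intros\<close>)
  also have "\<dots> = C14 * eps\<^sup>2 * (s - (t + h)) + C15 * Y s + C15 * integral {t + h..s} (\<lambda>u. Z (dtime xp u))"
    using s by (subst Henstock_Kurzweil_Integration.integral_add, (auto intro!: integrable_continuous_real continuous_intros c)[2],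
      subst Henstock_Kurzweil_Integration.integral_add, (auto intro!: integrable_continuous_real continuous_intros c)[2])
      (simp add: Y_def)
  also have "\<dots> \<le> C14 * eps\<^sup>2 * (T - t0) + C15 * Y s + C15 * ((1 / DD) * (ZJ * eps\<^sup>2 + Y s))"
  proof (intro add_mono mult_left_mono order.refl)
    have "integral {t + h..s} (\<lambda>u. Z (dtime xp u)) \<le> (1 / DD) * integral {t + h - b..s} Z"
      by (rule integral_dtime_xp[OF s Z_cont Z_nonneg])
    also have "\<dots> \<le> (1 / DD) * (ZJ * eps\<^sup>2 + Y s)"
      using Z_integral[OF s] const_bounds(7) unfolding Y_def by (intro mult_left_mono) auto
    finally show "integral {t + h..s} (\<lambda>u. Z (dtime xp u)) \<le> (1 / DD) * (ZJ * eps\<^sup>2 + Y s)" .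
  qed (use s t_range const_bounds2 in auto)
  finally have "norm (S s - S (t + h)) \<le> C14 * eps\<^sup>2 * (T - t0) + C15 * Y s + C15 * ((1 / DD) * (ZJ * eps\<^sup>2 + Y s))" .
  then have "norm (S s) \<le> C10 * eps\<^sup>2 + (C14 * eps\<^sup>2 * (T - t0) + C15 * Y s + C15 * ((1 / DD) * (ZJ * eps\<^sup>2 + Y s)))"
    using S_start_bound norm_triangle_sub[of "S s" "S (t + h)"] by linarith
  also have "\<dots> = C16 * eps\<^sup>2 + C17 * Y s" by (simp add: C16_def C17_def algebra_simps)
  finally show ?thesis .
qed

lemma Y_bound:
  assumes s: "s \<in> {t + h..T}"
  shows "Y s \<le> C18 * eps\<^sup>2"
proof -
  obtain B where B: "\<And>s. s \<in> {t + h..T} \<Longrightarrow> norm (norm (S s)) \<le> B" "0 \<le> B"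
    using continuous_on_Icc_bounded[OF continuous_on_norm[OF S_cont']] by blast
  have lY: "B-lipschitz_on {t + h..T} Y" unfolding Y_def[abs_def]
    by (rule continuous_indefinite_integral_lipschitz[OF continuous_on_norm[OF S_cont'] B])
  have "norm (Y s) \<le> 2 * (0 + 0 + C16 * eps\<^sup>2 * (T - (t + h))) * exp (2 * C17 * (s - (t + h)))"
  \<comment> \<open>The derivative of \<open>Y\<close> is \<open>norm (S u)\<close>, so the
    inequality for \<open>S\<close> is a differential inequality for \<open>Y\<close>; the rate
    \<open>2 * C17\<close> allows for the factor \<open>k / 2\<close>.\<close>
  proof (rule exponential_gronwall[where e = Y and E = "\<lambda>_. 0" and K = B and N = "{}"])
    show "B-lipschitz_on {t + h..T} (\<lambda>s. Y s - 0)" using lY by simp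
    show "norm (Y (t + h) - 0) \<le> 0" by (simp add: Y_def)
    fix u assume "u \<in> {t + h<..<T} - {}"
    then have u: "u \<in> {t + h<..<T}" "u \<in> {t + h..T}" by auto
    have "((\<lambda>s. Y s - 0) has_vector_derivative norm (S u)) (at u)"
      using integral_has_vector_derivative_interior[OF continuous_on_norm[OF S_cont'] u(1)] by (simp add: Y_def[abs_def])
    moreover have "norm (norm (S u)) \<le> 2 * C17 / 2 * M * exp (2 * C17 * (u - (t + h))) + C16 * eps\<^sup>2"
      if M: "0 \<le> M" "\<forall>v\<in>{t + h..u}. norm (Y v) \<le> M * exp (2 * C17 * (v - (t + h)))" for M
    proof -
      have "Y u \<le> M * exp (2 * C17 * (u - (t + h)))" using bspec[OF M(2), of u] u by auto
      then have "C17 * Y u \<le> C17 * (M * exp (2 * C17 * (u - (t + h))))" using const_bounds2(6) by (intro mult_left_mono) auto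
      then show ?thesis using S_integral_inequality[OF u(2)] by (simp add: mult.assoc)
    qed
    ultimately show "\<exists>D. ((\<lambda>s. Y s - 0) has_vector_derivative D) (at u) \<and>
         (\<forall>M\<ge>0. (\<forall>v\<in>{t + h..u}. norm (Y v) \<le> M * exp (2 * C17 * (v - (t + h)))) \<longrightarrow>
            norm D \<le> 2 * C17 / 2 * M * exp (2 * C17 * (u - (t + h))) + C16 * eps\<^sup>2)"
      by blast
  qed (use s t_up const_bounds2(5,6) lipschitz_on_continuous_on[OF lY] in auto)
  also have "\<dots> \<le> 2 * (C16 * eps\<^sup>2 * (T - t0)) * exp (2 * C17 * (T - t0))"
  proof (intro mult_mono)
    show "0 + 0 + C16 * eps\<^sup>2 * (T - (t + h)) \<le> C16 * eps\<^sup>2 * (T - t0)"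
      using mult_left_mono[of "T - (t + h)" "T - t0" "C16 * eps\<^sup>2"] t_range const_bounds2(5) by simp
    show "exp (2 * C17 * (s - (t + h))) \<le> exp (2 * C17 * (T - t0))"
      using mult_left_mono[of "s - (t + h)" "T - t0" "2 * C17"] s t_range const_bounds2(6) by simp
  qed (use const_bounds2(5,10) t_up in auto)
  also have "\<dots> = C18 * eps\<^sup>2" by (simp add: C18_def)
  finally show ?thesis by simp
qed

lemma S_bound:
  assumes s: "s \<in> {t + h..T}"
  shows "norm (S s) \<le> C19 * eps\<^sup>2"
proof -
  have "norm (S s) \<le> C16 * eps\<^sup>2 + C17 * (C18 * eps\<^sup>2)"
    using S_integral_inequality[OF s] mult_left_mono[OF Y_bound[OF s], of C17] const_bounds2(6) by linarith
  also have "\<dots> = C19 * eps\<^sup>2" by (simp add: C19_def algebra_simps)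
  finally show ?thesis .
qed

lemma D2_cont: "continuous_on {t + h..T} D2"
  unfolding D2_def[abs_def]
proof (intro continuous_intros)
  show "continuous_on {t + h..T} (delayed x)"
    using h_pos by (intro continuous_on_subset[OF continuous_on_delayed[OF t_range(4) lipschitz_on_continuous_on[OF traj_lip(1)]]]) auto
  show "continuous_on {t + h..T} (delayed xp)"
    by (rule continuous_on_delayed[OF t_range(5) lipschitz_on_continuous_on[OF traj_lip(2)]])
  show "continuous_on {t + h..T} (delayed xm)"
    using h_pos by (intro continuous_on_subset[OF continuous_on_delayed[OF t_low lipschitz_on_continuous_on[OF traj_lip(3)]]]) auto
qed

lemma D2_integral: "integral {t + h..T} (\<lambda>u. norm (D2 u)) \<le> C20 * eps\<^sup>2"
proof -
  have TT: "T \<in> {t + h..T}" using t_up by auto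
  have "integral {t + h..T} (\<lambda>u. norm (D2 u)) \<le> integral {t + h..T} (\<lambda>u. C12 * eps\<^sup>2 + C12 * norm (S u) + (1 + C13) * Z (dtime xp u))"
    by (intro integral_le integrable_continuous_real continuous_intros D2_cont S_cont' Z_dtime_cont D2_bound_Z)
  also have "\<dots> = C12 * eps\<^sup>2 * (T - (t + h)) + C12 * Y T + (1 + C13) * integral {t + h..T} (\<lambda>u. Z (dtime xp u))"
    using t_up by (subst Henstock_Kurzweil_Integration.integral_add, (auto intro!: integrable_continuous_real continuous_intros S_cont' Z_dtime_cont)[2],
      subst Henstock_Kurzweil_Integration.integral_add, (auto intro!: integrable_continuous_real continuous_intros S_cont' Z_dtime_cont)[2])
      (simp add: Y_def)
  also have "\<dots> \<le> C12 * eps\<^sup>2 * (T - t0) + C12 * (C18 * eps\<^sup>2) + (1 + C13) * ((1 / DD) * (ZJ * eps\<^sup>2 + C18 * eps\<^sup>2))"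
  proof (intro add_mono mult_left_mono Y_bound TT)
    have "integral {t + h..T} (\<lambda>u. Z (dtime xp u)) \<le> (1 / DD) * integral {t + h - b..T} Z"
      by (rule integral_dtime_xp[OF TT Z_cont Z_nonneg])
    also have "\<dots> \<le> (1 / DD) * (ZJ * eps\<^sup>2 + C18 * eps\<^sup>2)"
      using Z_integral[OF TT] Y_bound[OF TT] const_bounds(7) unfolding Y_def by (intro mult_left_mono) auto
    finally show "integral {t + h..T} (\<lambda>u. Z (dtime xp u)) \<le> (1 / DD) * (ZJ * eps\<^sup>2 + C18 * eps\<^sup>2)" .
  qed (use t_range const_bounds(25,26) in auto)
  also have "\<dots> = C20 * eps\<^sup>2" by (simp add: C20_def algebra_simps add_divide_distrib)
  finally show ?thesis .
qed

end

section \<open>Semiconcavity of the value function\<close>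

text \<open>A derivative given piecewise on both sides of its jump at \<open>c\<close>. The clamped
  arguments extend it to the whole line using only the values of \<open>p\<close> on
  \<open>{l..c}\<close> and of \<open>q\<close> on \<open>{c..u}\<close>, which yields Borel
  measurability for continuous pieces.\<close>

definition glue :: "real \<Rightarrow> real \<Rightarrow> real \<Rightarrow> (real \<Rightarrow> 'a) \<Rightarrow> (real \<Rightarrow> 'a) \<Rightarrow> real \<Rightarrow> 'a" where
  "glue l c u p q s = (if s < c then p (max l (min c s)) else q (max c (min u s)))"

lemma glue_left: "l \<le> s \<Longrightarrow> s < c \<Longrightarrow> glue l c u p q s = p s"
  and glue_right: "c \<le> s \<Longrightarrow> s \<le> u \<Longrightarrow> glue l c u p q s = q s"
  by (simp_all add: glue_def)

lemma glue_measurable: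
  fixes p q :: "real \<Rightarrow> 'a::euclidean_space"
  assumes "B-lipschitz_on {l..c} p" "B-lipschitz_on {c..u} q" "l \<le> c" "c \<le> u"
  shows "glue l c u p q \<in> borel_measurable borel"
proof -
  have "continuous_on UNIV (\<lambda>s. p (max l (min c s)))"
    by (rule continuous_on_compose2[OF lipschitz_on_continuous_on[OF assms(1)]]) (use assms in \<open>auto intro!: continuous_intros\<close>)
  moreover have "continuous_on UNIV (\<lambda>s. q (max c (min u s)))"
    by (rule continuous_on_compose2[OF lipschitz_on_continuous_on[OF assms(2)]]) (use assms in \<open>auto intro!: continuous_intros\<close>)
  ultimately show ?thesis unfolding glue_def[abs_def]
    by (intro measurable_If borel_measurable_continuous_onI) auto
qed

lemma glue_lipschitz:
  fixes p q :: "real \<Rightarrow> 'a::real_normed_vector"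
  assumes p: "B-lipschitz_on {l..c} p" and q: "B-lipschitz_on {c..u} q" and "l \<le> c" "c \<le> u"
    and s: "s \<in> {m<..<n}" "s' \<in> {m<..<n}" and c: "c \<notin> {m<..<n}"
  shows "norm (glue l c u p q s - glue l c u p q s') \<le> B * \<bar>s - s'\<bar>"
proof -
  have B: "0 \<le> B" using p by (simp add: lipschitz_on_def)
  consider "s < c" "s' < c" | "\<not> s < c" "\<not> s' < c" using s c by force
  then show ?thesis
  proof cases
    case 1
    have "dist (p (max l (min c s))) (p (max l (min c s'))) \<le> B * dist (max l (min c s)) (max l (min c s'))"
      by (rule lipschitz_onD[OF p]) (use assms in auto)
    also have "\<dots> \<le> B * \<bar>s - s'\<bar>" using B by (intro mult_left_mono) (auto simp: dist_real_def)
    finally show ?thesis using 1 by (simp add: glue_def dist_norm)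
  next
    case 2
    have "dist (q (max c (min u s))) (q (max c (min u s'))) \<le> B * dist (max c (min u s)) (max c (min u s'))"
      by (rule lipschitz_onD[OF q]) (use assms in auto)
    also have "\<dots> \<le> B * \<bar>s - s'\<bar>" using B by (intro mult_left_mono) (auto simp: dist_real_def)
    finally show ?thesis using 2 by (simp add: glue_def dist_norm)
  qed
qed

lemma glue_derivative:
  assumes "\<And>s. s \<in> {l<..<c} \<Longrightarrow> (y has_vector_derivative p s) (at s)"
    and "\<And>s. s \<in> {c<..<u} \<Longrightarrow> (y has_vector_derivative q s) (at s)"
    and "s \<in> {l<..<u} - {c}"
  shows "(y has_vector_derivative glue l c u p q s) (at s)"
  using assms by (cases "s < c") (auto simp: glue_left glue_right)

text \<open>If the left integrand is not integrable its Bochner integral is \<open>0\<close>, which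
  still lies below the integral of the nonnegative majorant. This covers \<open>hist_deriv\<close>
  without a discussion of its integrability.\<close>

lemma set_lebesgue_integral_le_except_finite:
  fixes \<phi> G :: "real \<Rightarrow> real"
  assumes G: "integrable lebesgue G" and F: "finite F"
    and le: "\<And>\<xi>. \<xi> \<in> X - F \<Longrightarrow> \<phi> \<xi> \<le> G \<xi>" and nonneg: "\<And>\<xi>. 0 \<le> G \<xi>"
  shows "(LINT \<xi>:X|lebesgue. \<phi> \<xi>) \<le> integral\<^sup>L lebesgue G"
  unfolding set_lebesgue_integral_def
proof (rule integral_mono_AE'[OF G])
  have "F \<in> null_sets lebesgue" using F negligible_iff_null_sets negligible_finite by blast
  then have "AE \<xi> in lebesgue. \<xi> \<notin> F" by (rule AE_not_in)
  then show "AE \<xi> in lebesgue. indicator X \<xi> *\<^sub>R \<phi> \<xi> \<le> G \<xi>"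
    by eventually_elim (use le nonneg in \<open>auto simp: indicator_def\<close>)
qed (simp add: nonneg)

lemma norm_H1_square_le:
  fixes u D :: "real \<Rightarrow> 'a::euclidean_space" and p :: "real \<Rightarrow> real"
  assumes F: "finite F" and A0: "0 \<le> A0" and B0: "0 \<le> B0" and b: "0 < b"
    and u: "\<And>\<xi>. \<xi> \<in> {-b..0} \<Longrightarrow> (norm (u \<xi>))\<^sup>2 \<le> A0"
    and p: "continuous_on {m..n} p" "\<And>\<xi>. \<xi> \<in> {m..n} \<Longrightarrow> 0 \<le> p \<xi>"
    and D: "\<And>\<xi>. \<xi> \<in> {-b..0} - F \<Longrightarrow> (norm (hist_deriv b u \<xi>))\<^sup>2 \<le> B0 + (if \<xi> \<in> {m..n} then p \<xi> else 0)"
  shows "(norm_H1 b u)\<^sup>2 \<le> b * A0 + (b * B0 + integral {m..n} p)"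
proof -
  have c: "integrable lebesgue (\<lambda>\<xi>. indicator {-b..0} \<xi> *\<^sub>R k)" "(LINT \<xi>|lebesgue. indicator {-b..0} \<xi> *\<^sub>R k) = b * k" for k :: real
  proof -
    have "(\<lambda>_. k) absolutely_integrable_on {-b..0}" by (intro absolutely_integrable_continuous_real continuous_intros)
    then show "integrable lebesgue (\<lambda>\<xi>. indicator {-b..0} \<xi> *\<^sub>R k)" "(LINT \<xi>|lebesgue. indicator {-b..0} \<xi> *\<^sub>R k) = b * k"
      using set_lebesgue_integral_eq_integral(2)[of "{-b..0}" "\<lambda>_. k"] b
      by (auto simp: set_integrable_def set_lebesgue_integral_def)
  qed
  have pi: "p absolutely_integrable_on {m..n}" by (rule absolutely_integrable_continuous_real[OF p(1)])
  then have p2: "integrable lebesgue (\<lambda>\<xi>. indicator {m..n} \<xi> *\<^sub>R p \<xi>)" by (simp add: set_integrable_def)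
  have p3: "(LINT \<xi>|lebesgue. indicator {m..n} \<xi> *\<^sub>R p \<xi>) = integral {m..n} p"
    using set_lebesgue_integral_eq_integral(2)[OF pi] by (simp add: set_lebesgue_integral_def)
  have 1: "(LINT \<xi>:{-b..0}|lebesgue. (norm (u \<xi>))\<^sup>2) \<le> b * A0"
    unfolding c(2)[symmetric]
    by (rule set_lebesgue_integral_le_except_finite[OF c(1), of "{}"]) (use u A0 in auto)
  have "(LINT \<xi>:{-b..0}|lebesgue. (norm (hist_deriv b u \<xi>))\<^sup>2)
      \<le> (LINT \<xi>|lebesgue. indicator {-b..0} \<xi> *\<^sub>R B0 + indicator {m..n} \<xi> *\<^sub>R p \<xi>)"
  proof (rule set_lebesgue_integral_le_except_finite[OF _ F])
    show "integrable lebesgue (\<lambda>\<xi>. indicator {-b..0} \<xi> *\<^sub>R B0 + indicator {m..n} \<xi> *\<^sub>R p \<xi>)"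
      by (rule Bochner_Integration.integrable_add[OF c(1) p2])
    show "(norm (hist_deriv b u \<xi>))\<^sup>2 \<le> indicator {-b..0} \<xi> *\<^sub>R B0 + indicator {m..n} \<xi> *\<^sub>R p \<xi>" if "\<xi> \<in> {-b..0} - F" for \<xi>
      using D[OF that] that by (auto simp: indicator_def split: if_splits)
    show "0 \<le> indicator {-b..0} \<xi> *\<^sub>R B0 + indicator {m..n} \<xi> *\<^sub>R p \<xi>" for \<xi>
      using B0 p(2)[of \<xi>] by (auto simp: indicator_def)
  qed
  also have "\<dots> = b * B0 + integral {m..n} p"
    by (subst Bochner_Integration.integral_add[OF c(1) p2]) (simp only: c(2) p3)
  finally have 2: "(LINT \<xi>:{-b..0}|lebesgue. (norm (hist_deriv b u \<xi>))\<^sup>2) \<le> b * B0 + integral {m..n} p" .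
  have "0 \<le> (LINT \<xi>:{-b..0}|lebesgue. (norm (u \<xi>))\<^sup>2) + (LINT \<xi>:{-b..0}|lebesgue. (norm (hist_deriv b u \<xi>))\<^sup>2)"
    unfolding set_lebesgue_integral_def by (intro add_nonneg_nonneg Bochner_Integration.integral_nonneg) auto
  then have "(norm_H1 b u)\<^sup>2 = (LINT \<xi>:{-b..0}|lebesgue. (norm (u \<xi>))\<^sup>2) + (LINT \<xi>:{-b..0}|lebesgue. (norm (hist_deriv b u \<xi>))\<^sup>2)"
    by (simp add: norm_H1_def)
  then show ?thesis using 1 2 by linarith
qed

context semiconc_const
begin

text \<open>\<open>CL1\<close> and \<open>CL2\<close> belong to the running cost after and before
  \<open>t + h\<close>. \<open>rW\<close> is the radius of the class in which the semiconcavity of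
  \<open>g\<close> is invoked; it must be known before the configuration. \<open>C21\<close> and
  \<open>C22\<close> belong to the half difference and to the midpoint of the final
  segments.\<close>

definition "CL1 = LD RR * (C2\<^sup>2 + C3\<^sup>2) * (T - t0) + LC RR * (C18 + C20)"
definition "CL2 = LC RR * (4 * C4 + 2 * (C2 + C3))"
definition "rW = RR + MM + kF + 2 * r"
definition "C21 = b * C2\<^sup>2 + b * (C6\<^sup>2 + 2 * C7\<^sup>2) + 2"
definition "C22 = gL RR * (C19 + C9 * (b + (1 + b) / 2) + C18)"

end

section \<open>Running cost\<close>

context semiconc
begin

abbreviation "L_along y s \<equiv> L s (y s) (delayed y s) (\<alpha> s)"

lemma L_along_cont: "continuous_on {t..T} (L_along x)" "continuous_on {t + h..T} (L_along xp)" "continuous_on {t - h..T} (L_along xm)"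
proof -
  have b: "0 < b" by (rule max_delay_pos)
  have c: "continuous_on {t - b..T} x" "continuous_on {t + h - b..T} xp" "continuous_on {t - h - b..T} xm"
    using traj_lip lipschitz_on_continuous_on by blast+
  show "continuous_on {t..T} (L_along x)"
    using b t_range by (intro continuous_on_along[OF L_cont _ continuous_on_subset[OF c(1)] continuous_on_delayed[OF _ c(1)] \<alpha>_cont \<alpha>A]) auto
  show "continuous_on {t + h..T} (L_along xp)"
    using b t_range by (intro continuous_on_along[OF L_cont _ continuous_on_subset[OF c(2)] continuous_on_delayed[OF _ c(2)] \<alpha>_cont \<alpha>A]) auto
  show "continuous_on {t - h..T} (L_along xm)"
    using b t_range by (intro continuous_on_along[OF L_cont _ continuous_on_subset[OF c(3)] continuous_on_delayed[OF _ c(3)] \<alpha>_cont \<alpha>A]) auto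
qed

text \<open>The argument of \<open>S_deriv_bound\<close> with \<open>L\<close> in place of
  \<open>f\<close>. The delayed second difference is kept in the bound, since it is of second order
  only after integration.\<close>

lemma L_second_difference_along:
  assumes u: "u \<in> {t + h..T}"
  shows "L_along xp u + L_along xm u - 2 * L_along x u \<le> LD RR * (C2\<^sup>2 + C3\<^sup>2) * eps\<^sup>2 + LC RR * (norm (S u) + norm (D2 u))"
proof -
  have u': "u \<in> {t0..T}" using u t_range by auto
  note sb = state_bounds[OF u]
  let ?mx = "(1/2) *\<^sub>R (xp u + xm u)" and ?my = "(1/2) *\<^sub>R (delayed xp u + delayed xm u)"
  have m: "norm ?mx \<le> RR" "norm ?my \<le> RR"
    using norm_triangle_ineq[of "xp u" "xm u"] norm_triangle_ineq[of "delayed xp u" "delayed xm u"] sb by simp_all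
  have 1: "\<bar>L_along xp u + L_along xm u - 2 * L u ?mx ?my (\<alpha> u)\<bar> \<le> LD RR * ((C2\<^sup>2 + C3\<^sup>2) * eps\<^sup>2)"
    by (rule order_trans[OF LD(2)[OF const_bounds(3) u' \<alpha>A[of u] sb(2,3,5,6)]
          mult_left_mono[OF sb(7) less_imp_le[OF LD(1)[OF const_bounds(3)]]]])
  have "\<bar>L u ?mx ?my (\<alpha> u) - L_along x u\<bar> \<le> LC RR * (\<bar>u - u\<bar> + norm (?mx - x u) + norm (?my - delayed x u) + norm (\<alpha> u - \<alpha> u))"
    by (rule LC(2)[OF u' u' \<alpha>A \<alpha>A m(1) sb(1) m(2) sb(4)])
  also have "\<dots> = LC RR * (norm (S u) + norm (D2 u)) / 2" unfolding midpoint_diffs by (simp add: algebra_simps add_divide_distrib)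
  finally have 2: "\<bar>L u ?mx ?my (\<alpha> u) - L_along x u\<bar> \<le> LC RR * (norm (S u) + norm (D2 u)) / 2" .
  show ?thesis using 1 2 unfolding mult.assoc by linarith
qed

lemma cost_late:
  "integral {t + h..T} (\<lambda>u. L_along xp u + L_along xm u - 2 * L_along x u) \<le> CL1 * eps\<^sup>2"
proof -
  have sub: "continuous_on {t + h..T} (L_along x)" "continuous_on {t + h..T} (L_along xm)"
    using h_pos by (auto intro: continuous_on_subset[OF L_along_cont(1)] continuous_on_subset[OF L_along_cont(3)])
  have T: "T \<in> {t + h..T}" using t_up by simp
  let ?k = "LD RR * (C2\<^sup>2 + C3\<^sup>2) * eps\<^sup>2"
  have k: "0 \<le> ?k" using LD(1)[OF const_bounds(3)] by simp
  have "integral {t + h..T} (\<lambda>u. L_along xp u + L_along xm u - 2 * L_along x u)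
      \<le> integral {t + h..T} (\<lambda>u. ?k + LC RR * (norm (S u) + norm (D2 u)))"
    by (intro integral_le integrable_continuous_real continuous_intros sub L_along_cont(2) S_cont' D2_cont L_second_difference_along)
  also have "\<dots> = ?k * (T - (t + h)) + LC RR * (Y T + integral {t + h..T} (\<lambda>u. norm (D2 u)))"
    using t_up unfolding Y_def
    by (subst Henstock_Kurzweil_Integration.integral_add, (auto intro!: integrable_continuous_real continuous_intros S_cont' D2_cont)[2],
      subst integral_mult_right, subst Henstock_Kurzweil_Integration.integral_add, (auto intro!: integrable_continuous_real continuous_intros S_cont' D2_cont)[2])
      simp
  also have "\<dots> \<le> ?k * (T - t0) + LC RR * (C18 * eps\<^sup>2 + C20 * eps\<^sup>2)"
    using LC(1)[of RR] t_range k by (intro add_mono mult_left_mono Y_bound[OF T] D2_integral) auto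
  also have "\<dots> = CL1 * eps\<^sup>2" by (simp add: CL1_def algebra_simps)
  finally show ?thesis .
qed

text \<open>Up to \<open>t + h\<close> the trajectory \<open>xm\<close> pays over a length
  \<open>2 * h\<close> and \<open>x\<close>, counted twice, over a length \<open>h\<close>, while
  \<open>xp\<close> has not started. All integrands are \<open>l\<close> up to order
  \<open>eps\<close>, so the leading terms \<open>2 * h * l\<close> cancel.\<close>

lemma cost_early: "integral {t - h..t + h} (L_along xm) - 2 * integral {t..t + h} (L_along x) \<le> CL2 * eps\<^sup>2"
proof -
  define l where "l = L t (w 0 - w0 0) (w (- \<tau> t (w 0 - w0 0)) - w0 (- \<tau> t (w 0 - w0 0))) (\<alpha> t)"
  define k where "k = LC RR * (C4 * h)"
  define k' where "k' = LC RR * ((C2 + C3) * eps)"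
  have c: "continuous_on {t - h..t + h} (L_along xm)" "continuous_on {t..t + h} (L_along x)"
    using t_up by (auto intro: continuous_on_subset[OF L_along_cont(1)] continuous_on_subset[OF L_along_cont(3)])
  have m: "\<bar>L_along xm s - l\<bar> \<le> k" if s: "s \<in> {t - h..t + h}" for s
  proof -
    note a = args_near_start[OF s]
    show ?thesis unfolding l_def k_def
      by (rule order_trans[OF LC(2)[OF a(6) t_range(1) \<alpha>A \<alpha>A a(2,3,4,5)] mult_left_mono[OF a(1)]]) (use LC(1)[of RR] in simp)
  qed
  have x: "l - k - k' \<le> L_along x s" if s: "s \<in> {t..t + h}" for s
  proof -
    have s': "s \<in> {t - h..t + h}" "s \<in> {t0..T}" "s \<in> {t..T}" "s \<in> {t - b..T}" using s h_pos t_range t_up max_delay_pos by auto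
    note a = args_near_start[OF s'(1)]
    have d: "norm (delayed x s) \<le> RR" unfolding delayed_eq by (rule traj_bound(1)[OF dtime_in_range[OF s'(3) t_range(4)]])
    have "\<bar>L_along xm s - L_along x s\<bar> \<le> LC RR * (\<bar>s - s\<bar> + norm (xm s - x s) + norm (delayed xm s - delayed x s) + norm (\<alpha> s - \<alpha> s))"
      by (rule LC(2)[OF s'(2) s'(2) \<alpha>A \<alpha>A a(2) traj_bound(1)[OF s'(4)] a(4) d])
    also have "\<dots> \<le> k'" unfolding k'_def
      using traj_close(1)[OF s'(4)] delayed_close_m[OF s'(3)] LC(1)[of RR] by (intro mult_left_mono) (auto simp: distrib_right)
    finally show ?thesis using m[OF s'(1)] by linarith
  qed
  have "integral {t - h..t + h} (L_along xm) \<le> integral {t - h..t + h} (\<lambda>_. l + k)"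
  proof (intro integral_le integrable_continuous_real c continuous_intros)
    show "L_along xm s \<le> l + k" if "s \<in> {t - h..t + h}" for s using m[OF that] by linarith
  qed
  then have 1: "integral {t - h..t + h} (L_along xm) \<le> (l + k) * (2 * h)" using h_pos by (simp add: algebra_simps)
  have "integral {t..t + h} (\<lambda>_. l - k - k') \<le> integral {t..t + h} (L_along x)"
    by (intro integral_le integrable_continuous_real c continuous_intros x)
  then have 2: "(l - k - k') * h \<le> integral {t..t + h} (L_along x)" using h_pos by (simp add: algebra_simps)
  have "k * h \<le> LC RR * C4 * eps\<^sup>2"
  proof -
    have "h * h \<le> eps * eps" using eps h_pos by (intro mult_mono) auto
    then have "LC RR * C4 * (h * h) \<le> LC RR * C4 * (eps * eps)" using LC(1)[of RR] const_bounds(15) by (intro mult_left_mono) auto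
    then show ?thesis by (simp add: k_def power2_eq_square algebra_simps)
  qed
  moreover have "k' * h \<le> LC RR * (C2 + C3) * eps\<^sup>2"
  proof -
    have "LC RR * (C2 + C3) * (eps * h) \<le> LC RR * (C2 + C3) * (eps * eps)"
      using LC(1)[of RR] const_bounds(12,13) eps by (intro mult_left_mono) auto
    then show ?thesis by (simp add: k'_def power2_eq_square algebra_simps)
  qed
  ultimately show ?thesis using 1 2 by (simp add: CL2_def algebra_simps)
qed

lemma running_cost:
  "integral {t + h..T} (L_along xp) + integral {t - h..T} (L_along xm) - 2 * integral {t..T} (L_along x) \<le> (CL1 + CL2) * eps\<^sup>2"
proof -
  have i: "(L_along x) integrable_on {t..T}" "(L_along xp) integrable_on {t + h..T}" "(L_along xm) integrable_on {t - h..T}"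
    by (intro integrable_continuous_real L_along_cont)+
  have i': "(L_along x) integrable_on {t + h..T}" "(L_along xm) integrable_on {t + h..T}"
    using h_pos by (auto intro!: integrable_continuous_real continuous_on_subset[OF L_along_cont(1)] continuous_on_subset[OF L_along_cont(3)])
  have "integral {t..T} (L_along x) = integral {t..t + h} (L_along x) + integral {t + h..T} (L_along x)"
    using h_pos t_up by (intro Henstock_Kurzweil_Integration.integral_combine[symmetric] i) auto
  moreover have "integral {t - h..T} (L_along xm) = integral {t - h..t + h} (L_along xm) + integral {t + h..T} (L_along xm)"
    using h_pos t_up by (intro Henstock_Kurzweil_Integration.integral_combine[symmetric] i) auto
  moreover have "integral {t + h..T} (\<lambda>u. L_along xp u + L_along xm u - 2 * L_along x u) =
     integral {t + h..T} (L_along xp) + integral {t + h..T} (L_along xm) - 2 * integral {t + h..T} (L_along x)"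
    by (subst Henstock_Kurzweil_Integration.integral_diff[OF integrable_add[OF i(2) i'(2)] integrable_on_mult_right[OF i'(1)]])
       (simp add: Henstock_Kurzweil_Integration.integral_add[OF i(2) i'(2)])
  ultimately show ?thesis using cost_late cost_early unfolding distrib_right by linarith
qed

section \<open>Terminal cost\<close>

definition "dp = glue (t + h - b) (t + h) T (\<lambda>s. v (s - (t + h)) + v0 (s - (t + h))) (\<lambda>s. f s (xp s) (delayed xp s) (\<alpha> s))"
definition "dm = glue (t - h - b) (t - h) T (\<lambda>s. v (s - (t - h)) - v0 (s - (t - h))) (\<lambda>s. f s (xm s) (delayed xm s) (\<alpha> s))"

lemma glue_pieces:
  "(2 * r + kF)-lipschitz_on {t + h - b..t + h} (\<lambda>s. v (s - (t + h)) + v0 (s - (t + h)))"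
  "(2 * r + kF)-lipschitz_on {t - h - b..t - h} (\<lambda>s. v (s - (t - h)) - v0 (s - (t - h)))"
  "(2 * r + kF)-lipschitz_on {t + h..T} (\<lambda>s. f s (xp s) (delayed xp s) (\<alpha> s))"
  "(2 * r + kF)-lipschitz_on {t - h..T} (\<lambda>s. f s (xm s) (delayed xm s) (\<alpha> s))"
proof -
  have sh: "r-lipschitz_on {c - b..c} (\<lambda>s. v (s - c))" "r-lipschitz_on {c - b..c} (\<lambda>s. v0 (s - c))" for c
    using r_pos by (auto intro!: lipschitz_onI simp: dist_norm v_diff[where \<theta> = "_ - c" and \<theta>' = "_ - c", simplified])
  have "(r + r)-lipschitz_on {t + h - b..t + h} (\<lambda>s. v (s - (t + h)) + v0 (s - (t + h)))"
    "(r + r)-lipschitz_on {t - h - b..t - h} (\<lambda>s. v (s - (t - h)) - v0 (s - (t - h)))"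
    by (intro lipschitz_on_add lipschitz_on_diff sh)+
  then show "(2 * r + kF)-lipschitz_on {t + h - b..t + h} (\<lambda>s. v (s - (t + h)) + v0 (s - (t + h)))"
    "(2 * r + kF)-lipschitz_on {t - h - b..t - h} (\<lambda>s. v (s - (t - h)) - v0 (s - (t - h)))"
    using const_bounds(23) by (auto elim!: lipschitz_on_le)
  show "(2 * r + kF)-lipschitz_on {t + h..T} (\<lambda>s. f s (xp s) (delayed xp s) (\<alpha> s))"
    by (rule lipschitz_on_le[OF rhs_lipschitz[OF t_range(5) traj_lip(2) traj_bound(2)]]) (use r_pos in simp_all)
  show "(2 * r + kF)-lipschitz_on {t - h..T} (\<lambda>s. f s (xm s) (delayed xm s) (\<alpha> s))"
    by (rule lipschitz_on_le[OF rhs_lipschitz[OF t_low traj_lip(3) traj_bound(3)]]) (use r_pos in simp_all)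
qed

lemma dp: "s \<in> {t + h - b<..<T} - {t + h} \<Longrightarrow> (xp has_vector_derivative dp s) (at s)"
  and dm: "s \<in> {t - h - b<..<T} - {t - h} \<Longrightarrow> (xm has_vector_derivative dm s) (at s)"
  unfolding dp_def dm_def by (rule glue_derivative[OF hist_deriv_traj(2) traj_deriv(2)], assumption+)
     (rule glue_derivative[OF hist_deriv_traj(3) traj_deriv(3)], assumption+)

lemma dp_measurable: "dp \<in> borel_measurable borel" and dm_measurable: "dm \<in> borel_measurable borel"
  unfolding dp_def dm_def using max_delay_pos t_up h_pos
  by (auto intro!: glue_measurable[OF glue_pieces(1,3)] glue_measurable[OF glue_pieces(2,4)])

lemma dp_lipschitz: "\<lbrakk>s \<in> {m<..<n}; s' \<in> {m<..<n}; t + h \<notin> {m<..<n}\<rbrakk> \<Longrightarrow> norm (dp s - dp s') \<le> (2 * r + kF) * \<bar>s - s'\<bar>"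
  and dm_lipschitz: "\<lbrakk>s \<in> {m<..<n}; s' \<in> {m<..<n}; t - h \<notin> {m<..<n}\<rbrakk> \<Longrightarrow> norm (dm s - dm s') \<le> (2 * r + kF) * \<bar>s - s'\<bar>"
proof -
  have "t + h - b \<le> t + h" "t - h - b \<le> t - h" "t - h \<le> T" using max_delay_pos t_up h_pos by auto
  then show "\<lbrakk>s \<in> {m<..<n}; s' \<in> {m<..<n}; t + h \<notin> {m<..<n}\<rbrakk> \<Longrightarrow> norm (dp s - dp s') \<le> (2 * r + kF) * \<bar>s - s'\<bar>"
    "\<lbrakk>s \<in> {m<..<n}; s' \<in> {m<..<n}; t - h \<notin> {m<..<n}\<rbrakk> \<Longrightarrow> norm (dm s - dm s') \<le> (2 * r + kF) * \<bar>s - s'\<bar>"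
    unfolding dp_def dm_def
    using glue_lipschitz[OF glue_pieces(1,3) _ t_up] glue_lipschitz[OF glue_pieces(2,4)] by blast+
qed

text \<open>Before \<open>t + h\<close> the velocity of \<open>xp\<close> is \<open>v + v0\<close>
  while that of \<open>xm\<close> is \<open>v - v0\<close> up to order \<open>eps\<close>, so half
  the difference is \<open>v0\<close> up to order \<open>eps\<close>; afterwards both obey the state
  equation and the difference is of order \<open>eps\<close>. Squares are kept because
  \<open>v0\<close> is controlled in L2.\<close>

lemma dp_dm_close:
  assumes s: "s \<in> {t + h - b<..<T} - {t + h, t - h}"
  shows "(norm ((1/2) *\<^sub>R (dp s - dm s)))\<^sup>2 \<le> (C6\<^sup>2 + 2 * C7\<^sup>2) * eps\<^sup>2 +
     (if s \<in> {t + h - b..t + h} then 2 * (norm (v0 (s - (t + h))))\<^sup>2 else 0)"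
proof (cases "s < t + h")
  case True
  let ?\<theta> = "s - (t + h)"
  have \<theta>: "?\<theta> \<in> {-b..0}" using s True by auto
  have "\<exists>D. (xm has_vector_derivative D) (at s) \<and> norm (D - (v ?\<theta> - v0 ?\<theta>)) \<le> C7 * h"
    using s h_pos True by (intro xm_deriv_near[OF \<theta>]) auto
  then obtain D where D: "(xm has_vector_derivative D) (at s)" "norm (D - (v ?\<theta> - v0 ?\<theta>)) \<le> C7 * h" by blast
  have "(xm has_vector_derivative dm s) (at s)" using s h_pos by (intro dm) auto
  then have eq: "dm s = D" using vector_derivative_unique_at D(1) by blast
  have dps: "dp s = v ?\<theta> + v0 ?\<theta>" unfolding dp_def by (subst glue_left) (use s True in auto)
  have "(1/2) *\<^sub>R (dp s - dm s) = v0 ?\<theta> - (1/2) *\<^sub>R (D - (v ?\<theta> - v0 ?\<theta>))"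
    unfolding eq dps by (simp add: vec_eq_iff field_simps)
  then have "norm ((1/2) *\<^sub>R (dp s - dm s)) \<le> norm (v0 ?\<theta>) + norm ((1/2) *\<^sub>R (D - (v ?\<theta> - v0 ?\<theta>)))"
    using norm_triangle_ineq4 by metis
  also have "\<dots> \<le> norm (v0 ?\<theta>) + C7 * eps"
  proof -
    have "C7 * h \<le> C7 * eps" "0 \<le> C7 * eps" using const_bounds(18) eps by (auto intro!: mult_left_mono)
    then show ?thesis using D(2) by simp
  qed
  finally have "(norm ((1/2) *\<^sub>R (dp s - dm s)))\<^sup>2 \<le> (norm (v0 ?\<theta>) + C7 * eps)\<^sup>2" by (intro power_mono) auto
  also have "\<dots> \<le> 2 * (norm (v0 ?\<theta>))\<^sup>2 + 2 * (C7 * eps)\<^sup>2"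
    using sum_squares_bound[of "norm (v0 ?\<theta>)" "C7 * eps"] by (simp add: power2_sum)
  finally have "(norm ((1/2) *\<^sub>R (dp s - dm s)))\<^sup>2 \<le> 2 * (norm (v0 ?\<theta>))\<^sup>2 + 2 * (C7 * eps)\<^sup>2" .
  moreover have "2 * (C7 * eps)\<^sup>2 \<le> (C6\<^sup>2 + 2 * C7\<^sup>2) * eps\<^sup>2" by (simp add: power_mult_distrib distrib_right)
  moreover have "s \<in> {t + h - b..t + h}" using s True by auto
  ultimately show ?thesis by simp
next
  case False
  then have s': "s \<in> {t + h..T}" "s \<in> {t - h..T}" "s \<notin> {t + h - b..t + h}" using s h_pos by auto
  have "dp s = f s (xp s) (delayed xp s) (\<alpha> s)" "dm s = f s (xm s) (delayed xm s) (\<alpha> s)"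
    unfolding dp_def dm_def using s' by (auto simp: glue_right)
  moreover have "0 \<le> C6 * eps" using const_bounds(17) eps by simp
  ultimately have "norm ((1/2) *\<^sub>R (dp s - dm s)) \<le> C6 * eps" using deriv_close_p[OF s'(1)] by simp
  then have "(norm ((1/2) *\<^sub>R (dp s - dm s)))\<^sup>2 \<le> (C6 * eps)\<^sup>2" by (intro power_mono) auto
  then show ?thesis using s'(3) by (simp add: power_mult_distrib distrib_right add_increasing2)
qed

definition "mid \<xi> = (1/2) *\<^sub>R (xp (T + \<xi>) + xm (T + \<xi>))"
definition "hdf \<xi> = (1/2) *\<^sub>R (xp (T + \<xi>) - xm (T + \<xi>))"

lemma segment_range: "\<xi> \<in> {-b..0} \<Longrightarrow> T + \<xi> \<in> {t - b..T}" "\<xi> \<in> {-b..0} \<Longrightarrow> T + \<xi> \<in> {t + h - b..T}" "\<xi> \<in> {-b..0} \<Longrightarrow> T + \<xi> \<in> {t - h - b..T}"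
  using t_up h_pos by auto

lemma segment_lipschitz: "MM-lipschitz_on {-b..0} (\<lambda>\<xi>. xp (T + \<xi>))" "MM-lipschitz_on {-b..0} (\<lambda>\<xi>. xm (T + \<xi>))" "MM-lipschitz_on {-b..0} (\<lambda>\<xi>. x (T + \<xi>))"
  using const_bounds(5) traj_diff(2)[OF segment_range(2) segment_range(2)] traj_diff(3)[OF segment_range(3) segment_range(3)]
    traj_diff(1)[OF segment_range(1) segment_range(1)]
  by (auto intro!: lipschitz_onI simp: dist_norm)

lemma mid_hdf_lipschitz: "MM-lipschitz_on {-b..0} mid" "MM-lipschitz_on {-b..0} hdf"
proof -
  have "(\<bar>1/2\<bar> * (MM + MM))-lipschitz_on {-b..0} mid" "(\<bar>1/2\<bar> * (MM + MM))-lipschitz_on {-b..0} hdf"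
    unfolding mid_def[abs_def] hdf_def[abs_def]
    by (intro lipschitz_on_cmult lipschitz_on_add lipschitz_on_diff segment_lipschitz)+
  then show "MM-lipschitz_on {-b..0} mid" "MM-lipschitz_on {-b..0} hdf" by simp_all
qed

lemma mid_hdf_bound: assumes "\<xi> \<in> {-b..0}" shows "norm (mid \<xi>) \<le> RR" "norm (hdf \<xi>) \<le> RR"
  using traj_bound(2)[OF segment_range(2)[OF assms]] traj_bound(3)[OF segment_range(3)[OF assms]]
    norm_triangle_ineq[of "xp (T + \<xi>)" "xm (T + \<xi>)"] norm_triangle_ineq4[of "xp (T + \<xi>)" "xm (T + \<xi>)"]
  by (simp_all add: mid_def hdf_def)

lemma rW: "RR \<le> rW" "MM \<le> rW" "2 * r + kF \<le> rW" "0 < rW"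
  using const_bounds(3,5,23) r_pos by (auto simp: rW_def)

abbreviation "breaks \<equiv> {t + h - T, t - h - T}"

text \<open>The final segments may contain the kinks of \<open>xp\<close> at \<open>t + h\<close>
  and of \<open>xm\<close> at \<open>t - h\<close>. These give the two breakpoints, and they are why
  semiconcavity of \<open>g\<close> is used on piecewise regular histories.\<close>

lemma segments_W:
  shows "mid \<in> W_hist b rW" and "hdf \<in> W_hist b rW"
    and "\<And>\<xi>. \<xi> \<in> {-b<..<0} - breaks \<Longrightarrow> hist_deriv b hdf \<xi> = (1/2) *\<^sub>R (dp (T + \<xi>) - dm (T + \<xi>))"
proof -
  have m: "(\<lambda>\<xi>. dp (T + \<xi>)) \<in> borel_measurable borel" "(\<lambda>\<xi>. dm (T + \<xi>)) \<in> borel_measurable borel"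
    by (rule measurable_compose[OF _ dp_measurable], simp, rule measurable_compose[OF _ dm_measurable], simp)
  have d: "((\<lambda>\<xi>. xp (T + \<xi>)) has_vector_derivative dp (T + \<xi>)) (at \<xi>)" "((\<lambda>\<xi>. xm (T + \<xi>)) has_vector_derivative dm (T + \<xi>)) (at \<xi>)"
    if "\<xi> \<in> {-b<..<0} - breaks" for \<xi>
  proof -
    have s: "T + \<xi> \<in> {t + h - b<..<T} - {t + h}" "T + \<xi> \<in> {t - h - b<..<T} - {t - h}" using that t_up h_pos by auto
    show "((\<lambda>\<xi>. xp (T + \<xi>)) has_vector_derivative dp (T + \<xi>)) (at \<xi>)" "((\<lambda>\<xi>. xm (T + \<xi>)) has_vector_derivative dm (T + \<xi>)) (at \<xi>)"
      using has_vector_derivative_shift[of xp "dp (T + \<xi>)" \<xi> "-T"] has_vector_derivative_shift[of xm "dm (T + \<xi>)" \<xi> "-T"] dp[OF s(1)] dm[OF s(2)]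
      by (simp_all add: add.commute)
  qed
  have lip: "norm (dp (T + \<xi>) - dp (T + \<xi>')) \<le> rW * \<bar>\<xi> - \<xi>'\<bar>" "norm (dm (T + \<xi>) - dm (T + \<xi>')) \<le> rW * \<bar>\<xi> - \<xi>'\<bar>"
    if q: "\<xi> \<in> {p<..<q}" "\<xi>' \<in> {p<..<q}" "{p<..<q} \<inter> breaks = {}" for \<xi> \<xi>' p q
  proof -
    have b: "t + h - T \<notin> {p<..<q}" "t - h - T \<notin> {p<..<q}" using q(3) by blast+
    have n: "t + h \<notin> {T + p<..<T + q}" "t - h \<notin> {T + p<..<T + q}" using b(1,2) by auto
    have e: "(2 * r + kF) * \<bar>\<xi> - \<xi>'\<bar> \<le> rW * \<bar>\<xi> - \<xi>'\<bar>" using rW by (intro mult_right_mono) auto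
    show "norm (dp (T + \<xi>) - dp (T + \<xi>')) \<le> rW * \<bar>\<xi> - \<xi>'\<bar>"
      using dp_lipschitz[OF _ _ n(1), of "T + \<xi>" "T + \<xi>'"] e q by simp
    show "norm (dm (T + \<xi>) - dm (T + \<xi>')) \<le> rW * \<bar>\<xi> - \<xi>'\<bar>"
      using dm_lipschitz[OF _ _ n(2), of "T + \<xi>" "T + \<xi>'"] e q by simp
  qed
  have lip': "rW-lipschitz_on {p<..<q} (\<lambda>\<xi>. dp (T + \<xi>))" "rW-lipschitz_on {p<..<q} (\<lambda>\<xi>. dm (T + \<xi>))" if "{p<..<q} \<inter> breaks = {}" for p q
    using lip[OF _ _ that] rW by (auto intro!: lipschitz_onI simp: dist_norm)
  have lip2: "rW-lipschitz_on {p<..<q} (\<lambda>\<xi>. (1/2) *\<^sub>R (dp (T + \<xi>) + dm (T + \<xi>)))" "rW-lipschitz_on {p<..<q} (\<lambda>\<xi>. (1/2) *\<^sub>R (dp (T + \<xi>) - dm (T + \<xi>)))"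
    if "{p<..<q} \<inter> breaks = {}" for p q
  proof -
    have "(\<bar>1/2\<bar> * (rW + rW))-lipschitz_on {p<..<q} (\<lambda>\<xi>. (1/2) *\<^sub>R (dp (T + \<xi>) + dm (T + \<xi>)))"
      "(\<bar>1/2\<bar> * (rW + rW))-lipschitz_on {p<..<q} (\<lambda>\<xi>. (1/2) *\<^sub>R (dp (T + \<xi>) - dm (T + \<xi>)))"
      by (intro lipschitz_on_cmult lipschitz_on_add lipschitz_on_diff lip' that)+
    then show "rW-lipschitz_on {p<..<q} (\<lambda>\<xi>. (1/2) *\<^sub>R (dp (T + \<xi>) + dm (T + \<xi>)))" "rW-lipschitz_on {p<..<q} (\<lambda>\<xi>. (1/2) *\<^sub>R (dp (T + \<xi>) - dm (T + \<xi>)))" by simp_all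
  qed
  have bd: "norm (mid \<xi>) \<le> rW" "norm (hdf \<xi>) \<le> rW" if "\<xi> \<in> {-b..0}" for \<xi>
    using mid_hdf_bound[OF that] rW by linarith+
  have F: "finite breaks" by simp
  show "mid \<in> W_hist b rW"
  proof (rule W_histI(1)[OF max_delay_pos lipschitz_on_le[OF mid_hdf_lipschitz(1) rW(2)] bd(1) F])
    show "(mid has_vector_derivative (1/2) *\<^sub>R (dp (T + \<xi>) + dm (T + \<xi>))) (at \<xi>)" if "\<xi> \<in> {-b<..<0} - breaks" for \<xi>
      unfolding mid_def[abs_def]
      by (intro bounded_linear.has_vector_derivative[OF bounded_linear_scaleR_right] has_vector_derivative_add d that)
  qed (auto intro!: borel_measurable_scaleR borel_measurable_add m lip2)
  have der: "(hdf has_vector_derivative (1/2) *\<^sub>R (dp (T + \<xi>) - dm (T + \<xi>))) (at \<xi>)" if "\<xi> \<in> {-b<..<0} - breaks" for \<xi>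
    unfolding hdf_def[abs_def]
    by (intro bounded_linear.has_vector_derivative[OF bounded_linear_scaleR_right] has_vector_derivative_diff d that)
  have me: "(\<lambda>\<xi>. (1/2) *\<^sub>R (dp (T + \<xi>) - dm (T + \<xi>))) \<in> borel_measurable borel"
    by (intro borel_measurable_scaleR borel_measurable_diff m) simp
  show "hdf \<in> W_hist b rW"
    by (rule W_histI(1)[OF max_delay_pos lipschitz_on_le[OF mid_hdf_lipschitz(2) rW(2)] bd(2) F der me lip2(2)])
  show "hist_deriv b hdf \<xi> = (1/2) *\<^sub>R (dp (T + \<xi>) - dm (T + \<xi>))" if "\<xi> \<in> {-b<..<0} - breaks" for \<xi>
    by (rule W_histI(2)[OF max_delay_pos lipschitz_on_le[OF mid_hdf_lipschitz(2) rW(2)] bd(2) F der me lip2(2) that])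
qed


text \<open>The squared L2 norm of \<open>v0\<close> is at most \<open>H\<^sup>2\<close> and
  accounts for the summand \<open>2\<close> of \<open>C21\<close>; the other summands come from the
  distance of the trajectories and from the part of order \<open>eps\<close> of the
  velocities.\<close>

lemma hdf_H1: "(norm_H1 b hdf)\<^sup>2 \<le> C21 * eps\<^sup>2"
proof -
  let ?p = "\<lambda>\<xi>. 2 * (norm (v0 (\<xi> + (T - (t + h)))))\<^sup>2"
  have "(norm_H1 b hdf)\<^sup>2 \<le> b * (C2 * eps)\<^sup>2 + (b * ((C6\<^sup>2 + 2 * C7\<^sup>2) * eps\<^sup>2) + integral {t + h - b - T..t + h - T} ?p)"
  proof (rule norm_H1_square_le[OF _ _ _ max_delay_pos, of "{-b, 0} \<union> breaks"])
    show "(norm (hdf \<xi>))\<^sup>2 \<le> (C2 * eps)\<^sup>2" if "\<xi> \<in> {-b..0}" for \<xi>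
    proof (rule power_mono)
      have "0 \<le> C2 * eps" using const_bounds(12) eps by simp
      then show "norm (hdf \<xi>) \<le> C2 * eps" using traj_close(3)[OF segment_range(2)[OF that]] by (simp add: hdf_def)
    qed simp
    show "continuous_on {t + h - b - T..t + h - T} ?p"
      by (intro continuous_intros continuous_on_compose2[OF v0_cont]) auto
    show "(norm (hist_deriv b hdf \<xi>))\<^sup>2 \<le> (C6\<^sup>2 + 2 * C7\<^sup>2) * eps\<^sup>2 + (if \<xi> \<in> {t + h - b - T..t + h - T} then ?p \<xi> else 0)"
      if \<xi>: "\<xi> \<in> {-b..0} - ({-b, 0} \<union> breaks)" for \<xi>
    proof -
      have s: "T + \<xi> \<in> {t + h - b<..<T} - {t + h, t - h}" "\<xi> \<in> {-b<..<0} - breaks" using \<xi> t_up by auto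
      have e: "T + \<xi> \<in> {t + h - b..t + h} \<longleftrightarrow> \<xi> \<in> {t + h - b - T..t + h - T}" "T + \<xi> - (t + h) = \<xi> + (T - (t + h))" by auto
      show ?thesis using dp_dm_close[OF s(1)] unfolding segments_W(3)[OF s(2)] e .
    qed
  qed auto
  also have "integral {t + h - b - T..t + h - T} ?p = 2 * integral {-b..0} (\<lambda>\<theta>. (norm (v0 \<theta>))\<^sup>2)"
    using integral_shift_Icc[where h = "\<lambda>\<theta>. (norm (v0 \<theta>))\<^sup>2" and a = "t + h - b - T" and c = "t + h - T" and d = "T - (t + h)"] by simp
  also have "integral {-b..0} (\<lambda>\<theta>. (norm (v0 \<theta>))\<^sup>2) \<le> H\<^sup>2"
    unfolding H_def by (rule norm_H1_W'(3)[OF w0 max_delay_pos r_pos])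
  also have "H\<^sup>2 \<le> eps\<^sup>2" using eps H_nonneg by (intro power_mono) auto
  finally show ?thesis by (simp add: C21_def power_mult_distrib algebra_simps)
qed

text \<open>The midpoint differs from the segment of \<open>x\<close> by half of \<open>S\<close>.
  If \<open>T - b < t + h\<close>, part of the segment lies in the history, where the second order
  bound on \<open>S\<close> holds only in L1; besides the value at \<open>T\<close>, the Lipschitz
  bound of \<open>g\<close> asks for just that.\<close>

lemma terminal_midpoint:
  "g (mid 0, mid) - g (x T, segment_at x T) \<le> C22 / 2 * eps\<^sup>2"
proof -
  have b: "0 < b" by (rule max_delay_pos)
  have T: "T \<in> {t + h..T}" using t_up by simp
  have c: "continuous_on {t + h - b..T} (\<lambda>s. norm (S s))" by (intro continuous_intros S_cont)
  have "\<bar>g (mid 0, mid) - g (x (T + 0), \<lambda>\<xi>. x (T + \<xi>))\<bar>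
      \<le> gL RR * (norm (mid 0 - x (T + 0)) + integral {-b..0} (\<lambda>\<xi>. norm (mid \<xi> - x (T + \<xi>))))"
    by (rule g_lipschitz_L1[OF const_bounds(3) mid_hdf_lipschitz(1) segment_lipschitz(3) mid_hdf_bound(1) traj_bound(1)[OF segment_range(1)]])
  moreover have d: "mid \<xi> - x (T + \<xi>) = (1/2) *\<^sub>R S (T + \<xi>)" for \<xi> unfolding mid_def by (rule midpoint_diffs)
  moreover have "mid 0 - x T = (1/2) *\<^sub>R S T" using d[of 0] by simp
  ultimately have "g (mid 0, mid) - g (x T, segment_at x T)
      \<le> gL RR * (norm (S T) / 2 + integral {-b..0} (\<lambda>\<xi>. norm (S (T + \<xi>)) / 2))"
    by (simp add: segment_at_def)
  also have "integral {-b..0} (\<lambda>\<xi>. norm (S (T + \<xi>)) / 2) = integral {T - b..T} (\<lambda>s. norm (S s)) / 2"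
    using integral_shift_Icc[where h = "\<lambda>s. norm (S s)" and a = "-b" and c = 0 and d = T] by (simp add: add.commute)
  also have "integral {T - b..T} (\<lambda>s. norm (S s)) \<le> integral {t + h - b..T} (\<lambda>s. norm (S s))"
    using t_up by (intro integral_subset_le integrable_continuous_real continuous_on_subset[OF c]) auto
  also have "\<dots> = integral {t + h - b..t + h} (\<lambda>s. norm (S s)) + Y T"
    unfolding Y_def using b t_up
    by (intro Henstock_Kurzweil_Integration.integral_combine[symmetric] integrable_continuous_real c) auto
  also have "\<dots> \<le> C9 * (b + (1 + b) / 2) * eps\<^sup>2 + C18 * eps\<^sup>2" by (intro add_mono S_hist_integral Y_bound[OF T])
  also have "gL RR * (norm (S T) / 2 + (C9 * (b + (1 + b) / 2) * eps\<^sup>2 + C18 * eps\<^sup>2) / 2)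
      \<le> gL RR * (C19 * eps\<^sup>2 / 2 + (C9 * (b + (1 + b) / 2) * eps\<^sup>2 + C18 * eps\<^sup>2) / 2)"
    using S_bound[OF T] gL_pos[OF const_bounds(3)] by (intro mult_left_mono) auto
  also have "\<dots> = C22 / 2 * eps\<^sup>2" by (simp add: C22_def algebra_simps add_divide_distrib)
  finally show ?thesis using gL_pos[OF const_bounds(3)] by (simp add: mult_left_mono)
qed

lemma terminal_cost:
  assumes sc: "\<forall>(z, w)\<in>X_space b. \<forall>(z0, w0)\<in>X_space b. w \<in> W_hist b rW \<longrightarrow> w0 \<in> W_hist b rW \<longrightarrow>
        g (z + z0, \<lambda>\<theta>. w \<theta> + w0 \<theta>) + g (z - z0, \<lambda>\<theta>. w \<theta> - w0 \<theta>) - 2 * g (z, w) \<le> Cg * (norm_H1 b w0)\<^sup>2"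
  shows "g (xp T, segment_at xp T) + g (xm T, segment_at xm T) - 2 * g (x T, segment_at x T) \<le> (max 0 Cg * C21 + C22) * eps\<^sup>2"
proof -
  have X: "(mid 0, mid) \<in> X_space b" "(hdf 0, hdf) \<in> X_space b"
    using mid_hdf_lipschitz by (auto simp: X_space_def Lip_hist_def)
  have e: "mid \<xi> + hdf \<xi> = xp (T + \<xi>)" "mid \<xi> - hdf \<xi> = xm (T + \<xi>)" for \<xi>
    by (simp_all add: mid_def hdf_def vec_eq_iff field_simps)
  have "g (mid 0 + hdf 0, \<lambda>\<theta>. mid \<theta> + hdf \<theta>) + g (mid 0 - hdf 0, \<lambda>\<theta>. mid \<theta> - hdf \<theta>) - 2 * g (mid 0, mid) \<le> Cg * (norm_H1 b hdf)\<^sup>2"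
    using bspec[OF bspec[OF sc X(1), unfolded prod.case] X(2), unfolded prod.case] segments_W(1,2) by blast
  then have "g (xp T, segment_at xp T) + g (xm T, segment_at xm T) - 2 * g (mid 0, mid) \<le> Cg * (norm_H1 b hdf)\<^sup>2"
    unfolding e by (simp add: segment_at_def)
  \<comment> \<open>Semiconcavity does not fix the sign of \<open>Cg\<close>; the maximum with
    \<open>0\<close> permits inserting an upper bound for the norm.\<close>
  also have "\<dots> \<le> max 0 Cg * (C21 * eps\<^sup>2)" using hdf_H1 by (intro mult_mono) auto
  finally show ?thesis using terminal_midpoint by (simp add: algebra_simps)
qed

end

section \<open>Comparison of the value functions\<close>

context smooth_delay_control_problem
begin

text \<open>The inserted control is optimal at \<open>t\<close> and merely admissible for the two
  outer initial data; as the value function is an infimum, this gives the inequality in the right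
  direction.\<close>

lemma value_semiconcave:
  assumes sc: "locally_semiconcave b g" and r: "0 < r"
  shows "\<exists>C>0. \<forall>h>0. \<forall>t w w0 \<alpha> \<alpha>'.
           t0 \<le> t - h \<longrightarrow> t - h < t + h \<longrightarrow> t + h \<le> T \<longrightarrow> w \<in> W'_hist b r \<longrightarrow> w0 \<in> W'_hist b r \<longrightarrow>
           optimal_control A f L g \<tau> b T t w \<alpha> \<longrightarrow> lipschitz_representative t T \<alpha> \<alpha>' \<longrightarrow>
           (\<lambda>\<theta>. w \<theta> - w0 \<theta>) \<in> C11_solution_manifold f \<tau> b t (\<alpha>' t) \<longrightarrow>
           value_fn A f L g \<tau> b T (t + h) (\<lambda>\<theta>. w \<theta> + w0 \<theta>) + value_fn A f L g \<tau> b T (t - h) (\<lambda>\<theta>. w \<theta> - w0 \<theta>)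
             - 2 * value_fn A f L g \<tau> b T t w \<le> C * (h\<^sup>2 + (norm_H1 b w0)\<^sup>2)"
proof -
  \<comment> \<open>Obtained, like \<open>Cg\<close> below, before \<open>h\<close>,
    \<open>t\<close>, \<open>w\<close> and \<open>w0\<close> are fixed, so that the constants of the
    interpreted locale depend on \<open>r\<close> only.\<close>
  obtain K where K: "1 \<le> K" "\<forall>t\<in>{t0..<T}. \<forall>w \<alpha> \<alpha>'. r-lipschitz_on {-b..0} w \<longrightarrow> (\<forall>\<theta>\<in>{-b..0}. norm (w \<theta>) \<le> r) \<longrightarrow>
     optimal_control A f L g \<tau> b T t w \<alpha> \<longrightarrow> lipschitz_representative t T \<alpha> \<alpha>' \<longrightarrow> K-lipschitz_on {t..T} \<alpha>'"
    using optimal_control_lipschitz[OF r] by (elim exE conjE)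
  interpret semiconc_const t0 T A f L g \<tau> b r K
    by unfold_locales (fact r, fact K(1))
  have "0 < rW" using const_bounds(3,5,23) r by (simp add: rW_def)
  then obtain Cg where Cg: "\<forall>(z, w)\<in>X_space b. \<forall>(z0, w0)\<in>X_space b. w \<in> W_hist b rW \<longrightarrow> w0 \<in> W_hist b rW \<longrightarrow>
        g (z + z0, \<lambda>\<theta>. w \<theta> + w0 \<theta>) + g (z - z0, \<lambda>\<theta>. w \<theta> - w0 \<theta>) - 2 * g (z, w) \<le> Cg * (norm_H1 b w0)\<^sup>2"
    using sc unfolding locally_semiconcave_def by (elim allE impE exE)
  define C where "C = max 1 (CL1 + CL2 + (max 0 Cg * C21 + C22))"
  show ?thesis
  proof (intro exI[of _ "2 * C"] conjI allI impI)
    show "0 < 2 * C" by (simp add: C_def)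
    fix h t :: real and w w0 :: "real \<Rightarrow> real ^ 'n" and \<alpha> \<alpha>' :: "real \<Rightarrow> real ^ 'm"
    assume h: "0 < h" and lo: "t0 \<le> t - h" and up: "t + h \<le> T" and w: "w \<in> W'_hist b r" and w0: "w0 \<in> W'_hist b r"
      and opt: "optimal_control A f L g \<tau> b T t w \<alpha>" and rep: "lipschitz_representative t T \<alpha> \<alpha>'"
      and man: "(\<lambda>\<theta>. w \<theta> - w0 \<theta>) \<in> C11_solution_manifold f \<tau> b t (\<alpha>' t)"
    have tr: "t \<in> {t0..<T}" "t \<in> {t0..T}" "t + h \<in> {t0..T}" "t - h \<in> {t0..T}" "t \<le> T" using h lo up by auto
    note wr = W'_hist_regular[OF w max_delay_pos r] and w0r = W'_hist_regular[OF w0 max_delay_pos r]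
    have LH: "w \<in> Lip_hist b" "(\<lambda>\<theta>. w \<theta> + w0 \<theta>) \<in> Lip_hist b" "(\<lambda>\<theta>. w \<theta> - w0 \<theta>) \<in> Lip_hist b"
      unfolding Lip_hist_def using wr(5) lipschitz_on_add[OF wr(5) w0r(5)] lipschitz_on_diff[OF wr(5) w0r(5)] by blast+
    obtain x where x: "solves t w \<alpha>' x" "value_fn A f L g \<tau> b T t w = J t x \<alpha>'" "\<And>s. s \<in> {t..T} \<Longrightarrow> \<alpha>' s \<in> A"
      using optimal_control_J[OF tr(1) LH(1) opt rep] by blast
    have \<alpha>'K: "K-lipschitz_on {t..T} \<alpha>'"
      using K(2)[rule_format, OF tr(1) wr(5) _ opt rep] wr(2) by blast
    \<comment> \<open>Extension by constant values preserves the Lipschitz constant; on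
      \<open>{t - h..t}\<close> the trajectory \<open>xm\<close> is driven by
      \<open>\<alpha>' t\<close>, the control value in the solution manifold.\<close>
    define \<beta> where "\<beta> s = \<alpha>' (max t (min T s))" for s
    have \<beta>A: "\<beta> s \<in> A" for s unfolding \<beta>_def by (rule x(3)) (use tr in auto)
    have \<beta>K: "K-lipschitz_on UNIV \<beta>"
    proof (rule lipschitz_onI)
      fix s s' :: real
      have "dist (\<beta> s) (\<beta> s') \<le> K * dist (max t (min T s)) (max t (min T s'))"
        unfolding \<beta>_def by (rule lipschitz_onD[OF \<alpha>'K]) (use tr in auto)
      also have "\<dots> \<le> K * dist s s'" using K(1) by (intro mult_left_mono) (auto simp: dist_real_def)
      finally show "dist (\<beta> s) (\<beta> s') \<le> K * dist s s'" .
    qed (use K(1) in simp)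
    have \<beta>eq: "\<beta> s = \<alpha>' s" if "s \<in> {t..T}" for s using that by (simp add: \<beta>_def)
    have \<beta>c: "\<beta> \<in> controls A s T" for s
      unfolding controls_def using \<beta>A
      by (auto intro!: continuous_imp_measurable_on_sets_lebesgue continuous_on_subset[OF lipschitz_on_continuous_on[OF \<beta>K]])
    have x\<beta>: "solves t w \<beta> x"
      by (rule trajectory_restrict_cong[OF x(1) tr(2) _ negligible_empty]) (auto simp: \<beta>eq)
    have J\<beta>: "J t x \<beta> = J t x \<alpha>'"
    proof -
      have "integral {t..T} (\<lambda>s. L s (x s) (delayed x s) (\<beta> s)) = integral {t..T} (\<lambda>s. L s (x s) (delayed x s) (\<alpha>' s))"
        by (rule Henstock_Kurzweil_Integration.integral_cong) (simp add: \<beta>eq)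
      then show ?thesis by (simp add: J_def)
    qed
    obtain xp where xp: "solves (t + h) (\<lambda>\<theta>. w \<theta> + w0 \<theta>) \<beta> xp" by (rule trajectory_obtain[OF tr(3) \<beta>c LH(2)])
    obtain xm where xm: "solves (t - h) (\<lambda>\<theta>. w \<theta> - w0 \<theta>) \<beta> xm" by (rule trajectory_obtain[OF tr(4) \<beta>c LH(3)])
    have z: "(0::real) \<in> {-b..0}" using max_delay_pos by simp
    have "hist_deriv b (\<lambda>\<theta>. w \<theta> - w0 \<theta>) 0 = hist_deriv b w 0 - hist_deriv b w0 0"
      using vector_derivative_within_cbox[of "-b" 0 0 "\<lambda>\<theta>. w \<theta> - w0 \<theta>"] max_delay_pos
        has_vector_derivative_diff[OF wr(1)[OF z] w0r(1)[OF z]] by (simp add: hist_deriv_def[of b "\<lambda>\<theta>. w \<theta> - w0 \<theta>"])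
    then have compat: "hist_deriv b w 0 - hist_deriv b w0 0 =
       f t (w 0 - w0 0) (w (- \<tau> t (w 0 - w0 0)) - w0 (- \<tau> t (w 0 - w0 0))) (\<beta> t)"
      using man \<beta>eq[of t] tr(5) by (simp add: C11_solution_manifold_def)
    note value_x = x(2)
    interpret semiconc t0 T A f L g \<tau> b r K h t w w0 \<beta> x xp xm
      by unfold_locales (fact h lo up w w0 \<beta>K \<beta>A compat x\<beta> xp xm)+
    have "J (t + h) xp \<beta> + J (t - h) xm \<beta> - 2 * J t x \<beta> \<le> (CL1 + CL2) * eps\<^sup>2 + (max 0 Cg * C21 + C22) * eps\<^sup>2"
      using add_mono[OF running_cost terminal_cost[OF Cg]] unfolding J_def by (simp add: algebra_simps)
    also have "\<dots> \<le> C * eps\<^sup>2"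
      unfolding distrib_right[symmetric] by (intro mult_right_mono) (auto simp: C_def)
    \<comment> \<open>As \<open>eps = h + H\<close>, its square is at most twice the sum of the
      squares, which explains the constant \<open>2 * C\<close>.\<close>
    also have "\<dots> \<le> C * (2 * (h\<^sup>2 + H\<^sup>2))"
      using sum_squares_bound[of h H] by (intro mult_left_mono) (auto simp: C_def eps_def power2_sum)
    also have "\<dots> = 2 * C * (h\<^sup>2 + H\<^sup>2)" by simp
    finally show "value_fn A f L g \<tau> b T (t + h) (\<lambda>\<theta>. w \<theta> + w0 \<theta>) + value_fn A f L g \<tau> b T (t - h) (\<lambda>\<theta>. w \<theta> - w0 \<theta>)
             - 2 * value_fn A f L g \<tau> b T t w \<le> 2 * C * (h\<^sup>2 + (norm_H1 b w0)\<^sup>2)"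
      using value_le_J[OF tr(3) LH(2) \<beta>c xp] value_le_J[OF tr(4) LH(3) \<beta>c xm] value_x J\<beta> unfolding H_def by linarith
  qed
qed

end

theorem theorem6p6:
  fixes t0 T :: real
    and A :: "(real ^ 'm) set"
    and f :: "real \<Rightarrow> real ^ 'n \<Rightarrow> real ^ 'n \<Rightarrow> real ^ 'm \<Rightarrow> real ^ 'n"
    and L :: "real \<Rightarrow> real ^ 'n \<Rightarrow> real ^ 'n \<Rightarrow> real ^ 'm \<Rightarrow> real"
    and g :: "(real ^ 'n) \<times> (real \<Rightarrow> real ^ 'n) \<Rightarrow> real"
    and \<tau> :: "real \<Rightarrow> real ^ 'n \<Rightarrow> real"
    and b r :: real
  assumes "smooth_delay_control_problem t0 T A f L g \<tau> b"
    and "locally_semiconcave b g"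
    and "r > 0"
  shows "\<exists>C>0. \<forall>h>0. \<forall>t w w0 \<alpha> \<alpha>'.
           t0 \<le> t - h \<longrightarrow> t - h < t + h \<longrightarrow> t + h \<le> T \<longrightarrow>
           w \<in> W'_hist b r \<longrightarrow> w0 \<in> W'_hist b r \<longrightarrow>
           optimal_control A f L g \<tau> b T t w \<alpha> \<longrightarrow> lipschitz_representative t T \<alpha> \<alpha>' \<longrightarrow>
           (\<lambda>\<theta>. w \<theta> - w0 \<theta>) \<in> C11_solution_manifold f \<tau> b t (\<alpha>' t) \<longrightarrow>
           value_fn A f L g \<tau> b T (t + h) (\<lambda>\<theta>. w \<theta> + w0 \<theta>)
             + value_fn A f L g \<tau> b T (t - h) (\<lambda>\<theta>. w \<theta> - w0 \<theta>)
             - 2 * value_fn A f L g \<tau> b T t w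
           \<le> C * (h\<^sup>2 + (norm_H1 b w0)\<^sup>2)"
  by (rule smooth_delay_control_problem.value_semiconcave[OF assms])

end
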